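(* Let $A$ be a brick-finite finite dimensional algebra over a field $k$, and let $M$ be the direct sum of all $X\in\operatorname{brick} A$ (one representative for each isomorphism class). Then $A$ is brick-directed if and only if there exists an indivisible increasing path in the Newton polytope $\mathrm{N}(M)$ from $0$ to $[M]$.
   Context: $\operatorname{mod} A$ is the category of finitely generated left $A$-modules. A brick is a module $X\in\operatorname{mod} A$ such that $\operatorname{End}_A(X)$ is a division algebra; $\operatorname{brick} A$ is the set of isomorphism classes of bricks; $A$ is brick-finite if $\operatorname{brick} A$ is finite. A brick-cycle is a sequence $X_0\xrightarrow{f_1}X_1\to\cdots\xrightarrow{f_m}X_m$ with $m\ge 1$, all $X_i$ bricks, $X_0\simeq X_m$, and each $f_j$ non-zero and non-invertible. $A$ is brick-directed if $\operatorname{mod} A$ contains no brick-cycle. Let $S_1,\dots,S_n$ be the simple $A$-modules up to isomorphism, $K_0(\operatorname{mod} A)=\bigoplus_i\mathbb{Z}[S_i]$ and $K_0(\operatorname{mod} A)_{\mathbb{R}}=\bigoplus_i\mathbb{R}[S_i]$. The Newton polytope $\mathrm{N}(M)$ of $M\in\operatorname{mod} A$ is the convex hull in $K_0(\operatorname{mod} A)_{\mathbb{R}}$ of $\{[L]\mid L\text{ is a submodule of }M\}$. For $v,w\in K_0(\operatorname{mod} A)_{\mathbb{R}}$ write $v\le w$ if $w-v=\sum_i a_i[S_i]$ with all $a_i\ge 0$, and $v<w$ if $v\le w$ and $v\ne w$. An increasing path in $\mathrm{N}(M)$ from $v_0$ to $v_l$ is a sequence $v_0<v_1<\cdots<v_l$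 of vertices of $\mathrm{N}(M)$ such that each segment $[v_{i-1},v_i]$ ($1\le i\le l$) is an edge of $\mathrm{N}(M)$. It is indivisible if each $v_i-v_{i-1}$ is an indivisible element of the free abelian group $K_0(\operatorname{mod} A)$ (i.e. not of the form $mw$ with $w\in K_0(\operatorname{mod} A)$ and $m\ge 2$ an integer). *)

theory Defs
  imports "HOL-Analysis.Polytope" "HOL-Algebra.Module" "HOL-Algebra.AbelCoset"
begin

text \<open>
  \<^locale>\<open>module\<close> demands a commutative base ring, so left modules over an arbitrary ring are
  introduced here, on the same records. In a module that is not an algebra the record fields
  \<^const>\<open>mult\<close> and \<^const>\<open>one\<close> carry no meaning.
\<close>

locale left_module = R?: ring + M?: abelian_group M for M (structure) +
  assumes smult_closed:
      "\<lbrakk> a \<in> carrier R; x \<in> carrier M \<rbrakk> \<Longrightarrow> a \<odot>\<^bsub>M\<^esub> x \<in> carrier M"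
    and smult_l_distr:
      "\<lbrakk> a \<in> carrier R; b \<in> carrier R; x \<in> carrier M \<rbrakk> \<Longrightarrow>
        (a \<oplus> b) \<odot>\<^bsub>M\<^esub> x = a \<odot>\<^bsub>M\<^esub> x \<oplus>\<^bsub>M\<^esub> b \<odot>\<^bsub>M\<^esub> x"
    and smult_r_distr:
      "\<lbrakk> a \<in> carrier R; x \<in> carrier M; y \<in> carrier M \<rbrakk> \<Longrightarrow>
        a \<odot>\<^bsub>M\<^esub> (x \<oplus>\<^bsub>M\<^esub> y) = a \<odot>\<^bsub>M\<^esub> x \<oplus>\<^bsub>M\<^esub> a \<odot>\<^bsub>M\<^esub> y"
    and smult_assoc1:
      "\<lbrakk> a \<in> carrier R; b \<in> carrier R; x \<in> carrier M \<rbrakk> \<Longrightarrow>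
        (a \<otimes> b) \<odot>\<^bsub>M\<^esub> x = a \<odot>\<^bsub>M\<^esub> (b \<odot>\<^bsub>M\<^esub> x)"
    and smult_one:
      "x \<in> carrier M \<Longrightarrow> \<one> \<odot>\<^bsub>M\<^esub> x = x"

definition finitely_generated :: "('a, 'r) ring_scheme \<Rightarrow> ('a, 'b, 'c) module_scheme \<Rightarrow> bool" where
  "finitely_generated R M \<longleftrightarrow>
    (\<exists>G. finite G \<and> G \<subseteq> carrier M \<and>
      (\<forall>x \<in> carrier M. \<exists>c \<in> G \<rightarrow> carrier R. x = (\<Oplus>\<^bsub>M\<^esub>g\<in>G. c g \<odot>\<^bsub>M\<^esub> g)))"

text \<open>An algebra over \<open>K\<close> is a module record over \<open>K\<close> whose ring part is the ring structure.\<close>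

locale fin_dim_algebra = K?: field K + A?: ring A + module K A
  for K :: "('k, 'q) ring_scheme" (structure) and A :: "('k, 'a) module" (structure) +
  assumes smult_mult_l:
      "\<lbrakk> c \<in> carrier K; x \<in> carrier A; y \<in> carrier A \<rbrakk> \<Longrightarrow>
        (c \<odot>\<^bsub>A\<^esub> x) \<otimes>\<^bsub>A\<^esub> y = c \<odot>\<^bsub>A\<^esub> (x \<otimes>\<^bsub>A\<^esub> y)"
    and smult_mult_r:
      "\<lbrakk> c \<in> carrier K; x \<in> carrier A; y \<in> carrier A \<rbrakk> \<Longrightarrow>
        x \<otimes>\<^bsub>A\<^esub> (c \<odot>\<^bsub>A\<^esub> y) = c \<odot>\<^bsub>A\<^esub> (x \<otimes>\<^bsub>A\<^esub> y)"
    and finite_dim: "finitely_generated K A"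

text \<open>
  Morphisms are extensional, so that they are equal as soon as they agree on the carrier.
\<close>

definition module_hom ::
  "('a, 'r) ring_scheme \<Rightarrow> ('a, 'x) module \<Rightarrow> ('a, 'y) module \<Rightarrow> ('x \<Rightarrow> 'y) set" where
  "module_hom R X Y = {f \<in> carrier X \<rightarrow>\<^sub>E carrier Y.
     (\<forall>x \<in> carrier X. \<forall>y \<in> carrier X. f (x \<oplus>\<^bsub>X\<^esub> y) = f x \<oplus>\<^bsub>Y\<^esub> f y) \<and>
     (\<forall>a \<in> carrier R. \<forall>x \<in> carrier X. f (a \<odot>\<^bsub>X\<^esub> x) = a \<odot>\<^bsub>Y\<^esub> f x)}"

definition module_iso ::
  "('a, 'r) ring_scheme \<Rightarrow> ('a, 'x) module \<Rightarrow> ('a, 'y) module \<Rightarrow> ('x \<Rightarrow> 'y) set" where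
  "module_iso R X Y = {f \<in> module_hom R X Y. bij_betw f (carrier X) (carrier Y)}"

definition isomorphic_modules ::
  "('a, 'r) ring_scheme \<Rightarrow> ('a, 'x) module \<Rightarrow> ('a, 'y) module \<Rightarrow> bool" where
  "isomorphic_modules R X Y \<longleftrightarrow> module_iso R X Y \<noteq> {}"

definition End_ring :: "('a, 'r) ring_scheme \<Rightarrow> ('a, 'x) module \<Rightarrow> ('x \<Rightarrow> 'x) ring" where
  "End_ring R X =
    \<lparr> carrier = module_hom R X X,
      mult = (\<lambda>f g. compose (carrier X) f g),
      one = (\<lambda>x\<in>carrier X. x),
      zero = (\<lambda>x\<in>carrier X. \<zero>\<^bsub>X\<^esub>),
      add = (\<lambda>f g. \<lambda>x\<in>carrier X. f x \<oplus>\<^bsub>X\<^esub> g x) \<rparr>"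

definition simple_module :: "('a, 'r) ring_scheme \<Rightarrow> ('a, 'x) module \<Rightarrow> bool" where
  "simple_module R X \<longleftrightarrow> left_module R X \<and> carrier X \<noteq> {\<zero>\<^bsub>X\<^esub>} \<and>
     (\<forall>L. submodule L R X \<longrightarrow> L = {\<zero>\<^bsub>X\<^esub>} \<or> L = carrier X)"

definition quotient_module :: "('a, 'x) module \<Rightarrow> 'x set \<Rightarrow> ('a, 'x set) module" where
  "quotient_module X L =
    \<lparr> carrier = a_rcosets\<^bsub>X\<^esub> L,
      mult = undefined, one = undefined,
      zero = L,
      add = (\<lambda>C D. C <+>\<^bsub>X\<^esub> D),
      smult = (\<lambda>a C. \<Union>x\<in>C. L +>\<^bsub>X\<^esub> (a \<odot>\<^bsub>X\<^esub> x)) \<rparr>"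

text \<open>The external direct sum of a finite set of modules.\<close>

definition finite_direct_sum ::
  "('a, 'x) module set \<Rightarrow> ('a, ('a, 'x) module \<Rightarrow> 'x) module" where
  "finite_direct_sum B =
    \<lparr> carrier = (\<Pi>\<^sub>E X\<in>B. carrier X),
      mult = undefined, one = undefined,
      zero = (\<lambda>X\<in>B. \<zero>\<^bsub>X\<^esub>),
      add = (\<lambda>u v. \<lambda>X\<in>B. u X \<oplus>\<^bsub>X\<^esub> v X),
      smult = (\<lambda>a u. \<lambda>X\<in>B. a \<odot>\<^bsub>X\<^esub> u X) \<rparr>"

text \<open>
  To quantify over the objects of mod A one needs a single carrier type. Over an algebra of type
  \<open>('k, 'a) module\<close> the type \<open>nat \<Rightarrow> 'k\<close> is used; the lemma \<open>mod_universe\<close> below shows that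
  every finitely generated module, on whatever type, has an isomorphic copy there.
\<close>

definition mod_objects :: "('k, 'a) module \<Rightarrow> ('a, nat \<Rightarrow> 'k) module set" where
  "mod_objects A = {X. left_module A X \<and> finitely_generated A X}"

lemma finsum_transport:
  assumes X: "abelian_group X" and Y: "abelian_group Y"
    and f: "f \<in> carrier X \<rightarrow> carrier Y"
    and add: "\<And>x y. \<lbrakk>x \<in> carrier X; y \<in> carrier X\<rbrakk> \<Longrightarrow> f (x \<oplus>\<^bsub>X\<^esub> y) = f x \<oplus>\<^bsub>Y\<^esub> f y"
    and G: "finite G" "h \<in> G \<rightarrow> carrier X"
  shows "f (\<Oplus>\<^bsub>X\<^esub>g\<in>G. h g) = (\<Oplus>\<^bsub>Y\<^esub>g\<in>G. f (h g))"
proof -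
  interpret X: abelian_group X by fact
  interpret Y: abelian_group Y by fact
  have f0: "f \<zero>\<^bsub>X\<^esub> = \<zero>\<^bsub>Y\<^esub>"
  proof -
    have c: "f \<zero>\<^bsub>X\<^esub> \<in> carrier Y" using f by auto
    have "f \<zero>\<^bsub>X\<^esub> \<oplus>\<^bsub>Y\<^esub> f \<zero>\<^bsub>X\<^esub> = f \<zero>\<^bsub>X\<^esub>"
      using add[of "\<zero>\<^bsub>X\<^esub>" "\<zero>\<^bsub>X\<^esub>"] by simp
    then show ?thesis using c by (simp add: Y.add.l_cancel_one)
  qed
  show ?thesis
    using G
  proof (induction G rule: finite_induct)
    case empty
    then show ?case by (simp add: f0)
  next
    case (insert g G)
    have hG: "h \<in> G \<rightarrow> carrier X" and hg: "h g \<in> carrier X" using insert.prems by auto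
    have fG: "(\<lambda>g. f (h g)) \<in> G \<rightarrow> carrier Y" and fg: "f (h g) \<in> carrier Y"
      using hG hg f by auto
    show ?case
      using insert.hyps insert.IH[OF hG] hG hg fG fg
      by (simp add: X.finsum_insert Y.finsum_insert add X.finsum_closed)
  qed
qed

lemma module_transport:
  fixes X :: "('a, 'x) module" and e :: "'x \<Rightarrow> 'y" and A :: "('a, 'r) ring_scheme"
  assumes X: "left_module A X" and fg: "finitely_generated A X" and e: "inj_on e (carrier X)"
  shows "\<exists>Y :: ('a, 'y) module.
    left_module A Y \<and> finitely_generated A Y \<and> isomorphic_modules A X Y"
proof -
  interpret X: left_module A X by fact
  define d where "d = inv_into (carrier X) e"
  have de [simp]: "d (e x) = x" if "x \<in> carrier X" for x
    using that e by (simp add: d_def)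
  define Y :: "('a, 'y) module" where
    "Y = \<lparr> carrier = e ` carrier X, mult = undefined, one = undefined, zero = e \<zero>\<^bsub>X\<^esub>,
           add = (\<lambda>u v. e (d u \<oplus>\<^bsub>X\<^esub> d v)), smult = (\<lambda>a u. e (a \<odot>\<^bsub>X\<^esub> d u)) \<rparr>"
  have [simp]: "carrier Y = e ` carrier X" "\<zero>\<^bsub>Y\<^esub> = e \<zero>\<^bsub>X\<^esub>"
    "\<And>u v. u \<oplus>\<^bsub>Y\<^esub> v = e (d u \<oplus>\<^bsub>X\<^esub> d v)" "\<And>a u. a \<odot>\<^bsub>Y\<^esub> u = e (a \<odot>\<^bsub>X\<^esub> d u)"
    by (simp_all add: Y_def)
  have abY: "abelian_group Y"
  proof (rule abelian_groupI)
    fix u assume "u \<in> carrier Y"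
    then obtain x where x: "x \<in> carrier X" "u = e x" by auto
    then show "\<exists>v \<in> carrier Y. v \<oplus>\<^bsub>Y\<^esub> u = \<zero>\<^bsub>Y\<^esub>"
      by (intro bexI[of _ "e (\<ominus>\<^bsub>X\<^esub> x)"]) (auto simp: X.l_neg)
  qed (auto simp: X.add.m_ac)
  have lmY: "left_module A Y"
    using abY
    by (intro left_module.intro left_module_axioms.intro X.ring_axioms)
       (auto simp: X.smult_closed X.smult_l_distr X.smult_r_distr X.smult_assoc1 X.smult_one)
  have "restrict e (carrier X) \<in> module_iso A X Y"
    using e by (auto simp: module_iso_def module_hom_def X.smult_closed bij_betw_def)
  then have iso: "isomorphic_modules A X Y" by (auto simp: isomorphic_modules_def)
  have "finitely_generated A Y"
  proof -
    obtain G where G: "finite G" "G \<subseteq> carrier X"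
      and gen: "\<And>x. x \<in> carrier X \<Longrightarrow>
        \<exists>c \<in> G \<rightarrow> carrier A. x = (\<Oplus>\<^bsub>X\<^esub>g\<in>G. c g \<odot>\<^bsub>X\<^esub> g)"
      using fg unfolding finitely_generated_def by blast
    interpret Y: abelian_group Y by (fact abY)
    have "\<exists>c \<in> e ` G \<rightarrow> carrier A. e x = (\<Oplus>\<^bsub>Y\<^esub>g\<in>e ` G. c g \<odot>\<^bsub>Y\<^esub> g)"
      if x: "x \<in> carrier X" for x
    proof -
      obtain c where c: "c \<in> G \<rightarrow> carrier A" "x = (\<Oplus>\<^bsub>X\<^esub>g\<in>G. c g \<odot>\<^bsub>X\<^esub> g)"
        using gen[OF x] by blast
      have cl: "(\<lambda>g. c g \<odot>\<^bsub>X\<^esub> g) \<in> G \<rightarrow> carrier X"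
        using c(1) G(2) by (auto intro!: X.smult_closed)
      have deG: "d (e g) = g" if "g \<in> G" for g using that G(2) by auto
      have "e x = (\<Oplus>\<^bsub>Y\<^esub>g\<in>G. e (c g \<odot>\<^bsub>X\<^esub> g))"
        unfolding c(2)
        by (rule finsum_transport[OF X.abelian_group_axioms abY _ _ G(1) cl]) auto
      also have "\<dots> = (\<Oplus>\<^bsub>Y\<^esub>g\<in>G. c (d (e g)) \<odot>\<^bsub>Y\<^esub> e g)"
        using cl by (intro Y.finsum_cong') (auto simp: deG)
      also have "\<dots> = (\<Oplus>\<^bsub>Y\<^esub>g\<in>e ` G. c (d g) \<odot>\<^bsub>Y\<^esub> g)"
        using cl by (intro Y.finsum_reindex[symmetric] inj_on_subset[OF e G(2)]) (auto simp: deG)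
      finally show ?thesis
        using c(1) by (intro bexI[of _ "\<lambda>g. c (d g)"]) (auto simp: deG)
    qed
    then show ?thesis
      unfolding finitely_generated_def using G by (intro exI[of _ "e ` G"]) auto
  qed
  with lmY iso show ?thesis by blast
qed

lemma mod_universe:
  fixes K :: "('k, 'q) ring_scheme" and A :: "('k, 'a) module" and X :: "('a, 'x) module"
  assumes A: "fin_dim_algebra K A" and X: "left_module A X" and fg: "finitely_generated A X"
  shows "\<exists>Y \<in> mod_objects A. isomorphic_modules A X Y"
proof -
  interpret A: fin_dim_algebra K A by fact
  interpret X: left_module A X by fact
  obtain B where B: "finite B" "B \<subseteq> carrier A"
    and gB: "\<forall>a \<in> carrier A. \<exists>c \<in> B \<rightarrow> carrier K. a = (\<Oplus>\<^bsub>A\<^esub>b\<in>B. c b \<odot>\<^bsub>A\<^esub> b)"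
    using A.finite_dim unfolding finitely_generated_def by (elim exE conjE) rule
  obtain p where p: "\<And>a. a \<in> carrier A \<Longrightarrow>
      p a \<in> B \<rightarrow> carrier K \<and> a = (\<Oplus>\<^bsub>A\<^esub>b\<in>B. p a b \<odot>\<^bsub>A\<^esub> b)"
    using bchoice[OF gB[unfolded Bex_def]] by (elim exE) (rule, erule bspec)
  obtain G where G: "finite G" "G \<subseteq> carrier X"
    and gG: "\<forall>x \<in> carrier X. \<exists>c \<in> G \<rightarrow> carrier A. x = (\<Oplus>\<^bsub>X\<^esub>g\<in>G. c g \<odot>\<^bsub>X\<^esub> g)"
    using fg unfolding finitely_generated_def by (elim exE conjE) rule
  obtain q where q: "\<And>x. x \<in> carrier X \<Longrightarrow>
      q x \<in> G \<rightarrow> carrier A \<and> x = (\<Oplus>\<^bsub>X\<^esub>g\<in>G. q x g \<odot>\<^bsub>X\<^esub> g)"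
    using bchoice[OF gG[unfolded Bex_def]] by (elim exE) (rule, erule bspec)
  obtain j :: "'a \<times> 'x \<Rightarrow> nat" where j: "inj_on j (B \<times> G)"
    using finite_imp_inj_to_nat_seg[of "B \<times> G"] B(1) G(1) by auto
  define e :: "'x \<Rightarrow> nat \<Rightarrow> 'k" where
    "e x = (\<lambda>n. case inv_into (B \<times> G) j n of (b, g) \<Rightarrow> p (q x g) b)" for x
  have "inj_on e (carrier X)"
  proof (rule inj_onI)
    fix x y assume x: "x \<in> carrier X" and y: "y \<in> carrier X" and xy: "e x = e y"
    have pq: "p (q x g) b = p (q y g) b" if "b \<in> B" "g \<in> G" for b g
      using fun_cong[OF xy, of "j (b, g)"] that j by (simp add: e_def)
    have qxy: "q x g = q y g" if g: "g \<in> G" for g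
    proof -
      have cx: "q x g \<in> carrier A" and cy: "q y g \<in> carrier A" using q[OF x] q[OF y] g by auto
      have "q x g = (\<Oplus>\<^bsub>A\<^esub>b\<in>B. p (q x g) b \<odot>\<^bsub>A\<^esub> b)" using p[OF cx] by blast
      also have "\<dots> = (\<Oplus>\<^bsub>A\<^esub>b\<in>B. p (q y g) b \<odot>\<^bsub>A\<^esub> b)"
        using p[OF cy] B(2) pq[OF _ g]
        by (intro A.A.finsum_cong') (auto intro!: A.smult_closed)
      also have "\<dots> = q y g" using p[OF cy] by simp
      finally show ?thesis .
    qed
    have "x = (\<Oplus>\<^bsub>X\<^esub>g\<in>G. q x g \<odot>\<^bsub>X\<^esub> g)" using q[OF x] by blast
    also have "\<dots> = (\<Oplus>\<^bsub>X\<^esub>g\<in>G. q y g \<odot>\<^bsub>X\<^esub> g)"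
      using q[OF y] G(2) qxy by (intro X.M.finsum_cong') (auto intro!: X.smult_closed)
    also have "\<dots> = y" using q[OF y] by simp
    finally show "x = y" .
  qed
  from module_transport[OF X fg this] show ?thesis
    unfolding mod_objects_def by blast
qed

definition bricks :: "('k, 'a) module \<Rightarrow> ('a, nat \<Rightarrow> 'k) module set" where
  "bricks A = {X \<in> mod_objects A. ring (End_ring A X) \<and>
     Units (End_ring A X) = carrier (End_ring A X) - {\<zero>\<^bsub>End_ring A X\<^esub>}}"

definition brick_classes :: "('k, 'a) module \<Rightarrow> ('a, nat \<Rightarrow> 'k) module set set" where
  "brick_classes A =
    bricks A // {(X, Y). X \<in> bricks A \<and> Y \<in> bricks A \<and> isomorphic_modules A X Y}"

definition brick_finite :: "('k, 'a) module \<Rightarrow> bool" where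
  "brick_finite A \<longleftrightarrow> finite (brick_classes A)"

definition brick_representatives ::
  "('k, 'a) module \<Rightarrow> ('a, nat \<Rightarrow> 'k) module set \<Rightarrow> bool" where
  "brick_representatives A B \<longleftrightarrow>
     B \<subseteq> bricks A \<and> (\<forall>X \<in> bricks A. \<exists>!Y. Y \<in> B \<and> isomorphic_modules A X Y)"

definition brick_cycle ::
  "('k, 'a) module \<Rightarrow> ('a, nat \<Rightarrow> 'k) module list \<Rightarrow> ((nat \<Rightarrow> 'k) \<Rightarrow> (nat \<Rightarrow> 'k)) list \<Rightarrow> bool" where
  "brick_cycle A Xs fs \<longleftrightarrow>
     fs \<noteq> [] \<and> length Xs = Suc (length fs) \<and> set Xs \<subseteq> bricks A \<and>
     isomorphic_modules A (hd Xs) (last Xs) \<and>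
     (\<forall>j < length fs. fs ! j \<in> module_hom A (Xs ! j) (Xs ! Suc j) \<and>
        fs ! j \<noteq> (\<lambda>x\<in>carrier (Xs ! j). \<zero>\<^bsub>Xs ! Suc j\<^esub>) \<and>
        fs ! j \<notin> module_iso A (Xs ! j) (Xs ! Suc j))"

definition brick_directed :: "('k, 'a) module \<Rightarrow> bool" where
  "brick_directed A \<longleftrightarrow> (\<nexists>Xs fs. brick_cycle A Xs fs)"

text \<open>
  Given a complete irredundant list \<open>S\<close> of the simple modules, indexed by a finite type \<open>'n\<close>, the
  space of real combinations of the \<open>[S\<^sub>i]\<close> is \<open>real ^ 'n\<close>, and the Grothendieck group is its
  subgroup of integral vectors. The library order on \<open>real ^ 'n\<close> is the componentwise one.
\<close>

definition simple_representatives ::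
  "('k, 'a) module \<Rightarrow> ('n \<Rightarrow> ('a, nat \<Rightarrow> 'k) module) \<Rightarrow> bool" where
  "simple_representatives A S \<longleftrightarrow>
     (\<forall>i. S i \<in> mod_objects A \<and> simple_module A (S i)) \<and>
     (\<forall>X \<in> mod_objects A. simple_module A X \<longrightarrow> (\<exists>!i. isomorphic_modules A X (S i)))"

definition subquotient :: "('a, 'x) module \<Rightarrow> 'x set \<Rightarrow> 'x set \<Rightarrow> ('a, 'x set) module" where
  "subquotient X L L' = quotient_module (X\<lparr>carrier := L'\<rparr>) L"

definition composition_series ::
  "('a, 'r) ring_scheme \<Rightarrow> ('a, 'x) module \<Rightarrow> 'x set list \<Rightarrow> bool" where
  "composition_series R X Ls \<longleftrightarrow>
     Ls \<noteq> [] \<and> hd Ls = {\<zero>\<^bsub>X\<^esub>} \<and> last Ls = carrier X \<and> (\<forall>L \<in> set Ls. submodule L R X) \<and>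
     (\<forall>j. Suc j < length Ls \<longrightarrow> Ls ! j \<subseteq> Ls ! Suc j \<and>
        simple_module R (subquotient X (Ls ! j) (Ls ! Suc j)))"

text \<open>
  The coefficient of \<open>[S\<^sub>i]\<close> in \<open>[X]\<close> is the Jordan--Hoelder multiplicity of \<open>S\<^sub>i\<close> in \<open>X\<close>, which
  does not depend on the composition series.
\<close>

definition K0_class ::
  "('k, 'a) module \<Rightarrow> ('n \<Rightarrow> ('a, nat \<Rightarrow> 'k) module) \<Rightarrow> ('a, 'x) module \<Rightarrow> real ^ 'n::finite" where
  "K0_class A S X =
    (let Ls = (SOME Ls. composition_series A X Ls) in
     \<chi> i. real (card {j. Suc j < length Ls \<and>
              isomorphic_modules A (subquotient X (Ls ! j) (Ls ! Suc j)) (S i)}))"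

definition newton_polytope ::
  "('k, 'a) module \<Rightarrow> ('n \<Rightarrow> ('a, nat \<Rightarrow> 'k) module) \<Rightarrow> ('a, 'x) module \<Rightarrow> (real ^ 'n::finite) set" where
  "newton_polytope A S X =
     convex hull {K0_class A S (X\<lparr>carrier := L\<rparr>) | L. submodule L A X}"

definition increasing_path :: "(real ^ 'n::finite) set \<Rightarrow> (real ^ 'n) list \<Rightarrow> bool" where
  "increasing_path P vs \<longleftrightarrow>
     vs \<noteq> [] \<and> (\<forall>v \<in> set vs. v extreme_point_of P) \<and>
     (\<forall>i. Suc i < length vs \<longrightarrow>
        vs ! i < vs ! Suc i \<and> closed_segment (vs ! i) (vs ! Suc i) edge_of P)"

definition K0_lattice :: "(real ^ 'n::finite) set" where
  "K0_lattice = {v. \<forall>i. v $ i \<in> \<int>}"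

definition indivisible :: "real ^ 'n::finite \<Rightarrow> bool" where
  "indivisible v \<longleftrightarrow> v \<in> K0_lattice \<and> (\<nexists>(m::int) w. m \<ge> 2 \<and> w \<in> K0_lattice \<and> v = of_int m *\<^sub>R w)"

definition indivisible_path :: "(real ^ 'n::finite) list \<Rightarrow> bool" where
  "indivisible_path vs \<longleftrightarrow> (\<forall>i. Suc i < length vs \<longrightarrow> indivisible (vs ! Suc i - vs ! i))"

end

theory Submission
  imports Defs
begin

text \<open>
  Only short exact sequences of isomorphism classes of modules matter. If there is no brick-cycle,
  number the bricks as \<open>X 1, \<dots>, X m\<close> so that nonzero maps \<open>X i \<rightarrow> X j\<close> exist only for \<open>j \<le> i\<close>. The modules
  without nonzero maps to \<open>X j\<close> for \<open>j > i\<close> and those without nonzero maps from \<open>X j\<close> for \<open>j \<le> i\<close> form a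
  torsion pair \<open>(T i, F i)\<close>. By induction on \<open>i\<close> there is a linear functional that is positive on \<open>T i\<close> and
  negative on \<open>F i\<close>: the classes of the simple objects of the tilted heart generate the Grothendieck
  group, mutation injects the simple objects at step \<open>i + 1\<close> into those at step \<open>i\<close>, so there are at most
  \<open>n\<close> of them; they form a basis, and this provides both the next functional and the indivisibility of
  the class of \<open>X (i + 1)\<close>. The functionals on the wall between two steps expose the edges
  from \<open>[X 1] + \<dots> + [X i]\<close> to \<open>[X 1] + \<dots> + [X (i + 1)]\<close> of the Newton polytope.

  Conversely, the vertices of an indivisible path come from a chain of submodules of \<open>M\<close>. As the
  edges contain no lattice points besides their endpoints, the layers are stable for a functional
  exposing the edge, hence bricks. There are no nonzero maps from an earlier layer to a later one, so
  the layers are pairwise nonisomorphic; as their classes sum up to \<open>[M]\<close>, they exhaust the bricks,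
  and their order excludes brick-cycles.
\<close>

section \<open>Exact structures and bricks\<close>

text \<open>Submodules, quotients and fibre products live on different carrier types, whereas an
  isomorphism class is a set of modules on one fixed type; this is why \<open>ses\<close> relates
  classes. It forgets the maps, so arguments about composites become existence statements combined
  with well-foundedness: an object is never a proper part of itself. Reversing all sequences
  preserves the axioms. For two subobjects, \<open>two_subs\<close> yields the intersection, the two
  quotients by it and the quotient by the sum; most arguments force one of these to vanish.

  The tilted heart never appears as a category. The sequences needed from it are rotations of
  \<open>ses\<close>, and a functional separating the two halves of a torsion pair bounds lengths in
  it. Therefore the functionals must be built together with the bound on the number of simple
  objects.

  In the converse direction, a nonzero map from an earlier layer to a later one would produce a
  brick N that is a direct summand of M. Adding N to an intermediate submodule would exceed the
  maximum of the functional exposing a vertex.\<close>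

locale exact_structure =
  fixes Ob :: "'o set" and ses :: "'o \<Rightarrow> 'o \<Rightarrow> 'o \<Rightarrow> bool" and Z :: 'o
  assumes ses_in: "ses K M Q \<Longrightarrow> K \<in> Ob \<and> M \<in> Ob \<and> Q \<in> Ob"
    and zero_in: "Z \<in> Ob"
    and ses_triv_sub: "M \<in> Ob \<Longrightarrow> ses Z M M"
    and ses_triv_quot: "M \<in> Ob \<Longrightarrow> ses M M Z"
    and ses_zero_sub: "ses Z M Q \<Longrightarrow> Q = M"
    and ses_zero_quot: "ses K M Z \<Longrightarrow> K = M"
    and ses_of_zero: "ses K Z Q \<Longrightarrow> K = Z \<and> Q = Z"
    and quot_lift: "ses K M Q \<Longrightarrow> ses Q' Q Q'' \<Longrightarrow> \<exists>P. ses P M Q'' \<and> ses K P Q'"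
    and sub_quot: "ses K M Q \<Longrightarrow> ses K' K K'' \<Longrightarrow> \<exists>R. ses K' M R \<and> ses K'' R Q"
    and two_subs: "ses K M Q \<Longrightarrow> ses K' M Q' \<Longrightarrow>
      \<exists>J I I' C. ses J K' I \<and> ses I Q C \<and> ses J K I' \<and> ses I' Q' C"
    and pullback: "ses K G Q \<Longrightarrow> ses L V Q \<Longrightarrow> \<exists>P. ses K P V \<and> ses L P G"
    and pushout: "ses K G Q \<Longrightarrow> ses K V R \<Longrightarrow> \<exists>P. ses V P Q \<and> ses G P R"
    and wf_sub: "wfP (\<lambda>K M. \<exists>Q. Q \<noteq> Z \<and> ses K M Q)"
    and wf_quot: "wfP (\<lambda>Q M. \<exists>K. K \<noteq> Z \<and> ses K M Q)"
begin

text \<open>A nonzero map is recorded by its image I, because \<open>ses\<close> carries no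
  maps.\<close>

definition nzmap :: "'o \<Rightarrow> 'o \<Rightarrow> bool" where
  "nzmap M N \<longleftrightarrow> (\<exists>I K C. I \<noteq> Z \<and> ses K M I \<and> ses I N C)"

text \<open>I runs through the images of endomorphisms. By finite length a surjective endomorphism
  is bijective, so this is the division ring condition.\<close>

definition brick :: "'o \<Rightarrow> bool" where
  "brick X \<longleftrightarrow> X \<in> Ob \<and> X \<noteq> Z \<and> (\<forall>I K C. ses K X I \<longrightarrow> ses I X C \<longrightarrow> I = Z \<or> I = X)"

definition simple :: "'o \<Rightarrow> bool" where
  "simple X \<longleftrightarrow> X \<in> Ob \<and> X \<noteq> Z \<and> (\<forall>K Q. ses K X Q \<longrightarrow> K = Z \<or> Q = Z)"

text \<open>The axioms come in mutually dual pairs, and \<open>two_subs\<close> is dual to itself.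
  Statements about quotients thus yield those about subobjects.\<close>

lemma dual: "exact_structure Ob (\<lambda>K M Q. ses Q M K) Z"
proof (unfold_locales, goal_cases)
  case (1 K M Q)
  then show ?case using ses_in by blast
next
  case 2 show ?case by (rule zero_in)
next
  case (3 M) then show ?case by (rule ses_triv_quot)
next
  case (4 M) then show ?case by (rule ses_triv_sub)
next
  case (5 M Q) then show ?case using ses_zero_quot by simp
next
  case (6 K M) then show ?case using ses_zero_sub by simp
next
  case (7 K Q) then show ?case using ses_of_zero by blast
next
  case (8 K M Q Q' Q'')
  then show ?case using sub_quot by blast
next
  case (9 K M Q K' K'')
  then show ?case using quot_lift by blast
next
  case (10 K M Q K' Q')
  from two_subs[OF this] show ?case by blast
next
  case (11 K G Q L V)
  then show ?case using pushout by blast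
next
  case (12 K G Q V R)
  then show ?case using pullback by blast
next
  case 13 show ?case by (rule wf_quot)
next
  case 14 show ?case by (rule wf_sub)
qed

lemma dual_nzmap: "exact_structure.nzmap (\<lambda>K M Q. ses Q M K) Z M N \<longleftrightarrow> nzmap N M"
  unfolding exact_structure.nzmap_def[OF dual] nzmap_def by (intro iffI; elim exE conjE; intro exI conjI)

lemma sub_trans: "ses K M Q \<Longrightarrow> ses K' K K'' \<Longrightarrow> \<exists>R. ses K' M R"
  using sub_quot by blast

lemma quot_trans: "ses K M Q \<Longrightarrow> ses Q' Q Q'' \<Longrightarrow> \<exists>P. ses P M Q''"
  using quot_lift by blast

lemma nzmapI: "I \<noteq> Z \<Longrightarrow> ses K M I \<Longrightarrow> ses I N C \<Longrightarrow> nzmap M N"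
  unfolding nzmap_def by blast

lemma nzmap_quot: "ses K M Q \<Longrightarrow> nzmap Q N \<Longrightarrow> nzmap M N"
  unfolding nzmap_def using quot_trans by blast

lemma nzmap_sub: "ses K N Q \<Longrightarrow> nzmap M K \<Longrightarrow> nzmap M N"
  unfolding nzmap_def using sub_trans by blast

text \<open>Restrict the map to K. If the image \<open>I1\<close> of K vanishes, the map factors
  through Q; otherwise the restriction is the required nonzero map.\<close>

lemma nzmap_ext_source:
  assumes "ses K M Q" "nzmap M N"
  shows "nzmap K N \<or> nzmap Q N"
proof -
  obtain I L D where I: "I \<noteq> Z" "ses L M I" "ses I N D" using assms(2) unfolding nzmap_def by blast
  obtain J I1 I' C where J: "ses J K I1" "ses I1 I C" "ses J L I'" "ses I' Q C"
    using two_subs[OF I(2) assms(1)] by blast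
  show ?thesis
  proof (cases "I1 = Z")
    case True
    then have "C = I" using J(2) ses_zero_sub by simp
    then show ?thesis using I J(4) nzmapI by blast
  next
    case False
    then show ?thesis using J(1,2) I(3) sub_trans nzmapI by meson
  qed
qed

lemma nzmap_ext_target:
  assumes "ses K N Q" "nzmap M N"
  shows "nzmap M K \<or> nzmap M Q"
  using exact_structure.nzmap_ext_source[OF dual assms(1), of M] assms(2)
  by (auto simp: dual_nzmap)

lemma nzmap_self: "M \<in> Ob \<Longrightarrow> M \<noteq> Z \<Longrightarrow> nzmap M M"
  using ses_triv_sub ses_triv_quot nzmapI by blast

lemma nzmap_zero: "\<not> nzmap Z M" "\<not> nzmap M Z"
  unfolding nzmap_def by (auto dest: ses_of_zero)

text \<open>Well-foundedness replaces a comparison of lengths here: an M with a proper subobject in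
  its own class would start an infinite descent.\<close>

lemma ses_self_sub: "ses M M Q \<Longrightarrow> Q = Z"
  using wfp_imp_irreflp[OF wf_sub] by (auto simp: irreflp_def)

lemma ses_self_quot: "ses K M M \<Longrightarrow> K = Z"
  using wfp_imp_irreflp[OF wf_quot] by (auto simp: irreflp_def)

text \<open>An image of minimal length of a nonzero endomorphism is a brick.\<close>

lemma ex_brick:
  assumes "M \<in> Ob" "M \<noteq> Z"
  shows "\<exists>N K C. brick N \<and> ses K M N \<and> ses N M C"
  using assms
proof (induction M rule: wfp_induct_rule[OF wf_quot])
  case (1 M)
  show ?case
  proof (cases "brick M")
    case True
    then show ?thesis using ses_triv_quot ses_triv_sub 1 by blast
  next
    case False
    then obtain I K C where I: "ses K M I" "ses I M C" "I \<noteq> Z" "I \<noteq> M"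
      unfolding brick_def using 1 by blast
    have "K \<noteq> Z" using I ses_zero_sub by blast
    then obtain N K' C' where N: "brick N" "ses K' I N" "ses N I C'"
      using 1(1)[of I] I ses_in by blast
    then show ?thesis using quot_trans[OF I(1)] sub_trans[OF I(2)] by blast
  qed
qed

lemma ex_simple_quot:
  assumes "M \<in> Ob" "M \<noteq> Z"
  shows "\<exists>K S. simple S \<and> ses K M S"
  using assms
proof (induction M rule: wfp_induct_rule[OF wf_quot])
  case (1 M)
  show ?case
  proof (cases "simple M")
    case True
    then show ?thesis using ses_triv_sub 1 by blast
  next
    case False
    then obtain K Q where I: "ses K M Q" "K \<noteq> Z" "Q \<noteq> Z"
      unfolding simple_def using 1 by blast
    then obtain K' S where N: "simple S" "ses K' Q S"
      using 1(1)[of Q] I ses_in by blast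
    then show ?thesis using quot_trans[OF I(1)] by blast
  qed
qed

end

section \<open>Jordan-Hoelder multiplicities and classes in the Grothendieck group\<close>

locale exact_structure_simples = exact_structure Ob ses Z
  for Ob :: "'o set" and ses :: "'o \<Rightarrow> 'o \<Rightarrow> 'o \<Rightarrow> bool" and Z :: 'o +
  fixes s :: "'n::finite \<Rightarrow> 'o"
  assumes simple_iff: "simple X \<longleftrightarrow> X \<in> range s"
    and inj_s: "inj s"
begin

text \<open>\<open>cs M n v\<close>: there is a composition series of \<open>M\<close> of length \<open>n\<close> with multiplicities \<open>v\<close>.\<close>

inductive cs :: "'o \<Rightarrow> nat \<Rightarrow> real ^ 'n \<Rightarrow> bool" where
  cs_zero: "cs Z 0 0"
| cs_step: "cs K n v \<Longrightarrow> ses K M (s i) \<Longrightarrow> cs M (Suc n) (v + axis i 1)"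

lemma simple_s: "simple (s i)"
  using simple_iff by blast

lemma s_props: "s i \<in> Ob" "s i \<noteq> Z" "ses K (s i) Q \<Longrightarrow> K = Z \<or> Q = Z"
  using simple_s unfolding simple_def by blast+

lemma cs_ex: "M \<in> Ob \<Longrightarrow> \<exists>n v. cs M n v"
proof (induction M rule: wfp_induct_rule[OF wf_sub])
  case (1 M)
  show ?case
  proof (cases "M = Z")
    case True then show ?thesis using cs_zero by blast
  next
    case False
    then obtain K i where K: "ses K M (s i)" using ex_simple_quot[OF 1(2)] simple_iff by (metis rangeE)
    then have "\<exists>n v. cs K n v" using 1(1)[of K] s_props ses_in by blast
    then show ?thesis using cs_step K by blast
  qed
qed

lemma cs_of_zero: "cs Z n v \<Longrightarrow> n = 0 \<and> v = 0"
proof (erule cs.cases)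
  fix K n' v' M i assume "Z = M" "ses K M (s i)"
  then show ?thesis using ses_of_zero s_props(2) by blast
qed auto

text \<open>The Jordan-Hoelder argument: compare the last maximal subobjects K1 and K2 of the two
  series through their intersection J.\<close>

lemma cs_unique: "cs M n v \<Longrightarrow> cs M n' v' \<Longrightarrow> n' = n \<and> v' = v"
proof (induction n arbitrary: M v n' v' rule: less_induct)
  case (less n)
  from less.prems(1) show ?case
  proof (cases rule: cs.cases)
    case cs_zero
    then show ?thesis using cs_of_zero less.prems by simp
  next
    case (cs_step K1 n1 v1 i)
    note 1 = cs_step
    from less.prems(2) show ?thesis
    proof (cases rule: cs.cases)
      case cs_zero
      then show ?thesis using cs_of_zero less.prems by simp
    next
      case (cs_step K2 n2 v2 j)
      note 2 = cs_step
      obtain J I I' C where J: "ses J K2 I" "ses I (s i) C" "ses J K1 I'" "ses I' (s j) C"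
        using two_subs[OF 1(4) 2(4)] by blast
      show ?thesis
      proof (cases "I = Z")
        \<comment> \<open>K2 lies in K1, so by simplicity the two maximal subobjects have the same
          class and the same simple quotient.\<close>
        case True
        then have C: "C = s i" using J(2) ses_zero_sub by blast
        then have "I' = Z" using J(4) s_props by blast
        then have "C = s j" using J(4) ses_zero_sub by blast
        then have ij: "i = j" using C inj_s by (metis injD)
        have "J = K2" "J = K1" using J True \<open>I' = Z\<close> ses_zero_quot by blast+
        then have "n2 = n1 \<and> v2 = v1" using less.IH[of n1 K1 v1 n2 v2] 1 2 by simp
        then show ?thesis using 1 2 ij by simp
      next
        case False
        then have C: "C = Z" using J(2) s_props by blast
        then have I: "I = s i" "I' = s j" using J ses_zero_quot by blast+
        \<comment> \<open>Now J is maximal in both K1 and K2, with the two simple quotients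
          exchanged; a series of J extends to series of both.\<close>
        obtain m u where u: "cs J m u" using cs_ex ses_in J by blast
        have a: "cs K1 (Suc m) (u + axis j 1)" using cs.cs_step[OF u] J I by blast
        have b: "cs K2 (Suc m) (u + axis i 1)" using cs.cs_step[OF u] J I by blast
        have 3: "Suc m = n1 \<and> u + axis j 1 = v1" using less.IH[OF _ 1(3) a] 1 by simp
        then have "n2 = Suc m \<and> v2 = u + axis i 1" using less.IH[OF _ b 2(3)] 1 by simp
        then show ?thesis using 1 2 3 by (auto simp: algebra_simps)
      qed
    qed
  qed
qed

definition cls :: "'o \<Rightarrow> real ^ 'n" where
  "cls M = (THE v. \<exists>n. cs M n v)"

lemma cs_cls: "cs M n v \<Longrightarrow> cls M = v"
  unfolding cls_def using cs_unique by blast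

text \<open>A composition series of Q lifts to M one simple quotient at a time, on top of the series
  of K.\<close>

lemma cs_add:
  assumes "cs Q m w" "cs K n v" "ses K M Q"
  shows "cs M (n + m) (v + w)"
  using assms(1,3)
proof (induction arbitrary: M)
  case cs_zero
  then show ?case using assms(2) ses_zero_quot by auto
next
  case (cs_step Q1 m w Q i)
  obtain P where P: "ses P M (s i)" "ses K P Q1" using quot_lift[OF cs_step(4) cs_step(2)] by blast
  from cs.cs_step[OF cs_step.IH[OF P(2)] P(1)] show ?case by (simp add: add.assoc)
qed

lemma cls_add: "ses K M Q \<Longrightarrow> cls M = cls K + cls Q"
  using cs_ex cs_add cs_cls ses_in by metis

lemma cls_zero [simp]: "cls Z = 0"
  using cs_cls cs_zero by blast

lemma cls_simple: "cls (s i) = axis i 1"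
  using cs_cls[OF cs_step[OF cs_zero ses_triv_sub[OF s_props(1)]]] by simp

lemma cs_nonneg: "cs M n v \<Longrightarrow> v $ i \<ge> 0 \<and> v $ i \<in> \<int>"
  by (induction rule: cs.induct) (auto simp: axis_def)

lemma cls_nonneg: "M \<in> Ob \<Longrightarrow> cls M $ i \<ge> 0" "M \<in> Ob \<Longrightarrow> cls M $ i \<in> \<int>"
  using cs_ex cs_nonneg cs_cls by metis+

lemma cls_ge_0: "M \<in> Ob \<Longrightarrow> cls M \<ge> 0"
  using cls_nonneg by (simp add: less_eq_vec_def)

lemma cls_nonzero: "M \<in> Ob \<Longrightarrow> M \<noteq> Z \<Longrightarrow> cls M \<noteq> 0"
proof -
  assume M: "M \<in> Ob" "M \<noteq> Z"
  obtain K i where K: "ses K M (s i)" using ex_simple_quot[OF M] simple_iff by (metis rangeE)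
  have "cls M $ i = cls K $ i + 1" using cls_add[OF K] cls_simple by simp
  then show ?thesis using cls_nonneg(1)[of K i] ses_in[OF K] by auto
qed

lemma cls_gt_0: "M \<in> Ob \<Longrightarrow> M \<noteq> Z \<Longrightarrow> cls M > 0"
  using cls_ge_0 cls_nonzero by (metis order_le_neq_trans)

lemma cls_eq_sub: "ses K M Q \<Longrightarrow> cls K = cls M \<Longrightarrow> K = M \<and> Q = Z"
proof -
  assume a: "ses K M Q" "cls K = cls M"
  have "cls Q = 0" using cls_add[OF a(1)] a(2) by simp
  then have "Q = Z" using cls_nonzero ses_in a(1) by blast
  then show ?thesis using a(1) ses_zero_quot by blast
qed

end

section \<open>Torsion pairs and tilted hearts\<close>

locale torsion_pair = exact_structure Ob ses Z
  for Ob :: "'o set" and ses :: "'o \<Rightarrow> 'o \<Rightarrow> 'o \<Rightarrow> bool" and Z :: 'o +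
  fixes T F :: "'o \<Rightarrow> bool"
  assumes T_quot: "ses K M Q \<Longrightarrow> T M \<Longrightarrow> T Q"
    and T_ext: "ses K M Q \<Longrightarrow> T K \<Longrightarrow> T Q \<Longrightarrow> T M"
    and F_sub: "ses K M Q \<Longrightarrow> F M \<Longrightarrow> F K"
    and F_ext: "ses K M Q \<Longrightarrow> F K \<Longrightarrow> F Q \<Longrightarrow> F M"
    and TF_zero: "T M \<Longrightarrow> F M \<Longrightarrow> M = Z"
    and T_in: "T M \<Longrightarrow> M \<in> Ob" and F_in: "F M \<Longrightarrow> M \<in> Ob"
    and torsion_ex: "M \<in> Ob \<Longrightarrow> \<exists>t r. ses t M r \<and> T t \<and> F r"
begin

lemma T_zero: "T Z" and F_zero: "F Z"
proof -
  obtain t r where t: "ses t Z r" "T t" "F r" using torsion_ex[OF zero_in] by blast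
  with ses_of_zero[OF t(1)] show "T Z" "F Z" by auto
qed

lemma dual_torsion: "torsion_pair Ob (\<lambda>K M Q. ses Q M K) Z F T"
proof -
  interpret d: exact_structure Ob "\<lambda>K M Q. ses Q M K" Z by (rule dual)
  show ?thesis
    by unfold_locales (use T_quot T_ext F_sub F_ext TF_zero T_in F_in torsion_ex in blast)+
qed

text \<open>
  The simple objects of the tilted heart whose objects are extensions of objects of \<open>T\<close> by
  objects of \<open>F[1]\<close>, described inside the original category.
\<close>

definition ET :: "'o \<Rightarrow> bool" where
  "ET X \<longleftrightarrow> T X \<and> X \<noteq> Z \<and> (\<forall>K Q. ses K X Q \<longrightarrow> Q \<noteq> Z \<longrightarrow> F K) \<and>
     (\<forall>L G. ses L G X \<longrightarrow> F L \<longrightarrow> T G \<longrightarrow> L = Z)"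

text \<open>The object X[1] is simple in the heart. A sequence X -> G -> Q with G in F and Q in T
  rotates to Q -> X[1] -> G[1], so Q is a subobject of X[1] and must vanish. In \<open>ET\<close>
  the sequence L -> G -> X likewise rotates to G -> X -> L[1].\<close>

definition EF :: "'o \<Rightarrow> bool" where
  "EF X \<longleftrightarrow> F X \<and> X \<noteq> Z \<and> (\<forall>K Q. ses K X Q \<longrightarrow> K \<noteq> Z \<longrightarrow> T Q) \<and>
     (\<forall>G Q. ses X G Q \<longrightarrow> F G \<longrightarrow> T Q \<longrightarrow> Q = Z)"

lemma dual_ET: "torsion_pair.ET (\<lambda>K M Q. ses Q M K) Z F T = EF"
  unfolding torsion_pair.ET_def[OF dual_torsion, abs_def] EF_def[abs_def] by (intro ext iffI; metis)

text \<open>Failure of simplicity is turned into an exact sequence of the heart with two nonzero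
  outer terms, the shape on which induction over weights can act.\<close>

lemma not_ET:
  assumes "T V" "V \<noteq> Z" "\<not> ET V"
  shows "(\<exists>K Q. ses K V Q \<and> T K \<and> K \<noteq> Z \<and> Q \<noteq> Z) \<or> (\<exists>L G. ses L G V \<and> F L \<and> L \<noteq> Z \<and> T G)"
proof -
  consider K Q where "ses K V Q" "Q \<noteq> Z" "\<not> F K" | L G where "ses L G V" "F L" "T G" "L \<noteq> Z"
    using assms unfolding ET_def by blast
  then show ?thesis
  proof cases
    case 1
    \<comment> \<open>A subobject outside F has a nonzero torsion part, which replaces K.\<close>
    obtain t r where t: "ses t K r" "T t" "F r" using torsion_ex ses_in 1 by blast
    have "t \<noteq> Z" using t 1(3) ses_zero_sub[of K r] by auto
    obtain R where R: "ses t V R" "ses r R Q" using sub_quot[OF 1(1) t(1)] by blast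
    have "R \<noteq> Z" using R 1(2) ses_of_zero[of r Q] by auto
    then show ?thesis using t R \<open>t \<noteq> Z\<close> by blast
  qed blast
qed

lemma not_EF:
  assumes "F V" "V \<noteq> Z" "\<not> EF V"
  shows "(\<exists>K Q. ses K V Q \<and> F Q \<and> K \<noteq> Z \<and> Q \<noteq> Z) \<or> (\<exists>G Q. ses V G Q \<and> T Q \<and> Q \<noteq> Z \<and> F G)"
  using torsion_pair.not_ET[OF dual_torsion assms(1,2)] assms(3) dual_ET by metis

text \<open>The image of t' in r is a quotient of a torsion object inside a torsion-free one, hence
  zero; by symmetry both r and r' are the quotient by the sum of t and t'.\<close>

lemma torsion_unique:
  assumes "ses t M r" "T t" "F r" "ses t' M r'" "T t'" "F r'"
  shows "r = r'"
proof -
  obtain J I I' C where J: "ses J t' I" "ses I r C" "ses J t I'" "ses I' r' C"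
    using two_subs[OF assms(1,4)] by blast
  have "I = Z" using T_quot[OF J(1) assms(5)] F_sub[OF J(2) assms(3)] TF_zero by blast
  moreover have "I' = Z" using T_quot[OF J(3) assms(2)] F_sub[OF J(4) assms(6)] TF_zero by blast
  ultimately show ?thesis using J ses_zero_sub by blast
qed

end

text \<open>With the sign changed on F[1], the weight is additive on the heart and at least
  \<open>\<epsilon>\<close> on each nonzero object of T or F[1]. It therefore bounds lengths in the
  heart without a reference to the heart itself.\<close>

locale torsion_pair_weight = torsion_pair Ob ses Z T F
  for Ob :: "'o set" and ses :: "'o \<Rightarrow> 'o \<Rightarrow> 'o \<Rightarrow> bool" and Z :: 'o and T F +
  fixes w :: "'o \<Rightarrow> real" and \<epsilon> :: real
  assumes w_add: "ses K M Q \<Longrightarrow> w M = w K + w Q"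
    and eps: "\<epsilon> > 0"
    and w_T: "T M \<Longrightarrow> M \<noteq> Z \<Longrightarrow> w M \<ge> \<epsilon>"
    and w_F: "F M \<Longrightarrow> M \<noteq> Z \<Longrightarrow> w M \<le> - \<epsilon>"
begin

text \<open>The weight is real-valued, but each step lowers its absolute value by at least
  \<open>\<epsilon>\<close>, so ordinary induction on a bound \<open>n * \<epsilon>\<close>
  suffices.\<close>

lemma weight_induct [case_names less]:
  assumes "\<And>V. (\<And>V'. \<bar>w V'\<bar> \<le> \<bar>w V\<bar> - \<epsilon> \<Longrightarrow> P V') \<Longrightarrow> P V"
  shows "P V"
proof -
  have "\<bar>w V\<bar> \<le> real n * \<epsilon> \<Longrightarrow> P V" for n V
  proof (induction n arbitrary: V)
    case 0
    then have "w V = 0" by simp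
    then show ?case using assms[of V] eps by force
  next
    case (Suc n)
    then show ?case using assms[of V] by (force simp: algebra_simps)
  qed
  moreover obtain n where "\<bar>w V\<bar> / \<epsilon> \<le> real n" using real_arch_simple by blast
  then have "\<bar>w V\<bar> \<le> real n * \<epsilon>" using eps by (simp add: field_simps)
  ultimately show ?thesis by blast
qed

text \<open>
  Both classes are generated under extension in the heart by its simple objects;
  \<open>G\<close> collects signed classes.
\<close>

lemma generation:
  assumes addG: "\<And>a b. G a \<Longrightarrow> G b \<Longrightarrow> G (a + b :: 'v::ab_group_add)" and G0: "G 0"
    and c_add: "\<And>K M Q. ses K M Q \<Longrightarrow> c M = c K + c Q"
    and GT: "\<And>V. ET V \<Longrightarrow> G (c V)" and GF: "\<And>V. EF V \<Longrightarrow> G (- c V)"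
  shows "(T M \<longrightarrow> G (c M)) \<and> (F M \<longrightarrow> G (- c M))"
proof (induction M rule: weight_induct)
  case (less V)
  have c0: "c Z = 0" using c_add[OF ses_triv_sub[OF zero_in]] by simp
  show ?case
  proof (cases "V = Z")
    case True then show ?thesis using c0 G0 by simp
  next
    case False
    have "G (c V)" if TV: "T V"
    proof (cases "ET V")
      case True then show ?thesis using GT by blast
    next
      case nE: False
      from not_ET[OF TV False nE] show ?thesis
      proof (elim disjE exE conjE)
        fix K Q assume a: "ses K V Q" "T K" "K \<noteq> Z" "Q \<noteq> Z"
        have TQ: "T Q" using T_quot a(1) TV by blast
        have "G (c K)" using less[of K] a w_T[of K] w_T[of Q] w_T[of V] TQ TV False w_add[OF a(1)] eps
          by auto
        moreover have "G (c Q)" using less[of Q] a w_T[of K] w_T[of Q] TQ w_add[OF a(1)] eps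
          by auto
        ultimately show ?thesis using addG c_add[OF a(1)] by simp
      next
        fix L B assume a: "ses L B V" "F L" "L \<noteq> Z" "T B"
        have B: "B \<noteq> Z" using a(1) False ses_of_zero by blast
        \<comment> \<open>As \<open>w L\<close> is negative, \<open>w V = w B - w L\<close> is a sum
          of two positive parts, so both B and L have smaller absolute weight than V.\<close>
        have "G (c B)" using less[of B] a B w_T[of B] w_F[of L] w_T[of V] TV False w_add[OF a(1)] eps
          by auto
        moreover have "G (- c L)" using less[of L] a B w_T[of B] w_F[of L] w_T[of V] TV False w_add[OF a(1)] eps
          by auto
        moreover have "c V = c B + - c L" using c_add[OF a(1)] by simp
        ultimately show ?thesis using addG by metis
      qed
    qed
    moreover have "G (- c V)" if TV: "F V"
    proof (cases "EF V")
      case True then show ?thesis using GF by blast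
    next
      case nE: False
      from not_EF[OF TV False nE] show ?thesis
      proof (elim disjE exE conjE)
        fix K Q assume a: "ses K V Q" "F Q" "K \<noteq> Z" "Q \<noteq> Z"
        have TQ: "F K" using F_sub a(1) TV by blast
        have "G (- c K)" using less[of K] a w_F[of K] w_F[of Q] TQ w_add[OF a(1)] eps
          by auto
        moreover have "G (- c Q)" using less[of Q] a w_F[of K] w_F[of Q] TQ w_add[OF a(1)] eps
          by auto
        moreover have "- c V = - c K + - c Q" using c_add[OF a(1)] by simp
        ultimately show ?thesis using addG by metis
      next
        fix B L assume a: "ses V B L" "T L" "L \<noteq> Z" "F B"
        have B: "B \<noteq> Z" using a(1) False ses_of_zero by blast
        have "G (- c B)" using less[of B] a B w_F[of B] w_T[of L] w_F[of V] TV False w_add[OF a(1)] eps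
          by auto
        moreover have "G (c L)" using less[of L] a B w_F[of B] w_T[of L] w_F[of V] TV False w_add[OF a(1)] eps
          by auto
        moreover have "- c V = - c B + c L" using c_add[OF a(1)] by simp
        ultimately show ?thesis using addG by metis
      qed
    qed
    ultimately show ?thesis by blast
  qed
qed

text \<open>A nonzero object \<open>M[1]\<close> of the heart has a simple subobject with quotient in \<open>F[1]\<close>.\<close>

lemma heart_simple_sub:
  assumes "F M" "M \<noteq> Z"
  shows "(\<exists>V Q. EF V \<and> ses V M Q \<and> F Q) \<or> (\<exists>V G. ET V \<and> ses M G V \<and> F G)"
proof -
  let ?C = "(\<exists>V Q. EF V \<and> ses V M Q \<and> F Q) \<or> (\<exists>V G. ET V \<and> ses M G V \<and> F G)"
  \<comment> \<open>The two disjuncts describe subobjects of M[1] in the heart, namely V[1] or V,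
    whose quotient lies in F[1]. If such a subobject is not simple, a smaller one of either kind is
    found inside it; the descent starts with M[1] itself.\<close>
  have "V \<noteq> Z \<longrightarrow> (F V \<and> (\<exists>Q. ses V M Q \<and> F Q)) \<or> (T V \<and> (\<exists>G. ses M G V \<and> F G)) \<longrightarrow> ?C" for V
  proof (induction V rule: weight_induct)
    case (less V)
    show ?case
    proof (intro impI, elim disjE conjE exE)
      fix Q assume V: "V \<noteq> Z" "F V" "ses V M Q" "F Q"
      show ?C
      proof (cases "EF V")
        case True then show ?thesis using V by blast
      next
        case False
        from not_EF[OF V(2,1) False] show ?thesis
        proof (elim disjE exE conjE)
          fix K R assume a: "ses K V R" "F R" "K \<noteq> Z" "R \<noteq> Z"
          obtain Q2 where Q2: "ses K M Q2" "ses R Q2 Q" using sub_quot[OF V(3) a(1)] by blast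
          have "F Q2" using F_ext Q2 a V by blast
          moreover have "F K" using F_sub a V by blast
          moreover have "\<bar>w K\<bar> \<le> \<bar>w V\<bar> - \<epsilon>"
            using w_F[OF a(2,4)] w_F[OF \<open>F K\<close> a(3)] w_add[OF a(1)] eps by auto
          ultimately show ?thesis using less[of K] Q2 a(3) by blast
        next
          fix G L assume a: "ses V G L" "T L" "L \<noteq> Z" "F G"
          obtain P where P: "ses M P L" "ses G P Q" using pushout[OF a(1) V(3)] by blast
          have "F P" using F_ext P a V by blast
          have "G \<noteq> Z" using a(1) V(1) ses_of_zero by blast
          have "\<bar>w L\<bar> \<le> \<bar>w V\<bar> - \<epsilon>"
            using w_T[OF a(2,3)] w_F[OF a(4) \<open>G \<noteq> Z\<close>] w_F[OF V(2,1)] w_add[OF a(1)] eps by auto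
          then show ?thesis using less[of L] P a \<open>F P\<close> by blast
        qed
      qed
    next
      fix G assume V: "V \<noteq> Z" "T V" "ses M G V" "F G"
      show ?C
      proof (cases "ET V")
        case True then show ?thesis using V by blast
      next
        case False
        from not_ET[OF V(2,1) False] show ?thesis
        proof (elim disjE exE conjE)
          fix K R assume a: "ses K V R" "T K" "K \<noteq> Z" "R \<noteq> Z"
          obtain P where P: "ses P G R" "ses M P K" using quot_lift[OF V(3) a(1)] by blast
          have "F P" using F_sub P V by blast
          have "T R" using T_quot a V by blast
          have "\<bar>w K\<bar> \<le> \<bar>w V\<bar> - \<epsilon>"
            using w_T[OF a(2,3)] w_T[OF \<open>T R\<close> a(4)] w_add[OF a(1)] eps by auto
          then show ?thesis using less[of K] P a \<open>F P\<close> by blast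
        next
          fix L B assume a: "ses L B V" "F L" "L \<noteq> Z" "T B"
          obtain P where P: "ses M P B" "ses L P G" using pullback[OF V(3) a(1)] by blast
          have "F P" using F_ext P a V by blast
          have "B \<noteq> Z" using a(1) V(1) ses_of_zero by blast
          have "\<bar>w B\<bar> \<le> \<bar>w V\<bar> - \<epsilon>"
            using w_T[OF a(4) \<open>B \<noteq> Z\<close>] w_F[OF a(2,3)] w_T[OF V(2,1)] w_add[OF a(1)] eps by auto
          then show ?thesis using less[of B] P a \<open>F P\<close> \<open>B \<noteq> Z\<close> by blast
        qed
      qed
    qed
  qed
  from this[of M] show ?thesis using assms ses_triv_quot F_in F_zero by blast
qed

end

section \<open>Mutation of the simple objects of the heart\<close>

text \<open>The axiom \<open>layer\<close> expresses that the objects of T' and F are built from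
  copies of X alone. Only X[1] is replaced by X when passing from the old heart to the new
  one.\<close>

locale torsion_mutation = exact_structure Ob ses Z + old: torsion_pair_weight Ob ses Z T F w \<epsilon> +
    new: torsion_pair Ob ses Z T' F'
  for Ob :: "'o set" and ses :: "'o \<Rightarrow> 'o \<Rightarrow> 'o \<Rightarrow> bool" and Z :: 'o
    and T F :: "'o \<Rightarrow> bool" and w :: "'o \<Rightarrow> real" and \<epsilon> :: real and T' F' :: "'o \<Rightarrow> bool" +
  fixes X :: 'o
  assumes T_le: "T M \<Longrightarrow> T' M" and F_le: "F' M \<Longrightarrow> F M"
    and X: "X \<noteq> Z" "T' X" "F X"
    and layer: "T' M \<Longrightarrow> F M \<Longrightarrow> M \<noteq> Z \<Longrightarrow> (\<exists>K. ses K M X) \<and> (\<exists>Q. ses X M Q)"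
begin

text \<open>A nonzero torsion-free part of Q would lie in T' and F and thus map onto X. Then X would
  be a proper quotient of itself.\<close>

lemma quot_X: "ses K X Q \<Longrightarrow> K \<noteq> Z \<Longrightarrow> T Q"
proof -
  assume a: "ses K X Q" "K \<noteq> Z"
  obtain t r where t: "ses t Q r" "T t" "F r" using old.torsion_ex ses_in a by blast
  have "T' r" using new.T_quot a(1) t(1) X(2) by blast
  have "r = Z"
  proof (rule ccontr)
    assume "r \<noteq> Z"
    then obtain L where L: "ses L r X" using layer \<open>T' r\<close> t(3) by blast
    obtain P where P: "ses P Q X" using quot_trans[OF t(1) L] by blast
    obtain P' where P': "ses P' X X" "ses K P' P" using quot_lift[OF a(1) P] by blast
    have "P' = Z" using ses_self_quot P' by blast
    then show False using P'(2) ses_of_zero[of K P] a(2) by simp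
  qed
  then have "t = Q" using t(1) ses_zero_quot by simp
  then show ?thesis using t(2) by simp
qed

lemma sub_X: "ses K X Q \<Longrightarrow> Q \<noteq> Z \<Longrightarrow> F' K"
proof -
  assume a: "ses K X Q" "Q \<noteq> Z"
  obtain t r where t: "ses t K r" "T' t" "F' r" using new.torsion_ex ses_in a by blast
  have "F t" using old.F_sub a(1) t(1) X(3) by blast
  have "t = Z"
  proof (rule ccontr)
    assume "t \<noteq> Z"
    then obtain L where L: "ses X t L" using layer \<open>F t\<close> t(2) by blast
    obtain P where P: "ses X K P" using sub_trans[OF t(1) L] by blast
    obtain P' where P': "ses X X P'" "ses P P' Q" using sub_quot[OF a(1) P] by blast
    have "P' = Z" using ses_self_sub P' by blast
    then show False using P'(2) ses_of_zero[of P Q] a(2) by simp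
  qed
  then have "r = K" using t(1) ses_zero_sub by simp
  then show ?thesis using t(3) by simp
qed

text \<open>G lies in T' and F, hence maps onto X. The composite X -> G -> X is an isomorphism, so Q
  is also a subobject of G and lies in both T and F.\<close>

lemma ext_X: "ses X G Q \<Longrightarrow> F G \<Longrightarrow> T Q \<Longrightarrow> Q = Z"
proof -
  assume a: "ses X G Q" "F G" "T Q"
  have "T' G" using new.T_ext a T_le X by blast
  have "G \<noteq> Z" using a(1) X(1) ses_of_zero[of X Q] by auto
  then obtain K where K: "ses K G X" using layer \<open>T' G\<close> a(2) by blast
  obtain J I I' C where J: "ses J X I" "ses I X C" "ses J K I'" "ses I' Q C"
    using two_subs[OF K a(1)] by blast
  have "T C" using old.T_quot J(4) a(3) by blast
  have "I \<noteq> Z"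
  proof
    assume "I = Z"
    then have "C = X" using J(2) ses_zero_sub by simp
    then show False using \<open>T C\<close> X old.TF_zero by simp
  qed
  have "J = Z"
  proof (rule ccontr)
    assume "J \<noteq> Z"
    then have "T I" using quot_X J(1) by blast
    moreover have "F I" using old.F_sub J(2) X by blast
    ultimately show False using \<open>I \<noteq> Z\<close> old.TF_zero by blast
  qed
  then have "I = X" "I' = K" using J(1,3) ses_zero_sub by simp_all
  then have "C = Z" using J(2) ses_self_sub by simp
  then have "K = Q" using J(4) \<open>I' = K\<close> ses_zero_quot by simp
  then have "F Q" using old.F_sub K a(2) by simp
  then show ?thesis using a(3) old.TF_zero by blast
qed

text \<open>Here G contains a copy of X by \<open>layer\<close>, and X -> G -> X is again an
  isomorphism; so L is a quotient of G and lies in both T' and F'.\<close>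

lemma coext_X: "ses L G X \<Longrightarrow> F' L \<Longrightarrow> T' G \<Longrightarrow> L = Z"
proof -
  assume a: "ses L G X" "F' L" "T' G"
  have "F G" using old.F_ext a F_le X by blast
  have "G \<noteq> Z" using a(1) X(1) ses_of_zero[of L X] by auto
  then obtain Q where Q: "ses X G Q" using layer \<open>F G\<close> a(3) by blast
  obtain J I I' C where J: "ses J X I" "ses I X C" "ses J L I'" "ses I' Q C"
    using two_subs[OF a(1) Q] by blast
  have "F' J" using new.F_sub J(3) a(2) by blast
  have "I \<noteq> Z"
  proof
    assume "I = Z"
    then have "J = X" using J(1) ses_zero_quot by simp
    then show False using \<open>F' J\<close> X new.TF_zero by simp
  qed
  have "J = Z"
  proof (rule ccontr)
    assume "J \<noteq> Z"
    then have "T I" using quot_X J(1) by blast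
    moreover have "F I" using old.F_sub J(2) X by blast
    ultimately show False using \<open>I \<noteq> Z\<close> old.TF_zero by blast
  qed
  then have "I = X" "I' = L" using J(1,3) ses_zero_sub by simp_all
  then have "C = Z" using J(2) ses_self_sub by simp
  then have "L = Q" using J(4) \<open>I' = L\<close> ses_zero_quot by simp
  then have "T' L" using new.T_quot Q a(3) by simp
  then show ?thesis using a(2) new.TF_zero by blast
qed

lemma EF_X: "old.EF X"
  unfolding old.EF_def using X quot_X ext_X by blast

lemma ET_X: "new.ET X"
  unfolding new.ET_def using X sub_X coext_X by blast

text \<open>The torsion part t of Q pulls back to an extension of t by X inside G, and
  \<open>ext_X\<close> kills it.\<close>

lemma layer_quot:
  assumes "T' G" "F G" "ses X G Q"
  shows "T' Q" "F Q"
proof -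
  show "T' Q" using new.T_quot assms by blast
  obtain t r where t: "ses t Q r" "T t" "F r" using old.torsion_ex ses_in assms(3) by blast
  obtain P where P: "ses P G r" "ses X P t" using quot_lift[OF assms(3) t(1)] by blast
  have "t = Z" using ext_X[OF P(2) _ t(2)] old.F_sub[OF P(1) assms(2)] by blast
  then have "r = Q" using t(1) ses_zero_sub by simp
  then show "F Q" using t(3) by simp
qed

text \<open>A copy of X inside G meets Y trivially and therefore embeds into E. Dividing it out
  keeps the shape of the sequence and makes G smaller.\<close>

lemma layer_kernel:
  assumes "F' Y" "ses Y G E" "T' G" "T' E" "F E"
  shows "Y = Z"
  using assms
proof (induction G arbitrary: E rule: wfp_induct_rule[OF wf_quot])
  case (1 G)
  have FG: "F G" using old.F_ext 1 F_le by blast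
  show ?case
  proof (cases "G = Z")
    case True
    then show ?thesis using 1(3) ses_of_zero[of Y E] by simp
  next
    case False
    then obtain Q where Q: "ses X G Q" using layer 1 FG by blast
    have WQ: "T' Q" using layer_quot[OF 1(4) FG Q] by blast
    obtain J I I' C where J: "ses J X I" "ses I E C" "ses J Y I'" "ses I' Q C"
      using two_subs[OF 1(3) Q] by blast
    have "J = Z"
    proof (rule ccontr)
      assume "J \<noteq> Z"
      then have "T I" using quot_X J(1) by blast
      moreover have "F I" using old.F_sub J(2) 1 by blast
      ultimately have "I = Z" using old.TF_zero by blast
      then have "J = X" using J(1) ses_zero_quot by simp
      moreover have "F' J" using new.F_sub J(3) 1 by blast
      ultimately show False using X new.TF_zero by simp
    qed
    then have "I = X" "I' = Y" using J(1,3) ses_zero_sub by simp_all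
    then have "T' C" "F C" using layer_quot[of E C] 1 J(2) by simp_all
    then show ?thesis using 1(1)[of Q C] Q X(1) 1(2) J(4) \<open>I' = Y\<close> WQ by blast
  qed
qed

text \<open>The torsion-free quotient r of G for the new pair is Y itself. The torsion part t meets
  Y trivially, since otherwise G would be torsion against \<open>layer_kernel\<close>; then Y embeds
  into r with torsion quotient, which vanishes by simplicity.\<close>

lemma EF_ext_split:
  assumes "new.EF Y" "ses Y G E" "T' E" "F E"
  shows "\<exists>t. T' t \<and> ses t G Y"
proof -
  have Y: "F' Y" "Y \<noteq> Z" using assms(1) unfolding new.EF_def by blast+
  obtain t r where t: "ses t G r" "T' t" "F' r" using new.torsion_ex ses_in assms(2) by blast
  obtain J I I' C where J: "ses J Y I" "ses I r C" "ses J t I'" "ses I' E C"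
    using two_subs[OF t(1) assms(2)] by blast
  have "T' C" using new.T_quot J(4) assms(3) by blast
  have "J = Z"
  proof (rule ccontr)
    assume "J \<noteq> Z"
    then have "T' I" using assms(1) J(1) unfolding new.EF_def by blast
    moreover have "F' I" using new.F_sub J(2) t(3) by blast
    ultimately have "I = Z" using new.TF_zero by blast
    then have "C = r" using J(2) ses_zero_sub by simp
    then have "r = Z" using \<open>T' C\<close> t(3) new.TF_zero by simp
    then have "t = G" using t(1) ses_zero_quot by simp
    then show False using layer_kernel[OF Y(1) assms(2) _ assms(3,4)] t(2) Y(2) by simp
  qed
  then have "I = Y" using J(1) ses_zero_sub by simp
  then have "C = Z" using assms(1) J(2) t(3) \<open>T' C\<close> unfolding new.EF_def by blast
  then have "I = r" using J(2) ses_zero_quot by simp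
  then show ?thesis using t \<open>I = Y\<close> by blast
qed

text \<open>Both Y1 and Y2 are the torsion-free quotient of P for the new pair, which is
  unique.\<close>

lemma EF_determined:
  assumes "new.EF Y1" "ses Y1 P E1" "T' E1" "F E1" "new.EF Y2" "ses Y2 P E2" "T' E2" "F E2"
  shows "Y1 = Y2"
proof -
  obtain t where t: "T' t" "ses t P Y1" using EF_ext_split assms by blast
  obtain t2 where t2: "T' t2" "ses t2 P Y2" using EF_ext_split assms by blast
  show ?thesis using new.torsion_unique t t2 assms(1,5) unfolding new.EF_def by blast
qed

text \<open>E is built from copies of X, and Y is a simple object of the new heart different from X.
  Copies of X inside E map to zero in Y and can be divided out.\<close>

lemma no_layer_quot:
  assumes "new.ET Y" "Y \<noteq> X" "T' E" "F E"
  shows "\<not> ses K E Y"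
proof
  assume "ses K E Y"
  then show False using assms(3,4)
  proof (induction E arbitrary: K rule: wfp_induct_rule[OF wf_quot])
    case (1 E)
    have Y: "Y \<noteq> Z" "T' Y" using assms(1) unfolding new.ET_def by auto
    have "E \<noteq> Z" using 1(2) Y ses_of_zero[of K Y] by auto
    then obtain Q where Q: "ses X E Q" using layer 1 by blast
    have WQ: "T' Q" "F Q" using layer_quot[OF 1(3,4) Q] by blast+
    obtain J I I' C where J: "ses J X I" "ses I Y C" "ses J K I'" "ses I' Q C"
      using two_subs[OF 1(2) Q] by blast
    show False
    proof (cases "C = Z")
      case True
      then have I: "I = Y" using J(2) ses_zero_quot by simp
      have "F' J" using sub_X J(1) I Y by blast
      then have "J = Z" using assms(1) J(1) I X(2) unfolding new.ET_def by blast
      then show False using J(1) ses_zero_sub I assms(2) by simp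
    next
      case False
      then have "F' I" using assms(1) J(2) unfolding new.ET_def by blast
      moreover have "T' I" using new.T_quot J(1) X(2) by blast
      ultimately have "I = Z" using new.TF_zero by blast
      then have "C = Y" using J(2) ses_zero_sub by simp
      then show False using 1(1)[of Q I'] Q X(1) J(4) WQ by blast
    qed
  qed
qed

lemma no_layer_nzmap:
  assumes "new.ET Y" "Y \<noteq> X" "T' E" "F E"
  shows "\<not> nzmap E Y"
proof
  assume "nzmap E Y"
  then obtain I K C where I: "I \<noteq> Z" "ses K E I" "ses I Y C" unfolding nzmap_def by blast
  have "T' I" using new.T_quot I(2) assms(3) by blast
  show False
  proof (cases "C = Z")
    case True
    then have "I = Y" using I(3) ses_zero_quot by simp
    then show False using no_layer_quot[OF assms] I(2) by blast
  next
    case False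
    then have "F' I" using assms(1) I(3) unfolding new.ET_def by blast
    then show False using \<open>T' I\<close> new.TF_zero I(1) by blast
  qed
qed

text \<open>Y' and Y differ by an object E built from copies of X; the three shapes reflect on which
  side the two simple objects lie. The fourth combination is absent because a new simple object of
  T' other than X already lies in T.\<close>

definition mutates :: "'o \<Rightarrow> 'o \<Rightarrow> bool" where
  "mutates Y' Y \<longleftrightarrow> (\<exists>E. T' E \<and> F E \<and>
    (new.EF Y' \<and> old.EF Y \<and> ses Y Y' E \<or> new.EF Y' \<and> old.ET Y \<and> ses Y' E Y \<or>
     new.ET Y' \<and> old.ET Y \<and> ses E Y Y'))"

text \<open>If two new torsion-free simple objects share a partner Y, the pushout or pullback over Y
  contains both with quotients built from X, so \<open>EF_determined\<close> applies. The remaining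
  cases contradict the absence of maps from such objects to torsion simples.\<close>

lemma mutates_inj:
  assumes "mutates Y1 Y" "mutates Y2 Y" "Y1 \<noteq> X" "Y2 \<noteq> X"
  shows "Y1 = Y2"
proof -
  have aux: False if "old.EF Y" "old.ET Y" for Y
    using that old.TF_zero unfolding old.EF_def old.ET_def by blast
  have 23: False if a: "T' E1" "F E1" "T' E2" "F E2" "new.ET V" "V \<noteq> X" "ses U E1 Y" "ses E2 Y V"
    for E1 E2 U V
    using quot_trans[OF a(7,8)] no_layer_quot[OF a(5,6) a(1,2)] by blast
  have 33: "V = U" if a: "T' E1" "F E1" "T' E2" "F E2" "new.ET V" "V \<noteq> X" "new.ET U" "U \<noteq> X"
      "ses E1 Y U" "ses E2 Y V" for E1 E2 U V
  proof -
    obtain J I I' C where J: "ses J E2 I" "ses I U C" "ses J E1 I'" "ses I' V C"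
      using two_subs[OF a(9,10)] by blast
    have "I = Z" using no_layer_nzmap[OF a(7,8,3,4)] nzmapI J(1,2) by blast
    moreover have "I' = Z" using no_layer_nzmap[OF a(5,6,1,2)] nzmapI J(3,4) by blast
    ultimately show ?thesis using J ses_zero_sub by blast
  qed
  obtain E1 where E1: "T' E1" "F E1" and
    c1: "new.EF Y1 \<and> old.EF Y \<and> ses Y Y1 E1 \<or> new.EF Y1 \<and> old.ET Y \<and> ses Y1 E1 Y \<or>
     new.ET Y1 \<and> old.ET Y \<and> ses E1 Y Y1" using assms(1) unfolding mutates_def by blast
  obtain E2 where E2: "T' E2" "F E2" and
    c2: "new.EF Y2 \<and> old.EF Y \<and> ses Y Y2 E2 \<or> new.EF Y2 \<and> old.ET Y \<and> ses Y2 E2 Y \<or>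
     new.ET Y2 \<and> old.ET Y \<and> ses E2 Y Y2" using assms(2) unfolding mutates_def by blast
  show ?thesis
  proof (cases "old.EF Y")
    case True
    then have a: "new.EF Y1" "ses Y Y1 E1" "new.EF Y2" "ses Y Y2 E2" using aux c1 c2 by blast+
    obtain P where "ses Y2 P E1" "ses Y1 P E2" using pushout[OF a(2,4)] by blast
    then show ?thesis using EF_determined a E1 E2 by blast
  next
    case False
    then consider "new.EF Y1" "ses Y1 E1 Y" "new.EF Y2" "ses Y2 E2 Y"
      | "new.EF Y1" "ses Y1 E1 Y" "new.ET Y2" "ses E2 Y Y2"
      | "new.ET Y1" "ses E1 Y Y1" "new.EF Y2" "ses Y2 E2 Y"
      | "new.ET Y1" "ses E1 Y Y1" "new.ET Y2" "ses E2 Y Y2"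
      using c1 c2 by blast
    then show ?thesis
    proof cases
      case 1
      obtain P where "ses Y1 P E2" "ses Y2 P E1" using pullback[OF 1(2,4)] by blast
      then show ?thesis using EF_determined 1 E1 E2 by blast
    next
      case 2
      then show ?thesis using 23 E1 E2 assms by blast
    next
      case 3
      then show ?thesis using 23 E1 E2 assms by blast
    next
      case 4
      then show ?thesis using 33 E1 E2 assms by blast
    qed
  qed
qed

text \<open>The partner is a simple subobject of Y'[1] in the old heart. Simplicity of Y'[1] in the
  new heart puts the third term of the sequence into T'.\<close>

lemma mutates_ex_EF:
  assumes "new.EF Y'"
  shows "\<exists>Y. Y \<noteq> X \<and> mutates Y' Y"
proof -
  have Y': "F' Y'" "Y' \<noteq> Z" using assms unfolding new.EF_def by auto
  from old.heart_simple_sub[OF F_le[OF Y'(1)] Y'(2)] show ?thesis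
  proof (elim disjE exE conjE)
    fix V Q assume a: "old.EF V" "ses V Y' Q" "F Q"
    have V: "V \<noteq> Z" "F' V" using a new.F_sub Y' unfolding old.EF_def by blast+
    have "T' Q" using assms a(2) V(1) unfolding new.EF_def by blast
    moreover have "V \<noteq> X" using V X new.TF_zero by blast
    ultimately show ?thesis using a assms unfolding mutates_def by blast
  next
    fix V G assume a: "old.ET V" "ses Y' G V" "F G"
    have V: "V \<noteq> Z" "T V" using a unfolding old.ET_def by blast+
    obtain t r where t: "ses t G r" "T' t" "F' r" using new.torsion_ex ses_in a(2) by blast
    obtain J I I' C where J: "ses J Y' I" "ses I r C" "ses J t I'" "ses I' V C"
      using two_subs[OF t(1) a(2)] by blast
    have "T C" using old.T_quot J(4) V by blast
    then have "T' C" by (rule T_le)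
    have "T' G"
    proof (cases "J = Z")
      case True
      then have "I = Y'" "I' = t" using J(1,3) ses_zero_sub by simp_all
      then have "C = Z" using assms J(2) t(3) \<open>T' C\<close> unfolding new.EF_def by blast
      then have "t = V" using J(4) \<open>I' = t\<close> ses_zero_quot by simp
      then have "F V" using old.F_sub t(1) a(3) by blast
      then show ?thesis using V old.TF_zero by blast
    next
      case False
      then have "T' I" using assms J(1) unfolding new.EF_def by blast
      moreover have "F' I" using new.F_sub J(2) t(3) by blast
      ultimately have "I = Z" using new.TF_zero by blast
      then have "C = r" using J(2) ses_zero_sub by simp
      then have "r = Z" using \<open>T' C\<close> t(3) new.TF_zero by simp
      then have "t = G" using t(1) ses_zero_quot by simp
      then show ?thesis using t(2) by simp
    qed
    moreover have "V \<noteq> X" using V X old.TF_zero by blast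
    ultimately show ?thesis using a assms unfolding mutates_def by blast
  qed
qed

text \<open>Y' lies in T: otherwise it would lie in F, so X would embed properly in it, against
  simplicity. The partner is then a simple subobject V of Y' in the old heart with quotient L[1],
  where simplicity of Y' in the new heart forces L into T'.\<close>

lemma mutates_ex_ET:
  assumes Y': "new.ET Y'" "Y' \<noteq> X"
  shows "\<exists>Y. Y \<noteq> X \<and> mutates Y' Y"
proof -
  have Y: "T' Y'" "Y' \<noteq> Z" and sub: "\<And>K Q. ses K Y' Q \<Longrightarrow> Q \<noteq> Z \<Longrightarrow> F' K"
    and ext: "\<And>L G. ses L G Y' \<Longrightarrow> F' L \<Longrightarrow> T' G \<Longrightarrow> L = Z"
    using Y' unfolding new.ET_def by auto
  have "T Y'"
  proof -
    obtain t r where t: "ses t Y' r" "T t" "F r" using old.torsion_ex ses_in Y(1) new.T_in by blast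
    have "T' r" using new.T_quot t(1) Y(1) by blast
    have "r = Z"
    proof (rule ccontr)
      assume r: "r \<noteq> Z"
      then have "F' t" using sub t(1) by blast
      then have "t = Z" using t(2) T_le new.TF_zero by blast
      then have "r = Y'" using t(1) ses_zero_sub by simp
      then have "F Y'" using t(3) by simp
      then obtain Q where Q: "ses X Y' Q" using layer Y by blast
      have "Q \<noteq> Z"
      proof
        assume "Q = Z"
        then have "X = Y'" using Q ses_zero_quot by simp
        then show False using Y'(2) by simp
      qed
      then have "F' X" using sub Q by blast
      then show False using X new.TF_zero by blast
    qed
    then have "t = Y'" using t(1) ses_zero_quot by simp
    then show ?thesis using t(2) by simp
  qed
  \<comment> \<open>The sequence L -> V -> Y' says that V is a subobject of Y' in the old heart with
    quotient L[1]. The descent starts with V = Y' and L = Z.\<close>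
  have "T V \<longrightarrow> F L \<longrightarrow> ses L V Y' \<longrightarrow> (\<exists>V L. old.ET V \<and> F L \<and> ses L V Y')" for V L
  proof (induction V arbitrary: L rule: old.weight_induct)
    case (less V)
    show ?case
    proof (intro impI)
      assume V: "T V" "F L" "ses L V Y'"
      have V0: "V \<noteq> Z" using V(3) Y(2) ses_of_zero[of L Y'] by auto
      show "\<exists>V L. old.ET V \<and> F L \<and> ses L V Y'"
      proof (cases "old.ET V")
        case True then show ?thesis using V by blast
      next
        case False
        from old.not_ET[OF V(1) V0 False] show ?thesis
        proof (elim disjE exE conjE)
          fix K R assume a: "ses K V R" "T K" "K \<noteq> Z" "R \<noteq> Z"
          have "T R" using old.T_quot a V by blast
          obtain J I I' C where J: "ses J K I" "ses I Y' C" "ses J L I'" "ses I' R C"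
            using two_subs[OF V(3) a(1)] by blast
          have FJ: "F J" using old.F_sub J(3) V(2) by blast
          have "T I" using old.T_quot J(1) a(2) by blast
          have "C = Z"
          proof (rule ccontr)
            assume "C \<noteq> Z"
            then have "F' I" using sub J(2) by blast
            then have "I = Z" using \<open>T I\<close> T_le new.TF_zero by blast
            then have "J = K" using J(1) ses_zero_quot by simp
            then show False using FJ a old.TF_zero by blast
          qed
          then have "ses J K Y'" using J(1,2) ses_zero_quot by blast
          moreover have "\<bar>w K\<bar> \<le> \<bar>w V\<bar> - \<epsilon>"
            using old.w_T[OF a(2,3)] old.w_T[OF \<open>T R\<close> a(4)] old.w_add[OF a(1)] old.eps by auto
          ultimately show ?thesis using less[of K J] a(2) FJ by blast
        next
          fix L1 B assume a: "ses L1 B V" "F L1" "L1 \<noteq> Z" "T B"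
          obtain P where P: "ses P B Y'" "ses L1 P L" using quot_lift[OF a(1) V(3)] by blast
          have "F P" using old.F_ext P a V by blast
          have "B \<noteq> Z" using a(1) V0 ses_of_zero[of L1 V] by auto
          have "\<bar>w B\<bar> \<le> \<bar>w V\<bar> - \<epsilon>"
            using old.w_T[OF a(4) \<open>B \<noteq> Z\<close>] old.w_F[OF a(2,3)] old.w_T[OF V(1) V0] old.w_add[OF a(1)]
              old.eps by auto
          then show ?thesis using less[of B P] P a \<open>F P\<close> by blast
        qed
      qed
    qed
  qed
  from this[of Y' Z] obtain V L where V: "old.ET V" "F L" "ses L V Y'"
    using \<open>T Y'\<close> old.F_zero ses_triv_sub old.T_in by blast
  have TV: "T V" using V(1) unfolding old.ET_def by blast
  obtain t r where t: "ses t L r" "T' t" "F' r" using new.torsion_ex ses_in V by blast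
  obtain R where R: "ses t V R" "ses r R Y'" using sub_quot[OF V(3) t(1)] by blast
  have "T' R" using T_le old.T_quot R(1) TV by blast
  then have "r = Z" using ext R(2) t(3) by blast
  then have "t = L" using t(1) ses_zero_quot by simp
  then have "T' L" using t(2) by simp
  moreover have "V \<noteq> X" using TV X old.TF_zero by blast
  ultimately show ?thesis using V Y' unfolding mutates_def by blast
qed

text \<open>X belongs to both sets, and choosing a partner distinct from X is injective on the
  remaining new simple objects.\<close>

lemma card_heart_simples:
  assumes "finite {Y. old.ET Y \<or> old.EF Y}"
  shows "finite {Y. new.ET Y \<or> new.EF Y}"
    and "card {Y. new.ET Y \<or> new.EF Y} \<le> card {Y. old.ET Y \<or> old.EF Y}"
proof -
  let ?N = "{Y. new.ET Y \<or> new.EF Y}" and ?O = "{Y. old.ET Y \<or> old.EF Y}"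
  have "\<forall>Y \<in> ?N - {X}. \<exists>V. V \<noteq> X \<and> mutates Y V"
    using mutates_ex_EF mutates_ex_ET by blast
  from bchoice[OF this] obtain f where f: "\<And>Y. Y \<in> ?N - {X} \<Longrightarrow> f Y \<noteq> X \<and> mutates Y (f Y)"
    by blast
  have inj: "inj_on f (?N - {X})"
    using f mutates_inj unfolding inj_on_def by (metis Diff_iff singletonI)
  have sub: "f ` (?N - {X}) \<subseteq> ?O - {X}"
    using f unfolding mutates_def by blast
  have fin: "finite (?N - {X})" using inj_on_finite[OF inj sub] assms by blast
  then show "finite ?N" by simp
  have "card (?N - {X}) \<le> card (?O - {X})" using card_inj_on_le[OF inj sub] assms by blast
  moreover have "X \<in> ?N" "X \<in> ?O" using ET_X EF_X by auto
  ultimately show "card ?N \<le> card ?O"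
    using assms \<open>finite ?N\<close> card_Suc_Diff1[of ?N X] card_Suc_Diff1[of ?O X] by linarith
qed

end

section \<open>The torsion pairs of a directed ordering of the bricks\<close>

locale brick_chain = exact_structure_simples Ob ses Z s
  for Ob :: "'o set" and ses :: "'o \<Rightarrow> 'o \<Rightarrow> 'o \<Rightarrow> bool" and Z :: 'o and s :: "'n::finite \<Rightarrow> 'o" +
  fixes m :: nat and X :: "nat \<Rightarrow> 'o"
  assumes bricks: "brick Y \<longleftrightarrow> Y \<in> X ` {1..m}"
    and inj_X: "inj_on X {1..m}"
    and dir: "i \<in> {1..m} \<Longrightarrow> j \<in> {1..m} \<Longrightarrow> nzmap (X i) (X j) \<Longrightarrow> j \<le> i"
begin

definition T :: "nat \<Rightarrow> 'o \<Rightarrow> bool" where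
  "T i M \<longleftrightarrow> M \<in> Ob \<and> (\<forall>j \<in> {i<..m}. \<not> nzmap M (X j))"

definition F :: "nat \<Rightarrow> 'o \<Rightarrow> bool" where
  "F i M \<longleftrightarrow> M \<in> Ob \<and> (\<forall>j \<in> {1..i}. \<not> nzmap (X j) M)"

lemma X_brick: "j \<in> {1..m} \<Longrightarrow> brick (X j)"
  using bricks[of "X j"] by simp

lemma X_props: "j \<in> {1..m} \<Longrightarrow> X j \<in> Ob" "j \<in> {1..m} \<Longrightarrow> X j \<noteq> Z"
  using X_brick unfolding brick_def by blast+

lemma T_X: "j \<in> {1..m} \<Longrightarrow> T i (X j) \<longleftrightarrow> j \<le> i"
proof
  assume j: "j \<in> {1..m}"
  show "T i (X j) \<Longrightarrow> j \<le> i"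
    using nzmap_self[OF X_props[OF j]] j unfolding T_def by force
  show "T i (X j)" if "j \<le> i"
    unfolding T_def
  proof (intro conjI ballI notI)
    fix k assume k: "k \<in> {i<..m}" "nzmap (X j) (X k)"
    then have "k \<in> {1..m}" by simp
    then show False using dir[OF j _ k(2)] k(1) that by simp
  qed (use X_props[OF j] in simp)
qed

lemma F_X: "j \<in> {1..m} \<Longrightarrow> F i (X j) \<longleftrightarrow> i < j"
proof
  assume j: "j \<in> {1..m}"
  show "F i (X j) \<Longrightarrow> i < j"
    using nzmap_self[OF X_props[OF j]] j unfolding F_def by force
  show "F i (X j)" if "i < j"
    unfolding F_def
  proof (intro conjI ballI notI)
    fix k assume k: "k \<in> {1..i}" "nzmap (X k) (X j)"
    then have "k \<in> {1..m}" using that j by simp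
    then show False using dir[OF _ j k(2)] k(1) that by simp
  qed (use X_props[OF j] in simp)
qed

lemma T_mono: "i \<le> i' \<Longrightarrow> T i M \<Longrightarrow> T i' M" and F_mono: "i \<le> i' \<Longrightarrow> F i' M \<Longrightarrow> F i M"
  unfolding T_def F_def by auto

lemma ex_brick_X:
  assumes "M \<in> Ob" "M \<noteq> Z"
  obtains j K C where "j \<in> {1..m}" "ses K M (X j)" "ses (X j) M C"
  using ex_brick[OF assms] bricks by (metis imageE)

lemma T_quot: "ses K M Q \<Longrightarrow> T i M \<Longrightarrow> T i Q"
  unfolding T_def using nzmap_quot ses_in by blast

lemma F_sub: "ses K M Q \<Longrightarrow> F i M \<Longrightarrow> F i K"
  unfolding F_def using nzmap_sub ses_in by blast

lemma T_ext: "ses K M Q \<Longrightarrow> T i K \<Longrightarrow> T i Q \<Longrightarrow> T i M"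
  unfolding T_def using nzmap_ext_source ses_in by blast

lemma F_ext: "ses K M Q \<Longrightarrow> F i K \<Longrightarrow> F i Q \<Longrightarrow> F i M"
  unfolding F_def using nzmap_ext_target ses_in by blast

lemma T_zero: "T i Z" and F_zero: "F i Z"
  unfolding T_def F_def using nzmap_zero zero_in by auto

text \<open>The brick supplied by \<open>ex_brick\<close> is both a quotient and a subobject of M:
  as a quotient it inherits \<open>T k\<close>, as a subobject \<open>F i\<close>, and these confine
  its index.\<close>

lemma layer:
  assumes "T k M" "F i M" "M \<noteq> Z"
  shows "\<exists>j \<in> {1..m}. i < j \<and> j \<le> k \<and> (\<exists>K. ses K M (X j)) \<and> (\<exists>Q. ses (X j) M Q)"
proof -
  have "M \<in> Ob" using assms unfolding T_def by blast
  from ex_brick_X[OF this assms(3)] obtain j K C where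
    j: "j \<in> {1..m}" "ses K M (X j)" "ses (X j) M C" .
  have "j \<le> k" using T_quot[OF j(2) assms(1)] T_X[OF j(1)] by blast
  moreover have "i < j" using F_sub[OF j(3) assms(2)] F_X[OF j(1)] by blast
  ultimately show ?thesis using j by blast
qed

text \<open>As long as one of the first i bricks maps nontrivially to M, its image is torsion and is
  divided out.\<close>

lemma torsion_ex: "M \<in> Ob \<Longrightarrow> \<exists>t r. ses t M r \<and> T i t \<and> F i r"
proof (induction M rule: wfp_induct_rule[OF wf_quot])
  case (1 M)
  show ?case
  proof (cases "i \<le> m \<longrightarrow> F i M")
    \<comment> \<open>For i > m every object lies in \<open>T i\<close>, as no brick remains to be
      tested.\<close>
    case True
    have "F i M \<or> T i M" using True 1 unfolding T_def by auto
    then show ?thesis using ses_triv_sub ses_triv_quot 1(2) T_zero F_zero by blast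
  next
    case False
    then obtain j where j: "j \<in> {1..i}" "i \<le> m" "nzmap (X j) M" using 1 unfolding F_def by blast
    then obtain I K Q where I: "I \<noteq> Z" "ses K (X j) I" "ses I M Q" unfolding nzmap_def by blast
    have "T i (X j)" using T_X[of j i] j by auto
    then have TI: "T i I" using T_quot I(2) by blast
    obtain t r where t: "ses t Q r" "T i t" "F i r" using 1(1)[of Q] I ses_in by blast
    obtain P where P: "ses P M r" "ses I P t" using quot_lift[OF I(3) t(1)] by blast
    then show ?thesis using T_ext TI t by blast
  qed
qed

lemma torsion: "torsion_pair Ob ses Z (T i) (F i)"
proof unfold_locales
  show "M = Z" if "T i M" "F i M" for M
    using layer[OF that] by (meson not_less)
  show "M \<in> Ob" if "T i M" for M using that unfolding T_def by blast
  show "M \<in> Ob" if "F i M" for M using that unfolding F_def by blast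
qed (use T_quot F_sub T_ext F_ext torsion_ex in blast)+

definition separates :: "nat \<Rightarrow> (real ^ 'n \<Rightarrow> real) \<Rightarrow> bool" where
  "separates i g \<longleftrightarrow> linear g \<and> (\<forall>j \<in> {1..m}. (j \<le> i \<longrightarrow> g (cls (X j)) > 0) \<and> (i < j \<longrightarrow> g (cls (X j)) < 0))"

text \<open>The borderline between \<open>separates i\<close> and \<open>separates (Suc i)\<close>,
  on which only the sign at brick \<open>Suc i\<close> differs.\<close>

definition wall :: "nat \<Rightarrow> (real ^ 'n \<Rightarrow> real) \<Rightarrow> bool" where
  "wall i g \<longleftrightarrow> linear g \<and> g (cls (X (Suc i))) = 0 \<and>
    (\<forall>j \<in> {1..m}. (j \<le> i \<longrightarrow> g (cls (X j)) > 0) \<and> (Suc i < j \<longrightarrow> g (cls (X j)) < 0))"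

definition heart_simples :: "nat \<Rightarrow> 'o set" where
  "heart_simples i = {Y. torsion_pair.ET ses Z (T i) (F i) Y \<or> torsion_pair.EF ses Z (T i) (F i) Y}"

text \<open>A nonzero torsion object contains one of the first i bricks, and the quotient is torsion
  again.\<close>

lemma positive_on_T:
  fixes g :: "real ^ 'n \<Rightarrow> real"
  assumes g: "linear g" and pos: "\<And>j. j \<in> {1..m} \<Longrightarrow> j \<le> i \<Longrightarrow> g (cls (X j)) \<ge> e" and e: "e \<ge> 0"
  shows "T i M \<Longrightarrow> M \<noteq> Z \<Longrightarrow> g (cls M) \<ge> e"
proof (induction M rule: wfp_induct_rule[OF wf_quot])
  case (1 M)
  interpret t: torsion_pair Ob ses Z "T i" "F i" by (rule torsion)
  have F0: "F 0 M" using 1 unfolding F_def T_def by auto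
  from layer[OF 1(2) F0 1(3)] obtain j Q where j: "j \<in> {1..m}" "j \<le> i" "ses (X j) M Q" by blast
  have "Q \<noteq> Z \<Longrightarrow> g (cls Q) \<ge> e"
    using 1(1)[of Q] j X_props T_quot 1(2) by blast
  moreover have "Q = Z \<Longrightarrow> g (cls Q) = 0" using linear_0[OF g] by simp
  moreover have "g (cls M) = g (cls (X j)) + g (cls Q)"
    using cls_add[OF j(3)] linear_add[OF g] by simp
  ultimately show ?case using pos[OF j(1,2)] e by (cases "Q = Z") simp_all
qed

lemma negative_on_F:
  fixes g :: "real ^ 'n \<Rightarrow> real"
  assumes g: "linear g" and pos: "\<And>j. j \<in> {1..m} \<Longrightarrow> i < j \<Longrightarrow> g (cls (X j)) \<le> - e" and e: "e \<ge> 0"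
  shows "F i M \<Longrightarrow> M \<noteq> Z \<Longrightarrow> g (cls M) \<le> - e"
proof (induction M rule: wfp_induct_rule[OF wf_sub])
  case (1 M)
  interpret t: torsion_pair Ob ses Z "T i" "F i" by (rule torsion)
  have F0: "T m M" using 1 unfolding F_def T_def by auto
  from layer[OF F0 1(2,3)] obtain j Q where j: "j \<in> {1..m}" "i < j" "ses Q M (X j)" by blast
  have "Q \<noteq> Z \<Longrightarrow> g (cls Q) \<le> - e"
    using 1(1)[of Q] j X_props F_sub 1(2) by blast
  moreover have "Q = Z \<Longrightarrow> g (cls Q) = 0" using linear_0[OF g] by simp
  moreover have "g (cls M) = g (cls (X j)) + g (cls Q)"
    using cls_add[OF j(3)] linear_add[OF g] by simp
  ultimately show ?case using pos[OF j(1,2)] e by (cases "Q = Z") simp_all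
qed

lemma separates_weight:
  assumes "separates i g"
  shows "\<exists>e. torsion_pair_weight Ob ses Z (T i) (F i) (\<lambda>M. g (cls M)) e"
proof -
  interpret t: torsion_pair Ob ses Z "T i" "F i" by (rule torsion)
  \<comment> \<open>The smallest absolute value on a brick; the inserted 1 covers m = 0.\<close>
  define e where "e = Min (insert 1 ((\<lambda>j. \<bar>g (cls (X j))\<bar>) ` {1..m}))"
  have g: "linear g" using assms unfolding separates_def by blast
  have le: "e \<le> \<bar>g (cls (X j))\<bar>" if "j \<in> {1..m}" for j
    unfolding e_def using that by (intro Min_le) auto
  have "\<bar>g (cls (X j))\<bar> > 0" if "j \<in> {1..m}" for j
  proof (cases "j \<le> i")
    case True
    then have "g (cls (X j)) > 0" using assms that unfolding separates_def by blast
    then show ?thesis by simp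
  next
    case False
    then have "i < j" by simp
    then have "g (cls (X j)) < 0" using assms that unfolding separates_def by blast
    then show ?thesis by simp
  qed
  then have pos: "e > 0" unfolding e_def by (subst Min_gr_iff) auto
  have low: "e \<le> g (cls (X j))" if "j \<in> {1..m}" "j \<le> i" for j
  proof -
    have "g (cls (X j)) > 0" using assms that unfolding separates_def by blast
    then show ?thesis using le[OF that(1)] by simp
  qed
  have high: "g (cls (X j)) \<le> - e" if "j \<in> {1..m}" "i < j" for j
  proof -
    have "g (cls (X j)) < 0" using assms that unfolding separates_def by blast
    then show ?thesis using le[OF that(1)] by simp
  qed
  show ?thesis
  proof (intro exI[of _ e] torsion_pair_weight.intro torsion torsion_pair_weight_axioms.intro)
    show "0 < e" by (rule pos)
    show "g (cls M) = g (cls K) + g (cls Q)" if "ses K M Q" for K M Q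
      using cls_add[OF that] linear_add[OF g] by simp
    show "e \<le> g (cls M)" if "T i M" "M \<noteq> Z" for M
      by (rule positive_on_T[OF g low less_imp_le[OF pos] that])
    show "g (cls M) \<le> - e" if "F i M" "M \<noteq> Z" for M
      by (rule negative_on_F[OF g high less_imp_le[OF pos] that])
  qed
qed

text \<open>The functional is the negative of the composition length.\<close>

lemma separates_0: "separates 0 (\<lambda>v. - (\<Sum>k\<in>UNIV. v $ k))"
proof -
  have "linear (\<lambda>v::real^'n. - (\<Sum>k\<in>UNIV. v $ k))"
    by (intro linearI) (simp_all add: sum.distrib sum_distrib_left)
  moreover have "(\<Sum>k\<in>UNIV. cls (X j) $ k) > 0" if j: "j \<in> {1..m}" for j
  proof -
    obtain k where "cls (X j) $ k \<noteq> 0" using cls_nonzero X_props j by (metis vec_eq_iff zero_index)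
    then show ?thesis using cls_nonneg(1) X_props j
      by (intro sum_pos2[of UNIV k]) (auto simp: less_le)
  qed
  ultimately show ?thesis unfolding separates_def by auto
qed

text \<open>\<open>T 0\<close> contains only the zero object, so the heart is the shifted original
  category and \<open>EF\<close> reduces to ordinary simplicity.\<close>

lemma heart_simples_0: "heart_simples 0 \<subseteq> range s"
proof
  interpret t: torsion_pair Ob ses Z "T 0" "F 0" by (rule torsion)
  fix Y assume "Y \<in> heart_simples 0"
  have T0: "M = Z" if "T 0 M" for M
    using that t.TF_zero[of M] unfolding T_def F_def by auto
  have "t.EF Y" using \<open>Y \<in> heart_simples 0\<close> T0 unfolding heart_simples_def t.ET_def by blast
  then have "simple Y" unfolding simple_def t.EF_def using T0 t.F_in by blast
  then show "Y \<in> range s" using simple_iff by blast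
qed

text \<open>One inductive step. The separating functional gives weights, hence generation by simple
  objects; generation and the bound on their number give a basis; dual functionals of this basis
  give the wall, primitivity and the next separating functional.\<close>

lemma heart_step:
  assumes i: "i < m" and sep: "separates i g"
    and fin: "finite (heart_simples i)" and card: "card (heart_simples i) \<le> CARD('n)"
  shows "\<exists>g'. separates (Suc i) g'" "finite (heart_simples (Suc i))"
    "card (heart_simples (Suc i)) \<le> CARD('n)" "\<exists>g'. wall i g'"
    "\<And>k w. (\<forall>i. w $ i \<in> \<int>) \<Longrightarrow> cls (X (Suc i)) = of_int k *\<^sub>R w \<Longrightarrow> \<bar>k\<bar> = 1"
proof -
  obtain e where e: "torsion_pair_weight Ob ses Z (T i) (F i) (\<lambda>M. g (cls M)) e"
    using separates_weight[OF sep] by blast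
  interpret t: torsion_pair_weight Ob ses Z "T i" "F i" "\<lambda>M. g (cls M)" e by (rule e)
  interpret t': torsion_pair Ob ses Z "T (Suc i)" "F (Suc i)" by (rule torsion)
  let ?X = "X (Suc i)"
  have Si: "Suc i \<in> {1..m}" using i by simp
  interpret mu: torsion_mutation Ob ses Z "T i" "F i" "\<lambda>M. g (cls M)" e "T (Suc i)" "F (Suc i)" ?X
  proof unfold_locales
    show "T (Suc i) M" if "T i M" for M using T_mono[OF _ that] by simp
    show "F i M" if "F (Suc i) M" for M using F_mono[OF _ that] by simp
    show "?X \<noteq> Z" "T (Suc i) ?X" "F i ?X" using X_props T_X F_X Si by auto
    show "(\<exists>K. ses K M ?X) \<and> (\<exists>Q. ses ?X M Q)" if "T (Suc i) M" "F i M" "M \<noteq> Z" for M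
      using layer[OF that] by (metis Suc_leI le_antisym)
  qed
  let ?C = "heart_simples i"
  have C: "?C = {Y. t.ET Y \<or> t.EF Y}" "heart_simples (Suc i) = {Y. t'.ET Y \<or> t'.EF Y}"
    unfolding heart_simples_def by auto
  show "finite (heart_simples (Suc i))" "card (heart_simples (Suc i)) \<le> CARD('n)"
    using mu.card_heart_simples fin card unfolding C by auto
  define c where "c Y = (if T i Y then cls Y else - cls Y)" for Y
  have cET: "c Y = cls Y" if "t.ET Y" for Y using that unfolding c_def t.ET_def by auto
  have cEF: "c Y = - cls Y" if "t.EF Y" for Y
    using that t.TF_zero unfolding c_def t.EF_def by auto
  have XC: "?X \<in> ?C" using mu.EF_X C by auto
  have cX: "c ?X = - cls ?X" using cEF mu.EF_X by blast
  \<comment> \<open>The monoid generated by the signed classes. Nonnegativity of the coefficients is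
    what later yields the signs of the functional.\<close>
  define G where "G v \<longleftrightarrow> (\<exists>a. v = (\<Sum>Y\<in>?C. real (a Y) *\<^sub>R c Y))" for v
  have G1: "G (c Y)" if "Y \<in> ?C" for Y
  proof -
    have "(\<Sum>V\<in>?C. real (if V = Y then 1 else 0) *\<^sub>R c V) = (\<Sum>V\<in>?C. if V = Y then c Y else 0)"
      by (intro sum.cong) auto
    also have "\<dots> = c Y" using that fin by simp
    finally show ?thesis unfolding G_def by metis
  qed
  have gen: "(T i M \<longrightarrow> G (cls M)) \<and> (F i M \<longrightarrow> G (- cls M))" for M
  proof (rule t.generation)
    show "G (a + b)" if ab: "G a" "G b" for a b
    proof -
      obtain p where "a = (\<Sum>Y\<in>?C. real (p Y) *\<^sub>R c Y)" using ab(1) unfolding G_def by (elim exE)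
      moreover obtain q where "b = (\<Sum>Y\<in>?C. real (q Y) *\<^sub>R c Y)" using ab(2) unfolding G_def by (elim exE)
      ultimately have "a + b = (\<Sum>Y\<in>?C. real (p Y + q Y) *\<^sub>R c Y)"
        by (simp add: sum.distrib scaleR_left_distrib)
      then show ?thesis unfolding G_def by (rule exI[of _ "\<lambda>Y. p Y + q Y"])
    qed
    show "G 0" unfolding G_def by (intro exI[of _ "\<lambda>_. 0"]) simp
    show "G (cls V)" if "t.ET V" for V using G1[of V] cET that C by simp
    show "G (- cls V)" if "t.EF V" for V using G1[of V] cEF that C by simp
  qed (rule cls_add)
  \<comment> \<open>A simple object of the original category has no proper torsion part, so it lies
    in T or in F.\<close>
  have axis: "G (axis k 1) \<or> G (- axis k 1)" for k
  proof -
    obtain t r where tr: "ses t (s k) r" "T i t" "F i r" using torsion_ex s_props(1) by blast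
    have "T i (s k) \<or> F i (s k)"
      using s_props(3)[OF tr(1)] tr ses_zero_sub ses_zero_quot by metis
    then show ?thesis using gen cls_simple by metis
  qed
  have Gspan: "v \<in> span (c ` ?C)" if "G v" for v
    using that unfolding G_def by (auto intro!: span_sum span_scale intro: span_base)
  have "axis k 1 \<in> span (c ` ?C)" for k
    using axis[of k] Gspan span_neg by (metis minus_minus)
  then have "Basis \<subseteq> span (c ` ?C)" by (auto simp: Basis_vec_def)
  then have sp: "span (c ` ?C) = UNIV"
    by (metis span_Basis span_mono span_span top.extremum_uniqueI)
  have fc: "finite (c ` ?C)" using fin by blast
  \<comment> \<open>A spanning set with at most as many elements as the dimension is a basis; the
    count of mutations enters here.\<close>
  have ind: "independent (c ` ?C)"
    by (rule card_le_dim_spanning[of _ UNIV]) (use sp fc card card_image_le[OF fin, of c] in auto)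
  have "card (c ` ?C) = CARD('n)"
    using dim_eq_card_independent[OF ind] sp by (metis DIM_cart DIM_real dim_UNIV dim_span mult.right_neutral)
  then have inj: "inj_on c ?C"
    using card card_image_le[OF fin, of c] by (intro eq_card_imp_inj_on[OF fin]) simp
  have functional: "\<exists>h. linear h \<and> (\<forall>Y\<in>?C. h (c Y) = f Y)" for f :: "'o \<Rightarrow> real"
  proof -
    obtain h where "linear h" "\<forall>x\<in>c ` ?C. h x = f (inv_into ?C c x)"
      using linear_independent_extend[OF ind, of "\<lambda>x. f (inv_into ?C c x)"] by blast
    then show ?thesis using inj by auto
  qed
  \<comment> \<open>The coordinate functional of X in this basis is integral on the whole lattice
    and takes the value -1 at the class of X, so k divides -1.\<close>
  show "\<bar>k\<bar> = 1" if w: "\<forall>i. w $ i \<in> \<int>" and kw: "cls ?X = of_int k *\<^sub>R w" for k :: int and w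
  proof -
    obtain h :: "real ^ 'n \<Rightarrow> real" where hh: "linear h" "\<forall>Y\<in>?C. h (c Y) = (if Y = ?X then 1 else 0)"
      using functional[of "\<lambda>Y. if Y = ?X then 1 else 0"] by blast
    note h = hh(1) bspec[OF hh(2)]
    have hG: "h v \<in> \<int>" if Gv: "G v" for v
    proof -
      obtain a where "v = (\<Sum>Y\<in>?C. real (a Y) *\<^sub>R c Y)" using Gv unfolding G_def by (elim exE)
      then have "h v = (\<Sum>Y\<in>?C. real (a Y) * h (c Y))" using h(1) by (simp add: linear_sum linear_scale)
      also have "\<dots> \<in> \<int>" by (intro Ints_sum Ints_mult) (auto simp: h(2))
      finally show ?thesis .
    qed
    have hax: "h (axis k 1) \<in> \<int>" for k
      using axis[of k] hG linear_neg[OF h(1)] by (metis Ints_minus minus_minus)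
    have "h w = (\<Sum>k\<in>UNIV. w $ k * h (axis k 1))"
      using h(1) by (subst basis_expansion[symmetric]) (simp add: linear_sum linear_scale scalar_mult_eq_scaleR)
    then have "h w \<in> \<int>" using w hax by (simp add: Ints_sum Ints_mult)
    then obtain b where b: "h w = of_int b" by (auto elim: Ints_cases)
    have "- 1 = h (cls ?X)" using h(2)[OF XC] cX linear_neg[OF h(1), of "cls ?X"] by simp
    also have "\<dots> = of_int k * h w" using kw linear_scale[OF h(1)] by simp
    finally have "real_of_int (k * b) = real_of_int (- 1)" using b by simp
    then have "k * b = - 1" by linarith
    then show ?thesis by (metis abs_minus_cancel abs_one zdvd1_eq dvd_minus_iff dvd_triv_left)
  qed
  \<comment> \<open>This functional counts the simple factors in the heart other than X[1] and
    becomes the wall.\<close>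
  obtain h :: "real ^ 'n \<Rightarrow> real" where hh: "linear h" "\<forall>Y\<in>?C. h (c Y) = (if Y = ?X then 0 else 1)"
    using functional[of "\<lambda>Y. if Y = ?X then 0 else 1"] by blast
  note h = hh(1) bspec[OF hh(2)]
  have hG: "h v \<ge> 0 \<and> (h v \<ge> 1 \<or> (\<exists>r\<ge>0. v = - (r *\<^sub>R cls ?X)))" if Gv: "G v" for v
  proof -
    obtain a where a: "v = (\<Sum>Y\<in>?C. real (a Y) *\<^sub>R c Y)" using Gv unfolding G_def by (elim exE)
    have "h v = (\<Sum>Y\<in>?C. real (a Y) * h (c Y))" using a h(1) by (simp add: linear_sum linear_scale)
    also have "\<dots> = (\<Sum>Y\<in>?C - {?X}. real (a Y) * h (c Y)) + real (a ?X) * h (c ?X)"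
      using fin XC by (simp add: sum.remove)
    also have "\<dots> = (\<Sum>Y\<in>?C - {?X}. real (a Y))" using h(2) XC by (auto intro: sum.cong)
    also have "\<dots> = real (\<Sum>Y\<in>?C - {?X}. a Y)" by simp
    finally have hv: "h v = real (\<Sum>Y\<in>?C - {?X}. a Y)" .
    show ?thesis
    proof (cases "(\<Sum>Y\<in>?C - {?X}. a Y) = 0")
      case True
      then have "\<forall>Y\<in>?C - {?X}. a Y = 0" using fin by simp
      then have "(\<Sum>Y\<in>?C - {?X}. real (a Y) *\<^sub>R c Y) = 0" by simp
      then have "v = real (a ?X) *\<^sub>R c ?X" using a fin XC by (simp add: sum.remove)
      then have "v = - (real (a ?X) *\<^sub>R cls ?X)" using cX by simp
      then show ?thesis using hv True by (metis of_nat_0_le_iff)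
    next
      case False
      then show ?thesis using hv by linarith
    qed
  qed
  \<comment> \<open>With no simple factor besides X[1], the class of M would be a nonpositive
    multiple of that of X, impossible for a nonzero object.\<close>
  have hT: "h (cls M) \<ge> 1" if M: "T i M" "M \<noteq> Z" for M
  proof (rule ccontr)
    assume "\<not> ?thesis"
    then obtain r where r: "r \<ge> 0" "cls M = - (r *\<^sub>R cls ?X)" using hG gen M by blast
    have "cls M $ k = 0" for k
    proof -
      have "cls M $ k = - (r * cls ?X $ k)" using r(2) by simp
      moreover have "r * cls ?X $ k \<ge> 0" using r(1) cls_nonneg(1)[OF X_props(1)[OF Si]] by simp
      ultimately show ?thesis using cls_nonneg(1)[OF t.T_in[OF M(1)], of k] by linarith
    qed
    then have "cls M = 0" by (simp add: vec_eq_iff)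
    then show False using cls_nonzero[of M] M t.T_in by blast
  qed
  \<comment> \<open>The object M[1] has a simple subobject in the heart. It is not X[1], because X
    is not torsion-free for the next pair, so it contributes 1 to the count.\<close>
  have hF: "h (cls M) \<le> - 1" if M: "F (Suc i) M" "M \<noteq> Z" for M
  proof -
    have FM: "F i M" using F_mono[OF _ M(1)] by simp
    from t.heart_simple_sub[OF FM M(2)] show ?thesis
    proof (elim disjE exE conjE)
      fix V Q assume a: "t.EF V" "ses V M Q" "F i Q"
      have "V \<noteq> ?X" using F_sub[OF a(2) M(1)] F_X[OF Si] by auto
      then have "h (- cls V) = 1" using h(2)[of V] a(1) cEF C by simp
      moreover have "h (- cls Q) \<ge> 0" using hG gen a(3) by blast
      ultimately show ?thesis
        using cls_add[OF a(2)] linear_add[OF h(1), of "cls V" "cls Q"] linear_add[OF h(1), of "cls M" "cls V"]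
          linear_neg[OF h(1), of "cls V"] linear_neg[OF h(1), of "cls Q"] by simp
    next
      fix V Q assume a: "t.ET V" "ses M Q V" "F i Q"
      have "T i V" using a unfolding t.ET_def by blast
      then have "V \<noteq> ?X" using T_X[OF Si] by auto
      then have "h (cls V) = 1" using h(2)[of V] a(1) cET C by simp
      moreover have "h (- cls Q) \<ge> 0" using hG gen a(3) by blast
      ultimately show ?thesis
        using cls_add[OF a(2)] linear_add[OF h(1), of "cls V" "cls Q"] linear_add[OF h(1), of "cls M" "cls V"]
          linear_neg[OF h(1), of "cls V"] linear_neg[OF h(1), of "cls Q"] by simp
    qed
  qed
  have hX: "h (cls ?X) = 0" using h(2)[OF XC] cX linear_neg[OF h(1), of "cls ?X"] by simp
  have hlow: "h (cls (X j)) \<ge> 1" if "j \<in> {1..m}" "j \<le> i" for j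
    using hT[of "X j"] T_X that X_props by blast
  have hhigh: "h (cls (X j)) \<le> - 1" if "j \<in> {1..m}" "Suc i < j" for j
    using hF[of "X j"] F_X that X_props by blast
  show "\<exists>g'. wall i g'"
    unfolding wall_def using h(1) hX hlow hhigh by (intro exI[of _ h]) force
  have g: "linear g" using sep unfolding separates_def by blast
  \<comment> \<open>Small enough that \<open>d * g\<close> stays below 1 in absolute value on all
    bricks, where h has absolute value at least 1 except at X.\<close>
  define d where "d = 1 / (1 + (\<Sum>j\<in>{1..m}. \<bar>g (cls (X j))\<bar>))"
  have pos: "1 + (\<Sum>j\<in>{1..m}. \<bar>g (cls (X j))\<bar>) > 0" by (simp add: add_pos_nonneg sum_nonneg)
  then have d: "d > 0" unfolding d_def by simp
  have dg: "d * \<bar>g (cls (X j))\<bar> < 1" if "j \<in> {1..m}" for j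
  proof -
    have "\<bar>g (cls (X j))\<bar> \<le> (\<Sum>j\<in>{1..m}. \<bar>g (cls (X j))\<bar>)"
      using that by (intro member_le_sum) auto
    then show ?thesis unfolding d_def using pos by (simp add: field_simps)
  qed
  have dg': "d * g (cls (X j)) < 1 \<and> d * g (cls (X j)) > - 1" if "j \<in> {1..m}" for j
    using dg[OF that] d by (simp add: abs_if split: if_splits)
      (smt (verit) mult_less_0_iff mult_nonneg_nonneg)+
  \<comment> \<open>Perturbing the wall by \<open>- d * g\<close> only decides the sign at X; it
    becomes positive because g was negative there.\<close>
  show "\<exists>g'. separates (Suc i) g'"
  proof (intro exI[of _ "\<lambda>v. h v - d * g v"], unfold separates_def, intro conjI ballI impI)
    show "linear (\<lambda>v. h v - d * g v)"
      using h(1) g by (intro linearI) (simp_all add: linear_add linear_scale algebra_simps)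
    show "0 < h (cls (X j)) - d * g (cls (X j))" if "j \<in> {1..m}" "j \<le> Suc i" for j
    proof (cases "j = Suc i")
      case True
      then show ?thesis using sep hX d that unfolding separates_def by (simp add: mult_pos_neg)
    next
      case False
      then show ?thesis using hlow[of j] dg'[of j] that by force
    qed
    show "h (cls (X j)) - d * g (cls (X j)) < 0" if "j \<in> {1..m}" "Suc i < j" for j
      using hhigh[of j] dg'[of j] that by force
  qed
qed

lemma chain_functionals:
  "i \<le> m \<Longrightarrow> (\<exists>g. separates i g) \<and> finite (heart_simples i) \<and> card (heart_simples i) \<le> CARD('n)"
proof (induction i)
  case 0
  have "card (heart_simples 0) \<le> card (range s)" using heart_simples_0 by (intro card_mono) auto
  then show ?case using separates_0 heart_simples_0 finite_subset[of _ "range s"] inj_s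
    by (auto simp: card_image)
next
  case (Suc i)
  then show ?case using heart_step[of i] by auto
qed

lemma wall_ex: "i < m \<Longrightarrow> \<exists>g. wall i g"
  using chain_functionals[of i] heart_step(4)[of i] by auto

lemma brick_primitive:
  assumes "i < m" "\<forall>i. w $ i \<in> \<int>" "cls (X (Suc i)) = of_int k *\<^sub>R w"
  shows "\<bar>k\<bar> = 1"
  using chain_functionals[of i] heart_step(5)[of i] assms by (auto simp: less_imp_le)

end

section \<open>Faces of Newton polytopes\<close>

text \<open>The affine hull of T stays in the hyperplane at level b, while the convex hull of the
  other points stays strictly below it.\<close>

lemma hull_max_face:
  fixes V :: "'v::euclidean_space set" and g :: "'v \<Rightarrow> real"
  assumes V: "finite V" "T \<subseteq> V" and g: "linear g"
    and T: "\<And>x. x \<in> T \<Longrightarrow> g x = b" and V': "\<And>x. x \<in> V - T \<Longrightarrow> g x < b"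
  shows "convex hull T face_of convex hull V"
proof (rule face_of_convex_hulls[OF V])
  have "affine hull T \<subseteq> {x. g x = b}"
  proof (rule hull_minimal)
    show "affine {x. g x = b}"
      unfolding affine_def using g
      by (auto simp: linear_add linear_scale simp flip: distrib_right)
  qed (use T in auto)
  moreover have "convex hull (V - T) \<subseteq> {x. g x < b}"
  proof (rule hull_minimal)
    have "{x. g x < b} = g -` {..<b}" by auto
    then show "convex {x. g x < b}"
      using convex_linear_vimage[OF g, of "{..<b}"] by simp
  qed (use V' in auto)
  ultimately show "affine hull T \<inter> convex hull (V - T) = {}" by fastforce
qed

lemma extreme_point_if_unique_max:
  fixes V :: "'v::euclidean_space set" and g :: "'v \<Rightarrow> real"
  assumes "finite V" "v \<in> V" "linear g" "\<And>u. u \<in> V \<Longrightarrow> u \<noteq> v \<Longrightarrow> g u < g v"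
  shows "v extreme_point_of convex hull V"
  using hull_max_face[of V "{v}" g "g v"] assms by (auto simp: face_of_singleton)

lemma edge_if_unique_max:
  fixes V :: "'v::euclidean_space set" and g :: "'v \<Rightarrow> real"
  assumes "finite V" "p \<in> V" "q \<in> V" "p \<noteq> q" "linear g" "g q = g p"
    and "\<And>u. u \<in> V \<Longrightarrow> u \<noteq> p \<Longrightarrow> u \<noteq> q \<Longrightarrow> g u < g p"
  shows "closed_segment p q edge_of convex hull V"
proof -
  have "convex hull {p, q} face_of convex hull V"
    by (rule hull_max_face[where g = g and b = "g p"]) (use assms in auto)
  moreover have "aff_dim (convex hull {p, q}) = 1"
    using assms(4) by (simp add: aff_dim_convex_hull)
  ultimately show ?thesis unfolding edge_of_def by (simp add: segment_convex_hull)
qed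

text \<open>Faces of polytopes are exposed, so an extreme point of the hull is the unique maximum of
  some functional on the finite set.\<close>

lemma extreme_point_exposed:
  fixes V :: "'v::euclidean_space set"
  assumes "finite V" "v extreme_point_of convex hull V"
  shows "v \<in> V \<and> (\<exists>a. \<forall>u\<in>V. a \<bullet> u \<le> a \<bullet> v \<and> (a \<bullet> u = a \<bullet> v \<longrightarrow> u = v))"
proof -
  have "{v} face_of convex hull V" using assms by (simp add: face_of_singleton)
  then have "{v} exposed_face_of convex hull V"
    using exposed_face_of_polyhedron polytope_imp_polyhedron polytope_convex_hull assms(1) by blast
  then obtain a b where ab: "convex hull V \<subseteq> {x. a \<bullet> x \<le> b}" "{v} = convex hull V \<inter> {x. a \<bullet> x = b}"
    unfolding exposed_face_of_def by blast
  have "V \<subseteq> convex hull V" by (rule hull_subset)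
  moreover have "a \<bullet> v = b" using ab(2) by blast
  ultimately have "a \<bullet> u \<le> a \<bullet> v \<and> (a \<bullet> u = a \<bullet> v \<longrightarrow> u = v)" if "u \<in> V" for u
    using ab that by blast
  then show ?thesis using extreme_point_of_convex_hull assms(2) by blast
qed

lemma edge_exposed:
  fixes V :: "'v::euclidean_space set"
  assumes "finite V" "closed_segment p q edge_of convex hull V"
  shows "\<exists>a. a \<bullet> q = a \<bullet> p \<and> (\<forall>u\<in>V. a \<bullet> u \<le> a \<bullet> p \<and> (a \<bullet> u = a \<bullet> p \<longrightarrow> u \<in> closed_segment p q))"
proof -
  have "closed_segment p q face_of convex hull V" using assms by (simp add: edge_of_def)
  then have "closed_segment p q exposed_face_of convex hull V"
    using exposed_face_of_polyhedron polytope_imp_polyhedron polytope_convex_hull assms(1) by blast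
  then obtain a b where ab: "convex hull V \<subseteq> {x. a \<bullet> x \<le> b}"
      "closed_segment p q = convex hull V \<inter> {x. a \<bullet> x = b}"
    unfolding exposed_face_of_def by blast
  have "V \<subseteq> convex hull V" by (rule hull_subset)
  moreover have "a \<bullet> p = b" "a \<bullet> q = b" using ab(2) ends_in_segment by blast+
  ultimately show ?thesis using ab by (intro exI[of _ a]) blast
qed

text \<open>The gcd of the coordinates of an indivisible vector is 1.\<close>

lemma indivisible_scale:
  fixes v :: "real ^ 'n::finite"
  assumes v: "indivisible v" and w: "w \<in> K0_lattice" "w = t *\<^sub>R v" and t: "0 \<le> t" "t \<le> 1"
  shows "t = 0 \<or> t = 1"
proof (rule ccontr)
  assume nt: "\<not> ?thesis"
  have vi: "v $ i \<in> \<int>" and wi: "w $ i \<in> \<int>" for i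
    using v w unfolding indivisible_def K0_lattice_def by auto
  \<comment> \<open>The zero vector is twice itself and hence not indivisible.\<close>
  have "v \<noteq> 0"
  proof
    assume "v = 0"
    then have "v = of_int 2 *\<^sub>R (0 :: real ^ 'n) \<and> (0 :: real ^ 'n) \<in> K0_lattice"
      by (simp add: K0_lattice_def)
    then show False using v unfolding indivisible_def by (metis order_refl)
  qed
  then obtain k where k: "v $ k \<noteq> 0" by (auto simp: vec_eq_iff)
  obtain x y where xy: "v $ k = of_int x" "w $ k = of_int y" using vi wi by (metis Ints_cases)
  have "t = of_int y / of_int x" using w(2) k xy by (simp add: field_simps)
  then have "t \<in> \<rat>" by simp
  then obtain a b :: int where ab: "b > 0" "coprime a b" "t = of_int a / of_int b"
    by (rule Rats_cases') 
  have b2: "b \<ge> 2"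
  proof (rule ccontr)
    assume "\<not> ?thesis"
    then have "b = 1" using ab by simp
    then have "t = of_int a" using ab by simp
    then show False using t nt by (metis antisym_conv2 int_one_le_iff_zero_less of_int_0_le_iff
        of_int_le_1_iff of_int_0 of_int_1 order_antisym zless_imp_add1_zle not_less le_less)
  qed
  \<comment> \<open>With t = a/b in lowest terms, \<open>b * w $ i = a * v $ i\<close> makes the
    denominator b divide every coordinate of v.\<close>
  have "v $ i / of_int b \<in> \<int>" for i
  proof -
    obtain x y where xy: "v $ i = of_int x" "w $ i = of_int y" using vi wi by (metis Ints_cases)
    have "of_int b * w $ i = of_int a * v $ i" using w(2) ab by simp
    then have "real_of_int (b * y) = real_of_int (a * x)" using xy by simp
    then have "b * y = a * x" by linarith
    then have "b dvd a * x" by (metis dvd_triv_left)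
    then have "b dvd x" using ab(2) by (simp add: coprime_commute coprime_dvd_mult_right_iff)
    then obtain z where "x = b * z" by blast
    then show ?thesis using xy ab by simp
  qed
  then have "(1 / of_int b) *\<^sub>R v \<in> K0_lattice" by (simp add: K0_lattice_def)
  moreover have "v = of_int b *\<^sub>R ((1 / of_int b) *\<^sub>R v)" using ab by simp
  ultimately show False using v b2 unfolding indivisible_def by blast
qed

section \<open>The lattice points given by subobjects\<close>

context exact_structure_simples
begin

definition sub_classes :: "'o \<Rightarrow> (real ^ 'n) set" where
  "sub_classes M = {cls L | L. \<exists>Q. ses L M Q}"

text \<open>These are integral points of the box between 0 and the class of M.\<close>

lemma finite_sub_classes: "finite (sub_classes M)"
proof -
  let ?B = "\<lambda>i. {0..nat \<lfloor>cls M $ i\<rfloor>}"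
  have "sub_classes M \<subseteq> (\<lambda>f. \<chi> i. real (f i)) ` (\<Pi>\<^sub>E i\<in>UNIV. ?B i)"
  proof
    fix v assume "v \<in> sub_classes M"
    then obtain L Q where L: "ses L M Q" "v = cls L" unfolding sub_classes_def by blast
    have "cls L $ i \<le> cls M $ i" for i
      using cls_add[OF L(1)] cls_nonneg(1)[of Q i] ses_in[OF L(1)] by simp
    moreover have e: "cls L $ i = real (nat \<lfloor>cls L $ i\<rfloor>)" for i
      using cls_nonneg[of L i] ses_in[OF L(1)] by (auto elim!: Ints_cases)
    ultimately have "nat \<lfloor>cls L $ i\<rfloor> \<in> ?B i" for i
      by (simp add: floor_mono nat_mono)
    moreover have "v = (\<chi> i. real (nat \<lfloor>cls L $ i\<rfloor>))"
      using e L(2) by (simp add: vec_eq_iff)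
    ultimately show "v \<in> (\<lambda>f. \<chi> i. real (f i)) ` (\<Pi>\<^sub>E i\<in>UNIV. ?B i)" by auto
  qed
  then show ?thesis by (rule finite_subset) (intro finite_imageI finite_PiE; simp)
qed

lemma cls_lattice: "M \<in> Ob \<Longrightarrow> cls M \<in> K0_lattice"
  unfolding K0_lattice_def using cls_nonneg(2) by blast

end

section \<open>From a directed ordering of the bricks to a path\<close>

context brick_chain
begin

lemma strict_on_T:
  fixes g :: "real ^ 'n \<Rightarrow> real"
  assumes g: "linear g" and pos: "\<And>j. j \<in> {1..m} \<Longrightarrow> j \<le> i \<Longrightarrow> g (cls (X j)) > 0"
    and M: "T i M" "M \<noteq> Z"
  shows "g (cls M) > 0"
proof -
  define e where "e = Min (insert 1 ((\<lambda>j. g (cls (X j))) ` {j \<in> {1..m}. j \<le> i}))"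
  have "e > 0" unfolding e_def using pos by (subst Min_gr_iff) auto
  moreover have "e \<le> g (cls (X j))" if "j \<in> {1..m}" "j \<le> i" for j
    unfolding e_def using that by (intro Min_le) auto
  ultimately show ?thesis using positive_on_T[OF g _ _ M, of e] by force
qed

lemma strict_on_F:
  fixes g :: "real ^ 'n \<Rightarrow> real"
  assumes g: "linear g" and pos: "\<And>j. j \<in> {1..m} \<Longrightarrow> i < j \<Longrightarrow> g (cls (X j)) < 0"
    and M: "F i M" "M \<noteq> Z"
  shows "g (cls M) < 0"
proof -
  define e where "e = Min (insert 1 ((\<lambda>j. - g (cls (X j))) ` {j \<in> {1..m}. i < j}))"
  have "e > 0" unfolding e_def using pos by (subst Min_gr_iff) auto
  moreover have "g (cls (X j)) \<le> - e" if "j \<in> {1..m}" "i < j" for j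
  proof -
    have "e \<le> - g (cls (X j))" unfolding e_def using that by (intro Min_le) auto
    then show ?thesis by simp
  qed
  ultimately show ?thesis using negative_on_F[OF g _ _ M, of e] by force
qed

text \<open>By \<open>layer\<close>, I maps onto the brick, which would be a proper quotient of
  itself if K were nonzero.\<close>

lemma no_proper_quot:
  assumes j: "Suc i \<in> {1..m}" and I: "ses K (X (Suc i)) I" "T (Suc i) I" "F i I" "I \<noteq> Z"
  shows "K = Z"
proof -
  from layer[OF I(2,3,4)] obtain A where A: "ses A I (X (Suc i))" by (metis Suc_leI le_antisym)
  obtain P where P: "ses P (X (Suc i)) (X (Suc i))" "ses K P A" using quot_lift[OF I(1) A] by blast
  have "P = Z" using ses_self_quot P(1) by blast
  then show ?thesis using P(2) ses_of_zero[of K A] by simp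
qed

text \<open>In the application \<open>Lo i\<close> is the direct sum of the first i bricks and
  \<open>Up i\<close> that of the others. They are the torsion part and torsion-free quotient of M,
  so separating functionals expose the vertices and walls expose the edges.\<close>

lemma path_of_chain:
  assumes lo: "\<And>i. i \<le> m \<Longrightarrow> ses (Lo i) M (Up i)" and lo0: "Lo 0 = Z" and lom: "Lo m = M"
    and lo_step: "\<And>i. i < m \<Longrightarrow> ses (Lo i) (Lo (Suc i)) (X (Suc i))"
    and up_step: "\<And>i. i < m \<Longrightarrow> ses (X (Suc i)) (Up i) (Up (Suc i))"
  shows "\<exists>vs. increasing_path (convex hull sub_classes M) vs \<and> indivisible_path vs \<and>
       hd vs = 0 \<and> last vs = cls M"
proof -
  have TLo: "i \<le> m \<Longrightarrow> T i (Lo i)" for i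
  proof (induction i)
    case 0 then show ?case using lo0 T_zero by simp
  next
    case (Suc i)
    then have "T (Suc i) (Lo i)" using T_mono[of i "Suc i"] by simp
    moreover have "T (Suc i) (X (Suc i))" using T_X[of "Suc i"] Suc.prems by simp
    ultimately show ?case using T_ext[OF lo_step[of i]] Suc.prems by simp
  qed
  have FUp: "i \<le> m \<Longrightarrow> F i (Up i)" for i
  proof (induction i rule: inc_induct)
    case base
    have "Up m = Z" using lo[of m] lom ses_self_sub by simp
    then show ?case using F_zero by simp
  next
    case (step i)
    then have "F i (Up (Suc i))" using F_mono[of i "Suc i"] by simp
    moreover have "F i (X (Suc i))" using F_X[of "Suc i"] step by simp
    ultimately show ?case using F_ext[OF up_step[of i]] step by simp
  qed
  let ?V = "sub_classes M"
  have inV: "cls (Lo i) \<in> ?V" if "i \<le> m" for i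
    using lo[OF that] unfolding sub_classes_def by blast
  have diff: "cls (Lo (Suc i)) - cls (Lo i) = cls (X (Suc i))" if "i < m" for i
    using cls_add[OF lo_step[OF that]] by simp
  \<comment> \<open>J is the intersection of L and \<open>Lo i\<close>. Passing from L to
    \<open>Lo i\<close> removes the torsion-free I and adds the torsion I', so a separating
    functional can only increase.\<close>
  have split: "\<exists>J I I'. ses J L I \<and> F i I \<and> ses J (Lo i) I' \<and> T i I'" if "i \<le> m" "ses L M Q" for i L Q
    using two_subs[OF lo[OF that(1)] that(2)] T_quot[OF _ TLo[OF that(1)]] F_sub[OF _ FUp[OF that(1)]]
    by meson
  have vertex: "cls (Lo i) extreme_point_of convex hull ?V" if i: "i \<le> m" for i
  proof -
    obtain g where g: "separates i g" using chain_functionals[OF i] by blast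
    then have lin: "linear g" unfolding separates_def by blast
    have gT: "g (cls N) > 0" if "T i N" "N \<noteq> Z" for N
      using strict_on_T[OF lin _ that] g unfolding separates_def by blast
    have gF: "g (cls N) < 0" if "F i N" "N \<noteq> Z" for N
      using strict_on_F[OF lin _ that] g unfolding separates_def by blast
    show ?thesis
    proof (rule extreme_point_if_unique_max[OF finite_sub_classes inV[OF i] lin])
      fix u assume "u \<in> ?V" and ne: "u \<noteq> cls (Lo i)"
      then obtain L Q where L: "ses L M Q" "u = cls L" unfolding sub_classes_def by blast
      obtain J I I' where J: "ses J L I" "F i I" "ses J (Lo i) I'" "T i I'"
        using split[OF i L(1)] by blast
      have a: "g u = g (cls J) + g (cls I)" "g (cls (Lo i)) = g (cls J) + g (cls I')"
        using cls_add[OF J(1)] cls_add[OF J(3)] L(2) linear_add[OF lin] by auto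
      have "I \<noteq> Z \<or> I' \<noteq> Z"
        using J(1,3) ses_zero_quot ne L(2) by blast
      then show "g u < g (cls (Lo i))"
        using a gT[OF J(4)] gF[OF J(2)] cls_zero linear_0[OF lin]
        by (cases "I = Z"; cases "I' = Z") auto
    qed
  qed
  have edge: "closed_segment (cls (Lo i)) (cls (Lo (Suc i))) edge_of convex hull ?V" if i: "i < m" for i
  proof -
    obtain g where g: "wall i g" using wall_ex[OF i] by blast
    then have lin: "linear g" and gX: "g (cls (X (Suc i))) = 0" unfolding wall_def by blast+
    have low: "g (cls (X j)) > 0" if "j \<in> {1..m}" "j \<le> i" for j
      using g that unfolding wall_def by blast
    have high: "g (cls (X j)) < 0" if "j \<in> {1..m}" "Suc i < j" for j
      using g that unfolding wall_def by blast
    have gT: "g (cls N) > 0" if "T i N" "N \<noteq> Z" for N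
      using strict_on_T[OF lin low that] by blast
    have gT': "g (cls N) \<ge> 0" if "T (Suc i) N" "N \<noteq> Z" for N
    proof (rule positive_on_T[OF lin _ order_refl that])
      fix j assume "j \<in> {1..m}" "j \<le> Suc i"
      then show "0 \<le> g (cls (X j))" using low[of j] gX by (cases "j = Suc i") auto
    qed
    have gF: "g (cls N) < 0" if "F (Suc i) N" "N \<noteq> Z" for N
      using strict_on_F[OF lin high that] by blast
    have Si: "Suc i \<in> {1..m}" "Suc i \<le> m" using i by auto
    let ?p = "cls (Lo i)" and ?q = "cls (Lo (Suc i))"
    have pq: "g ?q = g ?p" using cls_add[OF lo_step[OF i]] gX linear_add[OF lin] by simp
    show ?thesis
    proof (rule edge_if_unique_max[OF finite_sub_classes inV inV _ lin pq])
      show "?p \<noteq> ?q" using diff[OF i] cls_nonzero[OF X_props[OF Si(1)]] by auto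
      fix u assume "u \<in> ?V" and ne: "u \<noteq> ?p" "u \<noteq> ?q"
      then obtain L Q where L: "ses L M Q" "u = cls L" unfolding sub_classes_def by blast
      obtain J I I' where J: "ses J L I" "F (Suc i) I" "ses J (Lo (Suc i)) I'" "T (Suc i) I'"
        using split[OF Si(2) L(1)] by blast
      have a: "g u = g (cls J) + g (cls I)" "g ?q = g (cls J) + g (cls I')"
        using cls_add[OF J(1)] cls_add[OF J(3)] L(2) linear_add[OF lin] by auto
      have I': "g (cls I') \<ge> 0" using gT'[OF J(4)] linear_0[OF lin] by (cases "I' = Z") auto
      \<comment> \<open>If g vanishes on I', then L lies in \<open>Lo (Suc i)\<close> with a
        quotient in \<open>T (Suc i)\<close> and \<open>F i\<close>. It must be shown that L is then
        one of the two endpoints.\<close>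
      have "g (cls I') > 0" if "I = Z"
      proof (rule ccontr)
        assume "\<not> ?thesis"
        then have z: "g (cls I') = 0" using I' by simp
        have "J = L" using J(1) that ses_zero_quot by blast
        then have L': "ses L (Lo (Suc i)) I'" using J(3) by simp
        have I'0: "I' \<noteq> Z"
        proof
          assume "I' = Z"
          then have "L = Lo (Suc i)" using L' ses_zero_quot by simp
          then show False using ne L(2) by simp
        qed
        obtain t r where t: "ses t I' r" "T i t" "F i r" using torsion_ex ses_in J(3) by blast
        have "T (Suc i) r" using T_quot t(1) J(4) by blast
        then have "g (cls r) \<ge> 0" using gT' linear_0[OF lin] by (cases "r = Z") auto
        moreover have "g (cls t) + g (cls r) = 0" using cls_add[OF t(1)] z linear_add[OF lin] by simp
        ultimately have "t = Z" using gT[OF t(2)] by force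
        then have "r = I'" using t(1) ses_zero_sub by simp
        then have FI': "F i I'" using t(3) by simp
        obtain J2 I2 I2' C where J2: "ses J2 (Lo i) I2" "ses I2 I' C" "ses J2 L I2'" "ses I2' (X (Suc i)) C"
          using two_subs[OF L' lo_step[OF i]] by blast
        interpret tp: torsion_pair Ob ses Z "T i" "F i" by (rule torsion)
        \<comment> \<open>I2 is the image of \<open>Lo i\<close> in the torsion-free I', so it
          vanishes and \<open>Lo i\<close> lies in L. Thus I' is a nonzero quotient of the brick
          \<open>X (Suc i)\<close>, hence the brick itself, and L has the class of
          \<open>Lo i\<close>.\<close>
        have "T i I2" using T_quot[OF J2(1)] TLo i by simp
        moreover have "F i I2" using F_sub J2(2) FI' by blast
        ultimately have "I2 = Z" using tp.TF_zero by blast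
        then have C: "C = I'" "J2 = Lo i" using J2(1,2) ses_zero_sub ses_zero_quot by auto
        have "I2' = Z" by (rule no_proper_quot[OF Si(1) _ J(4) FI' I'0]) (use J2(4) C in simp)
        then have "J2 = L" using J2(3) ses_zero_quot by simp
        then show False using C ne L(2) by simp
      qed
      then show "g u < g ?p"
        using a pq I' gF[OF J(2)] linear_0[OF lin] by (cases "I = Z") auto
    qed (use i in auto)
  qed
  let ?vs = "map (\<lambda>i. cls (Lo i)) [0..<Suc m]"
  have nth: "?vs ! i = cls (Lo i)" if "i \<le> m" for i using that by (simp del: upt_Suc)
  have ip: "increasing_path (convex hull ?V) ?vs"
    unfolding increasing_path_def
  proof (intro conjI ballI allI impI)
    show "?vs \<noteq> []" by simp
    show "v extreme_point_of convex hull ?V" if v: "v \<in> set ?vs" for v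
    proof -
      from v obtain i where "i < Suc m" "v = cls (Lo i)" by (auto simp del: upt_Suc)
      then show ?thesis using vertex[of i] by simp
    qed
    fix i assume "Suc i < length ?vs"
    then have i: "i < m" by simp
    have e: "?vs ! i = cls (Lo i)" "?vs ! Suc i = cls (Lo (Suc i))" using nth i by auto
    have "cls (X (Suc i)) > 0" using cls_gt_0[OF X_props, of "Suc i"] i by simp
    then show "?vs ! i < ?vs ! Suc i"
      unfolding e using diff[OF i] by (metis diff_add_cancel less_vec_def less_eq_vec_def vector_add_component
        zero_index le_add_same_cancel2 add_le_same_cancel2)
    show "closed_segment (?vs ! i) (?vs ! Suc i) edge_of convex hull ?V" unfolding e by (rule edge[OF i])
  qed
  have "indivisible_path ?vs"
    unfolding indivisible_path_def
  proof (intro allI impI)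
    fix i assume "Suc i < length ?vs"
    then have i: "i < m" by simp
    have e: "?vs ! i = cls (Lo i)" "?vs ! Suc i = cls (Lo (Suc i))" using nth i by auto
    show "indivisible (?vs ! Suc i - ?vs ! i)"
      unfolding e diff[OF i] indivisible_def
    proof (intro conjI notI)
      show "cls (X (Suc i)) \<in> K0_lattice" using cls_lattice X_props i by simp
      assume "\<exists>(k::int) w. k \<ge> 2 \<and> w \<in> K0_lattice \<and> cls (X (Suc i)) = of_int k *\<^sub>R w"
      then show False using brick_primitive[OF i] unfolding K0_lattice_def by force
    qed
  qed
  moreover have "hd ?vs = 0" using lo0 by (simp add: hd_map del: upt_Suc)
  moreover have "last ?vs = cls M" using lom by simp
  ultimately show ?thesis using ip by blast
qed

end

section \<open>From an indivisible path back to a directed ordering of the bricks\<close>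

context exact_structure_simples
begin

text \<open>A functional b exposing the edge shows that L is contained in L' and that the quotient
  is stable for b: all proper nonzero subobjects have negative value. Stable objects are
  bricks.\<close>

lemma edge_layer_brick:
  assumes L: "ses L M R" and L': "ses L' M R'"
    and lt: "cls L < cls L'" and ind: "indivisible (cls L' - cls L)"
    and edge: "closed_segment (cls L) (cls L') edge_of convex hull sub_classes M"
  shows "\<exists>D. brick D \<and> ses L L' D \<and> (\<exists>C. ses D R C)"
proof -
  let ?p = "cls L" and ?q = "cls L'"
  obtain b where b: "b \<bullet> ?q = b \<bullet> ?p"
    "\<And>u. u \<in> sub_classes M \<Longrightarrow> b \<bullet> u \<le> b \<bullet> ?p \<and> (b \<bullet> u = b \<bullet> ?p \<longrightarrow> u \<in> closed_segment ?p ?q)"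
    using edge_exposed[OF finite_sub_classes edge] by blast
  have bmax: "b \<bullet> cls A \<le> b \<bullet> ?p" "b \<bullet> cls A = b \<bullet> ?p \<Longrightarrow> cls A \<in> closed_segment ?p ?q"
    if "ses A M Q" for A Q
    using b(2)[of "cls A"] that unfolding sub_classes_def by blast+
  obtain J I I' C where J: "ses J L I" "ses I R' C" "ses J L' I'" "ses I' R C"
    using two_subs[OF L' L] by blast
  obtain JQ where JM: "ses J M JQ" using sub_trans[OF L J(1)] by blast
  \<comment> \<open>U is the sum of L and L', and J is their intersection. Their values under b add
    up to twice the maximum, so both attain it.\<close>
  obtain U where U: "ses U M C" "ses L' U I" using quot_lift[OF L' J(2)] by blast
  have bI: "b \<bullet> cls I = 0"
  proof -
    have "b \<bullet> ?p = b \<bullet> cls J + b \<bullet> cls I" using cls_add[OF J(1)] by (simp add: inner_add_right)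
    moreover have "b \<bullet> cls U = b \<bullet> ?q + b \<bullet> cls I" using cls_add[OF U(2)] by (simp add: inner_add_right)
    ultimately show ?thesis using bmax(1)[OF JM] bmax(1)[OF U(1)] b(1) by linarith
  qed
  have "b \<bullet> cls J = b \<bullet> ?p" using cls_add[OF J(1)] bI by (simp add: inner_add_right)
  then have "cls J \<in> closed_segment ?p ?q" using bmax(2)[OF JM] by blast
  then obtain t where t: "0 \<le> t" "t \<le> 1" "cls J = (1 - t) *\<^sub>R ?p + t *\<^sub>R ?q"
    unfolding closed_segment_def by blast
  \<comment> \<open>The class of J lies on the segment, hence above that of L, but J is a subobject
    of L.\<close>
  have "cls I $ k = 0" for k
  proof -
    have "?p $ k \<le> ?q $ k" using lt by (simp add: less_vec_def less_eq_vec_def)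
    then have "t * (?q $ k - ?p $ k) \<ge> 0" using t(1) by simp
    moreover have "cls J $ k = ?p $ k + t * (?q $ k - ?p $ k)" using arg_cong[OF t(3), of "\<lambda>v. v $ k"] by (simp add: algebra_simps)
    moreover have "?p $ k = cls J $ k + cls I $ k" using cls_add[OF J(1)] by simp
    moreover have "cls I $ k \<ge> 0" using cls_nonneg(1) ses_in J(1) by blast
    ultimately show ?thesis by linarith
  qed
  then have "cls I = 0" by (simp add: vec_eq_iff)
  then have "I = Z" using cls_nonzero ses_in J(1) by blast
  then have "J = L" using J(1) ses_zero_quot by blast
  then have D: "ses L L' I'" using J(3) by simp
  have cD: "cls I' = ?q - ?p" using cls_add[OF D] by simp
  have bD: "b \<bullet> cls I' = 0" using cD b(1) by (simp add: inner_diff_right)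
  have stable: "b \<bullet> cls A < 0" if A: "ses A I' B" "A \<noteq> Z" "B \<noteq> Z" for A B
  proof -
    \<comment> \<open>P is the preimage of A in L'. If b vanished on A, the class of P would be a
      lattice point of the edge, so an endpoint by indivisibility.\<close>
    obtain P where P: "ses P L' B" "ses L P A" using quot_lift[OF D A(1)] by blast
    obtain PQ where PM: "ses P M PQ" using sub_trans[OF L' P(1)] by blast
    have cP: "cls P = ?p + cls A" using cls_add[OF P(2)] by simp
    have le: "b \<bullet> cls A \<le> 0" using bmax(1)[OF PM] cP by (simp add: inner_add_right)
    have "b \<bullet> cls A \<noteq> 0"
    proof
      assume z: "b \<bullet> cls A = 0"
      then have "cls P \<in> closed_segment ?p ?q" using bmax(2)[OF PM] cP by (simp add: inner_add_right)
      then obtain t where t: "0 \<le> t" "t \<le> 1" "cls P = (1 - t) *\<^sub>R ?p + t *\<^sub>R ?q"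
        unfolding closed_segment_def by blast
      have cA: "cls A = t *\<^sub>R (?q - ?p)" using t(3) cP by (simp add: algebra_simps)
      have "cls A \<in> K0_lattice" using cls_lattice ses_in A(1) by blast
      then have "t = 0 \<or> t = 1" using indivisible_scale[OF ind _ cA t(1,2)] by blast
      then show False
      proof
        assume "t = 0"
        then have "cls A = 0" using cA by simp
        then show False using cls_nonzero A ses_in by blast
      next
        assume "t = 1"
        then have "cls A = cls I'" using cA cD by simp
        then show False using cls_eq_sub[OF A(1)] A(3) by blast
      qed
    qed
    then show ?thesis using le by simp
  qed
  have "brick I'"
    unfolding brick_def
  proof (intro conjI allI impI)
    show "I' \<in> Ob" using ses_in D by blast
    show "I' \<noteq> Z" using cD lt cls_zero by fastforce
    fix A K C assume A: "ses K I' A" "ses A I' C"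
    show "A = Z \<or> A = I'"
    proof (rule ccontr)
      assume n: "\<not> ?thesis"
      have "C \<noteq> Z"
      proof
        assume "C = Z"
        then have "A = I'" using A(2) ses_zero_quot by simp
        then show False using n by simp
      qed
      have "K \<noteq> Z"
      proof
        assume "K = Z"
        then have "A = I'" using A(1) ses_zero_sub by simp
        then show False using n by simp
      qed
      \<comment> \<open>A proper nonzero image A and the kernel K are both proper nonzero
        subobjects, but their values under b sum to zero.\<close>
      have "b \<bullet> cls A < 0" using stable[OF A(2)] n \<open>C \<noteq> Z\<close> by blast
      moreover have "b \<bullet> cls K < 0" using stable[OF A(1) \<open>K \<noteq> Z\<close>] n by blast
      moreover have "b \<bullet> cls I' = b \<bullet> cls K + b \<bullet> cls A" using cls_add[OF A(1)] by (simp add: inner_add_right)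
      ultimately show False using bD by simp
    qed
  qed
  then show ?thesis using D J(4) by blast
qed

text \<open>The functional \<open>a k\<close> exposing the k-th vertex defines classes T and F in
  which \<open>L k\<close> and \<open>R k\<close> lie; these control the maps between the
  layers.\<close>

lemma chain_of_path:
  assumes fin: "finite {Y. brick Y}"
    and sum: "cls M = (\<Sum>Y | brick Y. cls Y)"
    and summand: "\<And>N. brick N \<Longrightarrow> \<exists>N'. ses N M N' \<and> ses N' M N"
    and path: "increasing_path (convex hull sub_classes M) vs" "indivisible_path vs"
      "hd vs = 0" "last vs = cls M"
  shows "\<exists>m X. brick_chain Ob ses Z s m X"
proof -
  define l where "l = length vs - 1"
  have vs: "vs \<noteq> []" using path(1) unfolding increasing_path_def by blast
  then have len: "length vs = Suc l" unfolding l_def by simp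
  have nth0: "vs ! 0 = 0" using path(3) vs by (simp add: hd_conv_nth)
  have nthl: "vs ! l = cls M" using path(4) vs by (simp add: last_conv_nth l_def)
  have inc: "vs ! k < vs ! Suc k" and edge: "closed_segment (vs ! k) (vs ! Suc k) edge_of convex hull sub_classes M"
    and ind: "indivisible (vs ! Suc k - vs ! k)" if "k < l" for k
    using path(1,2) that len unfolding increasing_path_def indivisible_path_def by auto
  have "\<forall>k. \<exists>L R a. k \<le> l \<longrightarrow> ses L M R \<and> cls L = vs ! k \<and>
    (\<forall>u \<in> sub_classes M. a \<bullet> u \<le> a \<bullet> vs ! k \<and> (a \<bullet> u = a \<bullet> vs ! k \<longrightarrow> u = vs ! k))"
  proof
    fix k
    show "\<exists>L R a. k \<le> l \<longrightarrow> ses L M R \<and> cls L = vs ! k \<and>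
      (\<forall>u \<in> sub_classes M. a \<bullet> u \<le> a \<bullet> vs ! k \<and> (a \<bullet> u = a \<bullet> vs ! k \<longrightarrow> u = vs ! k))"
    proof (cases "k \<le> l")
      case True
      then have "vs ! k extreme_point_of convex hull sub_classes M"
        using path(1) len unfolding increasing_path_def by (simp add: less_Suc_eq_le)
      from extreme_point_exposed[OF finite_sub_classes this] obtain a where
        a: "vs ! k \<in> sub_classes M" "\<forall>u \<in> sub_classes M. a \<bullet> u \<le> a \<bullet> vs ! k \<and> (a \<bullet> u = a \<bullet> vs ! k \<longrightarrow> u = vs ! k)"
        by blast
      from a(1) obtain L R where "ses L M R" "vs ! k = cls L" unfolding sub_classes_def by blast
      then show ?thesis using a(2) by metis
    qed auto
  qed
  from choice[OF this] obtain L where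
    "\<forall>k. \<exists>R a. k \<le> l \<longrightarrow> ses (L k) M R \<and> cls (L k) = vs ! k \<and>
    (\<forall>u \<in> sub_classes M. a \<bullet> u \<le> a \<bullet> vs ! k \<and> (a \<bullet> u = a \<bullet> vs ! k \<longrightarrow> u = vs ! k))" ..
  from choice[OF this] obtain R where
    "\<forall>k. \<exists>a. k \<le> l \<longrightarrow> ses (L k) M (R k) \<and> cls (L k) = vs ! k \<and>
    (\<forall>u \<in> sub_classes M. a \<bullet> u \<le> a \<bullet> vs ! k \<and> (a \<bullet> u = a \<bullet> vs ! k \<longrightarrow> u = vs ! k))" ..
  from choice[OF this] obtain a where LRa: "\<And>k. k \<le> l \<Longrightarrow> ses (L k) M (R k) \<and> cls (L k) = vs ! k \<and>
    (\<forall>u \<in> sub_classes M. a k \<bullet> u \<le> a k \<bullet> vs ! k \<and> (a k \<bullet> u = a k \<bullet> vs ! k \<longrightarrow> u = vs ! k))"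
    by blast
  have ses: "ses (L k) M (R k)" and cls: "cls (L k) = vs ! k" if "k \<le> l" for k using LRa[OF that] by blast+
  have amax: "a k \<bullet> cls A \<le> a k \<bullet> cls (L k)" and auniq: "a k \<bullet> cls A = a k \<bullet> cls (L k) \<Longrightarrow> cls A = cls (L k)"
    if "k \<le> l" "ses A M Q" for k A Q
    using LRa[OF that(1)] that(2) unfolding sub_classes_def by auto
  \<comment> \<open>The torsion pair of a stability functional. Only closure under quotients and
    subobjects and trivial intersection are needed.\<close>
  define T where "T k N \<longleftrightarrow> (\<forall>K Q. ses K N Q \<longrightarrow> Q \<noteq> Z \<longrightarrow> a k \<bullet> cls Q > 0)" for k N
  define F where "F k N \<longleftrightarrow> (\<forall>K Q. ses K N Q \<longrightarrow> K \<noteq> Z \<longrightarrow> a k \<bullet> cls K < 0)" for k N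
  have T_quot: "T k Q" if "ses K N Q" "T k N" for k K N Q
    using that quot_trans unfolding T_def by meson
  have F_sub: "F k K" if "ses K N Q" "F k N" for k K N Q
    using that sub_trans unfolding F_def by meson
  have Tpos: "a k \<bullet> cls N > 0" if "T k N" "N \<in> Ob" "N \<noteq> Z" for k N
    using that ses_triv_sub unfolding T_def by blast
  have Fneg: "a k \<bullet> cls N < 0" if "F k N" "N \<in> Ob" "N \<noteq> Z" for k N
    using that ses_triv_quot unfolding F_def by blast
  have TF: "N = Z" if "T k N" "F k N" "N \<in> Ob" for k N
    using Tpos[OF that(1,3)] Fneg[OF that(2,3)] by force
  have TL: "T k (L k)" if k: "k \<le> l" for k
    unfolding T_def
  proof (intro allI impI)
    fix K Q assume KQ: "ses K (L k) Q" "Q \<noteq> Z"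
    obtain KQ' where KM: "ses K M KQ'" using sub_trans[OF ses[OF k] KQ(1)] by blast
    have "a k \<bullet> cls (L k) = a k \<bullet> cls K + a k \<bullet> cls Q" using cls_add[OF KQ(1)] by (simp add: inner_add_right)
    moreover have "a k \<bullet> cls K \<noteq> a k \<bullet> cls (L k)"
      using auniq[OF k KM] cls_eq_sub[OF KQ(1)] KQ(2) by blast
    ultimately show "a k \<bullet> cls Q > 0" using amax[OF k KM] by linarith
  qed
  have FR: "F k (R k)" if k: "k \<le> l" for k
    unfolding F_def
  proof (intro allI impI)
    fix K Q assume KQ: "ses K (R k) Q" "K \<noteq> Z"
    obtain P where P: "ses P M Q" "ses (L k) P K" using quot_lift[OF ses[OF k] KQ(1)] by blast
    have "a k \<bullet> cls P = a k \<bullet> cls (L k) + a k \<bullet> cls K" using cls_add[OF P(2)] by (simp add: inner_add_right)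
    moreover have "a k \<bullet> cls P \<noteq> a k \<bullet> cls (L k)"
    proof
      assume "a k \<bullet> cls P = a k \<bullet> cls (L k)"
      then have "cls (L k) = cls P" using auniq[OF k P(1)] by simp
      then have "K = Z" using cls_eq_sub[OF P(2)] by blast
      then show False using KQ(2) by simp
    qed
    ultimately show "a k \<bullet> cls K < 0" using amax[OF k P(1)] by linarith
  qed
  have "\<forall>k. \<exists>D. k < l \<longrightarrow> brick D \<and> ses (L k) (L (Suc k)) D \<and> (\<exists>C. ses D (R k) C)"
  proof
    fix k
    show "\<exists>D. k < l \<longrightarrow> brick D \<and> ses (L k) (L (Suc k)) D \<and> (\<exists>C. ses D (R k) C)"
    proof (cases "k < l")
      case True
      then have k: "k \<le> l" "Suc k \<le> l" by auto
      show ?thesis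
        using edge_layer_brick[OF ses[OF k(1)] ses[OF k(2)]] inc[OF True] edge[OF True] ind[OF True]
          cls[OF k(1)] cls[OF k(2)] by metis
    qed auto
  qed
  from choice[OF this] obtain D where
    D: "\<And>k. k < l \<Longrightarrow> brick (D k)" "\<And>k. k < l \<Longrightarrow> ses (L k) (L (Suc k)) (D k)" "\<And>k. k < l \<Longrightarrow> \<exists>C. ses (D k) (R k) C"
    by blast
  have sub: "\<exists>Q. ses (L i) (L j) Q" if "i \<le> j" "j \<le> l" for i j
    using that
  proof (induction j rule: dec_induct)
    case base
    then show ?case using ses_triv_quot ses_in ses[of i] by blast
  next
    case (step j)
    then obtain Q where "ses (L i) (L j) Q" by auto
    then show ?case using sub_trans[OF D(2)[of j]] step by auto
  qed
  have hom: "\<not> nzmap (D i) (D j)" if ij: "i < j" "j < l" for i j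
  proof
    assume "nzmap (D i) (D j)"
    then obtain I K C where I: "I \<noteq> Z" "ses K (D i) I" "ses I (D j) C" unfolding nzmap_def by blast
    \<comment> \<open>The image I is replaced by a brick N, because bricks are direct summands of
      M.\<close>
    obtain N A B where N: "brick N" "ses A I N" "ses N I B" using ex_brick[of I] I ses_in by blast
    have NO: "N \<in> Ob" "N \<noteq> Z" using N(1) unfolding brick_def by blast+
    have i: "Suc i \<le> l" "i < l" "j \<le> l" "Suc i \<le> j" using ij by auto
    have TN: "T (Suc i) N"
      using T_quot[OF N(2) T_quot[OF I(2) T_quot[OF D(2)[OF i(2)] TL[OF i(1)]]]] .
    obtain C' where "ses (D j) (R j) C'" using D(3)[OF ij(2)] by blast
    then have FN: "F j N" using F_sub[OF N(3) F_sub[OF I(3) F_sub[OF _ FR[OF i(3)]]]] by blast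
    obtain N' where N': "ses N M N'" "ses N' M N" using summand[OF N(1)] by blast
    \<comment> \<open>I1 is the image of \<open>L j\<close> in N = M/N'. It is zero, since N is in
      \<open>F j\<close>; so \<open>L j\<close>, and with it \<open>L (Suc i)\<close>, lies in the
      complement N'.\<close>
    obtain J I1 I' C where J: "ses J (L j) I1" "ses I1 N C" "ses J N' I'" "ses I' (R j) C"
      using two_subs[OF N'(2) ses[OF i(3)]] by blast
    have "T j I1" using T_quot[OF J(1) TL[OF i(3)]] .
    moreover have "F j I1" using F_sub[OF J(2) FN] .
    ultimately have "I1 = Z" using TF ses_in J(1) by blast
    then have "J = L j" using J(1) ses_zero_quot by blast
    then have "ses (L j) N' I'" using J(3) by simp
    moreover obtain Q where "ses (L (Suc i)) (L j) Q" using sub[OF i(4,3)] by blast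
    ultimately obtain Q' where Q': "ses (L (Suc i)) N' Q'" using sub_trans by blast
    \<comment> \<open>P has the class of the direct sum of N and \<open>L (Suc i)\<close>. As
      \<open>a (Suc i)\<close> is positive on N, it exceeds its maximum at P.\<close>
    obtain P where P: "ses P M Q'" "ses N P (L (Suc i))" using quot_lift[OF N'(1) Q'] by blast
    have "a (Suc i) \<bullet> cls P = a (Suc i) \<bullet> cls N + a (Suc i) \<bullet> cls (L (Suc i))"
      using cls_add[OF P(2)] by (simp add: inner_add_right)
    then show False using amax[OF i(1) P(1)] Tpos[OF TN NO] by linarith
  qed
  have DO: "D k \<in> Ob" "D k \<noteq> Z" if "k < l" for k using D(1)[OF that] unfolding brick_def by blast+
  have inj: "inj_on D {..<l}"
  proof (rule inj_onI, rule ccontr)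
    fix i j assume ij: "i \<in> {..<l}" "j \<in> {..<l}" "D i = D j" "i \<noteq> j"
    then have "nzmap (D i) (D j)" "nzmap (D j) (D i)" using nzmap_self DO by (metis lessThan_iff)+
    then show False using hom[of i j] hom[of j i] ij by (metis lessThan_iff nat_neq_iff)
  qed
  have tel: "k \<le> l \<Longrightarrow> cls (L k) = (\<Sum>i<k. cls (D i))" for k
  proof (induction k)
    case 0 then show ?case using cls[of 0] nth0 by simp
  next
    case (Suc k)
    then show ?case using cls_add[OF D(2)[of k]] by simp
  qed
  have sub: "D ` {..<l} \<subseteq> {Y. brick Y}" using D(1) by auto
  have "cls M = (\<Sum>i<l. cls (D i))" using tel[of l] cls[of l] nthl by simp
  also have "\<dots> = (\<Sum>Y\<in>D ` {..<l}. cls Y)" using inj by (simp add: sum.reindex)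
  finally have "(\<Sum>Y | brick Y. cls Y) = (\<Sum>Y\<in>D ` {..<l}. cls Y)" using sum by simp
  \<comment> \<open>The classes of the bricks missing from the path sum to zero; they are
    nonnegative and nonzero, so none is missing.\<close>
  then have rest: "(\<Sum>Y\<in>{Y. brick Y} - D ` {..<l}. cls Y) = 0"
    using sum.subset_diff[OF sub fin, of cls] by simp
  have bO: "Y \<in> Ob" "Y \<noteq> Z" if "brick Y" for Y using that unfolding brick_def by blast+
  have all: "{Y. brick Y} = D ` {..<l}"
  proof (rule ccontr)
    assume "\<not> ?thesis"
    then obtain Y where Y: "brick Y" "Y \<notin> D ` {..<l}" using sub by blast
    have "cls Y $ k = 0" for k
    proof -
      have "(\<Sum>Y\<in>{Y. brick Y} - D ` {..<l}. cls Y $ k) = 0"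
        using rest by (metis sum_component zero_index)
      then have "\<forall>Y\<in>{Y. brick Y} - D ` {..<l}. cls Y $ k = 0"
        using fin cls_nonneg(1) bO(1) by (subst (asm) sum_nonneg_eq_0_iff) auto
      then show ?thesis using Y by blast
    qed
    then have "cls Y = 0" by (simp add: vec_eq_iff)
    then show False using cls_nonzero bO Y(1) by blast
  qed
  have im: "(\<lambda>k. D (k - 1)) ` {1..l} = D ` {..<l}"
  proof
    show "(\<lambda>k. D (k - 1)) ` {1..l} \<subseteq> D ` {..<l}" by auto
    show "D ` {..<l} \<subseteq> (\<lambda>k. D (k - 1)) ` {1..l}"
    proof
      fix y assume "y \<in> D ` {..<l}"
      then obtain k where "k < l" "y = D k" by blast
      then show "y \<in> (\<lambda>k. D (k - 1)) ` {1..l}" by (intro image_eqI[of _ _ "Suc k"]) auto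
    qed
  qed
  \<comment> \<open>The layers are counted from 0, the bricks of a chain from 1.\<close>
  have "brick_chain Ob ses Z s l (\<lambda>k. D (k - 1))"
  proof unfold_locales
    show "brick Y \<longleftrightarrow> Y \<in> (\<lambda>k. D (k - 1)) ` {1..l}" for Y
      unfolding im using all by blast
    show "inj_on (\<lambda>k. D (k - 1)) {1..l}"
    proof (rule inj_onI)
      fix x y assume xy: "x \<in> {1..l}" "y \<in> {1..l}" "D (x - 1) = D (y - 1)"
      then have "x - 1 = y - 1" using inj_onD[OF inj xy(3)] by auto
      then show "x = y" using xy(1,2) unfolding atLeastAtMost_iff by arith
    qed
    fix i j assume ij: "i \<in> {1..l}" "j \<in> {1..l}" "nzmap (D (i - 1)) (D (j - 1))"
    show "j \<le> i"
    proof (rule ccontr)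
      assume "\<not> ?thesis"
      then have "i - 1 < j - 1" "j - 1 < l" using ij by auto
      then show False using hom ij(3) by blast
    qed
  qed
  then show ?thesis by blast
qed

end

section \<open>Modules and linear maps\<close>

text \<open>Linear maps without the extensionality built into \<open>module_hom\<close>, so that
  plain composition and restriction to submodules need no adjustment outside the carrier.\<close>

definition lin :: "('a, 'r) ring_scheme \<Rightarrow> ('a, 'x) module \<Rightarrow> ('a, 'y) module \<Rightarrow> ('x \<Rightarrow> 'y) \<Rightarrow> bool" where
  "lin R M N f \<longleftrightarrow> f \<in> carrier M \<rightarrow> carrier N \<and>
     (\<forall>x \<in> carrier M. \<forall>y \<in> carrier M. f (x \<oplus>\<^bsub>M\<^esub> y) = f x \<oplus>\<^bsub>N\<^esub> f y) \<and>
     (\<forall>a \<in> carrier R. \<forall>x \<in> carrier M. f (a \<odot>\<^bsub>M\<^esub> x) = a \<odot>\<^bsub>N\<^esub> f x)"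

lemma linD:
  assumes "lin R M N f"
  shows "x \<in> carrier M \<Longrightarrow> f x \<in> carrier N"
    "x \<in> carrier M \<Longrightarrow> y \<in> carrier M \<Longrightarrow> f (x \<oplus>\<^bsub>M\<^esub> y) = f x \<oplus>\<^bsub>N\<^esub> f y"
    "a \<in> carrier R \<Longrightarrow> x \<in> carrier M \<Longrightarrow> f (a \<odot>\<^bsub>M\<^esub> x) = a \<odot>\<^bsub>N\<^esub> f x"
  using assms unfolding lin_def by auto

lemma linI:
  assumes "\<And>x. x \<in> carrier M \<Longrightarrow> f x \<in> carrier N"
    "\<And>x y. x \<in> carrier M \<Longrightarrow> y \<in> carrier M \<Longrightarrow> f (x \<oplus>\<^bsub>M\<^esub> y) = f x \<oplus>\<^bsub>N\<^esub> f y"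
    "\<And>a x. a \<in> carrier R \<Longrightarrow> x \<in> carrier M \<Longrightarrow> f (a \<odot>\<^bsub>M\<^esub> x) = a \<odot>\<^bsub>N\<^esub> f x"
  shows "lin R M N f"
  using assms unfolding lin_def by auto

lemma module_hom_lin: "f \<in> module_hom R M N \<longleftrightarrow> lin R M N f \<and> f \<in> extensional (carrier M)"
  unfolding module_hom_def lin_def by (auto simp: PiE_def)

context left_module
begin

lemma smult_l_null: "x \<in> carrier M \<Longrightarrow> \<zero> \<odot>\<^bsub>M\<^esub> x = \<zero>\<^bsub>M\<^esub>"
  using smult_l_distr[of \<zero> \<zero> x] smult_closed[of \<zero> x] by (simp add: M.add.r_cancel_one')

lemma smult_r_null: "a \<in> carrier R \<Longrightarrow> a \<odot>\<^bsub>M\<^esub> \<zero>\<^bsub>M\<^esub> = \<zero>\<^bsub>M\<^esub>"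
  using smult_r_distr[of a "\<zero>\<^bsub>M\<^esub>" "\<zero>\<^bsub>M\<^esub>"] smult_closed[of a "\<zero>\<^bsub>M\<^esub>"] by (simp add: M.add.r_cancel_one')

lemma smult_minus_one: "x \<in> carrier M \<Longrightarrow> (\<ominus> \<one>) \<odot>\<^bsub>M\<^esub> x = \<ominus>\<^bsub>M\<^esub> x"
proof -
  assume x: "x \<in> carrier M"
  have "(\<ominus> \<one>) \<odot>\<^bsub>M\<^esub> x \<oplus>\<^bsub>M\<^esub> x = (\<ominus> \<one> \<oplus> \<one>) \<odot>\<^bsub>M\<^esub> x"
    using smult_l_distr[of "\<ominus> \<one>" \<one> x] x by (simp add: smult_one)
  also have "\<dots> = \<zero>\<^bsub>M\<^esub>" using x by (simp add: R.l_neg smult_l_null)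
  finally show ?thesis using x smult_closed[of "\<ominus> \<one>" x] by (simp add: M.minus_equality)
qed

text \<open>Closure under negation follows from closure under the scalar -1.\<close>

lemma submodule_iff:
  "submodule L R M \<longleftrightarrow> L \<subseteq> carrier M \<and> \<zero>\<^bsub>M\<^esub> \<in> L \<and> (\<forall>x\<in>L. \<forall>y\<in>L. x \<oplus>\<^bsub>M\<^esub> y \<in> L) \<and>
    (\<forall>a\<in>carrier R. \<forall>x\<in>L. a \<odot>\<^bsub>M\<^esub> x \<in> L)"
proof
  assume L: "submodule L R M"
  then interpret s: submodule L R M .
  show "L \<subseteq> carrier M \<and> \<zero>\<^bsub>M\<^esub> \<in> L \<and> (\<forall>x\<in>L. \<forall>y\<in>L. x \<oplus>\<^bsub>M\<^esub> y \<in> L) \<and>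
    (\<forall>a\<in>carrier R. \<forall>x\<in>L. a \<odot>\<^bsub>M\<^esub> x \<in> L)"
    using s.subset s.one_closed s.m_closed by auto
next
  assume L: "L \<subseteq> carrier M \<and> \<zero>\<^bsub>M\<^esub> \<in> L \<and> (\<forall>x\<in>L. \<forall>y\<in>L. x \<oplus>\<^bsub>M\<^esub> y \<in> L) \<and>
    (\<forall>a\<in>carrier R. \<forall>x\<in>L. a \<odot>\<^bsub>M\<^esub> x \<in> L)"
  have neg: "\<ominus>\<^bsub>M\<^esub> x \<in> L" if "x \<in> L" for x
    using L that smult_minus_one[of x] by (metis R.add.inv_closed R.one_closed subsetD)
  show "submodule L R M"
    by (intro submodule.intro subgroup.intro submodule_axioms.intro)
      (use L neg in \<open>auto simp: a_inv_def\<close>)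
qed

lemma submoduleD:
  assumes "submodule L R M"
  shows "L \<subseteq> carrier M" "x \<in> L \<Longrightarrow> x \<in> carrier M" "\<zero>\<^bsub>M\<^esub> \<in> L"
    "x \<in> L \<Longrightarrow> y \<in> L \<Longrightarrow> x \<oplus>\<^bsub>M\<^esub> y \<in> L" "a \<in> carrier R \<Longrightarrow> x \<in> L \<Longrightarrow> a \<odot>\<^bsub>M\<^esub> x \<in> L"
    "x \<in> L \<Longrightarrow> \<ominus>\<^bsub>M\<^esub> x \<in> L" "x \<in> L \<Longrightarrow> y \<in> L \<Longrightarrow> x \<ominus>\<^bsub>M\<^esub> y \<in> L"
proof -
  note L = assms[unfolded submodule_iff]
  show "L \<subseteq> carrier M" "\<zero>\<^bsub>M\<^esub> \<in> L" "x \<in> L \<Longrightarrow> x \<in> carrier M" 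
    "x \<in> L \<Longrightarrow> y \<in> L \<Longrightarrow> x \<oplus>\<^bsub>M\<^esub> y \<in> L" "a \<in> carrier R \<Longrightarrow> x \<in> L \<Longrightarrow> a \<odot>\<^bsub>M\<^esub> x \<in> L"
    using L by auto
  have neg: "\<ominus>\<^bsub>M\<^esub> x \<in> L" if "x \<in> L" for x
    using L that smult_minus_one[of x] by (metis R.add.inv_closed R.one_closed subsetD)
  then show "x \<in> L \<Longrightarrow> \<ominus>\<^bsub>M\<^esub> x \<in> L" "x \<in> L \<Longrightarrow> y \<in> L \<Longrightarrow> x \<ominus>\<^bsub>M\<^esub> y \<in> L"
    using L by (auto simp: a_minus_def)
qed

lemma submoduleI:
  assumes "L \<subseteq> carrier M" "\<zero>\<^bsub>M\<^esub> \<in> L" "\<And>x y. x \<in> L \<Longrightarrow> y \<in> L \<Longrightarrow> x \<oplus>\<^bsub>M\<^esub> y \<in> L"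
    "\<And>a x. a \<in> carrier R \<Longrightarrow> x \<in> L \<Longrightarrow> a \<odot>\<^bsub>M\<^esub> x \<in> L"
  shows "submodule L R M"
  using assms unfolding submodule_iff by blast

lemma left_module_sub:
  assumes L: "submodule L R M"
  shows "left_module R (M\<lparr>carrier := L\<rparr>)"
proof -
  note D = submoduleD[OF L]
  have "abelian_group (M\<lparr>carrier := L\<rparr>)"
  proof (rule abelian_groupI)
    fix x assume "x \<in> carrier (M\<lparr>carrier := L\<rparr>)"
    then have x: "x \<in> L" by simp
    then show "\<exists>y\<in>carrier (M\<lparr>carrier := L\<rparr>). y \<oplus>\<^bsub>M\<lparr>carrier := L\<rparr>\<^esub> x = \<zero>\<^bsub>M\<lparr>carrier := L\<rparr>\<^esub>"
      using D(2,6) by (intro bexI[of _ "\<ominus>\<^bsub>M\<^esub> x"]) (auto simp: M.l_neg)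
  qed (use D in \<open>auto simp: M.add.m_ac\<close>)
  then show ?thesis
    by (intro left_module.intro left_module_axioms.intro R.ring_axioms)
      (use D in \<open>auto simp: smult_l_distr smult_r_distr smult_assoc1 smult_one\<close>)
qed

lemma submodule_sub_iff:
  assumes L: "submodule L R M"
  shows "submodule L' R (M\<lparr>carrier := L\<rparr>) \<longleftrightarrow> submodule L' R M \<and> L' \<subseteq> L"
  using left_module.submodule_iff[OF left_module_sub[OF L], of L'] submodule_iff[of L'] submoduleD(1)[OF L]
  by auto

lemma submodule_carrier: "submodule (carrier M) R M"
  by (rule submoduleI) (auto simp: smult_closed)

lemma submodule_zero: "submodule {\<zero>\<^bsub>M\<^esub>} R M"
  by (rule submoduleI) (auto simp: smult_r_null)

end

text \<open>Every identity in N is the image of the same identity in M. This equips quotients with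
  their module structure.\<close>

lemma lin_surj_left_module:
  assumes M: "left_module R M" and f: "lin R M N f" and s: "f ` carrier M = carrier N" and z: "f \<zero>\<^bsub>M\<^esub> = \<zero>\<^bsub>N\<^esub>"
  shows "left_module R N"
proof -
  interpret left_module R M by fact
  have ex: "\<exists>u\<in>carrier M. f u = y" if "y \<in> carrier N" for y
    using that unfolding s[symmetric] by blast
  note D = linD[OF f]
  have ac: "x \<oplus>\<^bsub>N\<^esub> y \<in> carrier N" if xy: "x \<in> carrier N" "y \<in> carrier N" for x y
  proof -
    obtain u v where "u \<in> carrier M" "v \<in> carrier M" "f u = x" "f v = y" using ex xy by blast
    then show ?thesis using D(1)[of "u \<oplus>\<^bsub>M\<^esub> v"] D(2)[of u v] by simp
  qed
  have "abelian_group N"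
  proof (rule abelian_groupI)
    show "\<zero>\<^bsub>N\<^esub> \<in> carrier N" using z D(1) by force
    fix x assume x: "x \<in> carrier N"
    obtain u where u: "u \<in> carrier M" "f u = x" using ex x by blast
    show "\<zero>\<^bsub>N\<^esub> \<oplus>\<^bsub>N\<^esub> x = x" using D(2)[of "\<zero>\<^bsub>M\<^esub>" u] u z by simp
    show "\<exists>y\<in>carrier N. y \<oplus>\<^bsub>N\<^esub> x = \<zero>\<^bsub>N\<^esub>"
      using D(2)[of "\<ominus>\<^bsub>M\<^esub> u" u] u z D(1)[of "\<ominus>\<^bsub>M\<^esub> u"] by (intro bexI[of _ "f (\<ominus>\<^bsub>M\<^esub> u)"]) (auto simp: M.l_neg)
    fix y assume y: "y \<in> carrier N"
    show "x \<oplus>\<^bsub>N\<^esub> y \<in> carrier N" by (rule ac[OF x y])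
    obtain v where v: "v \<in> carrier M" "f v = y" using ex y by blast
    show "x \<oplus>\<^bsub>N\<^esub> y = y \<oplus>\<^bsub>N\<^esub> x" using D(2)[of u v] D(2)[of v u] u v by (simp add: M.a_comm)
    fix w assume w: "w \<in> carrier N"
    obtain t where t: "t \<in> carrier M" "f t = w" using ex w by blast
    show "x \<oplus>\<^bsub>N\<^esub> y \<oplus>\<^bsub>N\<^esub> w = x \<oplus>\<^bsub>N\<^esub> (y \<oplus>\<^bsub>N\<^esub> w)"
      using D(2)[of "u \<oplus>\<^bsub>M\<^esub> v" t] D(2)[of u v] D(2)[of v t] D(2)[of u "v \<oplus>\<^bsub>M\<^esub> t"] u v t
      by (simp add: M.a_assoc)
  qed
  then show ?thesis
  proof (intro left_module.intro left_module_axioms.intro R.ring_axioms)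
    fix a x assume a: "a \<in> carrier R" and x: "x \<in> carrier N"
    obtain u where u: "u \<in> carrier M" "f u = x" using ex x by blast
    show "a \<odot>\<^bsub>N\<^esub> x \<in> carrier N" using D(3)[OF a u(1)] D(1)[of "a \<odot>\<^bsub>M\<^esub> u"] u a by (simp add: smult_closed)
    {
      fix b assume b: "b \<in> carrier R"
      show "(a \<oplus>\<^bsub>R\<^esub> b) \<odot>\<^bsub>N\<^esub> x = a \<odot>\<^bsub>N\<^esub> x \<oplus>\<^bsub>N\<^esub> b \<odot>\<^bsub>N\<^esub> x"
        using D(3)[of "a \<oplus>\<^bsub>R\<^esub> b" u] D(3)[of a u] D(3)[of b u] D(2)[of "a \<odot>\<^bsub>M\<^esub> u" "b \<odot>\<^bsub>M\<^esub> u"] a b u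
        by (simp add: smult_closed smult_l_distr)
      show "(a \<otimes>\<^bsub>R\<^esub> b) \<odot>\<^bsub>N\<^esub> x = a \<odot>\<^bsub>N\<^esub> (b \<odot>\<^bsub>N\<^esub> x)"
        using D(3)[of "a \<otimes>\<^bsub>R\<^esub> b" u] D(3)[of a "b \<odot>\<^bsub>M\<^esub> u"] D(3)[of b u] a b u
        by (simp add: smult_closed smult_assoc1)
    }
    fix y assume y: "y \<in> carrier N"
    obtain v where v: "v \<in> carrier M" "f v = y" using ex y by blast
    show "a \<odot>\<^bsub>N\<^esub> (x \<oplus>\<^bsub>N\<^esub> y) = a \<odot>\<^bsub>N\<^esub> x \<oplus>\<^bsub>N\<^esub> a \<odot>\<^bsub>N\<^esub> y"
      using D(2)[of u v] D(3)[of a "u \<oplus>\<^bsub>M\<^esub> v"] D(3)[of a u] D(3)[of a v]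
        D(2)[of "a \<odot>\<^bsub>M\<^esub> u" "a \<odot>\<^bsub>M\<^esub> v"] a u v
      by (simp add: smult_closed smult_r_distr)
  next
    fix x assume x: "x \<in> carrier N"
    obtain u where u: "u \<in> carrier M" "f u = x" using ex x by blast
    show "\<one>\<^bsub>R\<^esub> \<odot>\<^bsub>N\<^esub> x = x" using D(3)[of "\<one>\<^bsub>R\<^esub>" u] u by (simp add: smult_one)
  qed
qed

lemma lin_zero:
  assumes "left_module R M" "left_module R N" "lin R M N f"
  shows "f \<zero>\<^bsub>M\<^esub> = \<zero>\<^bsub>N\<^esub>"
proof -
  interpret M: left_module R M by fact
  interpret N: left_module R N by fact
  show ?thesis
    using linD(2)[OF assms(3), of "\<zero>\<^bsub>M\<^esub>" "\<zero>\<^bsub>M\<^esub>"] linD(1)[OF assms(3), of "\<zero>\<^bsub>M\<^esub>"]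
    by (simp add: N.M.add.r_cancel_one')
qed

lemma lin_minus:
  assumes "left_module R M" "left_module R N" "lin R M N f" "x \<in> carrier M" "y \<in> carrier M"
  shows "f (x \<ominus>\<^bsub>M\<^esub> y) = f x \<ominus>\<^bsub>N\<^esub> f y"
proof -
  interpret M: left_module R M by fact
  interpret N: left_module R N by fact
  have "f (\<ominus>\<^bsub>M\<^esub> y) = \<ominus>\<^bsub>N\<^esub> f y"
    using linD(3)[OF assms(3), of "\<ominus>\<^bsub>R\<^esub> \<one>\<^bsub>R\<^esub>" y] M.smult_minus_one[of y] N.smult_minus_one[of "f y"]
      linD(1)[OF assms(3)] assms(5) by simp
  then show ?thesis
    using linD(2)[OF assms(3), of x "\<ominus>\<^bsub>M\<^esub> y"] assms(4,5) by (simp add: a_minus_def)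
qed

section \<open>Kernels, images, quotients and the isomorphism theorems\<close>

definition ker :: "('a, 'x) module \<Rightarrow> ('a, 'y) module \<Rightarrow> ('x \<Rightarrow> 'y) \<Rightarrow> 'x set" where
  "ker M N f = {x \<in> carrier M. f x = \<zero>\<^bsub>N\<^esub>}"

lemma lin_comp: "lin R M N f \<Longrightarrow> lin R N P g \<Longrightarrow> lin R M P (\<lambda>x. g (f x))"
  unfolding lin_def by (auto simp: Pi_iff)

lemma lin_sub: "lin R M N f \<Longrightarrow> L \<subseteq> carrier M \<Longrightarrow> lin R (M\<lparr>carrier := L\<rparr>) N f"
  unfolding lin_def by (auto simp: subset_iff)

lemma lin_restrict_target: "lin R M N f \<Longrightarrow> f ` carrier M \<subseteq> L \<Longrightarrow> lin R M (N\<lparr>carrier := L\<rparr>) f"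
  unfolding lin_def by (auto simp: image_subset_iff)

lemma vimage_submodule:
  assumes M: "left_module R M" and N: "left_module R N" and f: "lin R M N f" and L: "submodule L R N"
  shows "submodule {x \<in> carrier M. f x \<in> L} R M"
proof -
  interpret M: left_module R M by fact
  interpret N: left_module R N by fact
  note D = linD[OF f]
  show ?thesis
    by (rule M.submoduleI)
      (use N.submoduleD[OF L] lin_zero[OF M N f] D M.smult_closed in auto)
qed

lemma image_submodule:
  assumes M: "left_module R M" and N: "left_module R N" and f: "lin R M N f" and L: "submodule L R M"
  shows "submodule (f ` L) R N"
proof -
  interpret M: left_module R M by fact
  interpret N: left_module R N by fact
  note D = linD[OF f] and L = M.submoduleD[OF L]
  show ?thesis
  proof (rule N.submoduleI)
    show "f ` L \<subseteq> carrier N" using D(1) L(2) by blast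
    show "\<zero>\<^bsub>N\<^esub> \<in> f ` L" using L(3) lin_zero[OF M N f] by (metis imageI)
    fix x y assume "x \<in> f ` L" "y \<in> f ` L"
    then obtain u v where "u \<in> L" "v \<in> L" "x = f u" "y = f v" by blast
    then show "x \<oplus>\<^bsub>N\<^esub> y \<in> f ` L" using D(2)[of u v] L by (metis imageI)
  next
    fix a x assume "a \<in> carrier R" "x \<in> f ` L"
    then obtain u where "u \<in> L" "x = f u" by blast
    then show "a \<odot>\<^bsub>N\<^esub> x \<in> f ` L" using D(3)[of a u] L(2,5) \<open>a \<in> carrier R\<close> by (metis imageI)
  qed
qed

lemma ker_submodule:
  assumes "left_module R M" "left_module R N" "lin R M N f"
  shows "submodule (ker M N f) R M"
  using vimage_submodule[OF assms left_module.submodule_zero[OF assms(2)]] by (simp add: ker_def)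

lemma lin_inj_iff:
  assumes "left_module R M" "left_module R N" "lin R M N f"
  shows "inj_on f (carrier M) \<longleftrightarrow> ker M N f = {\<zero>\<^bsub>M\<^esub>}"
proof -
  interpret M: left_module R M by fact
  interpret N: left_module R N by fact
  note z = lin_zero[OF assms]
  show ?thesis
  proof
    assume "inj_on f (carrier M)"
    then have "x = \<zero>\<^bsub>M\<^esub>" if "x \<in> carrier M" "f x = \<zero>\<^bsub>N\<^esub>" for x
      using that z inj_onD[of f "carrier M" x "\<zero>\<^bsub>M\<^esub>"] by simp
    then show "ker M N f = {\<zero>\<^bsub>M\<^esub>}" unfolding ker_def using z by auto
  next
    assume k: "ker M N f = {\<zero>\<^bsub>M\<^esub>}"
    show "inj_on f (carrier M)"
    proof (rule inj_onI)
      fix x y assume xy: "x \<in> carrier M" "y \<in> carrier M" "f x = f y"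
      then have "f (x \<ominus>\<^bsub>M\<^esub> y) = \<zero>\<^bsub>N\<^esub>"
        using lin_minus[OF assms xy(1,2)] linD(1)[OF assms(3) xy(2)] by (simp add: a_minus_def N.M.r_neg)
      then have "x \<ominus>\<^bsub>M\<^esub> y \<in> ker M N f" using xy by (simp add: ker_def)
      then show "x = y" using k xy by (metis M.M.minus_equality M.M.minus_minus M.M.a_inv_closed a_minus_def singletonD)
    qed
  qed
qed

definition proj :: "('a, 'x) module \<Rightarrow> 'x set \<Rightarrow> 'x \<Rightarrow> 'x set" where
  "proj M L x = L +>\<^bsub>M\<^esub> x"

locale submodule_of = left_module R M for R :: "('a, 'r) ring_scheme" and M :: "('a, 'x) module" +
  fixes L :: "'x set"
  assumes sub: "submodule L R M"
begin

lemma abelian_sub: "abelian_subgroup L M"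
  by (intro abelian_subgroupI3 additive_subgroup.intro M.abelian_group_axioms)
    (use sub in \<open>simp add: submodule_def\<close>)

sublocale abelian_subgroup L M by (rule abelian_sub)

lemma proj_eq:
  assumes "x \<in> carrier M" "y \<in> carrier M"
  shows "proj M L x = proj M L y \<longleftrightarrow> x \<ominus>\<^bsub>M\<^esub> y \<in> L"
proof
  assume e: "proj M L x = proj M L y"
  have "x \<in> proj M L x" unfolding proj_def using a_rcos_self assms by blast
  then show "x \<ominus>\<^bsub>M\<^esub> y \<in> L" using e a_rcos_module_imp[OF assms(2), of x]
    unfolding proj_def by (simp add: a_minus_def)
next
  assume "x \<ominus>\<^bsub>M\<^esub> y \<in> L"
  then have "x \<in> proj M L y" using a_rcos_module_rev[OF assms(2), of x] assms(1) by (simp add: proj_def a_minus_def)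
  then show "proj M L x = proj M L y" using a_repr_independence'[of x y] assms by (simp add: proj_def)
qed

lemma proj_zero: "proj M L \<zero>\<^bsub>M\<^esub> = L"
  unfolding proj_def using submoduleD(1)[OF sub] by simp

lemma quotient_simps:
  "carrier (quotient_module M L) = proj M L ` carrier M" "\<zero>\<^bsub>quotient_module M L\<^esub> = L"
  unfolding quotient_module_def proj_def by (auto simp: A_RCOSETS_def')

lemma proj_lin: "lin R M (quotient_module M L) (proj M L)"
proof (rule linI)
  show "proj M L x \<in> carrier (quotient_module M L)" if "x \<in> carrier M" for x
    using that by (simp add: quotient_simps)
  show "proj M L (x \<oplus>\<^bsub>M\<^esub> y) = proj M L x \<oplus>\<^bsub>quotient_module M L\<^esub> proj M L y"
    if "x \<in> carrier M" "y \<in> carrier M" for x y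
    using a_rcos_sum[OF that] by (simp add: quotient_module_def proj_def)
  fix a x assume a: "a \<in> carrier R" "x \<in> carrier M"
  \<comment> \<open>The scalar action on a coset is a union over its representatives; all members of
    the union coincide.\<close>
  have "proj M L (a \<odot>\<^bsub>M\<^esub> z) = proj M L (a \<odot>\<^bsub>M\<^esub> x)" if z: "z \<in> proj M L x" for z
  proof -
    have zc: "z \<in> carrier M" using z a(2) a_r_coset_subset_G[OF submoduleD(1)[OF sub]] unfolding proj_def by blast
    then have "proj M L z = proj M L x"
      using z a_repr_independence'[of z x] a by (simp add: proj_def)
    then have l: "z \<ominus>\<^bsub>M\<^esub> x \<in> L" using proj_eq zc a by blast
    have "a \<odot>\<^bsub>M\<^esub> z = a \<odot>\<^bsub>M\<^esub> ((z \<ominus>\<^bsub>M\<^esub> x) \<oplus>\<^bsub>M\<^esub> x)"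
      using zc a by (simp add: a_minus_def M.a_assoc M.l_neg)
    also have "\<dots> = a \<odot>\<^bsub>M\<^esub> (z \<ominus>\<^bsub>M\<^esub> x) \<oplus>\<^bsub>M\<^esub> a \<odot>\<^bsub>M\<^esub> x"
      using smult_r_distr[OF a(1)] a zc by simp
    finally have "a \<odot>\<^bsub>M\<^esub> z \<ominus>\<^bsub>M\<^esub> a \<odot>\<^bsub>M\<^esub> x = a \<odot>\<^bsub>M\<^esub> (z \<ominus>\<^bsub>M\<^esub> x)"
      using smult_closed a zc by (simp add: a_minus_def M.a_assoc M.r_neg)
    then show ?thesis using proj_eq smult_closed a zc submoduleD(5)[OF sub a(1) l] by simp
  qed
  moreover have "x \<in> proj M L x" unfolding proj_def using a_rcos_self a by blast
  ultimately have "(\<Union>z\<in>proj M L x. proj M L (a \<odot>\<^bsub>M\<^esub> z)) = proj M L (a \<odot>\<^bsub>M\<^esub> x)" by blast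
  then show "proj M L (a \<odot>\<^bsub>M\<^esub> x) = a \<odot>\<^bsub>quotient_module M L\<^esub> proj M L x"
    by (simp add: quotient_module_def proj_def)
qed

lemma quotient_left_module: "left_module R (quotient_module M L)"
  by (rule lin_surj_left_module[OF left_module_axioms proj_lin])
    (simp_all add: quotient_simps proj_zero)

lemma proj_ker: "ker M (quotient_module M L) (proj M L) = L"
proof -
  have "\<ominus>\<^bsub>M\<^esub> \<zero>\<^bsub>M\<^esub> = \<zero>\<^bsub>M\<^esub>" by (rule M.minus_equality) auto
  then have m0: "x \<ominus>\<^bsub>M\<^esub> \<zero>\<^bsub>M\<^esub> = x" if "x \<in> carrier M" for x
    unfolding a_minus_def using that by (metis M.r_zero)
  have "proj M L x = L \<longleftrightarrow> x \<in> L" if "x \<in> carrier M" for x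
    using proj_eq[OF that M.zero_closed] m0[OF that] by (simp only: proj_zero)
  then show ?thesis unfolding ker_def quotient_simps using submoduleD(1)[OF sub] by auto
qed

end

lemma submodule_ofI: "left_module R M \<Longrightarrow> submodule L R M \<Longrightarrow> submodule_of R M L"
  by (simp add: submodule_of_def submodule_of_axioms_def)

lemma isomorphic_iff:
  assumes M: "left_module R M"
  shows "isomorphic_modules R M N \<longleftrightarrow> (\<exists>f. lin R M N f \<and> bij_betw f (carrier M) (carrier N))"
proof
  assume "isomorphic_modules R M N"
  then show "\<exists>f. lin R M N f \<and> bij_betw f (carrier M) (carrier N)"
    unfolding isomorphic_modules_def module_iso_def by (auto simp: module_hom_lin)
next
  interpret left_module R M by fact
  assume "\<exists>f. lin R M N f \<and> bij_betw f (carrier M) (carrier N)"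
  then obtain f where f: "lin R M N f" "bij_betw f (carrier M) (carrier N)" by blast
  have "bij_betw (restrict f (carrier M)) (carrier M) (carrier N)"
    using f(2) bij_betw_cong[of "carrier M" "restrict f (carrier M)" f] by simp
  moreover have "restrict f (carrier M) \<in> module_hom R M N"
    using linD[OF f(1)] smult_closed by (auto simp: module_hom_def)
  ultimately show "isomorphic_modules R M N" unfolding isomorphic_modules_def module_iso_def by blast
qed

lemma isoI:
  assumes "left_module R M" "lin R M N f" "inj_on f (carrier M)" "f ` carrier M = carrier N"
  shows "isomorphic_modules R M N"
  unfolding isomorphic_iff[OF assms(1)] bij_betw_def using assms(2-4) by blast

lemma iso_refl: "left_module R M \<Longrightarrow> isomorphic_modules R M M"
  by (rule isoI[where f = id]) (auto simp: lin_def)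

lemma lin_inv:
  assumes M: "left_module R M" and f: "lin R M N f" "bij_betw f (carrier M) (carrier N)"
  shows "lin R N M (inv_into (carrier M) f)"
proof (rule linI)
  interpret left_module R M by fact
  have s: "f ` carrier M = carrier N" and i: "inj_on f (carrier M)" using f(2) by (auto simp: bij_betw_def)
  let ?g = "inv_into (carrier M) f"
  have fg: "f (?g y) = y" and gc: "?g y \<in> carrier M" if "y \<in> carrier N" for y
    using that s f_inv_into_f inv_into_into by metis+
  have gf: "?g (f x) = x" if "x \<in> carrier M" for x using that i by simp
  fix y assume y: "y \<in> carrier N"
  show "?g y \<in> carrier M" by (rule gc[OF y])
  show "?g (y \<oplus>\<^bsub>N\<^esub> z) = ?g y \<oplus>\<^bsub>M\<^esub> ?g z" if z: "z \<in> carrier N" for z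
    using linD(2)[OF f(1) gc[OF y] gc[OF z]] gf[of "?g y \<oplus>\<^bsub>M\<^esub> ?g z"] fg y z gc by simp
  show "?g (a \<odot>\<^bsub>N\<^esub> y) = a \<odot>\<^bsub>M\<^esub> ?g y" if a: "a \<in> carrier R" for a
    using linD(3)[OF f(1) a gc[OF y]] gf[of "a \<odot>\<^bsub>M\<^esub> ?g y"] fg y a gc smult_closed by simp
qed

lemma iso_sym:
  assumes "left_module R M" "left_module R N" "isomorphic_modules R M N"
  shows "isomorphic_modules R N M"
  using assms lin_inv bij_betw_inv_into unfolding isomorphic_iff[OF assms(1)] isomorphic_iff[OF assms(2)] by blast

lemma iso_trans:
  assumes M: "left_module R M" and N: "left_module R N"
    and "isomorphic_modules R M N" "isomorphic_modules R N P"
  shows "isomorphic_modules R M P"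
proof -
  obtain f where f: "lin R M N f" "bij_betw f (carrier M) (carrier N)" using assms(3) isomorphic_iff[OF M] by blast
  obtain g where g: "lin R N P g" "bij_betw g (carrier N) (carrier P)" using assms(4) isomorphic_iff[OF N] by blast
  have "bij_betw (\<lambda>x. g (f x)) (carrier M) (carrier P)"
    using bij_betw_trans[OF f(2) g(2)] by (simp add: comp_def)
  then show ?thesis using lin_comp[OF f(1) g(1)] isomorphic_iff[OF M] by blast
qed

text \<open>The map h evaluates g on a chosen preimage; the inclusion of kernels makes the choice
  irrelevant.\<close>

lemma lin_factor:
  assumes M: "left_module R M" and N: "left_module R N" and P: "left_module R P"
    and f: "lin R M N f" "f ` carrier M = carrier N" and g: "lin R M P g"
    and k: "ker M N f \<subseteq> ker M P g"
  shows "\<exists>h. lin R N P h \<and> (\<forall>x \<in> carrier M. h (f x) = g x)"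
proof -
  interpret M: left_module R M by fact
  interpret N: left_module R N by fact
  interpret P: left_module R P by fact
  have eq: "g x = g y" if xy: "x \<in> carrier M" "y \<in> carrier M" "f x = f y" for x y
  proof -
    have "f (x \<ominus>\<^bsub>M\<^esub> y) = \<zero>\<^bsub>N\<^esub>"
      using lin_minus[OF M N f(1) xy(1,2)] xy(3) linD(1)[OF f(1) xy(2)] by (simp add: a_minus_def N.M.r_neg)
    then have "x \<ominus>\<^bsub>M\<^esub> y \<in> ker M P g" using k xy by (auto simp: ker_def)
    then have "g x \<ominus>\<^bsub>P\<^esub> g y = \<zero>\<^bsub>P\<^esub>" using lin_minus[OF M P g xy(1,2)] by (simp add: ker_def)
    then show ?thesis
      using linD(1)[OF g xy(1)] linD(1)[OF g xy(2)]
      by (metis P.M.minus_equality P.M.minus_minus P.M.a_inv_closed a_minus_def)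
  qed
  define s where "s = inv_into (carrier M) f"
  have s: "s y \<in> carrier M" "f (s y) = y" if "y \<in> carrier N" for y
    using that f(2) unfolding s_def by (metis inv_into_into, metis f_inv_into_f)
  define h where "h y = g (s y)" for y
  have hf: "h (f x) = g x" if "x \<in> carrier M" for x
    unfolding h_def using eq s[of "f x"] linD(1)[OF f(1)] that by blast
  have "lin R N P h"
  proof (rule linI)
    fix y assume y: "y \<in> carrier N"
    show "h y \<in> carrier P" unfolding h_def using s[OF y] linD(1)[OF g] by blast
    show "h (y \<oplus>\<^bsub>N\<^esub> z) = h y \<oplus>\<^bsub>P\<^esub> h z" if z: "z \<in> carrier N" for z
    proof -
      have "h (y \<oplus>\<^bsub>N\<^esub> z) = h (f (s y \<oplus>\<^bsub>M\<^esub> s z))" using linD(2)[OF f(1)] s y z by simp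
      also have "\<dots> = g (s y \<oplus>\<^bsub>M\<^esub> s z)" using hf s y z by simp
      also have "\<dots> = h y \<oplus>\<^bsub>P\<^esub> h z" unfolding h_def using linD(2)[OF g] s y z by simp
      finally show ?thesis .
    qed
    show "h (a \<odot>\<^bsub>N\<^esub> y) = a \<odot>\<^bsub>P\<^esub> h y" if a: "a \<in> carrier R" for a
    proof -
      have "h (a \<odot>\<^bsub>N\<^esub> y) = h (f (a \<odot>\<^bsub>M\<^esub> s y))" using linD(3)[OF f(1) a] s y by simp
      also have "\<dots> = g (a \<odot>\<^bsub>M\<^esub> s y)" using hf s y a M.smult_closed by simp
      also have "\<dots> = a \<odot>\<^bsub>P\<^esub> h y" unfolding h_def using linD(3)[OF g a] s y by simp
      finally show ?thesis .
    qed
  qed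
  then show ?thesis using hf by blast
qed

text \<open>The common form of the isomorphism theorems below: to identify two quotients it is
  enough to compare kernels of surjections from one module.\<close>

lemma iso_of_surjections:
  assumes M: "left_module R M" and N: "left_module R N" and P: "left_module R P"
    and f: "lin R M N f" "f ` carrier M = carrier N" and g: "lin R M P g" "g ` carrier M = carrier P"
    and k: "ker M N f = ker M P g"
  shows "isomorphic_modules R N P"
proof -
  obtain h where h: "lin R N P h" "\<And>x. x \<in> carrier M \<Longrightarrow> h (f x) = g x"
    using lin_factor[OF M N P f g(1)] k by blast
  have "inj_on h (carrier N)"
    unfolding lin_inj_iff[OF N P h(1)]
  proof
    show "{\<zero>\<^bsub>N\<^esub>} \<subseteq> ker N P h"
      using left_module.submodule_iff[OF N] ker_submodule[OF N P h(1)] by blast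
    show "ker N P h \<subseteq> {\<zero>\<^bsub>N\<^esub>}"
    proof
      fix y assume "y \<in> ker N P h"
      then have y: "y \<in> carrier N" "h y = \<zero>\<^bsub>P\<^esub>" by (auto simp: ker_def)
      then obtain x where x: "x \<in> carrier M" "y = f x" using f(2) by (metis imageE)
      then have "x \<in> ker M P g" using y h(2) by (simp add: ker_def)
      then show "y \<in> {\<zero>\<^bsub>N\<^esub>}" using k x by (auto simp: ker_def)
    qed
  qed
  moreover have "h ` carrier N = carrier P"
    unfolding f(2)[symmetric] g(2)[symmetric] using h(2) by (force simp: image_image)
  ultimately show ?thesis using isoI[OF N h(1)] by blast
qed

lemma iso_image:
  assumes "left_module R M" "lin R M N f" "inj_on f (carrier M)"
  shows "isomorphic_modules R M (N\<lparr>carrier := f ` carrier M\<rparr>)"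
  by (rule isoI[OF assms(1) lin_restrict_target[OF assms(2)] assms(3)]) auto

lemma quotient_iso:
  assumes M: "left_module R M" and N: "left_module R N" and f: "lin R M N f" "f ` carrier M = carrier N"
  shows "isomorphic_modules R (quotient_module M (ker M N f)) N"
proof -
  interpret submodule_of R M "ker M N f" by (rule submodule_ofI[OF M ker_submodule[OF M N f(1)]])
  show ?thesis
    by (rule iso_of_surjections[OF M quotient_left_module N proj_lin _ f]) (simp_all add: quotient_simps(1) proj_ker)
qed

section \<open>Finite generation\<close>

definition fgm :: "('a, 'r) ring_scheme \<Rightarrow> ('a, 'x) module \<Rightarrow> bool" where
  "fgm R M \<longleftrightarrow> left_module R M \<and> finitely_generated R M"

text \<open>Linear combinations are traded for a condition on submodules, which passes through
  images and products without handling sums. The combinations of G form the least submodule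
  containing G.\<close>

lemma finitely_generated_iff:
  assumes M: "left_module R M"
  shows "finitely_generated R M \<longleftrightarrow>
    (\<exists>G. finite G \<and> G \<subseteq> carrier M \<and> (\<forall>L. submodule L R M \<longrightarrow> G \<subseteq> L \<longrightarrow> L = carrier M))"
    (is "_ \<longleftrightarrow> ?R")
proof
  interpret left_module R M by fact
  assume "finitely_generated R M"
  then obtain G where G: "finite G" "G \<subseteq> carrier M"
      "\<forall>x\<in>carrier M. \<exists>c\<in>G \<rightarrow> carrier R. x = (\<Oplus>\<^bsub>M\<^esub>g\<in>G. c g \<odot>\<^bsub>M\<^esub> g)"
    unfolding finitely_generated_def by blast
  have "x \<in> L" if L: "submodule L R M" "G \<subseteq> L" and x: "x \<in> carrier M" for L x
  proof -
    obtain c where c: "c \<in> G \<rightarrow> carrier R" "x = (\<Oplus>\<^bsub>M\<^esub>g\<in>G. c g \<odot>\<^bsub>M\<^esub> g)" using G(3) x by blast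
    have "(\<Oplus>\<^bsub>M\<^esub>g\<in>H. c g \<odot>\<^bsub>M\<^esub> g) \<in> L" if "H \<subseteq> G" for H
      using finite_subset[OF that G(1)] that
    proof (induction H rule: finite_induct)
      case empty then show ?case using submoduleD(3)[OF L(1)] by simp
    next
      case (insert g H)
      have cl: "(\<lambda>g. c g \<odot>\<^bsub>M\<^esub> g) \<in> H \<rightarrow> carrier M" "c g \<odot>\<^bsub>M\<^esub> g \<in> carrier M"
        using c(1) G(2) insert.prems by (auto intro!: smult_closed)
      have "c g \<odot>\<^bsub>M\<^esub> g \<in> L" using submoduleD(5)[OF L(1)] c(1) L(2) insert.prems by auto
      then show ?case using M.finsum_insert[OF insert.hyps cl] insert submoduleD(4)[OF L(1)] by simp
    qed
    then show ?thesis using c(2) by blast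
  qed
  then have "L = carrier M" if "submodule L R M" "G \<subseteq> L" for L
    using that submoduleD(1) by blast
  then show ?R using G by blast
next
  interpret left_module R M by fact
  assume ?R
  then obtain G where G: "finite G" "G \<subseteq> carrier M"
    "\<And>L. submodule L R M \<Longrightarrow> G \<subseteq> L \<Longrightarrow> L = carrier M" by blast
  let ?L = "{\<Oplus>\<^bsub>M\<^esub>g\<in>G. c g \<odot>\<^bsub>M\<^esub> g | c. c \<in> G \<rightarrow> carrier R}"
  have cl: "(\<lambda>g. c g \<odot>\<^bsub>M\<^esub> g) \<in> G \<rightarrow> carrier M" if "c \<in> G \<rightarrow> carrier R" for c
    using that G(2) by (auto intro!: smult_closed)
  have "submodule ?L R M"
  proof (rule submoduleI)
    show "?L \<subseteq> carrier M"
    proof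
      fix x assume "x \<in> ?L"
      then obtain c where "c \<in> G \<rightarrow> carrier R" "x = (\<Oplus>\<^bsub>M\<^esub>g\<in>G. c g \<odot>\<^bsub>M\<^esub> g)" by blast
      then show "x \<in> carrier M" using M.finsum_closed[OF cl[of c]] by simp
    qed
    have "(\<Oplus>\<^bsub>M\<^esub>g\<in>G. \<zero>\<^bsub>R\<^esub> \<odot>\<^bsub>M\<^esub> g) = (\<Oplus>\<^bsub>M\<^esub>g\<in>G. \<zero>\<^bsub>M\<^esub>)"
      using G(2) by (intro M.finsum_cong') (auto simp: smult_l_null)
    then have "\<zero>\<^bsub>M\<^esub> = (\<Oplus>\<^bsub>M\<^esub>g\<in>G. (\<lambda>_. \<zero>\<^bsub>R\<^esub>) g \<odot>\<^bsub>M\<^esub> g)" by simp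
    then show "\<zero>\<^bsub>M\<^esub> \<in> ?L" by (auto intro!: exI[of _ "\<lambda>_. \<zero>\<^bsub>R\<^esub>"])
    fix x y assume "x \<in> ?L" "y \<in> ?L"
    then obtain c d where c: "c \<in> G \<rightarrow> carrier R" "x = (\<Oplus>\<^bsub>M\<^esub>g\<in>G. c g \<odot>\<^bsub>M\<^esub> g)"
      and d: "d \<in> G \<rightarrow> carrier R" "y = (\<Oplus>\<^bsub>M\<^esub>g\<in>G. d g \<odot>\<^bsub>M\<^esub> g)" by blast
    have "x \<oplus>\<^bsub>M\<^esub> y = (\<Oplus>\<^bsub>M\<^esub>g\<in>G. c g \<odot>\<^bsub>M\<^esub> g \<oplus>\<^bsub>M\<^esub> d g \<odot>\<^bsub>M\<^esub> g)"
      unfolding c(2) d(2) by (rule M.finsum_addf[OF cl[OF c(1)] cl[OF d(1)], symmetric])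
    also have "\<dots> = (\<Oplus>\<^bsub>M\<^esub>g\<in>G. (\<lambda>g. c g \<oplus>\<^bsub>R\<^esub> d g) g \<odot>\<^bsub>M\<^esub> g)"
      using c(1) d(1) G(2) by (intro M.finsum_cong') (auto simp: smult_l_distr Pi_iff subset_iff smult_closed)
    finally show "x \<oplus>\<^bsub>M\<^esub> y \<in> ?L" using c(1) d(1) by (auto intro!: exI[of _ "\<lambda>g. c g \<oplus>\<^bsub>R\<^esub> d g"])
  next
    fix a x assume a: "a \<in> carrier R" and "x \<in> ?L"
    then obtain c where c: "c \<in> G \<rightarrow> carrier R" "x = (\<Oplus>\<^bsub>M\<^esub>g\<in>G. c g \<odot>\<^bsub>M\<^esub> g)" by blast
    have "a \<odot>\<^bsub>M\<^esub> x = (\<Oplus>\<^bsub>M\<^esub>g\<in>G. a \<odot>\<^bsub>M\<^esub> (c g \<odot>\<^bsub>M\<^esub> g))"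
      unfolding c(2)
      by (rule finsum_transport[OF M.abelian_group_axioms M.abelian_group_axioms _ _ G(1) cl[OF c(1)]])
        (use a smult_closed smult_r_distr in auto)
    also have "\<dots> = (\<Oplus>\<^bsub>M\<^esub>g\<in>G. (\<lambda>g. a \<otimes>\<^bsub>R\<^esub> c g) g \<odot>\<^bsub>M\<^esub> g)"
      using a c(1) G(2) by (intro M.finsum_cong') (auto simp: smult_assoc1 Pi_iff subset_iff smult_closed)
    finally show "a \<odot>\<^bsub>M\<^esub> x \<in> ?L" using c(1) a by (auto intro!: exI[of _ "\<lambda>g. a \<otimes>\<^bsub>R\<^esub> c g"])
  qed
  moreover have "G \<subseteq> ?L"
  proof
    fix x assume x: "x \<in> G"
    have "(\<Oplus>\<^bsub>M\<^esub>g\<in>G. (if g = x then \<one>\<^bsub>R\<^esub> else \<zero>\<^bsub>R\<^esub>) \<odot>\<^bsub>M\<^esub> g) = (\<Oplus>\<^bsub>M\<^esub>g\<in>G. if x = g then g else \<zero>\<^bsub>M\<^esub>)"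
      using G(2) by (intro M.finsum_cong') (auto simp: smult_one smult_l_null)
    also have "\<dots> = x" using M.finsum_singleton[OF x G(1), of "\<lambda>g. g"] G(2) by auto
    finally show "x \<in> ?L" by (auto intro!: exI[of _ "\<lambda>g. if g = x then \<one>\<^bsub>R\<^esub> else \<zero>\<^bsub>R\<^esub>"])
  qed
  ultimately have e: "?L = carrier M" using G(3) by blast
  have "\<exists>c\<in>G \<rightarrow> carrier R. x = (\<Oplus>\<^bsub>M\<^esub>g\<in>G. c g \<odot>\<^bsub>M\<^esub> g)" if x: "x \<in> carrier M" for x
  proof -
    have "x \<in> ?L" using x unfolding e .
    then obtain c where "c \<in> G \<rightarrow> carrier R" "x = (\<Oplus>\<^bsub>M\<^esub>g\<in>G. c g \<odot>\<^bsub>M\<^esub> g)" by blast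
    then show ?thesis by (intro bexI[of _ c])
  qed
  then show "finitely_generated R M"
    unfolding finitely_generated_def using G(1,2) by (intro exI[of _ G] conjI ballI)
qed

lemma fgm_image:
  assumes M: "fgm R M" and N: "left_module R N" and f: "lin R M N f" "f ` carrier M = carrier N"
  shows "fgm R N"
proof -
  have M': "left_module R M" using M by (simp add: fgm_def)
  obtain G where G: "finite G" "G \<subseteq> carrier M"
    "\<And>L. submodule L R M \<Longrightarrow> G \<subseteq> L \<Longrightarrow> L = carrier M"
    using M finitely_generated_iff[OF M'] unfolding fgm_def by blast
  have "L = carrier N" if L: "submodule L R N" "f ` G \<subseteq> L" for L
  proof -
    have "{x \<in> carrier M. f x \<in> L} = carrier M"
      using G(3)[OF vimage_submodule[OF M' N f(1) L(1)]] G(2) L(2) by blast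
    then have "carrier N \<subseteq> L" unfolding f(2)[symmetric] by blast
    then show ?thesis using left_module.submoduleD(1)[OF N L(1)] by blast
  qed
  moreover have "f ` G \<subseteq> carrier N" unfolding f(2)[symmetric] using G(2) by blast
  ultimately show ?thesis
    unfolding fgm_def finitely_generated_iff[OF N] using N G(1) by blast
qed

lemma fgm_quotient:
  assumes M: "fgm R M" and L: "submodule L R M"
  shows "fgm R (quotient_module M L)"
proof -
  interpret submodule_of R M L using M L by (simp add: fgm_def submodule_ofI)
  show ?thesis by (rule fgm_image[OF M quotient_left_module proj_lin]) (simp add: quotient_simps)
qed

section \<open>Finitely generated modules over a finite dimensional algebra\<close>

text \<open>The recursion along the list matches the elimination of one coordinate at a time in
  \<open>pivots\<close>; the list may be linearly dependent.\<close>

primrec lspan :: "('a, 'r) ring_scheme \<Rightarrow> ('a, 'x, 'm) module_scheme \<Rightarrow> 'x list \<Rightarrow> 'x set" where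
  "lspan R M [] = {\<zero>\<^bsub>M\<^esub>}"
| "lspan R M (g # gs) = {c \<odot>\<^bsub>M\<^esub> g \<oplus>\<^bsub>M\<^esub> y | c y. c \<in> carrier R \<and> y \<in> lspan R M gs}"

text \<open>
  The number of pivots replaces the dimension of \<open>W\<close>: it is strictly monotone on submodules, which gives
  both chain conditions.
\<close>

primrec pivots :: "('a, 'r) ring_scheme \<Rightarrow> ('a, 'x, 'm) module_scheme \<Rightarrow> 'x set \<Rightarrow> 'x list \<Rightarrow> nat" where
  "pivots R M W [] = 0"
| "pivots R M W (g # gs) = (if \<exists>y \<in> lspan R M gs. g \<oplus>\<^bsub>M\<^esub> y \<in> W then 1 else 0) + pivots R M W gs"

context left_module
begin

lemma lspan_submodule: "set gs \<subseteq> carrier M \<Longrightarrow> submodule (lspan R M gs) R M"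
proof (induction gs)
  case Nil
  then show ?case using submodule_zero by simp
next
  case (Cons g gs)
  then have g: "g \<in> carrier M" and IH: "submodule (lspan R M gs) R M" by auto
  note D = submoduleD[OF IH]
  show ?case
  proof (rule submoduleI)
    show "lspan R M (g # gs) \<subseteq> carrier M" using g D(2) smult_closed by auto
    have "\<zero>\<^bsub>M\<^esub> = \<zero> \<odot>\<^bsub>M\<^esub> g \<oplus>\<^bsub>M\<^esub> \<zero>\<^bsub>M\<^esub>" using g by (simp add: smult_l_null)
    then show "\<zero>\<^bsub>M\<^esub> \<in> lspan R M (g # gs)" using D(3) by auto
    fix x y assume "x \<in> lspan R M (g # gs)" "y \<in> lspan R M (g # gs)"
    then obtain c u d v where x: "c \<in> carrier R" "u \<in> lspan R M gs" "x = c \<odot>\<^bsub>M\<^esub> g \<oplus>\<^bsub>M\<^esub> u"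
      and y: "d \<in> carrier R" "v \<in> lspan R M gs" "y = d \<odot>\<^bsub>M\<^esub> g \<oplus>\<^bsub>M\<^esub> v" by auto
    have "x \<oplus>\<^bsub>M\<^esub> y = (c \<oplus> d) \<odot>\<^bsub>M\<^esub> g \<oplus>\<^bsub>M\<^esub> (u \<oplus>\<^bsub>M\<^esub> v)"
      using x y g D(2) smult_closed by (simp add: smult_l_distr M.add.m_ac)
    then show "x \<oplus>\<^bsub>M\<^esub> y \<in> lspan R M (g # gs)" using x y D(4) by auto
  next
    fix a x assume a: "a \<in> carrier R" and "x \<in> lspan R M (g # gs)"
    then obtain c u where x: "c \<in> carrier R" "u \<in> lspan R M gs" "x = c \<odot>\<^bsub>M\<^esub> g \<oplus>\<^bsub>M\<^esub> u" by auto
    have "a \<odot>\<^bsub>M\<^esub> x = (a \<otimes> c) \<odot>\<^bsub>M\<^esub> g \<oplus>\<^bsub>M\<^esub> a \<odot>\<^bsub>M\<^esub> u"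
      using x a g D(2) smult_closed by (simp add: smult_r_distr smult_assoc1)
    then show "a \<odot>\<^bsub>M\<^esub> x \<in> lspan R M (g # gs)" using x a D(5) by auto
  qed
qed

lemma lspan_base: "set gs \<subseteq> carrier M \<Longrightarrow> set gs \<subseteq> lspan R M gs"
proof (induction gs)
  case (Cons g gs)
  then have g: "g \<in> carrier M" and gs: "set gs \<subseteq> carrier M" by auto
  note D = submoduleD[OF lspan_submodule[OF gs]]
  have "g = \<one> \<odot>\<^bsub>M\<^esub> g \<oplus>\<^bsub>M\<^esub> \<zero>\<^bsub>M\<^esub>" using g by (simp add: smult_one)
  then have "g \<in> lspan R M (g # gs)" using D(3) by auto
  moreover have "x \<in> lspan R M (g # gs)" if "x \<in> lspan R M gs" for x
  proof -
    have "x = \<zero> \<odot>\<^bsub>M\<^esub> g \<oplus>\<^bsub>M\<^esub> x" using g that D(2) by (simp add: smult_l_null)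
    then show ?thesis using that by auto
  qed
  ultimately show ?case using Cons.IH[OF gs] by auto
qed simp

lemma pivots_mono: "W \<subseteq> W' \<Longrightarrow> pivots R M W gs \<le> pivots R M W' gs"
  by (induction gs) (auto intro: add_mono)

lemma pivots_le: "pivots R M W gs \<le> length gs"
  by (induction gs) auto

end

text \<open>Gaussian elimination: an element of W' with leading generator g is reduced by an element
  of W with the same leading generator, and the remainder involves only the later
  generators.\<close>

lemma pivots_eq:
  assumes K: "field K" and M: "left_module K M" and W: "submodule W K M" and W': "submodule W' K M" "W \<subseteq> W'"
  shows "set gs \<subseteq> carrier M \<Longrightarrow> pivots K M W gs = pivots K M W' gs \<Longrightarrow> W' \<inter> lspan K M gs \<subseteq> W"
proof (induction gs)
  interpret left_module K M by fact
  case Nil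
  then show ?case using submoduleD(3)[OF W] by auto
next
  interpret K: field K by fact
  interpret left_module K M by fact
  case (Cons g gs)
  note D = submoduleD[OF W] and D' = submoduleD[OF W'(1)]
  have g: "g \<in> carrier M" and gs: "set gs \<subseteq> carrier M" using Cons.prems by auto
  note S = submoduleD[OF lspan_submodule[OF gs]]
  let ?P = "\<lambda>W. \<exists>y \<in> lspan K M gs. g \<oplus>\<^bsub>M\<^esub> y \<in> W"
  have le: "pivots K M W gs \<le> pivots K M W' gs" by (rule pivots_mono[OF W'(2)])
  have PP: "?P W \<Longrightarrow> ?P W'" using W'(2) by blast
  \<comment> \<open>Both summands of the count are monotone in W, so equal totals force equality of
    each.\<close>
  have eq: "pivots K M W gs = pivots K M W' gs" and P: "?P W' \<Longrightarrow> ?P W"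
    using Cons.prems(2) le PP by (auto split: if_splits)
  note IH = Cons.IH[OF gs eq]
  show ?case
  proof
    fix w assume "w \<in> W' \<inter> lspan K M (g # gs)"
    then obtain c y where w: "w \<in> W'" "c \<in> carrier K" "y \<in> lspan K M gs" "w = c \<odot>\<^bsub>M\<^esub> g \<oplus>\<^bsub>M\<^esub> y" by auto
    show "w \<in> W"
    proof (cases "c = \<zero>\<^bsub>K\<^esub>")
      case True
      then have "w = y" using w g S(2) by (simp add: smult_l_null)
      then show ?thesis using IH w by blast
    next
      case False
      then have c: "c \<in> Units K" using w(2) by (simp add: K.field_Units)
      let ?i = "inv\<^bsub>K\<^esub> c"
      have i: "?i \<in> carrier K" using c by simp
      have "?i \<odot>\<^bsub>M\<^esub> w = (?i \<otimes>\<^bsub>K\<^esub> c) \<odot>\<^bsub>M\<^esub> g \<oplus>\<^bsub>M\<^esub> ?i \<odot>\<^bsub>M\<^esub> y"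
        using w i g S(2) smult_closed by (simp add: smult_r_distr smult_assoc1)
      also have "\<dots> = g \<oplus>\<^bsub>M\<^esub> ?i \<odot>\<^bsub>M\<^esub> y" using c g by (simp add: K.Units_l_inv smult_one)
      finally have "g \<oplus>\<^bsub>M\<^esub> ?i \<odot>\<^bsub>M\<^esub> y \<in> W'" using D'(5)[OF i w(1)] by simp
      \<comment> \<open>Dividing w by its leading coefficient shows that W' has a pivot at g, hence
        so does W.\<close>
      then have "?P W'" using S(5)[OF i w(3)] by blast
      then obtain z where z: "z \<in> lspan K M gs" "g \<oplus>\<^bsub>M\<^esub> z \<in> W" using P by blast
      have u: "c \<odot>\<^bsub>M\<^esub> (g \<oplus>\<^bsub>M\<^esub> z) \<in> W" using D(5) w(2) z(2) by blast
      have zc: "z \<in> carrier M" "y \<in> carrier M" "w \<in> carrier M" using S(2) z(1) w D'(2) by auto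
      have e: "w \<ominus>\<^bsub>M\<^esub> c \<odot>\<^bsub>M\<^esub> (g \<oplus>\<^bsub>M\<^esub> z) = y \<ominus>\<^bsub>M\<^esub> c \<odot>\<^bsub>M\<^esub> z"
      proof -
        have "w \<ominus>\<^bsub>M\<^esub> c \<odot>\<^bsub>M\<^esub> (g \<oplus>\<^bsub>M\<^esub> z) = (c \<odot>\<^bsub>M\<^esub> g \<oplus>\<^bsub>M\<^esub> y) \<oplus>\<^bsub>M\<^esub> (\<ominus>\<^bsub>M\<^esub> (c \<odot>\<^bsub>M\<^esub> g) \<oplus>\<^bsub>M\<^esub> \<ominus>\<^bsub>M\<^esub> (c \<odot>\<^bsub>M\<^esub> z))"
          using w g zc smult_closed by (simp add: a_minus_def smult_r_distr M.minus_add)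
        also have "\<dots> = (c \<odot>\<^bsub>M\<^esub> g \<oplus>\<^bsub>M\<^esub> \<ominus>\<^bsub>M\<^esub> (c \<odot>\<^bsub>M\<^esub> g)) \<oplus>\<^bsub>M\<^esub> (y \<oplus>\<^bsub>M\<^esub> \<ominus>\<^bsub>M\<^esub> (c \<odot>\<^bsub>M\<^esub> z))"
          using w(2) g zc smult_closed by (simp add: M.add.m_ac)
        also have "\<dots> = y \<ominus>\<^bsub>M\<^esub> c \<odot>\<^bsub>M\<^esub> z" using w(2) g zc smult_closed by (simp add: a_minus_def M.r_neg)
        finally show ?thesis .
      qed
      have "w \<ominus>\<^bsub>M\<^esub> c \<odot>\<^bsub>M\<^esub> (g \<oplus>\<^bsub>M\<^esub> z) \<in> W'" using D'(7) w(1) u W'(2) by blast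
      moreover have "w \<ominus>\<^bsub>M\<^esub> c \<odot>\<^bsub>M\<^esub> (g \<oplus>\<^bsub>M\<^esub> z) \<in> lspan K M gs" unfolding e using S(5,7) w z by blast
      ultimately have "w \<ominus>\<^bsub>M\<^esub> c \<odot>\<^bsub>M\<^esub> (g \<oplus>\<^bsub>M\<^esub> z) \<in> W" using IH by blast
      then have "w \<ominus>\<^bsub>M\<^esub> c \<odot>\<^bsub>M\<^esub> (g \<oplus>\<^bsub>M\<^esub> z) \<oplus>\<^bsub>M\<^esub> c \<odot>\<^bsub>M\<^esub> (g \<oplus>\<^bsub>M\<^esub> z) \<in> W" using D(4) u by blast
      moreover have "w \<ominus>\<^bsub>M\<^esub> c \<odot>\<^bsub>M\<^esub> (g \<oplus>\<^bsub>M\<^esub> z) \<oplus>\<^bsub>M\<^esub> c \<odot>\<^bsub>M\<^esub> (g \<oplus>\<^bsub>M\<^esub> z) = w"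
        using w(2) g zc smult_closed by (simp add: a_minus_def M.a_assoc M.l_neg)
      ultimately show ?thesis by simp
    qed
  qed
qed

section \<open>Restriction of scalars to the base field and chain conditions\<close>

context fin_dim_algebra
begin

definition base_change :: "('a, 'x) module \<Rightarrow> ('k, 'x) module" where
  "base_change M = \<lparr> carrier = carrier M, mult = undefined, one = undefined, zero = \<zero>\<^bsub>M\<^esub>,
     add = add M, smult = (\<lambda>c x. (c \<odot>\<^bsub>A\<^esub> \<one>\<^bsub>A\<^esub>) \<odot>\<^bsub>M\<^esub> x) \<rparr>"

lemma base_change_simps [simp]:
  "carrier (base_change M) = carrier M" "\<zero>\<^bsub>base_change M\<^esub> = \<zero>\<^bsub>M\<^esub>"
  "x \<oplus>\<^bsub>base_change M\<^esub> y = x \<oplus>\<^bsub>M\<^esub> y" "c \<odot>\<^bsub>base_change M\<^esub> x = (c \<odot>\<^bsub>A\<^esub> \<one>\<^bsub>A\<^esub>) \<odot>\<^bsub>M\<^esub> x"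
  by (simp_all add: base_change_def)

lemma scalar_mult: "c \<in> carrier K \<Longrightarrow> d \<in> carrier K \<Longrightarrow>
    (c \<otimes>\<^bsub>K\<^esub> d) \<odot>\<^bsub>A\<^esub> \<one>\<^bsub>A\<^esub> = (c \<odot>\<^bsub>A\<^esub> \<one>\<^bsub>A\<^esub>) \<otimes>\<^bsub>A\<^esub> (d \<odot>\<^bsub>A\<^esub> \<one>\<^bsub>A\<^esub>)"
  by (simp add: smult_mult_l smult_assoc1)

lemma left_module_base_change:
  assumes M: "left_module A M"
  shows "left_module K (base_change M)"
proof -
  interpret M: left_module A M by fact
  have "abelian_group (base_change M)"
  proof (rule abelian_groupI)
    fix x assume "x \<in> carrier (base_change M)"
    then show "\<exists>y\<in>carrier (base_change M). y \<oplus>\<^bsub>base_change M\<^esub> x = \<zero>\<^bsub>base_change M\<^esub>"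
      by (intro bexI[of _ "\<ominus>\<^bsub>M\<^esub> x"]) (auto simp: M.l_neg)
  qed (auto simp: M.add.m_ac)
  then show ?thesis
    by (intro left_module.intro left_module_axioms.intro K.ring_axioms)
      (auto simp: M.smult_closed smult_l_distr M.smult_l_distr M.smult_r_distr M.smult_assoc1 M.smult_one
        scalar_mult)
qed

lemma submodule_base_change:
  assumes M: "left_module A M" and L: "submodule L A M"
  shows "submodule L K (base_change M)"
  using L unfolding left_module.submodule_iff[OF M] left_module.submodule_iff[OF left_module_base_change[OF M]]
  by simp

lemma left_module_self: "left_module K A"
  by (intro left_module.intro left_module_axioms.intro K.ring_axioms A.abelian_group_axioms)
    (auto simp: smult_l_distr smult_r_distr smult_assoc1)

text \<open>The products of the generators of A over the field with the generators of M over A span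
  M over the field.\<close>

lemma fgm_spanned:
  assumes M: "fgm A M"
  shows "\<exists>gs. set gs \<subseteq> carrier M \<and> lspan K (base_change M) gs = carrier M"
proof -
  have M': "left_module A M" using M by (simp add: fgm_def)
  interpret M: left_module A M by fact
  interpret B: left_module K "base_change M" by (rule left_module_base_change[OF M'])
  interpret AK: left_module K A by (rule left_module_self)
  obtain G where G: "finite G" "G \<subseteq> carrier M" "\<And>L. submodule L A M \<Longrightarrow> G \<subseteq> L \<Longrightarrow> L = carrier M"
    using M finitely_generated_iff[OF M'] unfolding fgm_def by blast
  obtain H where H: "finite H" "H \<subseteq> carrier A" "\<And>L. submodule L K A \<Longrightarrow> H \<subseteq> L \<Longrightarrow> L = carrier A"
    using finite_dim finitely_generated_iff[OF left_module_self] by blast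
  have "finite ((\<lambda>(b, g). b \<odot>\<^bsub>M\<^esub> g) ` (H \<times> G))" using H(1) G(1) by simp
  from finite_list[OF this] obtain gs where gs: "set gs = (\<lambda>(b, g). b \<odot>\<^bsub>M\<^esub> g) ` (H \<times> G)" ..
  have gsc: "set gs \<subseteq> carrier (base_change M)" unfolding gs using G(2) H(2) by (auto intro!: M.smult_closed)
  let ?W = "lspan K (base_change M) gs"
  have W: "submodule ?W K (base_change M)" by (rule B.lspan_submodule[OF gsc])
  note D = B.submoduleD[OF W, simplified]
  have AG: "a \<odot>\<^bsub>M\<^esub> g \<in> ?W" if a: "a \<in> carrier A" and g: "g \<in> G" for a g
  proof -
    have gc: "g \<in> carrier M" using g G(2) by blast
    let ?L = "{a \<in> carrier A. a \<odot>\<^bsub>M\<^esub> g \<in> ?W}"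
    have "submodule ?L K A"
    proof (rule AK.submoduleI)
      show "\<zero>\<^bsub>A\<^esub> \<in> ?L" using D(3) gc by (simp add: M.smult_l_null)
      show "x \<oplus>\<^bsub>A\<^esub> y \<in> ?L" if "x \<in> ?L" "y \<in> ?L" for x y
        using that D(4) gc by (simp add: M.smult_l_distr)
      fix c x assume c: "c \<in> carrier K" and x: "x \<in> ?L"
      have "c \<odot>\<^bsub>A\<^esub> x = (c \<odot>\<^bsub>A\<^esub> \<one>\<^bsub>A\<^esub>) \<otimes>\<^bsub>A\<^esub> x" using c x by (simp add: smult_mult_l)
      then have "(c \<odot>\<^bsub>A\<^esub> x) \<odot>\<^bsub>M\<^esub> g = (c \<odot>\<^bsub>A\<^esub> \<one>\<^bsub>A\<^esub>) \<odot>\<^bsub>M\<^esub> (x \<odot>\<^bsub>M\<^esub> g)"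
        using c x gc by (simp add: M.smult_assoc1)
      then show "c \<odot>\<^bsub>A\<^esub> x \<in> ?L" using D(5) c x by simp
    qed auto
    moreover have "H \<subseteq> ?L"
      using B.lspan_base[OF gsc] gs g H(2) by auto
    ultimately have "?L = carrier A" using H(3) by blast
    then show ?thesis using a by blast
  qed
  \<comment> \<open>The induction runs over sublists, while the target stays the full span, as
    multiplication by a may reintroduce all generators.\<close>
  have AW: "a \<odot>\<^bsub>M\<^esub> w \<in> ?W" if a: "a \<in> carrier A" and w: "w \<in> lspan K (base_change M) hs" "set hs \<subseteq> set gs" for a w hs
    using w
  proof (induction hs arbitrary: w)
    case Nil
    then show ?case using D(3) a by (simp add: M.smult_r_null)
  next
    case (Cons h hs)
    then obtain c y where y: "c \<in> carrier K" "y \<in> lspan K (base_change M) hs"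
      "w = (c \<odot>\<^bsub>A\<^esub> \<one>\<^bsub>A\<^esub>) \<odot>\<^bsub>M\<^esub> h \<oplus>\<^bsub>M\<^esub> y" by auto
    have hs: "set hs \<subseteq> carrier (base_change M)" using Cons.prems gsc by auto
    have yc: "y \<in> carrier M" using B.submoduleD(2)[OF B.lspan_submodule[OF hs] y(2)] by simp
    obtain b g where h: "h = b \<odot>\<^bsub>M\<^esub> g" "b \<in> H" "g \<in> G" using Cons.prems(2) gs by auto
    have bg: "b \<in> carrier A" "g \<in> carrier M" using h H(2) G(2) by auto
    have "a \<odot>\<^bsub>M\<^esub> w = (a \<otimes>\<^bsub>A\<^esub> (c \<odot>\<^bsub>A\<^esub> \<one>\<^bsub>A\<^esub>) \<otimes>\<^bsub>A\<^esub> b) \<odot>\<^bsub>M\<^esub> g \<oplus>\<^bsub>M\<^esub> a \<odot>\<^bsub>M\<^esub> y"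
      using a y yc bg h(1) by (simp add: M.smult_r_distr M.smult_assoc1 M.smult_closed A.m_assoc)
    moreover have "a \<odot>\<^bsub>M\<^esub> y \<in> ?W" using Cons y(2) by simp
    moreover have "(a \<otimes>\<^bsub>A\<^esub> (c \<odot>\<^bsub>A\<^esub> \<one>\<^bsub>A\<^esub>) \<otimes>\<^bsub>A\<^esub> b) \<odot>\<^bsub>M\<^esub> g \<in> ?W"
      using AG a y(1) bg h(3) by simp
    ultimately show ?case using D(4) by simp
  qed
  have "submodule ?W A M"
    by (rule M.submoduleI) (use D AW[of _ _ gs] in auto)
  moreover have "g \<in> ?W" if "g \<in> G" for g
    using AG[OF A.one_closed that] M.smult_one[of g] G(2) that by auto
  ultimately have "?W = carrier M" using G(3)[of ?W] by blast
  then show ?thesis using gsc by auto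
qed

lemma ex_rank:
  assumes M: "fgm A M"
  shows "\<exists>(\<rho> :: 'x set \<Rightarrow> nat) d. (\<forall>L. \<rho> L \<le> d) \<and>
    (\<forall>L L'. submodule L A M \<longrightarrow> submodule L' A M \<longrightarrow> L \<subset> L' \<longrightarrow> \<rho> L < \<rho> L')"
proof -
  have M': "left_module A M" using M by (simp add: fgm_def)
  interpret B: left_module K "base_change M" by (rule left_module_base_change[OF M'])
  obtain gs where gs: "set gs \<subseteq> carrier M" "lspan K (base_change M) gs = carrier M"
    using fgm_spanned[OF M] by blast
  let ?r = "\<lambda>L. pivots K (base_change M) L gs"
  have "?r L < ?r L'" if L: "submodule L A M" "submodule L' A M" "L \<subset> L'" for L L'
  proof -
    have "?r L \<noteq> ?r L'"
    proof
      assume "?r L = ?r L'"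
      from pivots_eq[OF K.field_axioms B.left_module_axioms submodule_base_change[OF M' L(1)]
          submodule_base_change[OF M' L(2)] _ _ this]
      have "L' \<inter> carrier M \<subseteq> L" using L(3) gs by auto
      then show False using L left_module.submoduleD(1)[OF M' L(2)] by blast
    qed
    moreover have "?r L \<le> ?r L'" using B.pivots_mono L(3) by blast
    ultimately show ?thesis by simp
  qed
  then show ?thesis
    using B.pivots_le[of _ gs] by (intro exI[of _ ?r] exI[of _ "length gs"] conjI allI impI)
qed

text \<open>Among the submodules generated by finite subsets of L, one of maximal rank must be L:
  adding a further element of L would raise the rank.\<close>

lemma fgm_submodule:
  fixes M :: "('a, 'x) module"
  assumes M: "fgm A M" and L: "submodule L A M"
  shows "fgm A (M\<lparr>carrier := L\<rparr>)"
proof -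
  have M': "left_module A M" using M by (simp add: fgm_def)
  interpret M: left_module A M by fact
  obtain \<rho> :: "'x set \<Rightarrow> nat" and d where r: "\<And>L. \<rho> L \<le> d"
    "\<And>L L'. submodule L A M \<Longrightarrow> submodule L' A M \<Longrightarrow> L \<subset> L' \<Longrightarrow> \<rho> L < \<rho> L'"
    using ex_rank[OF M] by blast
  define h where "h G = \<Inter>{N. submodule N A M \<and> G \<subseteq> N}" for G
  have hsub: "submodule (h G) A M" if "G \<subseteq> carrier M" for G
    unfolding h_def M.submodule_iff using that M.submodule_carrier[unfolded M.submodule_iff] by blast
  have hL: "h G \<subseteq> L" if "G \<subseteq> L" for G unfolding h_def using that L by blast
  have hG: "G \<subseteq> h G" for G unfolding h_def by blast
  have Lc: "L \<subseteq> carrier M" using M.submoduleD(1)[OF L] .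
  let ?P = "\<lambda>n. \<exists>G. finite G \<and> G \<subseteq> L \<and> \<rho> (h G) = n"
  have "?P (\<rho> (h {}))" by blast
  then have "?P (Greatest ?P)" by (rule GreatestI_nat[where b = d]) (use r in auto)
  then obtain G where G: "finite G" "G \<subseteq> L" "\<rho> (h G) = Greatest ?P" by blast
  have max: "\<rho> (h G') \<le> \<rho> (h G)" if "finite G'" "G' \<subseteq> L" for G'
    unfolding G(3) by (rule Greatest_le_nat[where b = d]) (use that r in auto)
  have "h G = L"
  proof (rule ccontr)
    assume "h G \<noteq> L"
    then obtain x where x: "x \<in> L" "x \<notin> h G" using hL[OF G(2)] by blast
    have "h G \<subset> h (insert x G)" using hG[of "insert x G"] x unfolding h_def by blast
    then have "\<rho> (h G) < \<rho> (h (insert x G))"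
      using r(2) hsub[of G] hsub[of "insert x G"] G(2) x(1) Lc by blast
    then show False using max[of "insert x G"] G x by simp
  qed
  have lm: "left_module A (M\<lparr>carrier := L\<rparr>)" by (rule M.left_module_sub[OF L])
  have "N = L" if "submodule N A (M\<lparr>carrier := L\<rparr>)" "G \<subseteq> N" for N
    using that \<open>h G = L\<close> unfolding M.submodule_sub_iff[OF L] h_def by blast
  then show ?thesis
    unfolding fgm_def finitely_generated_iff[OF lm] using lm G(1,2) by auto
qed

end

section \<open>The exact structure on isomorphism classes of modules\<close>

definition prod_module :: "('a, 'x) module \<Rightarrow> ('a, 'y) module \<Rightarrow> ('a, 'x \<times> 'y) module" where
  "prod_module M N = \<lparr> carrier = carrier M \<times> carrier N, mult = undefined, one = undefined,
     zero = (\<zero>\<^bsub>M\<^esub>, \<zero>\<^bsub>N\<^esub>), add = (\<lambda>u v. (fst u \<oplus>\<^bsub>M\<^esub> fst v, snd u \<oplus>\<^bsub>N\<^esub> snd v)),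
     smult = (\<lambda>a u. (a \<odot>\<^bsub>M\<^esub> fst u, a \<odot>\<^bsub>N\<^esub> snd u)) \<rparr>"

lemma prod_module_simps [simp]:
  "carrier (prod_module M N) = carrier M \<times> carrier N" "\<zero>\<^bsub>prod_module M N\<^esub> = (\<zero>\<^bsub>M\<^esub>, \<zero>\<^bsub>N\<^esub>)"
  "u \<oplus>\<^bsub>prod_module M N\<^esub> v = (fst u \<oplus>\<^bsub>M\<^esub> fst v, snd u \<oplus>\<^bsub>N\<^esub> snd v)"
  "a \<odot>\<^bsub>prod_module M N\<^esub> u = (a \<odot>\<^bsub>M\<^esub> fst u, a \<odot>\<^bsub>N\<^esub> snd u)"
  by (simp_all add: prod_module_def)

lemma prod_left_module:
  assumes M: "left_module R M" and N: "left_module R N"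
  shows "left_module R (prod_module M N)"
proof -
  interpret M: left_module R M by fact
  interpret N: left_module R N by fact
  have "abelian_group (prod_module M N)"
  proof (rule abelian_groupI)
    fix x assume "x \<in> carrier (prod_module M N)"
    then show "\<exists>y\<in>carrier (prod_module M N). y \<oplus>\<^bsub>prod_module M N\<^esub> x = \<zero>\<^bsub>prod_module M N\<^esub>"
      by (intro bexI[of _ "(\<ominus>\<^bsub>M\<^esub> fst x, \<ominus>\<^bsub>N\<^esub> snd x)"]) (auto simp: M.M.l_neg N.M.l_neg)
  qed (auto simp: M.M.add.m_ac N.M.add.m_ac)
  then show ?thesis
    by (intro left_module.intro left_module_axioms.intro M.R.ring_axioms)
      (auto simp: M.smult_closed M.smult_l_distr M.smult_r_distr M.smult_assoc1 M.smult_one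
        N.smult_closed N.smult_l_distr N.smult_r_distr N.smult_assoc1 N.smult_one)
qed

lemma lin_fst: "lin R (prod_module M N) M fst" and lin_snd: "lin R (prod_module M N) N snd"
  by (auto intro!: linI)

lemma prod_fgm:
  assumes M: "fgm R M" and N: "fgm R N"
  shows "fgm R (prod_module M N)"
proof -
  have M': "left_module R M" and N': "left_module R N" using M N by (auto simp: fgm_def)
  interpret M: left_module R M by fact
  interpret N: left_module R N by fact
  interpret P: left_module R "prod_module M N" by (rule prod_left_module[OF M' N'])
  obtain G where G: "finite G" "G \<subseteq> carrier M" "\<And>L. submodule L R M \<Longrightarrow> G \<subseteq> L \<Longrightarrow> L = carrier M"
    using M finitely_generated_iff[OF M'] unfolding fgm_def by blast
  obtain H where H: "finite H" "H \<subseteq> carrier N" "\<And>L. submodule L R N \<Longrightarrow> H \<subseteq> L \<Longrightarrow> L = carrier N"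
    using N finitely_generated_iff[OF N'] unfolding fgm_def by blast
  let ?G = "(\<lambda>g. (g, \<zero>\<^bsub>N\<^esub>)) ` G \<union> (\<lambda>h. (\<zero>\<^bsub>M\<^esub>, h)) ` H"
  have "L = carrier (prod_module M N)" if L: "submodule L R (prod_module M N)" "?G \<subseteq> L" for L
  proof -
    have i1: "lin R M (prod_module M N) (\<lambda>x. (x, \<zero>\<^bsub>N\<^esub>))"
      by (auto intro!: linI simp: N.smult_r_null)
    have i2: "lin R N (prod_module M N) (\<lambda>x. (\<zero>\<^bsub>M\<^esub>, x))"
      by (auto intro!: linI simp: M.smult_r_null)
    have 1: "{x \<in> carrier M. (x, \<zero>\<^bsub>N\<^esub>) \<in> L} = carrier M"
      by (rule G(3)[OF vimage_submodule[OF M' P.left_module_axioms i1 L(1)]]) (use G(2) L(2) in auto)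
    have 2: "{x \<in> carrier N. (\<zero>\<^bsub>M\<^esub>, x) \<in> L} = carrier N"
      by (rule H(3)[OF vimage_submodule[OF N' P.left_module_axioms i2 L(1)]]) (use H(2) L(2) in auto)
    have "(x, y) \<in> L" if "x \<in> carrier M" "y \<in> carrier N" for x y
    proof -
      have "(x, \<zero>\<^bsub>N\<^esub>) \<in> L" "(\<zero>\<^bsub>M\<^esub>, y) \<in> L" using 1 2 that by blast+
      then show ?thesis using P.submoduleD(4)[OF L(1)] that by fastforce
    qed
    then show ?thesis using P.submoduleD(1)[OF L(1)] by auto
  qed
  moreover have "finite ?G" "?G \<subseteq> carrier (prod_module M N)" using G H by auto
  ultimately show ?thesis
    unfolding fgm_def finitely_generated_iff[OF P.left_module_axioms] using P.left_module_axioms by blast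
qed

section \<open>Isomorphism classes and the sequences between them\<close>

context fin_dim_algebra
begin

text \<open>The set of all copies on the universe type. It is defined for modules on any carrier
  type, so that subsets, cosets and pairs can be compared by equality.\<close>

definition cl :: "('a, 'x) module \<Rightarrow> ('a, nat \<Rightarrow> 'k) module set" where
  "cl M = {N \<in> mod_objects A. isomorphic_modules A M N}"

definition objs :: "('a, nat \<Rightarrow> 'k) module set set" where
  "objs = cl ` mod_objects A"

definition seq :: "('a, nat \<Rightarrow> 'k) module set \<Rightarrow> ('a, nat \<Rightarrow> 'k) module set \<Rightarrow> ('a, nat \<Rightarrow> 'k) module set \<Rightarrow> bool" where
  "seq a b c \<longleftrightarrow> (\<exists>M \<in> mod_objects A. \<exists>L. submodule L A M \<and> a = cl (M\<lparr>carrier := L\<rparr>) \<and>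
     b = cl M \<and> c = cl (quotient_module M L))"

lemma mod_objects_iff: "M \<in> mod_objects A \<longleftrightarrow> fgm A M"
  by (simp add: mod_objects_def fgm_def)

lemma fgmD: "fgm A M \<Longrightarrow> left_module A M"
  by (simp add: fgm_def)

text \<open>By \<open>mod_universe\<close> the class is nonempty, so equal classes share a member
  through which an isomorphism passes.\<close>

lemma cl_eq_iff:
  assumes M: "fgm A M" and N: "fgm A N"
  shows "cl M = cl N \<longleftrightarrow> isomorphic_modules A M N"
proof
  note M' = fgmD[OF M] and N' = fgmD[OF N]
  assume e: "cl M = cl N"
  obtain Y where Y: "Y \<in> mod_objects A" "isomorphic_modules A M Y"
    using mod_universe[OF fin_dim_algebra_axioms] M unfolding fgm_def by blast
  then have "Y \<in> cl N" using e unfolding cl_def by blast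
  then have NY: "isomorphic_modules A N Y" unfolding cl_def by blast
  have Y': "left_module A Y" using Y(1) mod_objects_iff fgmD by blast
  show "isomorphic_modules A M N" using iso_trans[OF M' Y' Y(2) iso_sym[OF N' Y' NY]] .
next
  note M' = fgmD[OF M] and N' = fgmD[OF N]
  assume i: "isomorphic_modules A M N"
  show "cl M = cl N"
    unfolding cl_def
  proof (intro Collect_cong conj_cong refl)
    fix Y assume "Y \<in> mod_objects A"
    then have Y': "left_module A Y" using mod_objects_iff fgmD by blast
    show "isomorphic_modules A M Y \<longleftrightarrow> isomorphic_modules A N Y"
      using iso_trans[OF M' N' i] iso_trans[OF N' M' iso_sym[OF M' N' i]] by blast
  qed
qed

lemma cl_in_objs:
  assumes M: "fgm A M"
  shows "\<exists>X \<in> mod_objects A. cl X = cl M"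
proof -
  obtain Y where Y: "Y \<in> mod_objects A" "isomorphic_modules A M Y"
    using mod_universe[OF fin_dim_algebra_axioms] M unfolding fgm_def by blast
  then show ?thesis using cl_eq_iff[OF M] mod_objects_iff by metis
qed

lemma cl_objs: "fgm A M \<Longrightarrow> cl M \<in> objs"
  using cl_in_objs unfolding objs_def by (metis image_eqI)

lemma objsE: "a \<in> objs \<Longrightarrow> \<exists>X. fgm A X \<and> X \<in> mod_objects A \<and> a = cl X"
  unfolding objs_def using mod_objects_iff by blast

lemma transport_sub_quot:
  assumes M: "fgm A M" and N: "fgm A N" and f: "lin A M N f" "bij_betw f (carrier M) (carrier N)"
    and L: "submodule L A M"
  shows "submodule (f ` L) A N" "cl (M\<lparr>carrier := L\<rparr>) = cl (N\<lparr>carrier := f ` L\<rparr>)"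
    "cl (quotient_module M L) = cl (quotient_module N (f ` L))"
proof -
  note M' = fgmD[OF M] and N' = fgmD[OF N]
  interpret M: submodule_of A M L by (rule submodule_ofI[OF M' L])
  have inj: "inj_on f (carrier M)" and im: "f ` carrier M = carrier N" using f(2) by (auto simp: bij_betw_def)
  have Lc: "L \<subseteq> carrier M" by (rule M.submoduleD(1)[OF L])
  show fL: "submodule (f ` L) A N" by (rule image_submodule[OF M' N' f(1) L])
  interpret N: submodule_of A N "f ` L" by (rule submodule_ofI[OF N' fL])
  have "isomorphic_modules A (M\<lparr>carrier := L\<rparr>) (N\<lparr>carrier := f ` L\<rparr>)"
    using iso_image[OF M.left_module_sub[OF L] lin_sub[OF f(1) Lc]] inj_on_subset[OF inj Lc] by simp
  then show "cl (M\<lparr>carrier := L\<rparr>) = cl (N\<lparr>carrier := f ` L\<rparr>)"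
    using cl_eq_iff fgm_submodule[OF M L] fgm_submodule[OF N fL] by blast
  have "isomorphic_modules A (quotient_module M L) (quotient_module N (f ` L))"
  proof (rule iso_of_surjections[OF M' M.quotient_left_module N.quotient_left_module M.proj_lin _
        lin_comp[OF f(1) N.proj_lin]])
    show "proj M L ` carrier M = carrier (quotient_module M L)" by (simp add: M.quotient_simps)
    show "(\<lambda>x. proj N (f ` L) (f x)) ` carrier M = carrier (quotient_module N (f ` L))"
      unfolding N.quotient_simps im[symmetric] by (simp add: image_image)
    have "ker M (quotient_module N (f ` L)) (\<lambda>x. proj N (f ` L) (f x)) = {x \<in> carrier M. f x \<in> f ` L}"
      using N.proj_ker linD(1)[OF f(1)] unfolding ker_def by blast
    also have "\<dots> = L" using inj Lc by (auto simp: inj_on_def)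
    finally show "ker M (quotient_module M L) (proj M L) =
        ker M (quotient_module N (f ` L)) (\<lambda>x. proj N (f ` L) (f x))"
      by (simp add: M.proj_ker)
  qed
  then show "cl (quotient_module M L) = cl (quotient_module N (f ` L))"
    using cl_eq_iff fgm_quotient[OF M L] fgm_quotient[OF N fL] by blast
qed

text \<open>An isomorphism of middle terms carries submodules and quotients along, so the sequence
  can be realized in any chosen representative of the middle term, on any carrier type.\<close>

lemma seq_iff:
  assumes M: "fgm A M"
  shows "seq a (cl M) c \<longleftrightarrow>
    (\<exists>L. submodule L A M \<and> a = cl (M\<lparr>carrier := L\<rparr>) \<and> c = cl (quotient_module M L))"
proof
  assume "seq a (cl M) c"
  then obtain N L where N0: "N \<in> mod_objects A" and L: "submodule L A N" "a = cl (N\<lparr>carrier := L\<rparr>)"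
    "cl M = cl N" "c = cl (quotient_module N L)" unfolding seq_def by blast
  then have N: "fgm A N" using mod_objects_iff by blast
  obtain f where "lin A N M f" "bij_betw f (carrier N) (carrier M)"
    using L(3)[symmetric] cl_eq_iff[OF N M] isomorphic_iff[OF fgmD[OF N]] by blast
  from transport_sub_quot[OF N M this L(1)] L
  show "\<exists>L. submodule L A M \<and> a = cl (M\<lparr>carrier := L\<rparr>) \<and> c = cl (quotient_module M L)" by metis
next
  assume "\<exists>L. submodule L A M \<and> a = cl (M\<lparr>carrier := L\<rparr>) \<and> c = cl (quotient_module M L)"
  then obtain L where L: "submodule L A M" "a = cl (M\<lparr>carrier := L\<rparr>)" "c = cl (quotient_module M L)" by blast
  obtain N where N: "N \<in> mod_objects A" "cl N = cl M" using cl_in_objs[OF M] by blast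
  then have N': "fgm A N" using mod_objects_iff by blast
  obtain f where "lin A M N f" "bij_betw f (carrier M) (carrier N)"
    using N(2) cl_eq_iff[OF M N'] isomorphic_iff[OF fgmD[OF M]] by metis
  from transport_sub_quot[OF M N' this L(1)] L N
  show "seq a (cl M) c" unfolding seq_def by metis
qed

lemma seqI: "fgm A M \<Longrightarrow> submodule L A M \<Longrightarrow> seq (cl (M\<lparr>carrier := L\<rparr>)) (cl M) (cl (quotient_module M L))"
  using seq_iff by blast

lemma seq_surj:
  assumes M: "fgm A M" and N: "left_module A N" and f: "lin A M N f" "f ` carrier M = carrier N"
  shows "seq (cl (M\<lparr>carrier := ker M N f\<rparr>)) (cl M) (cl N)"
proof -
  have k: "submodule (ker M N f) A M" by (rule ker_submodule[OF fgmD[OF M] N f(1)])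
  have "cl (quotient_module M (ker M N f)) = cl N"
    using quotient_iso[OF fgmD[OF M] N f] cl_eq_iff[OF fgm_quotient[OF M k] fgm_image[OF M N f]] by blast
  then show ?thesis using seqI[OF M k] by simp
qed

lemma cl_surjections:
  assumes M: "fgm A M" and N: "left_module A N" and P: "left_module A P"
    and f: "lin A M N f" "f ` carrier M = carrier N" and g: "lin A M P g" "g ` carrier M = carrier P"
    and k: "ker M N f = ker M P g"
  shows "cl N = cl P"
  using cl_eq_iff[OF fgm_image[OF M N f] fgm_image[OF M P g]] iso_of_surjections[OF fgmD[OF M] N P f g k] by blast

text \<open>The induced map from M/L2 to M/L has kernel the image of L, which is L/L2.\<close>

lemma third_iso:
  assumes M: "fgm A M" and L: "submodule L A M" and L2: "submodule L2 A M" "L2 \<subseteq> L"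
  shows "seq (cl (quotient_module (M\<lparr>carrier := L\<rparr>) L2)) (cl (quotient_module M L2)) (cl (quotient_module M L))"
proof -
  note M' = fgmD[OF M]
  interpret L: submodule_of A M L by (rule submodule_ofI[OF M' L])
  interpret L2: submodule_of A M L2 by (rule submodule_ofI[OF M' L2(1)])
  let ?Q = "quotient_module M L" and ?Q2 = "quotient_module M L2" and ?S = "M\<lparr>carrier := L\<rparr>"
  have L2': "submodule L2 A ?S" using L.submodule_sub_iff[OF L] L2 by blast
  have S: "fgm A ?S" by (rule fgm_submodule[OF M L])
  interpret S: submodule_of A ?S L2 by (rule submodule_ofI[OF fgmD[OF S] L2'])
  have im2: "proj M L2 ` carrier M = carrier ?Q2" by (simp add: L2.quotient_simps)
  have "ker M ?Q2 (proj M L2) \<subseteq> ker M ?Q (proj M L)" using L2(2) by (simp add: L.proj_ker L2.proj_ker)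
  from lin_factor[OF M' L2.quotient_left_module L.quotient_left_module L2.proj_lin im2 L.proj_lin this]
  obtain h where h: "lin A ?Q2 ?Q h" "\<And>x. x \<in> carrier M \<Longrightarrow> h (proj M L2 x) = proj M L x" by blast
  have Q2: "fgm A ?Q2" by (rule fgm_quotient[OF M L2(1)])
  have hs: "h ` carrier ?Q2 = carrier ?Q"
    unfolding im2[symmetric] L.quotient_simps by (simp add: image_image h(2))
  have k: "ker ?Q2 ?Q h = proj M L2 ` L"
  proof -
    have "proj M L x = L \<longleftrightarrow> x \<in> L" if "x \<in> carrier M" for x
      using L.proj_ker that unfolding ker_def L.quotient_simps by blast
    then have "ker ?Q2 ?Q h = {proj M L2 x | x. x \<in> carrier M \<and> x \<in> L}"
      unfolding ker_def L2.quotient_simps L.quotient_simps using h(2) by auto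
    then show ?thesis using L.submoduleD(1)[OF L] by auto
  qed
  have kS: "submodule (ker ?Q2 ?Q h) A ?Q2"
    by (rule ker_submodule[OF L2.quotient_left_module L.quotient_left_module h(1)])
  have "cl (quotient_module ?S L2) = cl (?Q2\<lparr>carrier := ker ?Q2 ?Q h\<rparr>)"
  proof (rule cl_surjections[OF S S.quotient_left_module _ S.proj_lin])
    show "left_module A (?Q2\<lparr>carrier := ker ?Q2 ?Q h\<rparr>)"
      by (rule left_module.left_module_sub[OF L2.quotient_left_module kS])
    show "proj ?S L2 ` carrier ?S = carrier (quotient_module ?S L2)" by (simp only: S.quotient_simps)
    show "lin A ?S (?Q2\<lparr>carrier := ker ?Q2 ?Q h\<rparr>) (proj M L2)"
      by (rule lin_restrict_target[OF lin_sub[OF L2.proj_lin L.submoduleD(1)[OF L]]]) (simp add: k)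
    show "proj M L2 ` carrier ?S = carrier (?Q2\<lparr>carrier := ker ?Q2 ?Q h\<rparr>)" by (simp add: k)
    have "ker ?S (?Q2\<lparr>carrier := ker ?Q2 ?Q h\<rparr>) (proj M L2) = L \<inter> ker M ?Q2 (proj M L2)"
      unfolding ker_def using L.submoduleD(1)[OF L] by auto
    then show "ker ?S (quotient_module ?S L2) (proj ?S L2) = ker ?S (?Q2\<lparr>carrier := ker ?Q2 ?Q h\<rparr>) (proj M L2)"
      using L2(2) by (auto simp: S.proj_ker L2.proj_ker)
  qed
  then show ?thesis using seq_surj[OF Q2 L.quotient_left_module h(1) hs] by simp
qed

end

definition zero_module :: "('a, nat \<Rightarrow> 'k) module" where
  "zero_module = \<lparr> carrier = {undefined}, mult = undefined, one = undefined, zero = undefined,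
     add = (\<lambda>_ _. undefined), smult = (\<lambda>_ _. undefined) \<rparr>"

context fin_dim_algebra
begin

abbreviation "Zcl \<equiv> cl (zero_module :: ('a, nat \<Rightarrow> 'k) module)"

lemma fgm_zero_module: "fgm A (zero_module :: ('a, nat \<Rightarrow> 'k) module)"
proof -
  let ?Z = "zero_module :: ('a, nat \<Rightarrow> 'k) module"
  have "abelian_group ?Z" by (rule abelian_groupI) (auto simp: zero_module_def)
  then have lm: "left_module A ?Z"
    by (intro left_module.intro left_module_axioms.intro A.ring_axioms) (auto simp: zero_module_def)
  have "L = carrier ?Z" if "submodule L A ?Z" for L
    using left_module.submoduleD(1,3)[OF lm that] by (auto simp: zero_module_def)
  then show ?thesis unfolding fgm_def finitely_generated_iff[OF lm] using lm by blast
qed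

lemma cl_zero_iff:
  assumes M: "fgm A M"
  shows "cl M = Zcl \<longleftrightarrow> carrier M = {\<zero>\<^bsub>M\<^esub>}"
proof -
  let ?Z = "zero_module :: ('a, nat \<Rightarrow> 'k) module"
  interpret M: left_module A M by (rule fgmD[OF M])
  have "cl M = Zcl \<longleftrightarrow> isomorphic_modules A M ?Z" by (rule cl_eq_iff[OF M fgm_zero_module])
  also have "\<dots> \<longleftrightarrow> carrier M = {\<zero>\<^bsub>M\<^esub>}"
  proof
    assume "isomorphic_modules A M ?Z"
    then obtain f where "bij_betw f (carrier M) (carrier ?Z)" using isomorphic_iff[OF fgmD[OF M]] by blast
    then have f: "bij_betw f (carrier M) {undefined}" by (simp add: zero_module_def)
    have "x = \<zero>\<^bsub>M\<^esub>" if "x \<in> carrier M" for x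
    proof -
      have "f ` carrier M = {undefined}" using f unfolding bij_betw_def by blast
      then have "f x = undefined" "f \<zero>\<^bsub>M\<^esub> = undefined" using that M.M.zero_closed by blast+
      then have "f x = f \<zero>\<^bsub>M\<^esub>" by simp
      then show ?thesis using f that M.M.zero_closed unfolding bij_betw_def by (meson inj_onD)
    qed
    then show "carrier M = {\<zero>\<^bsub>M\<^esub>}" using M.M.zero_closed by blast
  next
    assume c: "carrier M = {\<zero>\<^bsub>M\<^esub>}"
    show "isomorphic_modules A M ?Z"
      by (rule isoI[OF fgmD[OF M], of _ "\<lambda>_. undefined"])
        (use c in \<open>auto simp: lin_def zero_module_def\<close>)
  qed
  finally show ?thesis .
qed

lemma cl_sub_zero: "fgm A M \<Longrightarrow> submodule L A M \<Longrightarrow> cl (M\<lparr>carrier := L\<rparr>) = Zcl \<longleftrightarrow> L = {\<zero>\<^bsub>M\<^esub>}"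
  using cl_zero_iff[OF fgm_submodule] by simp

lemma cl_quot_zero:
  assumes M: "fgm A M" and L: "submodule L A M"
  shows "cl (quotient_module M L) = Zcl \<longleftrightarrow> L = carrier M"
proof -
  interpret submodule_of A M L by (rule submodule_ofI[OF fgmD[OF M] L])
  have "cl (quotient_module M L) = Zcl \<longleftrightarrow> proj M L ` carrier M = {L}"
    using cl_zero_iff[OF fgm_quotient[OF M L]] by (simp only: quotient_simps)
  also have "\<dots> \<longleftrightarrow> (\<forall>x\<in>carrier M. proj M L x = L)"
  proof
    show "\<forall>x\<in>carrier M. proj M L x = L" if "proj M L ` carrier M = {L}"
      using imageI[of _ "carrier M" "proj M L"] unfolding that by simp
    show "proj M L ` carrier M = {L}" if "\<forall>x\<in>carrier M. proj M L x = L"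
      using that M.zero_closed by force
  qed
  also have "\<dots> \<longleftrightarrow> ker M (quotient_module M L) (proj M L) = carrier M"
    unfolding ker_def quotient_simps by blast
  also have "\<dots> \<longleftrightarrow> L = carrier M" by (simp add: proj_ker)
  finally show ?thesis .
qed

lemma cl_sub_whole: "cl (M\<lparr>carrier := carrier M\<rparr>) = cl M"
proof -
  have "M\<lparr>carrier := carrier M\<rparr> = M" by (cases M) simp
  then show ?thesis by (rule arg_cong)
qed

lemma cl_quot_by_zero:
  assumes M: "fgm A M"
  shows "cl (quotient_module M {\<zero>\<^bsub>M\<^esub>}) = cl M"
proof -
  interpret left_module A M by (rule fgmD[OF M])
  interpret submodule_of A M "{\<zero>\<^bsub>M\<^esub>}" by (rule submodule_ofI[OF fgmD[OF M] submodule_zero])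
  show ?thesis
  proof (rule cl_surjections[OF M quotient_left_module fgmD[OF M] proj_lin])
    show "proj M {\<zero>\<^bsub>M\<^esub>} ` carrier M = carrier (quotient_module M {\<zero>\<^bsub>M\<^esub>})" by (simp only: quotient_simps)
    show "lin A M M (\<lambda>x. x)" by (rule linI) simp_all
    show "ker M (quotient_module M {\<zero>\<^bsub>M\<^esub>}) (proj M {\<zero>\<^bsub>M\<^esub>}) = ker M M (\<lambda>x. x)"
      unfolding proj_ker by (auto simp: ker_def)
  qed simp
qed

lemma seq_in: "seq a b c \<Longrightarrow> a \<in> objs \<and> b \<in> objs \<and> c \<in> objs"
  unfolding seq_def using cl_objs[OF fgm_submodule] cl_objs[OF fgm_quotient] cl_objs mod_objects_iff by metis

lemma seqE:
  assumes "seq a b c"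
  obtains M :: "('a, nat \<Rightarrow> 'k) module" and L where "fgm A M" "submodule L A M" "a = cl (M\<lparr>carrier := L\<rparr>)" "b = cl M"
    "c = cl (quotient_module M L)"
  using assms unfolding seq_def mod_objects_iff[symmetric] by (elim bexE exE conjE) blast

text \<open>The new middle term is the preimage in M of the submodule of the quotient.\<close>

lemma seq_quot_lift:
  assumes "seq a b c" "seq c' c c''"
  shows "\<exists>p. seq p b c'' \<and> seq a p c'"
proof -
  obtain M :: "('a, nat \<Rightarrow> 'k) module" and L where M: "fgm A M"
    and L: "submodule L A M" "a = cl (M\<lparr>carrier := L\<rparr>)" "b = cl M" "c = cl (quotient_module M L)"
    by (rule seqE[OF assms(1)])
  interpret L: submodule_of A M L by (rule submodule_ofI[OF fgmD[OF M] L(1)])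
  let ?Q = "quotient_module M L"
  have Q: "fgm A ?Q" by (rule fgm_quotient[OF M L(1)])
  obtain L2 where L2: "submodule L2 A ?Q" "c' = cl (?Q\<lparr>carrier := L2\<rparr>)" "c'' = cl (quotient_module ?Q L2)"
    using assms(2) unfolding L(4) seq_iff[OF Q] by blast
  interpret L2: submodule_of A ?Q L2 by (rule submodule_ofI[OF fgmD[OF Q] L2(1)])
  let ?P = "{x \<in> carrier M. proj M L x \<in> L2}"
  have P: "submodule ?P A M" by (rule vimage_submodule[OF fgmD[OF M] fgmD[OF Q] L.proj_lin L2(1)])
  let ?Q2 = "quotient_module ?Q L2"
  have "seq (cl (M\<lparr>carrier := ker M ?Q2 (\<lambda>x. proj ?Q L2 (proj M L x))\<rparr>)) (cl M) (cl ?Q2)"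
    by (rule seq_surj[OF M L2.quotient_left_module lin_comp[OF L.proj_lin L2.proj_lin]])
      (simp add: L2.quotient_simps L.quotient_simps image_image)
  moreover have "ker M ?Q2 (\<lambda>x. proj ?Q L2 (proj M L x)) = ?P"
  proof -
    have "proj ?Q L2 y = L2 \<longleftrightarrow> y \<in> L2" if "y \<in> carrier ?Q" for y
      using L2.proj_ker that unfolding ker_def L2.quotient_simps by blast
    then show ?thesis unfolding ker_def L2.quotient_simps using linD(1)[OF L.proj_lin] by auto
  qed
  ultimately have 1: "seq (cl (M\<lparr>carrier := ?P\<rparr>)) b c''" using L L2 by simp
  have PM: "fgm A (M\<lparr>carrier := ?P\<rparr>)" by (rule fgm_submodule[OF M P])
  have im: "proj M L ` ?P = L2"
    using L2.submoduleD(1)[OF L2(1)] unfolding L.quotient_simps by blast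
  have "seq (cl (M\<lparr>carrier := ?P\<rparr>\<lparr>carrier := ker (M\<lparr>carrier := ?P\<rparr>) (?Q\<lparr>carrier := L2\<rparr>) (proj M L)\<rparr>))
      (cl (M\<lparr>carrier := ?P\<rparr>)) (cl (?Q\<lparr>carrier := L2\<rparr>))"
  proof (rule seq_surj[OF PM])
    show "left_module A (?Q\<lparr>carrier := L2\<rparr>)" by (rule fgmD[OF fgm_submodule[OF Q L2(1)]])
    show "lin A (M\<lparr>carrier := ?P\<rparr>) (?Q\<lparr>carrier := L2\<rparr>) (proj M L)"
      by (rule lin_restrict_target[OF lin_sub[OF L.proj_lin]]) auto
    show "proj M L ` carrier (M\<lparr>carrier := ?P\<rparr>) = carrier (?Q\<lparr>carrier := L2\<rparr>)" using im by simp
  qed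
  moreover have "ker (M\<lparr>carrier := ?P\<rparr>) (?Q\<lparr>carrier := L2\<rparr>) (proj M L) = L"
  proof -
    have "L \<in> L2" using L2.submoduleD(3)[OF L2(1)] by (simp only: L.quotient_simps)
    then have "ker (M\<lparr>carrier := ?P\<rparr>) (?Q\<lparr>carrier := L2\<rparr>) (proj M L) = ker M ?Q (proj M L)"
      unfolding ker_def L.quotient_simps by (auto simp: L.quotient_simps)
    then show ?thesis by (simp add: L.proj_ker)
  qed
  ultimately have "seq a (cl (M\<lparr>carrier := ?P\<rparr>)) c'" using L L2 by simp
  then show ?thesis using 1 by blast
qed

lemma seq_sub_quot:
  assumes "seq a b c" "seq a' a a''"
  shows "\<exists>r. seq a' b r \<and> seq a'' r c"
proof -
  obtain M :: "('a, nat \<Rightarrow> 'k) module" and L where M: "fgm A M"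
    and L: "submodule L A M" "a = cl (M\<lparr>carrier := L\<rparr>)" "b = cl M" "c = cl (quotient_module M L)"
    by (rule seqE[OF assms(1)])
  interpret M: left_module A M by (rule fgmD[OF M])
  have S: "fgm A (M\<lparr>carrier := L\<rparr>)" by (rule fgm_submodule[OF M L(1)])
  obtain L2 where L2: "submodule L2 A (M\<lparr>carrier := L\<rparr>)" "a' = cl (M\<lparr>carrier := L2\<rparr>)"
    "a'' = cl (quotient_module (M\<lparr>carrier := L\<rparr>) L2)"
    using assms(2) unfolding L(2) seq_iff[OF S] by auto
  have L2': "submodule L2 A M" "L2 \<subseteq> L" using L2(1) M.submodule_sub_iff[OF L(1)] by blast+
  show ?thesis using third_iso[OF M L(1) L2'] seqI[OF M L2'(1)] L L2 by metis
qed

lemma seq_two_subs: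
  assumes "seq a b c" "seq a' b c'"
  shows "\<exists>j i i' d. seq j a' i \<and> seq i c d \<and> seq j a i' \<and> seq i' c' d"
proof -
  obtain M :: "('a, nat \<Rightarrow> 'k) module" and L where M: "fgm A M"
    and L: "submodule L A M" "a = cl (M\<lparr>carrier := L\<rparr>)" "b = cl M" "c = cl (quotient_module M L)"
    by (rule seqE[OF assms(1)])
  obtain L' where L': "submodule L' A M" "a' = cl (M\<lparr>carrier := L'\<rparr>)" "c' = cl (quotient_module M L')"
    using assms(2) unfolding L(3) seq_iff[OF M] by blast
  interpret M: left_module A M by (rule fgmD[OF M])
  \<comment> \<open>Proved for one order of L and L' and used for both. The last component is the
    sum of L and L', described as the kernel of the iterated quotient map.\<close>
  have half: "seq (cl (M\<lparr>carrier := L \<inter> L'\<rparr>)) (cl (M\<lparr>carrier := L'\<rparr>))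
      (cl ((quotient_module M L)\<lparr>carrier := proj M L ` L'\<rparr>)) \<and>
    submodule (proj M L ` L') A (quotient_module M L) \<and>
    (\<lambda>x. proj (quotient_module M L) (proj M L ` L') (proj M L x)) ` carrier M =
      carrier (quotient_module (quotient_module M L) (proj M L ` L')) \<and>
    ker M (quotient_module (quotient_module M L) (proj M L ` L'))
      (\<lambda>x. proj (quotient_module M L) (proj M L ` L') (proj M L x)) =
      {x \<in> carrier M. \<exists>y \<in> L'. x \<ominus>\<^bsub>M\<^esub> y \<in> L}"
    if L: "submodule L A M" and L': "submodule L' A M" for L L'
  proof -
    interpret L: submodule_of A M L by (rule submodule_ofI[OF fgmD[OF M] L])
    let ?Q = "quotient_module M L"
    have Q: "fgm A ?Q" by (rule fgm_quotient[OF M L])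
    note Lc' = M.submoduleD(1)[OF L']
    have im: "submodule (proj M L ` L') A ?Q"
      by (rule image_submodule[OF fgmD[OF M] fgmD[OF Q] L.proj_lin L'])
    interpret I: submodule_of A ?Q "proj M L ` L'" by (rule submodule_ofI[OF fgmD[OF Q] im])
    have "seq (cl (M\<lparr>carrier := L'\<rparr>\<lparr>carrier := ker (M\<lparr>carrier := L'\<rparr>) (?Q\<lparr>carrier := proj M L ` L'\<rparr>) (proj M L)\<rparr>))
      (cl (M\<lparr>carrier := L'\<rparr>)) (cl (?Q\<lparr>carrier := proj M L ` L'\<rparr>))"
    proof (rule seq_surj[OF fgm_submodule[OF M L'] fgmD[OF fgm_submodule[OF Q im]]])
      show "lin A (M\<lparr>carrier := L'\<rparr>) (?Q\<lparr>carrier := proj M L ` L'\<rparr>) (proj M L)"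
        by (rule lin_restrict_target[OF lin_sub[OF L.proj_lin Lc']]) simp
    qed simp
    moreover have "ker (M\<lparr>carrier := L'\<rparr>) (?Q\<lparr>carrier := proj M L ` L'\<rparr>) (proj M L) = L' \<inter> ker M ?Q (proj M L)"
      unfolding ker_def using Lc' by auto
    ultimately have 1: "seq (cl (M\<lparr>carrier := L \<inter> L'\<rparr>)) (cl (M\<lparr>carrier := L'\<rparr>)) (cl (?Q\<lparr>carrier := proj M L ` L'\<rparr>))"
      by (simp add: L.proj_ker Int_commute)
    have "proj ?Q (proj M L ` L') y = proj M L ` L' \<longleftrightarrow> y \<in> proj M L ` L'" if "y \<in> carrier ?Q" for y
      using I.proj_ker that unfolding ker_def I.quotient_simps by blast
    then have "ker M (quotient_module ?Q (proj M L ` L')) (\<lambda>x. proj ?Q (proj M L ` L') (proj M L x)) =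
        {x \<in> carrier M. proj M L x \<in> proj M L ` L'}"
      unfolding ker_def I.quotient_simps using linD(1)[OF L.proj_lin] by auto
    also have "\<dots> = {x \<in> carrier M. \<exists>y \<in> L'. x \<ominus>\<^bsub>M\<^esub> y \<in> L}"
      using L.proj_eq Lc' by (auto simp: image_iff subset_iff)
    finally show ?thesis using 1 im
      by (simp add: I.quotient_simps L.quotient_simps image_image)
  qed
  note h = half[OF L(1) L'(1)] and h' = half[OF L'(1) L(1)]
  let ?Q = "quotient_module M L" and ?Q' = "quotient_module M L'"
  have Q: "fgm A ?Q" "fgm A ?Q'" using fgm_quotient M L L' by blast+
  have k: "{x \<in> carrier M. \<exists>y \<in> L'. x \<ominus>\<^bsub>M\<^esub> y \<in> L} \<subseteq> {x \<in> carrier M. \<exists>y \<in> L. x \<ominus>\<^bsub>M\<^esub> y \<in> L'}"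
    if L: "submodule L A M" and L': "submodule L' A M" for L L'
  proof
    fix x assume "x \<in> {x \<in> carrier M. \<exists>y \<in> L'. x \<ominus>\<^bsub>M\<^esub> y \<in> L}"
    then obtain y where y: "x \<in> carrier M" "y \<in> L'" "x \<ominus>\<^bsub>M\<^esub> y \<in> L" by blast
    have yc: "y \<in> carrier M" using M.submoduleD(2)[OF L' y(2)] .
    have "x \<ominus>\<^bsub>M\<^esub> (x \<ominus>\<^bsub>M\<^esub> y) = x \<oplus>\<^bsub>M\<^esub> (\<ominus>\<^bsub>M\<^esub> x \<oplus>\<^bsub>M\<^esub> y)"
      using y(1) yc by (simp add: a_minus_def M.M.minus_add)
    also have "\<dots> = y" using y(1) yc by (simp add: M.M.r_neg2)
    finally show "x \<in> {x \<in> carrier M. \<exists>y \<in> L. x \<ominus>\<^bsub>M\<^esub> y \<in> L'}"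
      using y by (intro CollectI conjI bexI[of _ "x \<ominus>\<^bsub>M\<^esub> y"]) simp_all
  qed
  have sQ: "submodule (proj M L ` L') A ?Q" "submodule (proj M L' ` L) A ?Q'" using h h' by blast+
  interpret L: submodule_of A M L by (rule submodule_ofI[OF fgmD[OF M] L(1)])
  interpret L': submodule_of A M L' by (rule submodule_ofI[OF fgmD[OF M] L'(1)])
  interpret Q: submodule_of A ?Q "proj M L ` L'" by (rule submodule_ofI[OF fgmD[OF Q(1)] sQ(1)])
  interpret Q': submodule_of A ?Q' "proj M L' ` L" by (rule submodule_ofI[OF fgmD[OF Q(2)] sQ(2)])
  have "cl (quotient_module ?Q (proj M L ` L')) = cl (quotient_module ?Q' (proj M L' ` L))"
  proof (rule cl_surjections[OF M Q.quotient_left_module Q'.quotient_left_module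
        lin_comp[OF L.proj_lin Q.proj_lin] _ lin_comp[OF L'.proj_lin Q'.proj_lin]])
    show "ker M (quotient_module ?Q (proj M L ` L')) (\<lambda>x. proj ?Q (proj M L ` L') (proj M L x)) =
      ker M (quotient_module ?Q' (proj M L' ` L)) (\<lambda>x. proj ?Q' (proj M L' ` L) (proj M L' x))"
      using h h' k[OF L(1) L'(1)] k[OF L'(1) L(1)] by simp
  qed (use h h' in blast)+
  then have d: "seq (cl (?Q'\<lparr>carrier := proj M L' ` L\<rparr>)) (cl ?Q') (cl (quotient_module ?Q (proj M L ` L')))"
    using seqI[OF Q(2) sQ(2)] by simp
  have e: "seq (cl (M\<lparr>carrier := L \<inter> L'\<rparr>)) (cl (M\<lparr>carrier := L\<rparr>)) (cl (?Q'\<lparr>carrier := proj M L' ` L\<rparr>))"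
    using h' by (subst Int_commute) blast
  show ?thesis
    unfolding L(2-4) L'(2,3)
    by (intro exI conjI, rule conjunct1[OF h], rule seqI[OF Q(1) sQ(1)], rule e, rule d)
qed

text \<open>Everything below the class of M is realized by submodules of M, where the rank drops
  strictly. A set that is no class of a module has no predecessor.\<close>

lemma seq_wf_sub: "wfP (\<lambda>k m. \<exists>q. q \<noteq> Zcl \<and> seq k m q)"
proof (rule accp_wfpI, rule allI)
  let ?R = "\<lambda>k m. \<exists>q. q \<noteq> Zcl \<and> seq k m q"
  fix m :: "('a, nat \<Rightarrow> 'k) module set"
  show "Wellfounded.accp ?R m"
  proof (cases "m \<in> objs")
    case False
    show ?thesis
    proof (rule accpI)
      fix k assume "?R k m"
      then have "m \<in> objs" using seq_in by blast
      then show "Wellfounded.accp ?R k" using False by blast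
    qed
  next
    case True
    then obtain M :: "('a, nat \<Rightarrow> 'k) module" where M: "fgm A M" "m = cl M" using objsE by blast
    interpret M: left_module A M by (rule fgmD[OF M(1)])
    obtain \<rho> :: "(nat \<Rightarrow> 'k) set \<Rightarrow> nat" and d where r:
      "\<And>L L'. submodule L A M \<Longrightarrow> submodule L' A M \<Longrightarrow> L \<subset> L' \<Longrightarrow> \<rho> L < \<rho> L'"
      using ex_rank[OF M(1)] by blast
    have "submodule L A M \<Longrightarrow> Wellfounded.accp ?R (cl (M\<lparr>carrier := L\<rparr>))" for L
    proof (induction "\<rho> L" arbitrary: L rule: less_induct)
      case less
      show ?case
      proof (rule accpI)
        fix k assume "?R k (cl (M\<lparr>carrier := L\<rparr>))"
        then obtain q where q: "q \<noteq> Zcl" "seq k (cl (M\<lparr>carrier := L\<rparr>)) q" by blast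
        have S: "fgm A (M\<lparr>carrier := L\<rparr>)" by (rule fgm_submodule[OF M(1) less.prems])
        obtain L' where L': "submodule L' A (M\<lparr>carrier := L\<rparr>)" "k = cl (M\<lparr>carrier := L'\<rparr>)"
          "q = cl (quotient_module (M\<lparr>carrier := L\<rparr>) L')"
          using q(2) unfolding seq_iff[OF S] by auto
        have "L' \<noteq> L" using q(1) L' cl_quot_zero[OF S L'(1)] by auto
        then have "submodule L' A M" "L' \<subset> L" using L'(1) M.submodule_sub_iff[OF less.prems] by blast+
        then show "Wellfounded.accp ?R k" using less.hyps[OF r[OF _ less.prems]] L'(2) by blast
      qed
    qed
    from this[OF M.submodule_carrier] show ?thesis unfolding M(2) cl_sub_whole .
  qed
qed

text \<open>A quotient of M/L is M/P for the preimage P of the kernel. The corank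
  \<open>d - \<rho> L\<close> drops because P strictly contains L.\<close>

lemma seq_wf_quot: "wfP (\<lambda>q m. \<exists>k. k \<noteq> Zcl \<and> seq k m q)"
proof (rule accp_wfpI, rule allI)
  let ?R = "\<lambda>q m. \<exists>k. k \<noteq> Zcl \<and> seq k m q"
  fix m :: "('a, nat \<Rightarrow> 'k) module set"
  show "Wellfounded.accp ?R m"
  proof (cases "m \<in> objs")
    case False
    show ?thesis
    proof (rule accpI)
      fix k assume "?R k m"
      then have "m \<in> objs" using seq_in by blast
      then show "Wellfounded.accp ?R k" using False by blast
    qed
  next
    case True
    then obtain M :: "('a, nat \<Rightarrow> 'k) module" where M: "fgm A M" "m = cl M" using objsE by blast
    interpret M: left_module A M by (rule fgmD[OF M(1)])
    obtain \<rho> :: "(nat \<Rightarrow> 'k) set \<Rightarrow> nat" and d where r: "\<And>L. \<rho> L \<le> d"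
      "\<And>L L'. submodule L A M \<Longrightarrow> submodule L' A M \<Longrightarrow> L \<subset> L' \<Longrightarrow> \<rho> L < \<rho> L'"
      using ex_rank[OF M(1)] by blast
    have "submodule L A M \<Longrightarrow> Wellfounded.accp ?R (cl (quotient_module M L))" for L
    proof (induction "d - \<rho> L" arbitrary: L rule: less_induct)
      case less
      interpret L: submodule_of A M L by (rule submodule_ofI[OF fgmD[OF M(1)] less.prems])
      let ?Q = "quotient_module M L"
      have Q: "fgm A ?Q" by (rule fgm_quotient[OF M(1) less.prems])
      show ?case
      proof (rule accpI)
        fix q assume "?R q (cl ?Q)"
        then obtain k where k: "k \<noteq> Zcl" "seq k (cl ?Q) q" by blast
        obtain L2 where L2: "submodule L2 A ?Q" "k = cl (?Q\<lparr>carrier := L2\<rparr>)" "q = cl (quotient_module ?Q L2)"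
          using k(2) unfolding seq_iff[OF Q] by blast
        interpret L2: submodule_of A ?Q L2 by (rule submodule_ofI[OF fgmD[OF Q] L2(1)])
        let ?P = "{x \<in> carrier M. proj M L x \<in> L2}"
        have P: "submodule ?P A M" by (rule vimage_submodule[OF fgmD[OF M(1)] fgmD[OF Q] L.proj_lin L2(1)])
        interpret P: submodule_of A M ?P by (rule submodule_ofI[OF fgmD[OF M(1)] P])
        have LL2: "L \<in> L2" using L2.submoduleD(3)[OF L2(1)] by (simp only: L.quotient_simps)
        have e: "proj ?Q L2 y = L2 \<longleftrightarrow> y \<in> L2" if "y \<in> carrier ?Q" for y
          using L2.proj_ker that unfolding ker_def L2.quotient_simps by blast
        have "cl (quotient_module ?Q L2) = cl (quotient_module M ?P)"
        proof (rule cl_surjections[OF M(1) L2.quotient_left_module P.quotient_left_module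
              lin_comp[OF L.proj_lin L2.proj_lin] _ P.proj_lin])
          have "(\<lambda>x. proj ?Q L2 (proj M L x)) ` carrier M = proj ?Q L2 ` (proj M L ` carrier M)"
            by (simp only: image_image)
          then show "(\<lambda>x. proj ?Q L2 (proj M L x)) ` carrier M = carrier (quotient_module ?Q L2)"
            by (simp only: L.quotient_simps(1)[symmetric] L2.quotient_simps(1))
          show "proj M ?P ` carrier M = carrier (quotient_module M ?P)" by (simp only: P.quotient_simps)
          have "ker M (quotient_module ?Q L2) (\<lambda>x. proj ?Q L2 (proj M L x)) = ?P"
            unfolding ker_def L2.quotient_simps(2)
            by (intro Collect_cong conj_cong refl e linD(1)[OF L.proj_lin])
          then show "ker M (quotient_module ?Q L2) (\<lambda>x. proj ?Q L2 (proj M L x)) =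
            ker M (quotient_module M ?P) (proj M ?P)" by (simp only: P.proj_ker)
        qed
        then have qP: "q = cl (quotient_module M ?P)" by (simp only: L2(3))
        have pL: "proj M L x = L \<longleftrightarrow> x \<in> L" if "x \<in> carrier M" for x
          using L.proj_ker that unfolding ker_def L.quotient_simps by blast
        have "L \<subseteq> ?P"
        proof
          fix x assume x: "x \<in> L"
          have xc: "x \<in> carrier M" by (rule M.submoduleD(2)[OF less.prems x])
          have "proj M L x = L" using pL[OF xc] x by blast
          then have "proj M L x \<in> L2" using LL2 by (simp only:)
          then show "x \<in> ?P" using xc by blast
        qed
        moreover have "L \<noteq> ?P"
        proof
          assume e: "L = ?P"
          have "L2 \<subseteq> {L}"
          proof
            fix y assume y: "y \<in> L2"
            then obtain x where x: "x \<in> carrier M" "y = proj M L x"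
              using L2.submoduleD(2)[OF L2(1) y] unfolding L.quotient_simps by blast
            then have "x \<in> ?P" using y by blast
            then have "x \<in> L" by (rule subst[OF e[symmetric], of "\<lambda>s. x \<in> s"])
            then show "y \<in> {L}" using pL[OF x(1)] x(2) by blast
          qed
          then have "L2 = {L}" using LL2 by blast
          then have "L2 = {\<zero>\<^bsub>?Q\<^esub>}" by (simp only: L.quotient_simps(2))
          then have "cl (?Q\<lparr>carrier := L2\<rparr>) = Zcl" using cl_sub_zero[OF Q L2(1)] by blast
          then show False using k(1) L2(2) by (simp only:)
        qed
        ultimately have "\<rho> L < \<rho> ?P" using r(2)[OF less.prems P] by blast
        then have "d - \<rho> ?P < d - \<rho> L" using r(1)[of ?P] by linarith
        then show "Wellfounded.accp ?R q" using less.hyps[OF _ P] unfolding qP by blast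
      qed
    qed
    from this[OF M.submodule_zero] show ?thesis using M(2) cl_quot_by_zero[OF M(1)] by simp
  qed
qed

end

section \<open>Fibre products and amalgamated sums\<close>

context fin_dim_algebra
begin

lemma cl_quotient:
  assumes M: "fgm A M" and N: "left_module A N" and f: "lin A M N f" "f ` carrier M = carrier N"
    and k: "ker M N f = L"
  shows "cl (quotient_module M L) = cl N"
proof -
  have s: "submodule L A M" using ker_submodule[OF fgmD[OF M] N f(1)] k by simp
  show ?thesis
    using quotient_iso[OF fgmD[OF M] N f] cl_eq_iff[OF fgm_quotient[OF M s] fgm_image[OF M N f]] k by simp
qed

lemma cl_isoI:
  assumes M: "fgm A M" and N: "fgm A N" and f: "lin A M N f" "inj_on f (carrier M)" "f ` carrier M = carrier N"
  shows "cl M = cl N"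
  using cl_eq_iff[OF M N] isoI[OF fgmD[OF M] f] by blast

text \<open>One side of a fibre product P: the kernel of the projection p is identified with L by
  the other projection q.\<close>

lemma pullback_half:
  assumes P: "fgm A P" and Y: "left_module A Y" and X: "fgm A X"
    and p: "lin A P Y p" "p ` carrier P = carrier Y" and q: "lin A P X q"
    and qk: "inj_on q (ker P Y p)" "q ` ker P Y p = L" and L: "submodule L A X"
  shows "seq (cl (X\<lparr>carrier := L\<rparr>)) (cl P) (cl Y)"
proof -
  have k: "submodule (ker P Y p) A P" by (rule ker_submodule[OF fgmD[OF P] Y p(1)])
  have kc: "ker P Y p \<subseteq> carrier P" unfolding ker_def by blast
  have "cl (P\<lparr>carrier := ker P Y p\<rparr>) = cl (X\<lparr>carrier := L\<rparr>)"
  proof (rule cl_isoI[OF fgm_submodule[OF P k] fgm_submodule[OF X L]])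
    show "lin A (P\<lparr>carrier := ker P Y p\<rparr>) (X\<lparr>carrier := L\<rparr>) q"
      by (rule lin_restrict_target[OF lin_sub[OF q kc]]) (simp add: qk)
  qed (simp_all add: qk)
  then show ?thesis using seq_surj[OF P Y p] by simp
qed

lemma pushout_half:
  assumes W: "fgm A W" and S: "submodule S A W" and N: "submodule N A W" "N \<subseteq> S"
    and V: "left_module A V" and h: "lin A (W\<lparr>carrier := S\<rparr>) V h" "h ` S = carrier V"
      "ker (W\<lparr>carrier := S\<rparr>) V h = N"
    and Q: "left_module A Q" and k: "lin A W Q k" "k ` carrier W = carrier Q" "ker W Q k = S"
  shows "seq (cl V) (cl (quotient_module W N)) (cl Q)"
proof -
  have "cl (quotient_module (W\<lparr>carrier := S\<rparr>) N) = cl V"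
    by (rule cl_quotient[OF fgm_submodule[OF W S] V h(1) _ h(3)]) (simp add: h(2))
  moreover have "cl (quotient_module W S) = cl Q" by (rule cl_quotient[OF W Q k])
  ultimately show ?thesis using third_iso[OF W S N] by simp
qed

text \<open>The fibre product of X and Y over their common quotient; the kernels of its projections
  are copies of L1 and L2.\<close>

lemma seq_common_quot:
  assumes "seq a g q" "seq b v q"
  shows "\<exists>p. seq a p v \<and> seq b p g"
proof -
  obtain X :: "('a, nat \<Rightarrow> 'k) module" and L1 where X: "fgm A X"
    and L1: "submodule L1 A X" "a = cl (X\<lparr>carrier := L1\<rparr>)" "g = cl X" "q = cl (quotient_module X L1)"
    by (rule seqE[OF assms(1)])
  obtain Y :: "('a, nat \<Rightarrow> 'k) module" and L2 where Y: "fgm A Y"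
    and L2: "submodule L2 A Y" "b = cl (Y\<lparr>carrier := L2\<rparr>)" "v = cl Y" "q = cl (quotient_module Y L2)"
    by (rule seqE[OF assms(2)])
  let ?N = "quotient_module Y L2"
  interpret X0: left_module A X by (rule fgmD[OF X])
  interpret Y0: left_module A Y by (rule fgmD[OF Y])
  interpret X: submodule_of A X L1 by (rule submodule_ofI[OF fgmD[OF X] L1(1)])
  interpret Y: submodule_of A Y L2 by (rule submodule_ofI[OF fgmD[OF Y] L2(1)])
  have N: "fgm A ?N" by (rule fgm_quotient[OF Y L2(1)])
  have "cl (quotient_module X L1) = cl ?N" using L1(4) L2(4) by simp
  then have "isomorphic_modules A (quotient_module X L1) ?N"
    using cl_eq_iff[OF fgm_quotient[OF X L1(1)] N] by blast
  then obtain \<phi> where phi: "lin A (quotient_module X L1) ?N \<phi>"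
      "bij_betw \<phi> (carrier (quotient_module X L1)) (carrier ?N)"
    using isomorphic_iff[OF X.quotient_left_module] by blast
  \<comment> \<open>The two quotients agree only up to isomorphism, so X is mapped to the quotient
    of Y through \<open>\<phi>\<close>.\<close>
  define f where "f x = \<phi> (proj X L1 x)" for x
  have f: "lin A X ?N f" unfolding f_def by (rule lin_comp[OF X.proj_lin phi(1)])
  have fs: "f ` carrier X = carrier ?N"
  proof -
    have "f ` carrier X = \<phi> ` (proj X L1 ` carrier X)" unfolding f_def by (simp only: image_image)
    also have "\<dots> = carrier ?N" using phi(2) by (simp only: X.quotient_simps(1)[symmetric] bij_betw_def)
    finally show ?thesis .
  qed
  have fk: "f x = \<zero>\<^bsub>?N\<^esub> \<longleftrightarrow> x \<in> L1" if x: "x \<in> carrier X" for x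
  proof -
    have "\<phi> \<zero>\<^bsub>quotient_module X L1\<^esub> = \<zero>\<^bsub>?N\<^esub>"
      by (rule lin_zero[OF X.quotient_left_module Y.quotient_left_module phi(1)])
    then have "f x = \<zero>\<^bsub>?N\<^esub> \<longleftrightarrow> \<phi> (proj X L1 x) = \<phi> \<zero>\<^bsub>quotient_module X L1\<^esub>"
      unfolding f_def by (simp only:)
    also have "\<dots> \<longleftrightarrow> proj X L1 x = \<zero>\<^bsub>quotient_module X L1\<^esub>"
      by (rule inj_on_eq_iff[OF bij_betw_imp_inj_on[OF phi(2)] linD(1)[OF X.proj_lin x]
          left_module.submoduleD(3)[OF X.quotient_left_module left_module.submodule_carrier[OF X.quotient_left_module]]])
    also have "\<dots> \<longleftrightarrow> x \<in> ker X (quotient_module X L1) (proj X L1)" using x by (simp only: ker_def mem_Collect_eq simp_thms)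
    finally show ?thesis by (simp only: X.proj_ker)
  qed
  let ?g = "proj Y L2"
  have gk: "?g y = \<zero>\<^bsub>?N\<^esub> \<longleftrightarrow> y \<in> L2" if y: "y \<in> carrier Y" for y
  proof -
    have "?g y = \<zero>\<^bsub>?N\<^esub> \<longleftrightarrow> y \<in> ker Y ?N ?g" using y by (simp only: ker_def mem_Collect_eq simp_thms)
    then show ?thesis by (simp only: Y.proj_ker)
  qed
  have gs: "?g ` carrier Y = carrier ?N" by (simp only: Y.quotient_simps(1))
  let ?W = "prod_module X Y"
  have W: "fgm A ?W" by (rule prod_fgm[OF X Y])
  interpret W: left_module A ?W by (rule fgmD[OF W])
  interpret NN: left_module A ?N by (rule fgmD[OF N])
  have f0: "f \<zero>\<^bsub>X\<^esub> = \<zero>\<^bsub>?N\<^esub>" by (rule lin_zero[OF fgmD[OF X] fgmD[OF N] f])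
  have g0: "?g \<zero>\<^bsub>Y\<^esub> = \<zero>\<^bsub>?N\<^esub>" by (rule lin_zero[OF fgmD[OF Y] fgmD[OF N] Y.proj_lin])
  define P where "P = {u \<in> carrier X \<times> carrier Y. f (fst u) = ?g (snd u)}"
  have P: "submodule P A ?W"
  proof (rule W.submoduleI)
    show "P \<subseteq> carrier ?W" unfolding P_def by auto
    show "\<zero>\<^bsub>?W\<^esub> \<in> P" unfolding P_def using f0 g0 by auto
    show "u \<oplus>\<^bsub>?W\<^esub> w \<in> P" if "u \<in> P" "w \<in> P" for u w
      using that linD(2)[OF f, of "fst u" "fst w"] linD(2)[OF Y.proj_lin, of "snd u" "snd w"]
      unfolding P_def by (auto simp: X0.M.add.m_closed Y0.M.add.m_closed)
    show "c \<odot>\<^bsub>?W\<^esub> u \<in> P" if "c \<in> carrier A" "u \<in> P" for c u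
      using that linD(3)[OF f, of c "fst u"] linD(3)[OF Y.proj_lin, of c "snd u"]
      unfolding P_def by (auto simp: X0.smult_closed Y0.smult_closed)
  qed
  let ?P = "?W\<lparr>carrier := P\<rparr>"
  have Pf: "fgm A ?P" by (rule fgm_submodule[OF W P])
  have Pc: "P \<subseteq> carrier ?W" unfolding P_def by auto
  have fstP: "lin A ?P X fst" and sndP: "lin A ?P Y snd"
    by (rule lin_sub[OF lin_fst Pc], rule lin_sub[OF lin_snd Pc])
  have k1: "ker ?P Y snd = (\<lambda>x. (x, \<zero>\<^bsub>Y\<^esub>)) ` L1"
  proof (intro equalityI subsetI)
    fix u assume "u \<in> ker ?P Y snd"
    then have u: "fst u \<in> carrier X" "snd u = \<zero>\<^bsub>Y\<^esub>" "f (fst u) = ?g (snd u)"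
      unfolding ker_def P_def by auto
    then have "fst u \<in> L1" using fk[OF u(1)] g0 by metis
    then show "u \<in> (\<lambda>x. (x, \<zero>\<^bsub>Y\<^esub>)) ` L1" using u(2) by (intro image_eqI[of _ _ "fst u"]) (simp_all add: prod_eq_iff)
  next
    fix u assume "u \<in> (\<lambda>x. (x, \<zero>\<^bsub>Y\<^esub>)) ` L1"
    then obtain x where x: "x \<in> L1" "u = (x, \<zero>\<^bsub>Y\<^esub>)" by blast
    then have xc: "x \<in> carrier X" using X0.submoduleD(2)[OF L1(1)] by blast
    then have "f x = ?g \<zero>\<^bsub>Y\<^esub>" using fk[OF xc] x(1) g0 by metis
    then show "u \<in> ker ?P Y snd" unfolding ker_def P_def using x xc by simp
  qed
  have k2: "ker ?P X fst = (\<lambda>y. (\<zero>\<^bsub>X\<^esub>, y)) ` L2"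
  proof (intro equalityI subsetI)
    fix u assume "u \<in> ker ?P X fst"
    then have uP: "u \<in> P" and u0: "fst u = \<zero>\<^bsub>X\<^esub>" unfolding ker_def by simp_all
    have u: "snd u \<in> carrier Y" "fst u = \<zero>\<^bsub>X\<^esub>" "f (fst u) = ?g (snd u)"
      using uP u0 unfolding P_def mem_Collect_eq mem_Times_iff by blast+
    have "?g (snd u) = f (fst u)" by (rule u(3)[symmetric])
    also have "\<dots> = f \<zero>\<^bsub>X\<^esub>" by (simp only: u(2))
    also have "\<dots> = \<zero>\<^bsub>?N\<^esub>" by (rule f0)
    finally have "snd u \<in> L2" using gk[OF u(1)] by blast
    then show "u \<in> (\<lambda>y. (\<zero>\<^bsub>X\<^esub>, y)) ` L2" using u(2) by (intro image_eqI[of _ _ "snd u"]) (simp_all add: prod_eq_iff)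
  next
    fix u assume "u \<in> (\<lambda>y. (\<zero>\<^bsub>X\<^esub>, y)) ` L2"
    then obtain y where y: "y \<in> L2" "u = (\<zero>\<^bsub>X\<^esub>, y)" by blast
    then have yc: "y \<in> carrier Y" using Y0.submoduleD(2)[OF L2(1)] by blast
    have "?g y = \<zero>\<^bsub>?N\<^esub>" using gk[OF yc] y(1) by blast
    then have "f \<zero>\<^bsub>X\<^esub> = ?g y" by (simp only: f0)
    then show "u \<in> ker ?P X fst" unfolding ker_def P_def y(2) using yc X0.M.zero_closed by auto
  qed
  have s1: "snd ` P = carrier Y"
  proof
    show "snd ` P \<subseteq> carrier Y" unfolding P_def by auto
    show "carrier Y \<subseteq> snd ` P"
    proof
      fix y assume y: "y \<in> carrier Y"
      then have "?g y \<in> f ` carrier X" unfolding fs by (rule linD(1)[OF Y.proj_lin])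
      then obtain x where "x \<in> carrier X" "f x = ?g y" by (metis imageE)
      then show "y \<in> snd ` P" unfolding P_def using y by (intro image_eqI[of _ _ "(x, y)"]) auto
    qed
  qed
  have s2: "fst ` P = carrier X"
  proof
    show "fst ` P \<subseteq> carrier X" unfolding P_def by auto
    show "carrier X \<subseteq> fst ` P"
    proof
      fix x assume x: "x \<in> carrier X"
      then have "f x \<in> ?g ` carrier Y" unfolding gs by (rule linD(1)[OF f])
      then obtain y where "y \<in> carrier Y" "f x = ?g y" by (metis imageE)
      then show "x \<in> fst ` P" unfolding P_def using x by (intro image_eqI[of _ _ "(x, y)"]) auto
    qed
  qed
  have "seq (cl (X\<lparr>carrier := L1\<rparr>)) (cl ?P) (cl Y)"
    by (rule pullback_half[OF Pf fgmD[OF Y] X sndP _ fstP _ _ L1(1)])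
      (simp_all add: s1 k1 inj_on_def image_image)
  moreover have "seq (cl (Y\<lparr>carrier := L2\<rparr>)) (cl ?P) (cl X)"
    by (rule pullback_half[OF Pf fgmD[OF X] Y fstP _ sndP _ _ L2(1)])
      (simp_all add: s2 k2 inj_on_def image_image)
  ultimately show ?thesis unfolding L1(2,3) L2(2,3) by blast
qed

text \<open>The amalgamated sum of X and Y along their isomorphic submodules: the product modulo the
  antidiagonal N. Y is identified with S1/N through \<open>?h1\<close>, and the product modulo S1 is
  X/L1; the other side is symmetric.\<close>

lemma seq_common_sub:
  assumes "seq a g q" "seq a v r"
  shows "\<exists>p. seq v p q \<and> seq g p r"
proof -
  obtain X :: "('a, nat \<Rightarrow> 'k) module" and L1 where X: "fgm A X"
    and L1: "submodule L1 A X" "a = cl (X\<lparr>carrier := L1\<rparr>)" "g = cl X" "q = cl (quotient_module X L1)"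
    by (rule seqE[OF assms(1)])
  obtain Y :: "('a, nat \<Rightarrow> 'k) module" and L2 where Y: "fgm A Y"
    and L2: "submodule L2 A Y" "a = cl (Y\<lparr>carrier := L2\<rparr>)" "v = cl Y" "r = cl (quotient_module Y L2)"
    by (rule seqE[OF assms(2)])
  interpret X0: left_module A X by (rule fgmD[OF X])
  interpret Y0: left_module A Y by (rule fgmD[OF Y])
  interpret X: submodule_of A X L1 by (rule submodule_ofI[OF fgmD[OF X] L1(1)])
  interpret Y: submodule_of A Y L2 by (rule submodule_ofI[OF fgmD[OF Y] L2(1)])
  note X1 = fgm_submodule[OF X L1(1)] and Y2 = fgm_submodule[OF Y L2(1)]
  have "isomorphic_modules A (X\<lparr>carrier := L1\<rparr>) (Y\<lparr>carrier := L2\<rparr>)"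
    using cl_eq_iff[OF X1 Y2] L1(2) L2(2) by simp
  then obtain \<phi> where phi: "lin A (X\<lparr>carrier := L1\<rparr>) (Y\<lparr>carrier := L2\<rparr>) \<phi>"
    and bij0: "bij_betw \<phi> (carrier (X\<lparr>carrier := L1\<rparr>)) (carrier (Y\<lparr>carrier := L2\<rparr>))"
    using isomorphic_iff[OF fgmD[OF X1]] by blast
  have bij: "bij_betw \<phi> L1 L2" using bij0 by simp
  define \<psi> where "\<psi> = inv_into L1 \<phi>"
  have psi: "lin A (Y\<lparr>carrier := L2\<rparr>) (X\<lparr>carrier := L1\<rparr>) \<psi>"
    using lin_inv[OF fgmD[OF X1] phi] bij unfolding \<psi>_def by simp
  have inv: "\<psi> (\<phi> x) = x" if "x \<in> L1" for x
    using that bij unfolding \<psi>_def bij_betw_def by simp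
  have inv': "\<phi> (\<psi> y) = y" if "y \<in> L2" for y
    using that bij unfolding \<psi>_def bij_betw_def by (metis f_inv_into_f)
  have pc: "\<phi> x \<in> L2" if "x \<in> L1" for x using linD(1)[OF phi, of x] that by simp
  have qc: "\<psi> y \<in> L1" if "y \<in> L2" for y using linD(1)[OF psi, of y] that by simp
  have padd: "\<phi> (x \<oplus>\<^bsub>X\<^esub> x') = \<phi> x \<oplus>\<^bsub>Y\<^esub> \<phi> x'" if "x \<in> L1" "x' \<in> L1" for x x'
    using linD(2)[OF phi, of x x'] that by simp
  have qadd: "\<psi> (y \<oplus>\<^bsub>Y\<^esub> y') = \<psi> y \<oplus>\<^bsub>X\<^esub> \<psi> y'" if "y \<in> L2" "y' \<in> L2" for y y'
    using linD(2)[OF psi, of y y'] that by simp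
  have psm: "\<phi> (c \<odot>\<^bsub>X\<^esub> x) = c \<odot>\<^bsub>Y\<^esub> \<phi> x" if "c \<in> carrier A" "x \<in> L1" for c x
    using linD(3)[OF phi, of c x] that by simp
  have qsm: "\<psi> (c \<odot>\<^bsub>Y\<^esub> x) = c \<odot>\<^bsub>X\<^esub> \<psi> x" if "c \<in> carrier A" "x \<in> L2" for c x
    using linD(3)[OF psi, of c x] that by simp
  have p0: "\<phi> \<zero>\<^bsub>X\<^esub> = \<zero>\<^bsub>Y\<^esub>" using lin_zero[OF fgmD[OF X1] fgmD[OF Y2] phi] by simp
  have q0: "\<psi> \<zero>\<^bsub>Y\<^esub> = \<zero>\<^bsub>X\<^esub>" using lin_zero[OF fgmD[OF Y2] fgmD[OF X1] psi] by simp
  note D1 = X0.submoduleD[OF L1(1)] and D2 = Y0.submoduleD[OF L2(1)]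
  let ?W = "prod_module X Y"
  have W: "fgm A ?W" by (rule prod_fgm[OF X Y])
  interpret W: left_module A ?W by (rule fgmD[OF W])
  define S1 where "S1 = L1 \<times> carrier Y"
  define S2 where "S2 = carrier X \<times> L2"
  define N where "N = {u \<in> L1 \<times> L2. \<phi> (fst u) \<oplus>\<^bsub>Y\<^esub> snd u = \<zero>\<^bsub>Y\<^esub>}"
  have S1: "submodule S1 A ?W" unfolding S1_def
    by (rule W.submoduleI) (use D1 Y0.smult_closed in auto)
  have S2: "submodule S2 A ?W" unfolding S2_def
    by (rule W.submoduleI) (use D2 X0.smult_closed in auto)
  let ?h1 = "\<lambda>u. \<phi> (fst u) \<oplus>\<^bsub>Y\<^esub> snd u" and ?h2 = "\<lambda>u. fst u \<oplus>\<^bsub>X\<^esub> \<psi> (snd u)"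
  have pcY: "\<phi> x \<in> carrier Y" if "x \<in> L1" for x using pc[OF that] D2(2) by blast
  have qcX: "\<psi> y \<in> carrier X" if "y \<in> L2" for y using qc[OF that] D1(2) by blast
  have h1: "lin A (?W\<lparr>carrier := S1\<rparr>) Y ?h1"
  proof (rule linI)
    fix u assume "u \<in> carrier (?W\<lparr>carrier := S1\<rparr>)"
    then have u: "fst u \<in> L1" "snd u \<in> carrier Y" unfolding S1_def by auto
    show "?h1 u \<in> carrier Y" using u pcY by simp
    show "?h1 (c \<odot>\<^bsub>?W\<lparr>carrier := S1\<rparr>\<^esub> u) = c \<odot>\<^bsub>Y\<^esub> ?h1 u" if "c \<in> carrier A" for c
      using psm[OF that u(1)] u pcY that by (simp add: Y0.smult_r_distr)
    fix w assume "w \<in> carrier (?W\<lparr>carrier := S1\<rparr>)"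
    then have w: "fst w \<in> L1" "snd w \<in> carrier Y" unfolding S1_def by auto
    show "?h1 (u \<oplus>\<^bsub>?W\<lparr>carrier := S1\<rparr>\<^esub> w) = ?h1 u \<oplus>\<^bsub>Y\<^esub> ?h1 w"
      using padd[OF u(1) w(1)] u w pcY[OF u(1)] pcY[OF w(1)] by (simp add: Y0.M.add.m_ac)
  qed
  have h2: "lin A (?W\<lparr>carrier := S2\<rparr>) X ?h2"
  proof (rule linI)
    fix u assume "u \<in> carrier (?W\<lparr>carrier := S2\<rparr>)"
    then have u: "snd u \<in> L2" "fst u \<in> carrier X" unfolding S2_def by auto
    show "?h2 u \<in> carrier X" using u qcX by simp
    show "?h2 (c \<odot>\<^bsub>?W\<lparr>carrier := S2\<rparr>\<^esub> u) = c \<odot>\<^bsub>X\<^esub> ?h2 u" if "c \<in> carrier A" for c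
      using qsm[OF that u(1)] u qcX that by (simp add: X0.smult_r_distr)
    fix w assume "w \<in> carrier (?W\<lparr>carrier := S2\<rparr>)"
    then have w: "snd w \<in> L2" "fst w \<in> carrier X" unfolding S2_def by auto
    show "?h2 (u \<oplus>\<^bsub>?W\<lparr>carrier := S2\<rparr>\<^esub> w) = ?h2 u \<oplus>\<^bsub>X\<^esub> ?h2 w"
      using qadd[OF u(1) w(1)] u w qcX[OF u(1)] qcX[OF w(1)] by (simp add: X0.M.add.m_ac)
  qed
  have k1: "ker (?W\<lparr>carrier := S1\<rparr>) Y ?h1 = N"
  proof (intro equalityI subsetI)
    fix u assume "u \<in> ker (?W\<lparr>carrier := S1\<rparr>) Y ?h1"
    then have u: "fst u \<in> L1" "snd u \<in> carrier Y" "?h1 u = \<zero>\<^bsub>Y\<^esub>" unfolding ker_def S1_def by auto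
    then have "snd u = \<ominus>\<^bsub>Y\<^esub> \<phi> (fst u)" using pcY by (metis Y0.M.minus_equality Y0.M.minus_minus Y0.M.a_comm)
    then have "snd u \<in> L2" using D2(6) pc u(1) by simp
    then show "u \<in> N" using u unfolding N_def by (simp add: mem_Times_iff)
  next
    fix u assume "u \<in> N"
    then show "u \<in> ker (?W\<lparr>carrier := S1\<rparr>) Y ?h1" unfolding N_def ker_def S1_def using D2(2) by auto
  qed
  have Nalt: "fst u \<oplus>\<^bsub>X\<^esub> \<psi> (snd u) = \<zero>\<^bsub>X\<^esub> \<longleftrightarrow> \<phi> (fst u) \<oplus>\<^bsub>Y\<^esub> snd u = \<zero>\<^bsub>Y\<^esub>"
    if u: "fst u \<in> L1" "snd u \<in> L2" for u
  proof
    assume "fst u \<oplus>\<^bsub>X\<^esub> \<psi> (snd u) = \<zero>\<^bsub>X\<^esub>"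
    then show "\<phi> (fst u) \<oplus>\<^bsub>Y\<^esub> snd u = \<zero>\<^bsub>Y\<^esub>"
      using padd[OF u(1) qc[OF u(2)]] inv'[OF u(2)] p0 by simp
  next
    assume "\<phi> (fst u) \<oplus>\<^bsub>Y\<^esub> snd u = \<zero>\<^bsub>Y\<^esub>"
    then show "fst u \<oplus>\<^bsub>X\<^esub> \<psi> (snd u) = \<zero>\<^bsub>X\<^esub>"
      using qadd[OF pc[OF u(1)] u(2)] inv[OF u(1)] q0 by simp
  qed
  have k2: "ker (?W\<lparr>carrier := S2\<rparr>) X ?h2 = N"
  proof (intro equalityI subsetI)
    fix u assume "u \<in> ker (?W\<lparr>carrier := S2\<rparr>) X ?h2"
    then have u: "snd u \<in> L2" "fst u \<in> carrier X" "?h2 u = \<zero>\<^bsub>X\<^esub>" unfolding ker_def S2_def by auto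
    then have "fst u = \<ominus>\<^bsub>X\<^esub> \<psi> (snd u)" using qcX by (metis X0.M.minus_equality)
    then have "fst u \<in> L1" using D1(6) qc u(1) by simp
    then show "u \<in> N" using u Nalt[of u] unfolding N_def by (simp add: mem_Times_iff)
  next
    fix u assume "u \<in> N"
    then show "u \<in> ker (?W\<lparr>carrier := S2\<rparr>) X ?h2" unfolding N_def ker_def S2_def using D1(2) Nalt[of u] by auto
  qed
  have N: "submodule N A ?W"
    using ker_submodule[OF W.left_module_sub[OF S1] fgmD[OF Y] h1] unfolding k1 W.submodule_sub_iff[OF S1] by blast
  have NS: "N \<subseteq> S1" "N \<subseteq> S2" unfolding N_def S1_def S2_def using D1(2) D2(2) by auto
  have im1: "?h1 ` S1 = carrier Y"
  proof
    show "?h1 ` S1 \<subseteq> carrier Y" unfolding S1_def using pcY by auto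
    show "carrier Y \<subseteq> ?h1 ` S1"
    proof
      fix y assume "y \<in> carrier Y"
      then show "y \<in> ?h1 ` S1" unfolding S1_def using D1(3) p0 by (intro image_eqI[of _ _ "(\<zero>\<^bsub>X\<^esub>, y)"]) auto
    qed
  qed
  have im2: "?h2 ` S2 = carrier X"
  proof
    show "?h2 ` S2 \<subseteq> carrier X" unfolding S2_def using qcX by auto
    show "carrier X \<subseteq> ?h2 ` S2"
    proof
      fix x assume "x \<in> carrier X"
      then show "x \<in> ?h2 ` S2" unfolding S2_def using D2(3) q0 by (intro image_eqI[of _ _ "(x, \<zero>\<^bsub>Y\<^esub>)"]) auto
    qed
  qed
  have pk1: "proj X L1 x = L1 \<longleftrightarrow> x \<in> L1" if "x \<in> carrier X" for x
    using X.proj_ker that unfolding ker_def X.quotient_simps(2) by blast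
  have pk2: "proj Y L2 x = L2 \<longleftrightarrow> x \<in> L2" if "x \<in> carrier Y" for x
    using Y.proj_ker that unfolding ker_def Y.quotient_simps(2) by blast
  have "seq (cl Y) (cl (quotient_module ?W N)) (cl (quotient_module X L1))"
  proof (rule pushout_half[OF W S1 N NS(1) fgmD[OF Y] h1 im1 k1 X.quotient_left_module lin_comp[OF lin_fst X.proj_lin]])
    have "(\<lambda>u. proj X L1 (fst u)) ` carrier ?W = proj X L1 ` (fst ` carrier ?W)" by (simp only: image_image)
    also have "fst ` carrier ?W = carrier X" using Y0.M.zero_closed by force
    finally show "(\<lambda>u. proj X L1 (fst u)) ` carrier ?W = carrier (quotient_module X L1)"
      by (simp only: X.quotient_simps(1))
    show "ker ?W (quotient_module X L1) (\<lambda>u. proj X L1 (fst u)) = S1"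
    proof (intro equalityI subsetI)
      fix u assume "u \<in> ker ?W (quotient_module X L1) (\<lambda>u. proj X L1 (fst u))"
      then have u: "fst u \<in> carrier X" "snd u \<in> carrier Y" "proj X L1 (fst u) = L1"
        unfolding ker_def X.quotient_simps(2) by (simp_all add: mem_Times_iff)
      then have "fst u \<in> L1" using pk1 by blast
      then show "u \<in> S1" unfolding S1_def using u(1,2) by (simp add: mem_Times_iff)
    next
      fix u assume "u \<in> S1"
      then have u: "fst u \<in> carrier X" "snd u \<in> carrier Y" "fst u \<in> L1"
        unfolding S1_def using D1(2) by (simp_all add: mem_Times_iff)
      then have "proj X L1 (fst u) = L1" using pk1 by blast
      then show "u \<in> ker ?W (quotient_module X L1) (\<lambda>u. proj X L1 (fst u))"
        unfolding ker_def X.quotient_simps(2) using u(1,2) by (simp add: mem_Times_iff)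
    qed
  qed
  moreover have "seq (cl X) (cl (quotient_module ?W N)) (cl (quotient_module Y L2))"
  proof (rule pushout_half[OF W S2 N NS(2) fgmD[OF X] h2 im2 k2 Y.quotient_left_module lin_comp[OF lin_snd Y.proj_lin]])
    have "(\<lambda>u. proj Y L2 (snd u)) ` carrier ?W = proj Y L2 ` (snd ` carrier ?W)" by (simp only: image_image)
    also have "snd ` carrier ?W = carrier Y" using X0.M.zero_closed by force
    finally show "(\<lambda>u. proj Y L2 (snd u)) ` carrier ?W = carrier (quotient_module Y L2)"
      by (simp only: Y.quotient_simps(1))
    show "ker ?W (quotient_module Y L2) (\<lambda>u. proj Y L2 (snd u)) = S2"
    proof (intro equalityI subsetI)
      fix u assume "u \<in> ker ?W (quotient_module Y L2) (\<lambda>u. proj Y L2 (snd u))"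
      then have u: "fst u \<in> carrier X" "snd u \<in> carrier Y" "proj Y L2 (snd u) = L2"
        unfolding ker_def Y.quotient_simps(2) by (simp_all add: mem_Times_iff)
      then have "snd u \<in> L2" using pk2 by blast
      then show "u \<in> S2" unfolding S2_def using u(1,2) by (simp add: mem_Times_iff)
    next
      fix u assume "u \<in> S2"
      then have u: "fst u \<in> carrier X" "snd u \<in> carrier Y" "snd u \<in> L2"
        unfolding S2_def using D2(2) by (simp_all add: mem_Times_iff)
      then have "proj Y L2 (snd u) = L2" using pk2 by blast
      then show "u \<in> ker ?W (quotient_module Y L2) (\<lambda>u. proj Y L2 (snd u))"
        unfolding ker_def Y.quotient_simps(2) using u(1,2) by (simp add: mem_Times_iff)
    qed
  qed
  ultimately show ?thesis unfolding L1(3,4) L2(3,4) by blast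
qed

theorem exact_structure_modules: "exact_structure objs seq Zcl"
proof (rule exact_structure.intro)
  show "a \<in> objs \<and> b \<in> objs \<and> c \<in> objs" if "seq a b c" for a b c by (rule seq_in[OF that])
  show "Zcl \<in> objs" by (rule cl_objs[OF fgm_zero_module])
  show "seq Zcl b b" if b: "b \<in> objs" for b
  proof -
    obtain M :: "('a, nat \<Rightarrow> 'k) module" where M: "fgm A M" "b = cl M" using objsE[OF b] by blast
    interpret left_module A M by (rule fgmD[OF M(1)])
    show ?thesis
      using seqI[OF M(1) submodule_zero] cl_sub_zero[OF M(1) submodule_zero] cl_quot_by_zero[OF M(1)] M(2) by simp
  qed
  show "seq b b Zcl" if b: "b \<in> objs" for b
  proof -
    obtain M :: "('a, nat \<Rightarrow> 'k) module" where M: "fgm A M" "b = cl M" using objsE[OF b] by blast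
    interpret left_module A M by (rule fgmD[OF M(1)])
    show ?thesis
      using seqI[OF M(1) submodule_carrier] cl_quot_zero[OF M(1) submodule_carrier] M(2) cl_sub_whole[of M] by simp
  qed
  show "c = b" if s: "seq Zcl b c" for b c
  proof -
    obtain M :: "('a, nat \<Rightarrow> 'k) module" and L where M: "fgm A M" "submodule L A M" "Zcl = cl (M\<lparr>carrier := L\<rparr>)"
      "b = cl M" "c = cl (quotient_module M L)" by (rule seqE[OF s])
    then have "L = {\<zero>\<^bsub>M\<^esub>}" using cl_sub_zero[OF M(1,2)] by simp
    then show ?thesis using M(4,5) cl_quot_by_zero[OF M(1)] by simp
  qed
  show "a = b" if s: "seq a b Zcl" for a b
  proof -
    obtain M :: "('a, nat \<Rightarrow> 'k) module" and L where M: "fgm A M" "submodule L A M" "a = cl (M\<lparr>carrier := L\<rparr>)"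
      "b = cl M" "Zcl = cl (quotient_module M L)" by (rule seqE[OF s])
    then have "L = carrier M" using cl_quot_zero[OF M(1,2)] by simp
    then show ?thesis using M(3,4) cl_sub_whole[of M] by simp
  qed
  show "a = Zcl \<and> c = Zcl" if s: "seq a Zcl c" for a c
  proof -
    obtain M :: "('a, nat \<Rightarrow> 'k) module" and L where M: "fgm A M" "submodule L A M" "a = cl (M\<lparr>carrier := L\<rparr>)"
      "Zcl = cl M" "c = cl (quotient_module M L)" by (rule seqE[OF s])
    interpret left_module A M by (rule fgmD[OF M(1)])
    have "carrier M = {\<zero>\<^bsub>M\<^esub>}" using cl_zero_iff[OF M(1)] M(4) by simp
    then have "L = {\<zero>\<^bsub>M\<^esub>}" "L = carrier M" using submoduleD(1,3)[OF M(2)] by auto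
    then show ?thesis using M cl_sub_zero[OF M(1,2)] cl_quot_zero[OF M(1,2)] by simp
  qed
qed (fact seq_quot_lift seq_sub_quot seq_two_subs seq_common_quot seq_common_sub seq_wf_sub seq_wf_quot)+

end

section \<open>Bricks, direct sums and classes\<close>

lemma restrict_hom: "left_module R M \<Longrightarrow> lin R M N f \<Longrightarrow> restrict f (carrier M) \<in> module_hom R M N"
proof -
  assume M: "left_module R M" and f: "lin R M N f"
  interpret left_module R M by (rule M)
  show ?thesis using linD[OF f] smult_closed by (auto simp: module_hom_def)
qed

lemma End_ring_ring:
  assumes M: "left_module R M"
  shows "ring (End_ring R M)"
proof -
  interpret left_module R M by fact
  let ?C = "carrier M" and ?H = "module_hom R M M"
  have H: "lin R M M f" "f \<in> extensional ?C" if "f \<in> ?H" for f using that module_hom_lin by blast+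
  have fc: "f x \<in> ?C" if "f \<in> ?H" "x \<in> ?C" for f x using linD(1)[OF H(1)] that by blast
  have add: "(\<lambda>x\<in>?C. f x \<oplus>\<^bsub>M\<^esub> g x) \<in> ?H" if fg: "f \<in> ?H" "g \<in> ?H" for f g
  proof (rule restrict_hom[OF M], rule linI)
    show "f x \<oplus>\<^bsub>M\<^esub> g x \<in> ?C" if "x \<in> ?C" for x using fc fg that by simp
    show "f (x \<oplus>\<^bsub>M\<^esub> y) \<oplus>\<^bsub>M\<^esub> g (x \<oplus>\<^bsub>M\<^esub> y) = f x \<oplus>\<^bsub>M\<^esub> g x \<oplus>\<^bsub>M\<^esub> (f y \<oplus>\<^bsub>M\<^esub> g y)"
      if "x \<in> ?C" "y \<in> ?C" for x y
      using linD(2)[OF H(1)[OF fg(1)] that] linD(2)[OF H(1)[OF fg(2)] that] fc fg that by (simp add: M.add.m_ac)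
    show "f (a \<odot>\<^bsub>M\<^esub> x) \<oplus>\<^bsub>M\<^esub> g (a \<odot>\<^bsub>M\<^esub> x) = a \<odot>\<^bsub>M\<^esub> (f x \<oplus>\<^bsub>M\<^esub> g x)" if "a \<in> carrier R" "x \<in> ?C" for a x
      using linD(3)[OF H(1)[OF fg(1)] that] linD(3)[OF H(1)[OF fg(2)] that] fc fg that by (simp add: smult_r_distr)
  qed
  have zero: "(\<lambda>x\<in>?C. \<zero>\<^bsub>M\<^esub>) \<in> ?H"
    by (rule restrict_hom[OF M], rule linI) (auto simp: smult_r_null)
  have one: "(\<lambda>x\<in>?C. x) \<in> ?H"
    by (rule restrict_hom[OF M], rule linI) auto
  \<comment> \<open>Negation is multiplication by -1, which is linear over a noncommutative ring
    because -1 is central.\<close>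
  have neg: "(\<lambda>x\<in>?C. (\<ominus>\<^bsub>R\<^esub> \<one>\<^bsub>R\<^esub>) \<odot>\<^bsub>M\<^esub> f x) \<in> ?H" if f: "f \<in> ?H" for f
  proof (rule restrict_hom[OF M], rule linI)
    show "(\<ominus>\<^bsub>R\<^esub> \<one>\<^bsub>R\<^esub>) \<odot>\<^bsub>M\<^esub> f x \<in> ?C" if "x \<in> ?C" for x using fc f that smult_closed by simp
    show "(\<ominus>\<^bsub>R\<^esub> \<one>\<^bsub>R\<^esub>) \<odot>\<^bsub>M\<^esub> f (x \<oplus>\<^bsub>M\<^esub> y) = (\<ominus>\<^bsub>R\<^esub> \<one>\<^bsub>R\<^esub>) \<odot>\<^bsub>M\<^esub> f x \<oplus>\<^bsub>M\<^esub> (\<ominus>\<^bsub>R\<^esub> \<one>\<^bsub>R\<^esub>) \<odot>\<^bsub>M\<^esub> f y"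
      if "x \<in> ?C" "y \<in> ?C" for x y
      using linD(2)[OF H(1)[OF f] that] fc f that by (simp add: smult_r_distr)
    show "(\<ominus>\<^bsub>R\<^esub> \<one>\<^bsub>R\<^esub>) \<odot>\<^bsub>M\<^esub> f (a \<odot>\<^bsub>M\<^esub> x) = a \<odot>\<^bsub>M\<^esub> ((\<ominus>\<^bsub>R\<^esub> \<one>\<^bsub>R\<^esub>) \<odot>\<^bsub>M\<^esub> f x)"
      if a: "a \<in> carrier R" and x: "x \<in> ?C" for a x
    proof -
      have "(\<ominus>\<^bsub>R\<^esub> \<one>\<^bsub>R\<^esub>) \<odot>\<^bsub>M\<^esub> f (a \<odot>\<^bsub>M\<^esub> x) = ((\<ominus>\<^bsub>R\<^esub> \<one>\<^bsub>R\<^esub>) \<otimes>\<^bsub>R\<^esub> a) \<odot>\<^bsub>M\<^esub> f x"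
        using linD(3)[OF H(1)[OF f] a x] fc[OF f x] a by (simp add: smult_assoc1)
      also have "(\<ominus>\<^bsub>R\<^esub> \<one>\<^bsub>R\<^esub>) \<otimes>\<^bsub>R\<^esub> a = a \<otimes>\<^bsub>R\<^esub> (\<ominus>\<^bsub>R\<^esub> \<one>\<^bsub>R\<^esub>)" using a by (simp add: R.l_minus R.r_minus)
      finally show ?thesis using fc[OF f x] a by (simp add: smult_assoc1)
    qed
  qed
  have comp: "compose ?C f g \<in> ?H" if fg: "f \<in> ?H" "g \<in> ?H" for f g
    unfolding compose_def
    by (rule restrict_hom[OF M lin_comp[OF H(1)[OF fg(2)] H(1)[OF fg(1)]]])
  have ext: "f = g" if "f \<in> ?H" "g \<in> ?H" "\<And>x. x \<in> ?C \<Longrightarrow> f x = g x" for f g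
    using extensionalityI[OF H(2)[OF that(1)] H(2)[OF that(2)]] that(3) by blast
  have s [simp]: "carrier (End_ring R M) = ?H" "\<zero>\<^bsub>End_ring R M\<^esub> = (\<lambda>x\<in>?C. \<zero>\<^bsub>M\<^esub>)"
    "\<one>\<^bsub>End_ring R M\<^esub> = (\<lambda>x\<in>?C. x)" "f \<oplus>\<^bsub>End_ring R M\<^esub> g = (\<lambda>x\<in>?C. f x \<oplus>\<^bsub>M\<^esub> g x)"
    "f \<otimes>\<^bsub>End_ring R M\<^esub> g = compose ?C f g" for f g
    by (simp_all add: End_ring_def)
  show ?thesis
  proof (rule ringI)
    show "abelian_group (End_ring R M)"
    proof (rule abelian_groupI)
      fix f assume f: "f \<in> carrier (End_ring R M)"
      then have f': "f \<in> ?H" by simp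
      show "\<zero>\<^bsub>End_ring R M\<^esub> \<oplus>\<^bsub>End_ring R M\<^esub> f = f"
        by (rule ext[OF _ f'], unfold s, rule add[OF zero f'], simp add: fc[OF f'])
      show "\<exists>g\<in>carrier (End_ring R M). g \<oplus>\<^bsub>End_ring R M\<^esub> f = \<zero>\<^bsub>End_ring R M\<^esub>"
      proof (rule bexI)
        show "(\<lambda>x\<in>?C. (\<ominus>\<^bsub>R\<^esub> \<one>\<^bsub>R\<^esub>) \<odot>\<^bsub>M\<^esub> f x) \<in> carrier (End_ring R M)" using neg[OF f'] by simp
        show "(\<lambda>x\<in>?C. (\<ominus>\<^bsub>R\<^esub> \<one>\<^bsub>R\<^esub>) \<odot>\<^bsub>M\<^esub> f x) \<oplus>\<^bsub>End_ring R M\<^esub> f = \<zero>\<^bsub>End_ring R M\<^esub>"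
          using smult_minus_one fc[OF f'] by (auto simp: M.l_neg intro!: restrict_ext)
      qed
      fix g assume "g \<in> carrier (End_ring R M)"
      then have g': "g \<in> ?H" by simp
      show "f \<oplus>\<^bsub>End_ring R M\<^esub> g \<in> carrier (End_ring R M)" using add f' g' by simp
      show "f \<oplus>\<^bsub>End_ring R M\<^esub> g = g \<oplus>\<^bsub>End_ring R M\<^esub> f"
        using fc[OF f'] fc[OF g'] by (auto simp: M.a_comm intro!: restrict_ext)
      fix h assume "h \<in> carrier (End_ring R M)"
      then have h': "h \<in> ?H" by simp
      show "f \<oplus>\<^bsub>End_ring R M\<^esub> g \<oplus>\<^bsub>End_ring R M\<^esub> h = f \<oplus>\<^bsub>End_ring R M\<^esub> (g \<oplus>\<^bsub>End_ring R M\<^esub> h)"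
        using fc[OF f'] fc[OF g'] fc[OF h'] by (auto simp: M.a_assoc intro!: restrict_ext)
    qed (use zero in simp)
    show "monoid (End_ring R M)"
    proof (rule monoidI)
      fix f assume f: "f \<in> carrier (End_ring R M)"
      then have f': "f \<in> ?H" by simp
      show "\<one>\<^bsub>End_ring R M\<^esub> \<otimes>\<^bsub>End_ring R M\<^esub> f = f"
        using comp[OF one f'] fc[OF f'] by (intro ext[OF _ f']) (simp_all add: compose_eq)
      show "f \<otimes>\<^bsub>End_ring R M\<^esub> \<one>\<^bsub>End_ring R M\<^esub> = f"
        using comp[OF f' one] fc[OF f'] by (intro ext[OF _ f']) (simp_all add: compose_eq)
      fix g assume "g \<in> carrier (End_ring R M)"
      then have g': "g \<in> ?H" by simp
      show "f \<otimes>\<^bsub>End_ring R M\<^esub> g \<in> carrier (End_ring R M)" using comp[OF f' g'] by simp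
      fix h assume "h \<in> carrier (End_ring R M)"
      then have h': "h \<in> ?H" by simp
      show "f \<otimes>\<^bsub>End_ring R M\<^esub> g \<otimes>\<^bsub>End_ring R M\<^esub> h = f \<otimes>\<^bsub>End_ring R M\<^esub> (g \<otimes>\<^bsub>End_ring R M\<^esub> h)"
        using comp[OF comp[OF f' g'] h'] comp[OF f' comp[OF g' h']] fc[OF h']
        by (intro ext) (simp_all add: compose_eq)
    qed (use one in simp)
    fix f g h assume "f \<in> carrier (End_ring R M)" "g \<in> carrier (End_ring R M)" "h \<in> carrier (End_ring R M)"
    then have fgh: "f \<in> ?H" "g \<in> ?H" "h \<in> ?H" by simp_all
    show "(f \<oplus>\<^bsub>End_ring R M\<^esub> g) \<otimes>\<^bsub>End_ring R M\<^esub> h = f \<otimes>\<^bsub>End_ring R M\<^esub> h \<oplus>\<^bsub>End_ring R M\<^esub> g \<otimes>\<^bsub>End_ring R M\<^esub> h"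
      unfolding s compose_def by (rule restrict_ext) (simp add: fc[OF fgh(3)])
    show "h \<otimes>\<^bsub>End_ring R M\<^esub> (f \<oplus>\<^bsub>End_ring R M\<^esub> g) = h \<otimes>\<^bsub>End_ring R M\<^esub> f \<oplus>\<^bsub>End_ring R M\<^esub> h \<otimes>\<^bsub>End_ring R M\<^esub> g"
      unfolding s compose_def
      by (rule restrict_ext) (simp add: fc[OF fgh(1)] fc[OF fgh(2)] linD(2)[OF H(1)[OF fgh(3)]])
  qed
qed

lemma End_ring_Units:
  assumes M: "left_module R M"
  shows "Units (End_ring R M) = {f \<in> module_hom R M M. bij_betw f (carrier M) (carrier M)}"
proof -
  interpret left_module R M by fact
  let ?C = "carrier M"
  have H: "lin R M M f" "f \<in> extensional ?C" if "f \<in> module_hom R M M" for f using that module_hom_lin by blast+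
  have s: "carrier (End_ring R M) = module_hom R M M" "\<one>\<^bsub>End_ring R M\<^esub> = (\<lambda>x\<in>?C. x)"
    "f \<otimes>\<^bsub>End_ring R M\<^esub> g = compose ?C f g" for f g
    by (simp_all add: End_ring_def)
  show ?thesis
    unfolding Units_def s
  proof (intro equalityI subsetI)
    fix f assume "f \<in> {y \<in> module_hom R M M. \<exists>x\<in>module_hom R M M.
      compose ?C x y = (\<lambda>x\<in>?C. x) \<and> compose ?C y x = (\<lambda>x\<in>?C. x)}"
    then obtain g where f: "f \<in> module_hom R M M" and g: "g \<in> module_hom R M M"
      and e: "compose ?C g f = (\<lambda>x\<in>?C. x)" "compose ?C f g = (\<lambda>x\<in>?C. x)" by blast
    have gf: "g (f x) = x" and fg: "f (g x) = x" if "x \<in> ?C" for x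
      using fun_cong[OF e(1), of x] fun_cong[OF e(2), of x] that by (simp_all add: compose_def)
    have "bij_betw f ?C ?C"
      by (rule bij_betw_byWitness[where f' = g]) (use gf fg linD(1)[OF H(1)[OF f]] linD(1)[OF H(1)[OF g]] in auto)
    then show "f \<in> {f \<in> module_hom R M M. bij_betw f ?C ?C}" using f by blast
  next
    fix f assume "f \<in> {f \<in> module_hom R M M. bij_betw f ?C ?C}"
    then have f: "f \<in> module_hom R M M" "bij_betw f ?C ?C" by blast+
    define g where "g = restrict (inv_into ?C f) ?C"
    have g: "g \<in> module_hom R M M"
      unfolding g_def by (rule restrict_hom[OF M lin_inv[OF M H(1)[OF f(1)] f(2)]])
    have i: "inj_on f ?C" "f ` ?C = ?C" using f(2) by (auto simp: bij_betw_def)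
    have "compose ?C g f = (\<lambda>x\<in>?C. x)"
      unfolding compose_def g_def by (rule restrict_ext) (simp add: linD(1)[OF H(1)[OF f(1)]] i(1))
    moreover have "compose ?C f g = (\<lambda>x\<in>?C. x)"
    proof -
      have "f (inv_into ?C f x) = x" if "x \<in> ?C" for x
        by (rule f_inv_into_f) (simp only: i(2) that)
      then show ?thesis unfolding compose_def g_def by (intro restrict_ext) simp
    qed
    ultimately show "f \<in> {y \<in> module_hom R M M. \<exists>x\<in>module_hom R M M.
      compose ?C x y = (\<lambda>x\<in>?C. x) \<and> compose ?C y x = (\<lambda>x\<in>?C. x)}" using f(1) g by blast
  qed
qed

section \<open>Direct sums\<close>

lemma direct_sum_simps [simp]:
  "carrier (finite_direct_sum B) = (\<Pi>\<^sub>E X\<in>B. carrier X)" "\<zero>\<^bsub>finite_direct_sum B\<^esub> = (\<lambda>X\<in>B. \<zero>\<^bsub>X\<^esub>)"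
  "u \<oplus>\<^bsub>finite_direct_sum B\<^esub> v = (\<lambda>X\<in>B. u X \<oplus>\<^bsub>X\<^esub> v X)"
  "a \<odot>\<^bsub>finite_direct_sum B\<^esub> u = (\<lambda>X\<in>B. a \<odot>\<^bsub>X\<^esub> u X)"
  by (simp_all add: finite_direct_sum_def)

lemma direct_sum_left_module:
  fixes B :: "('a, 'x) module set"
  assumes R: "ring R" and B: "\<And>X. X \<in> B \<Longrightarrow> left_module R X"
  shows "left_module R (finite_direct_sum B)"
proof -
  interpret R: ring R by fact
  have mem: "u X \<in> carrier X" if "u \<in> (\<Pi>\<^sub>E X\<in>B. carrier X)" "X \<in> B" for u X using that by (rule PiE_mem)
  have ag: "abelian_group X" if "X \<in> B" for X using B[OF that] by (simp add: left_module_def)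
  have "abelian_group (finite_direct_sum B)"
  proof (rule abelian_groupI)
    fix u assume u: "u \<in> carrier (finite_direct_sum B)"
    show "\<zero>\<^bsub>finite_direct_sum B\<^esub> \<oplus>\<^bsub>finite_direct_sum B\<^esub> u = u"
    proof (rule extensionalityI[of _ B])
      show "(\<zero>\<^bsub>finite_direct_sum B\<^esub> \<oplus>\<^bsub>finite_direct_sum B\<^esub> u) X = u X" if "X \<in> B" for X
        using that mem[of u X] u abelian_group.axioms(1)[OF ag[OF that]] by (simp add: abelian_monoid.l_zero)
    qed (use u in \<open>auto simp: PiE_def\<close>)
    show "\<exists>v\<in>carrier (finite_direct_sum B). v \<oplus>\<^bsub>finite_direct_sum B\<^esub> u = \<zero>\<^bsub>finite_direct_sum B\<^esub>"
      using mem[of u] u ag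
      by (intro bexI[of _ "\<lambda>X\<in>B. \<ominus>\<^bsub>X\<^esub> u X"])
        (auto intro!: restrict_ext simp: abelian_group.l_neg abelian_group.a_inv_closed)
    fix v assume v: "v \<in> carrier (finite_direct_sum B)"
    show "u \<oplus>\<^bsub>finite_direct_sum B\<^esub> v \<in> carrier (finite_direct_sum B)"
      using mem[of u] mem[of v] u v ag by (auto intro!: abelian_monoid.a_closed simp: abelian_group.axioms(1))
    show "u \<oplus>\<^bsub>finite_direct_sum B\<^esub> v = v \<oplus>\<^bsub>finite_direct_sum B\<^esub> u"
      using mem[of u] mem[of v] u v ag
      by (auto intro!: restrict_ext abelian_monoid.a_comm simp: abelian_group.axioms(1))
    fix w assume w: "w \<in> carrier (finite_direct_sum B)"
    show "u \<oplus>\<^bsub>finite_direct_sum B\<^esub> v \<oplus>\<^bsub>finite_direct_sum B\<^esub> w = u \<oplus>\<^bsub>finite_direct_sum B\<^esub> (v \<oplus>\<^bsub>finite_direct_sum B\<^esub> w)"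
      using mem[of u] mem[of v] mem[of w] u v w ag
      by (auto intro!: restrict_ext abelian_monoid.a_assoc simp: abelian_group.axioms(1))
  qed (use ag in \<open>auto intro!: abelian_monoid.zero_closed simp: abelian_group.axioms(1)\<close>)
  then show ?thesis
  proof (intro left_module.intro left_module_axioms.intro R)
    fix a u assume a: "a \<in> carrier R" and u: "u \<in> carrier (finite_direct_sum B)"
    show "a \<odot>\<^bsub>finite_direct_sum B\<^esub> u \<in> carrier (finite_direct_sum B)"
      using a u mem[of u] B by (auto intro!: left_module.smult_closed[where R = R])
    show "a \<odot>\<^bsub>finite_direct_sum B\<^esub> (u \<oplus>\<^bsub>finite_direct_sum B\<^esub> v) =
        a \<odot>\<^bsub>finite_direct_sum B\<^esub> u \<oplus>\<^bsub>finite_direct_sum B\<^esub> a \<odot>\<^bsub>finite_direct_sum B\<^esub> v"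
      if "v \<in> carrier (finite_direct_sum B)" for v
      using a u that mem[of u] mem[of v] B by (auto intro!: restrict_ext left_module.smult_r_distr[where R = R])
    fix b assume b: "b \<in> carrier R"
    show "(a \<oplus>\<^bsub>R\<^esub> b) \<odot>\<^bsub>finite_direct_sum B\<^esub> u =
        a \<odot>\<^bsub>finite_direct_sum B\<^esub> u \<oplus>\<^bsub>finite_direct_sum B\<^esub> b \<odot>\<^bsub>finite_direct_sum B\<^esub> u"
      using a b u mem[of u] B by (auto intro!: restrict_ext left_module.smult_l_distr[where R = R])
    show "(a \<otimes>\<^bsub>R\<^esub> b) \<odot>\<^bsub>finite_direct_sum B\<^esub> u =
        a \<odot>\<^bsub>finite_direct_sum B\<^esub> (b \<odot>\<^bsub>finite_direct_sum B\<^esub> u)"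
      using a b u mem[of u] B by (auto intro!: restrict_ext left_module.smult_assoc1[where R = R])
  next
    fix u assume u: "u \<in> carrier (finite_direct_sum B)"
    show "\<one>\<^bsub>R\<^esub> \<odot>\<^bsub>finite_direct_sum B\<^esub> u = u"
    proof (rule extensionalityI[of _ B])
      show "(\<one>\<^bsub>R\<^esub> \<odot>\<^bsub>finite_direct_sum B\<^esub> u) X = u X" if "X \<in> B" for X
        using that mem[of u X] u left_module.smult_one[OF B[OF that]] by simp
    qed (use u in \<open>auto simp: PiE_def\<close>)
  qed
qed

lemma direct_sum_fgm:
  fixes B :: "('a, 'x) module set"
  assumes R: "ring R" and fin: "finite B" and B: "\<And>X. X \<in> B \<Longrightarrow> fgm R X"
  shows "fgm R (finite_direct_sum B)"
  using fin B
proof (induction B rule: finite_induct)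
  case empty
  have lm: "left_module R (finite_direct_sum ({} :: ('a, 'x) module set))" by (rule direct_sum_left_module[OF R]) simp
  have "L = carrier (finite_direct_sum {})" if "submodule L R (finite_direct_sum ({} :: ('a, 'x) module set))" for L
    using left_module.submoduleD(1,3)[OF lm that] by auto
  then show ?case unfolding fgm_def finitely_generated_iff[OF lm] using lm by blast
next
  case (insert X B)
  have lm: "left_module R (finite_direct_sum (insert X B))"
    by (rule direct_sum_left_module[OF R]) (use insert.prems in \<open>auto simp: fgm_def\<close>)
  have XB: "X \<notin> B" by fact
  let ?f = "\<lambda>p. \<lambda>Y\<in>insert X B. if Y = X then fst p else snd p Y"
  show ?case
  proof (rule fgm_image[OF prod_fgm[of R X "finite_direct_sum B"] lm, where f = ?f])
    show "fgm R X" using insert.prems by blast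
    show "fgm R (finite_direct_sum B)" by (rule insert.IH) (use insert.prems in blast)
    show "lin R (prod_module X (finite_direct_sum B)) (finite_direct_sum (insert X B)) ?f"
      using XB by (intro linI) (auto intro!: restrict_ext simp: PiE_iff)
    show "?f ` carrier (prod_module X (finite_direct_sum B)) = carrier (finite_direct_sum (insert X B))"
    proof (intro equalityI subsetI)
      fix u assume "u \<in> ?f ` carrier (prod_module X (finite_direct_sum B))"
      then show "u \<in> carrier (finite_direct_sum (insert X B))" by (auto simp: PiE_iff)
    next
      fix u assume u: "u \<in> carrier (finite_direct_sum (insert X B))"
      have e: "?f (u X, restrict u B) = u"
        by (rule extensionalityI[of _ "insert X B"]) (use u in \<open>auto simp: PiE_def\<close>)
      have m: "(u X, restrict u B) \<in> carrier (prod_module X (finite_direct_sum B))"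
        using u by (auto simp: PiE_iff)
      show "u \<in> ?f ` carrier (prod_module X (finite_direct_sum B))"
        by (rule image_eqI[OF _ m]) (rule e[symmetric])
    qed
  qed
qed

context fin_dim_algebra
begin

sublocale E: exact_structure objs seq Zcl
  by (rule exact_structure_modules)

text \<open>Restriction of families to B2 is onto, and restriction to B1 identifies its kernel with
  the sum over B1. With the roles exchanged, this makes every part a direct summand in the sense of
  \<open>seq\<close>.\<close>

lemma seq_direct_sum:
  fixes B1 :: "('a, 'x) module set"
  assumes fin: "finite B1" "finite B2" and disj: "B1 \<inter> B2 = {}"
    and B: "\<And>X. X \<in> B1 \<union> B2 \<Longrightarrow> fgm A X"
  shows "seq (cl (finite_direct_sum B1)) (cl (finite_direct_sum (B1 \<union> B2))) (cl (finite_direct_sum B2))"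
proof -
  let ?P = "finite_direct_sum (B1 \<union> B2)" and ?Y = "finite_direct_sum B2" and ?X = "finite_direct_sum B1"
  have P: "fgm A ?P" and Y: "fgm A ?Y" and X: "fgm A ?X"
    using direct_sum_fgm[OF A.ring_axioms] fin B by auto
  have lin: "lin A ?P (finite_direct_sum B') (\<lambda>u. restrict u B')" if "B' \<subseteq> B1 \<union> B2" for B'
    using that by (intro linI) (auto intro!: restrict_ext simp: PiE_iff subset_iff)
  have z: "\<zero>\<^bsub>X\<^esub> \<in> carrier X" if "X \<in> B1 \<union> B2" for X
    using left_module.submoduleD(3)[OF fgmD[OF B[OF that]] left_module.submodule_carrier[OF fgmD[OF B[OF that]]]] .
  let ?glue = "\<lambda>u v. \<lambda>X\<in>B1 \<union> B2. if X \<in> B1 then u X else v X"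
  have gl: "?glue u v \<in> carrier ?P" "restrict (?glue u v) B1 = u" "restrict (?glue u v) B2 = v"
    if "u \<in> carrier ?X" "v \<in> carrier ?Y" for u v
  proof -
    show "?glue u v \<in> carrier ?P" using that by (auto simp: PiE_iff)
    show "restrict (?glue u v) B1 = u"
      by (rule extensionalityI[of _ B1]) (use that in \<open>auto simp: PiE_def\<close>)
    show "restrict (?glue u v) B2 = v"
      by (rule extensionalityI[of _ B2]) (use that disj in \<open>auto simp: PiE_def\<close>)
  qed
  have z1: "\<zero>\<^bsub>?X\<^esub> \<in> carrier ?X" and z2: "\<zero>\<^bsub>?Y\<^esub> \<in> carrier ?Y" using z by auto
  have "seq (cl (?X\<lparr>carrier := carrier ?X\<rparr>)) (cl ?P) (cl ?Y)"
  proof (rule pullback_half[OF P fgmD[OF Y] X lin _ lin])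
    show "(\<lambda>u. restrict u B2) ` carrier ?P = carrier ?Y"
    proof (intro equalityI subsetI)
      show "v \<in> carrier ?Y" if "v \<in> (\<lambda>u. restrict u B2) ` carrier ?P" for v
        using that linD(1)[OF lin[of B2]] by blast
      show "v \<in> (\<lambda>u. restrict u B2) ` carrier ?P" if "v \<in> carrier ?Y" for v
        by (rule image_eqI[OF _ gl(1)[OF z1 that]]) (rule gl(3)[OF z1 that, symmetric])
    qed
    show "inj_on (\<lambda>u. restrict u B1) (ker ?P ?Y (\<lambda>u. restrict u B2))"
    proof (rule inj_onI)
      fix u v assume u: "u \<in> ker ?P ?Y (\<lambda>u. restrict u B2)" and v: "v \<in> ker ?P ?Y (\<lambda>u. restrict u B2)"
        and e: "restrict u B1 = restrict v B1"
      have e2: "restrict u B2 = restrict v B2" using u v unfolding ker_def by simp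
      show "u = v"
      proof (rule extensionalityI[of _ "B1 \<union> B2"])
        show "u X = v X" if "X \<in> B1 \<union> B2" for X
          using that fun_cong[OF e, of X] fun_cong[OF e2, of X] by (auto split: if_splits)
      qed (use u v in \<open>auto simp: ker_def PiE_def\<close>)
    qed
    show "(\<lambda>u. restrict u B1) ` ker ?P ?Y (\<lambda>u. restrict u B2) = carrier ?X"
    proof (intro equalityI subsetI)
      show "v \<in> carrier ?X" if "v \<in> (\<lambda>u. restrict u B1) ` ker ?P ?Y (\<lambda>u. restrict u B2)" for v
        using that linD(1)[OF lin[of B1]] unfolding ker_def by blast
      show "v \<in> (\<lambda>u. restrict u B1) ` ker ?P ?Y (\<lambda>u. restrict u B2)" if "v \<in> carrier ?X" for v
      proof (rule image_eqI)
        show "v = restrict (?glue v \<zero>\<^bsub>?Y\<^esub>) B1" by (rule gl(2)[OF that z2, symmetric])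
        show "?glue v \<zero>\<^bsub>?Y\<^esub> \<in> ker ?P ?Y (\<lambda>u. restrict u B2)"
          unfolding ker_def mem_Collect_eq using gl(1,3)[OF that z2] by blast
      qed
    qed
    show "submodule (carrier ?X) A ?X" by (rule left_module.submodule_carrier[OF fgmD[OF X]])
  qed auto
  then show ?thesis unfolding cl_sub_whole .
qed

lemma cl_direct_sum_empty: "cl (finite_direct_sum ({} :: ('a, 'x) module set)) = Zcl"
  using cl_zero_iff[OF direct_sum_fgm[OF A.ring_axioms, of "{} :: ('a, 'x) module set"]] by (simp add: restrict_def)

lemma cl_direct_sum_single:
  assumes X: "fgm A X"
  shows "cl (finite_direct_sum {X}) = cl X"
proof (rule cl_isoI[OF direct_sum_fgm[OF A.ring_axioms] X, where f = "\<lambda>u. u X"])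
  show "lin A (finite_direct_sum {X}) X (\<lambda>u. u X)" by (intro linI) auto
  show "inj_on (\<lambda>u. u X) (carrier (finite_direct_sum {X}))"
  proof (rule inj_onI)
    fix u v assume uv: "u \<in> carrier (finite_direct_sum {X})" "v \<in> carrier (finite_direct_sum {X})" "u X = v X"
    show "u = v" by (rule extensionalityI[of _ "{X}"]) (use uv in \<open>auto simp: PiE_def\<close>)
  qed
  show "(\<lambda>u. u X) ` carrier (finite_direct_sum {X}) = carrier X"
  proof (intro equalityI subsetI)
    show "x \<in> (\<lambda>u. u X) ` carrier (finite_direct_sum {X})" if "x \<in> carrier X" for x
      using that by (intro image_eqI[of _ _ "\<lambda>Y\<in>{X}. x"]) auto
  qed auto
qed (use X in auto)

section \<open>Translation between modules and their classes\<close>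

lemma simple_cl:
  assumes X: "fgm A X"
  shows "E.simple (cl X) \<longleftrightarrow> simple_module A X"
proof -
  have "(\<forall>U Q. seq U (cl X) Q \<longrightarrow> U = Zcl \<or> Q = Zcl) \<longleftrightarrow>
      (\<forall>L. submodule L A X \<longrightarrow> L = {\<zero>\<^bsub>X\<^esub>} \<or> L = carrier X)"
    using seq_iff[OF X] cl_sub_zero[OF X] cl_quot_zero[OF X] by metis
  then show ?thesis
    unfolding E.simple_def simple_module_def using cl_objs[OF X] cl_zero_iff[OF X] fgmD[OF X] by blast
qed

lemma image_seq:
  assumes M: "fgm A M" and N: "fgm A N" and f: "lin A M N f"
  shows "submodule (f ` carrier M) A N"
    "seq (cl (M\<lparr>carrier := ker M N f\<rparr>)) (cl M) (cl (N\<lparr>carrier := f ` carrier M\<rparr>))"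
    "seq (cl (N\<lparr>carrier := f ` carrier M\<rparr>)) (cl N) (cl (quotient_module N (f ` carrier M)))"
proof -
  show s: "submodule (f ` carrier M) A N"
    by (rule image_submodule[OF fgmD[OF M] fgmD[OF N] f left_module.submodule_carrier[OF fgmD[OF M]]])
  show "seq (cl (N\<lparr>carrier := f ` carrier M\<rparr>)) (cl N) (cl (quotient_module N (f ` carrier M)))"
    by (rule seqI[OF N s])
  have "ker M (N\<lparr>carrier := f ` carrier M\<rparr>) f = ker M N f" by (simp add: ker_def)
  then show "seq (cl (M\<lparr>carrier := ker M N f\<rparr>)) (cl M) (cl (N\<lparr>carrier := f ` carrier M\<rparr>))"
    using seq_surj[OF M fgmD[OF fgm_submodule[OF N s]] lin_restrict_target[OF f order_refl]] by simp
qed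

text \<open>Recovers an actual linear map from two sequences sharing the class I: project M to its
  quotient and apply an isomorphism to the submodule of N.\<close>

lemma image_factor:
  assumes M: "fgm A M" and N: "fgm A N" and seq: "seq U (cl M) I" "seq I (cl N) C"
  shows "\<exists>f. lin A M N f \<and> submodule (f ` carrier M) A N \<and> I = cl (N\<lparr>carrier := f ` carrier M\<rparr>)"
proof -
  obtain L where L: "submodule L A M" "I = cl (quotient_module M L)" using seq(1) seq_iff[OF M] by blast
  obtain L' where L': "submodule L' A N" "I = cl (N\<lparr>carrier := L'\<rparr>)" using seq(2) seq_iff[OF N] by blast
  interpret submodule_of A M L by (rule submodule_ofI[OF fgmD[OF M] L(1)])
  have "isomorphic_modules A (quotient_module M L) (N\<lparr>carrier := L'\<rparr>)"
    using cl_eq_iff[OF fgm_quotient[OF M L(1)] fgm_submodule[OF N L'(1)]] L(2) L'(2) by simp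
  then obtain h where h: "lin A (quotient_module M L) (N\<lparr>carrier := L'\<rparr>) h"
    "bij_betw h (carrier (quotient_module M L)) (carrier (N\<lparr>carrier := L'\<rparr>))"
    using isomorphic_iff[OF quotient_left_module] by blast
  have hL: "h ` carrier (quotient_module M L) = L'" using h(2) by (simp add: bij_betw_def)
  have "L' \<subseteq> carrier N" by (rule left_module.submoduleD(1)[OF fgmD[OF N] L'(1)])
  then have h': "lin A (quotient_module M L) N h" using h(1) unfolding lin_def by (auto simp: Pi_iff)
  have "(\<lambda>x. h (proj M L x)) ` carrier M = h ` (proj M L ` carrier M)" by (simp only: image_image)
  also have "\<dots> = L'" using hL by (simp only: quotient_simps(1))
  finally have "(\<lambda>x. h (proj M L x)) ` carrier M = L'" .
  then show ?thesis using lin_comp[OF proj_lin h'] L' by (intro exI[of _ "\<lambda>x. h (proj M L x)"]) simp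
qed

lemma nzmap_cl:
  assumes M: "fgm A M" and N: "fgm A N"
  shows "E.nzmap (cl M) (cl N) \<longleftrightarrow> (\<exists>f. lin A M N f \<and> f ` carrier M \<noteq> {\<zero>\<^bsub>N\<^esub>})"
proof
  assume "E.nzmap (cl M) (cl N)"
  then obtain I U C where I: "I \<noteq> Zcl" "seq U (cl M) I" "seq I (cl N) C" unfolding E.nzmap_def by blast
  obtain f where f: "lin A M N f" "submodule (f ` carrier M) A N" "I = cl (N\<lparr>carrier := f ` carrier M\<rparr>)"
    using image_factor[OF M N I(2,3)] by blast
  then show "\<exists>f. lin A M N f \<and> f ` carrier M \<noteq> {\<zero>\<^bsub>N\<^esub>}" using cl_sub_zero[OF N f(2)] I(1) by blast
next
  assume "\<exists>f. lin A M N f \<and> f ` carrier M \<noteq> {\<zero>\<^bsub>N\<^esub>}"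
  then obtain f where f: "lin A M N f" "f ` carrier M \<noteq> {\<zero>\<^bsub>N\<^esub>}" by blast
  show "E.nzmap (cl M) (cl N)"
    using E.nzmapI[OF _ image_seq(2,3)[OF M N f(1)]] cl_sub_zero[OF N image_seq(1)[OF M N f(1)]] f(2) by blast
qed

text \<open>If the image of a nonzero endomorphism has the class of X, then the kernel and the
  cokernel vanish by well-foundedness.\<close>

lemma brick_cl:
  assumes X: "fgm A X"
  shows "E.brick (cl X) \<longleftrightarrow> carrier X \<noteq> {\<zero>\<^bsub>X\<^esub>} \<and>
    (\<forall>f. lin A X X f \<longrightarrow> f ` carrier X \<noteq> {\<zero>\<^bsub>X\<^esub>} \<longrightarrow> bij_betw f (carrier X) (carrier X))"
proof
  assume b: "E.brick (cl X)"
  show "carrier X \<noteq> {\<zero>\<^bsub>X\<^esub>} \<and>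
    (\<forall>f. lin A X X f \<longrightarrow> f ` carrier X \<noteq> {\<zero>\<^bsub>X\<^esub>} \<longrightarrow> bij_betw f (carrier X) (carrier X))"
  proof (intro conjI allI impI)
    show "carrier X \<noteq> {\<zero>\<^bsub>X\<^esub>}" using b cl_zero_iff[OF X] unfolding E.brick_def by blast
    fix f assume f: "lin A X X f" "f ` carrier X \<noteq> {\<zero>\<^bsub>X\<^esub>}"
    note s = image_seq[OF X X f(1)]
    have "cl (X\<lparr>carrier := f ` carrier X\<rparr>) \<noteq> Zcl" using cl_sub_zero[OF X s(1)] f(2) by blast
    then have e: "cl (X\<lparr>carrier := f ` carrier X\<rparr>) = cl X"
      using b s(2,3) unfolding E.brick_def by blast
    have "cl (X\<lparr>carrier := ker X X f\<rparr>) = Zcl" using s(2) unfolding e by (rule E.ses_self_quot)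
    then have "ker X X f = {\<zero>\<^bsub>X\<^esub>}"
      using cl_sub_zero[OF X ker_submodule[OF fgmD[OF X] fgmD[OF X] f(1)]] by blast
    then have "inj_on f (carrier X)" using lin_inj_iff[OF fgmD[OF X] fgmD[OF X] f(1)] by blast
    moreover have "cl (quotient_module X (f ` carrier X)) = Zcl"
      using s(3) unfolding e by (rule E.ses_self_sub)
    then have "f ` carrier X = carrier X" using cl_quot_zero[OF X s(1)] by blast
    ultimately show "bij_betw f (carrier X) (carrier X)" unfolding bij_betw_def by blast
  qed
next
  assume b: "carrier X \<noteq> {\<zero>\<^bsub>X\<^esub>} \<and>
    (\<forall>f. lin A X X f \<longrightarrow> f ` carrier X \<noteq> {\<zero>\<^bsub>X\<^esub>} \<longrightarrow> bij_betw f (carrier X) (carrier X))"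
  show "E.brick (cl X)"
    unfolding E.brick_def
  proof (intro conjI allI impI)
    show "cl X \<in> objs" by (rule cl_objs[OF X])
    show "cl X \<noteq> Zcl" using b cl_zero_iff[OF X] by blast
    fix I U C assume I: "seq U (cl X) I" "seq I (cl X) C"
    obtain f where f: "lin A X X f" "submodule (f ` carrier X) A X" "I = cl (X\<lparr>carrier := f ` carrier X\<rparr>)"
      using image_factor[OF X X I] by blast
    show "I = Zcl \<or> I = cl X"
    proof (cases "f ` carrier X = {\<zero>\<^bsub>X\<^esub>}")
      case True
      then show ?thesis using f(3) cl_sub_zero[OF X f(2)] by blast
    next
      case False
      then have "f ` carrier X = carrier X" using b f(1) unfolding bij_betw_def by blast
      then show ?thesis using f(3) cl_sub_whole[of X] by simp
    qed
  qed
qed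

lemma nonzero_hom_iff:
  assumes M: "left_module A M" and N: "left_module A N" and f: "f \<in> module_hom A M N"
  shows "f \<noteq> (\<lambda>x\<in>carrier M. \<zero>\<^bsub>N\<^esub>) \<longleftrightarrow> f ` carrier M \<noteq> {\<zero>\<^bsub>N\<^esub>}"
proof -
  interpret M: left_module A M by fact
  have fl: "lin A M N f" and fe: "f \<in> extensional (carrier M)" using f module_hom_lin by blast+
  have "f = (\<lambda>x\<in>carrier M. \<zero>\<^bsub>N\<^esub>) \<longleftrightarrow> (\<forall>x\<in>carrier M. f x = \<zero>\<^bsub>N\<^esub>)"
  proof
    assume "\<forall>x\<in>carrier M. f x = \<zero>\<^bsub>N\<^esub>"
    then show "f = (\<lambda>x\<in>carrier M. \<zero>\<^bsub>N\<^esub>)"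
      by (intro extensionalityI[OF fe]) auto
  qed auto
  also have "\<dots> \<longleftrightarrow> f ` carrier M = {\<zero>\<^bsub>N\<^esub>}"
  proof -
    have "\<exists>x. x \<in> carrier M" using M.M.zero_closed by blast
    then show ?thesis by (auto simp: image_iff)
  qed
  finally show ?thesis by blast
qed

lemma bricks_iff: "X \<in> bricks A \<longleftrightarrow> fgm A X \<and> E.brick (cl X)"
proof (cases "fgm A X")
  case False
  then show ?thesis unfolding bricks_def mod_objects_iff by simp
next
  case True
  note X = fgmD[OF True]
  let ?E = "End_ring A X" and ?C = "carrier X" and ?z = "\<lambda>x\<in>carrier X. \<zero>\<^bsub>X\<^esub>"
  interpret X: left_module A X by (rule X)
  have E: "carrier ?E = module_hom A X X" "\<zero>\<^bsub>?E\<^esub> = ?z" by (simp_all add: End_ring_def)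
  have "X \<in> bricks A \<longleftrightarrow> {f \<in> module_hom A X X. bij_betw f ?C ?C} = module_hom A X X - {?z}"
    by (simp add: bricks_def mod_objects_iff End_ring_Units[OF X] E End_ring_ring[OF X] True)
  also have "\<dots> \<longleftrightarrow> ?C \<noteq> {\<zero>\<^bsub>X\<^esub>} \<and> (\<forall>f. lin A X X f \<longrightarrow> f ` ?C \<noteq> {\<zero>\<^bsub>X\<^esub>} \<longrightarrow> bij_betw f ?C ?C)"
  proof
    assume e: "{f \<in> module_hom A X X. bij_betw f ?C ?C} = module_hom A X X - {?z}"
    have id: "(\<lambda>x\<in>?C. x) \<in> module_hom A X X" by (rule restrict_hom[OF X]) (rule linI, auto)
    have "bij_betw (\<lambda>x\<in>?C. x) ?C ?C" by (simp add: bij_betw_def inj_on_def)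
    then have "(\<lambda>x\<in>?C. x) \<noteq> ?z" using e id by blast
    then have "?C \<noteq> {\<zero>\<^bsub>X\<^esub>}" by (metis restrict_ext singletonD)
    moreover have "bij_betw f ?C ?C" if f: "lin A X X f" "f ` ?C \<noteq> {\<zero>\<^bsub>X\<^esub>}" for f
    proof -
      have h: "restrict f ?C \<in> module_hom A X X" by (rule restrict_hom[OF X f(1)])
      have "restrict f ?C ` ?C = f ` ?C" by (rule image_cong) simp_all
      then have "restrict f ?C \<noteq> ?z" using nonzero_hom_iff[OF X X h] f(2) by simp
      then have "bij_betw (restrict f ?C) ?C ?C" using e h by blast
      then show ?thesis using bij_betw_cong[of ?C "restrict f ?C" f] by simp
    qed
    ultimately show "?C \<noteq> {\<zero>\<^bsub>X\<^esub>} \<and> (\<forall>f. lin A X X f \<longrightarrow> f ` ?C \<noteq> {\<zero>\<^bsub>X\<^esub>} \<longrightarrow> bij_betw f ?C ?C)" by blast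
  next
    assume b: "?C \<noteq> {\<zero>\<^bsub>X\<^esub>} \<and> (\<forall>f. lin A X X f \<longrightarrow> f ` ?C \<noteq> {\<zero>\<^bsub>X\<^esub>} \<longrightarrow> bij_betw f ?C ?C)"
    have "bij_betw f ?C ?C \<longleftrightarrow> f \<noteq> ?z" if f: "f \<in> module_hom A X X" for f
    proof -
      have fl: "lin A X X f" using f module_hom_lin by blast
      have "bij_betw f ?C ?C \<longleftrightarrow> f ` ?C \<noteq> {\<zero>\<^bsub>X\<^esub>}" using b fl unfolding bij_betw_def by metis
      then show ?thesis using nonzero_hom_iff[OF X X f] by blast
    qed
    then show "{f \<in> module_hom A X X. bij_betw f ?C ?C} = module_hom A X X - {?z}" by blast
  qed
  also have "\<dots> \<longleftrightarrow> E.brick (cl X)" using brick_cl[OF True] by blast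
  finally show ?thesis using True by blast
qed

end

text \<open>An element without predecessors in B receives the largest index and is removed; the
  relation then always leads to smaller indices.\<close>

lemma acyclic_enumeration:
  assumes "finite B" and acyc: "acyclic R"
  shows "\<exists>(m :: nat) X. B = X ` {1..m} \<and> inj_on X {1..m} \<and>
    (\<forall>i \<in> {1..m}. \<forall>j \<in> {1..m}. (X i, X j) \<in> R \<longrightarrow> j < i)"
  using assms(1)
proof (induction "card B" arbitrary: B)
  case 0
  then show ?case by (intro exI[of _ 0] exI[of _ undefined]) auto
next
  case (Suc m)
  let ?R = "R \<inter> B \<times> B"
  have "wf ?R"
  proof (rule finite_acyclic_wf)
    show "finite ?R" using Suc.prems by simp
    show "acyclic ?R" using acyc acyclic_subset by blast
  qed
  moreover obtain b where "b \<in> B" using Suc.hyps(2) Suc.prems by (metis card.empty ex_in_conv nat.distinct(1))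
  ultimately obtain x where x: "x \<in> B" "\<And>y. (y, x) \<in> ?R \<Longrightarrow> y \<notin> B" by (rule wfE_min) blast
  have "m = card (B - {x})" using Suc.hyps(2) Suc.prems x(1) by simp
  from Suc.hyps(1)[OF this] Suc.prems obtain m' :: nat and X where
    X: "B - {x} = X ` {1..m'}" "inj_on X {1..m'}"
      "\<And>i j. i \<in> {1..m'} \<Longrightarrow> j \<in> {1..m'} \<Longrightarrow> (X i, X j) \<in> R \<Longrightarrow> j < i" by blast
  let ?X = "X(Suc m' := x)"
  have eq: "?X i = X i" if "i \<in> {1..m'}" for i using that by auto
  have s: "{1..Suc m'} = insert (Suc m') {1..m'}" by auto
  have im: "?X ` {1..m'} = B - {x}" unfolding X(1) by (rule image_cong[OF refl eq])
  have in_B: "?X i \<in> B" if "i \<in> {1..Suc m'}" for i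
    using that im x(1) unfolding s by auto
  show ?case
  proof (intro exI[of _ "Suc m'"] exI[of _ ?X] conjI ballI impI)
    show "B = ?X ` {1..Suc m'}" unfolding s image_insert im using x(1) by auto
    have "inj_on ?X {1..m'}" using X(2) by (subst inj_on_cong[OF eq])
    moreover have "?X (Suc m') \<notin> ?X ` ({1..m'} - {Suc m'})"
    proof -
      have "{1..m'} - {Suc m'} = {1..m'}" by auto
      then have "?X ` ({1..m'} - {Suc m'}) = B - {x}" using im by (simp only:)
      moreover have "?X (Suc m') = x" by simp
      ultimately show ?thesis by blast
    qed
    ultimately show "inj_on ?X {1..Suc m'}" unfolding s inj_on_insert by blast
    fix i j assume ij: "i \<in> {1..Suc m'}" "j \<in> {1..Suc m'}" "(?X i, ?X j) \<in> R"
    show "j < i"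
    proof (cases "j = Suc m'")
      case True
      then have "(?X i, x) \<in> ?R" using ij in_B[OF ij(1)] x(1) by simp
      then show ?thesis using x(2) in_B[OF ij(1)] by blast
    next
      case False
      then have j: "j \<in> {1..m'}" using ij(2) unfolding s by blast
      show ?thesis
      proof (cases "i = Suc m'")
        case True
        then show ?thesis using j by simp
      next
        case False
        then have i: "i \<in> {1..m'}" using ij(1) unfolding s by blast
        show ?thesis using X(3)[OF i j] ij(3) unfolding eq[OF i] eq[OF j] .
      qed
    qed
  qed
qed

context fin_dim_algebra
begin

lemma brick_ex: "E.brick c \<Longrightarrow> \<exists>X \<in> bricks A. cl X = c"
proof -
  assume c: "E.brick c"
  then have "c \<in> objs" unfolding E.brick_def by (rule conjunct1)
  then obtain X :: "('a, nat \<Rightarrow> 'k) module" where X: "fgm A X" "c = cl X"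
    using objsE by blast
  have "X \<in> bricks A" using X c bricks_iff by simp
  then show ?thesis using X(2)[symmetric] by (rule bexI[rotated])
qed

lemma brick_classes_eq: "brick_classes A = {c. E.brick c}"
proof -
  let ?r = "{(X, Y). X \<in> bricks A \<and> Y \<in> bricks A \<and> isomorphic_modules A X Y}"
  have "?r `` {X} = cl X" if X: "X \<in> bricks A" for X
  proof -
    have X': "fgm A X" "E.brick (cl X)" using X bricks_iff by blast+
    have "Y \<in> bricks A" if "Y \<in> mod_objects A" "isomorphic_modules A X Y" for Y
      using that X' cl_eq_iff[OF X'(1)] bricks_iff mod_objects_iff by metis
    then show ?thesis unfolding cl_def using X unfolding bricks_def by blast
  qed
  then have "brick_classes A = cl ` bricks A" unfolding brick_classes_def quotient_def by auto
  also have "\<dots> = {c. E.brick c}" using brick_ex bricks_iff by blast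
  finally show ?thesis .
qed

lemma representatives_bij:
  assumes B: "brick_representatives A B"
  shows "bij_betw cl B {c. E.brick c}"
  unfolding bij_betw_def
proof
  have sub: "B \<subseteq> bricks A" and ex1: "\<And>X. X \<in> bricks A \<Longrightarrow> \<exists>!Y. Y \<in> B \<and> isomorphic_modules A X Y"
    using B unfolding brick_representatives_def by blast+
  have f: "fgm A X" if "X \<in> bricks A" for X using that bricks_iff by blast
  show "inj_on cl B"
  proof (rule inj_onI)
    fix X Y assume XY: "X \<in> B" "Y \<in> B" "cl X = cl Y"
    have fX: "fgm A X" "fgm A Y" using f sub XY by blast+
    have "isomorphic_modules A X X" "isomorphic_modules A X Y"
      using iso_refl[OF fgmD[OF fX(1)]] cl_eq_iff[OF fX] XY(3) by blast+
    then show "X = Y" using ex1[of X] sub XY by blast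
  qed
  show "cl ` B = {c. E.brick c}"
  proof (intro equalityI subsetI)
    show "c \<in> {c. E.brick c}" if "c \<in> cl ` B" for c using that sub bricks_iff by blast
    fix c assume "c \<in> {c. E.brick c}"
    then obtain X where X: "X \<in> bricks A" "cl X = c" using brick_ex by blast
    obtain Y where Y: "Y \<in> B" "isomorphic_modules A X Y" using ex1[OF X(1)] by blast
    have "cl X = cl Y" using cl_eq_iff[OF f[OF X(1)] f] Y sub by blast
    then show "c \<in> cl ` B" using X Y by blast
  qed
qed

text \<open>Between isomorphic bricks every nonzero map is invertible: followed by an isomorphism
  back, it is a nonzero endomorphism of a brick. Hence the steps of a cycle are exactly the nonzero
  maps between different classes.\<close>

lemma cycle_step:
  assumes X: "X \<in> bricks A" and Y: "Y \<in> bricks A"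
  shows "(\<exists>f \<in> module_hom A X Y. f \<noteq> (\<lambda>x\<in>carrier X. \<zero>\<^bsub>Y\<^esub>) \<and> f \<notin> module_iso A X Y) \<longleftrightarrow>
    cl X \<noteq> cl Y \<and> E.nzmap (cl X) (cl Y)"
proof -
  have fX: "fgm A X" and fY: "fgm A Y" and bX: "E.brick (cl X)" using X Y bricks_iff by blast+
  note lX = fgmD[OF fX] and lY = fgmD[OF fY]
  show ?thesis
  proof
    assume "\<exists>f \<in> module_hom A X Y. f \<noteq> (\<lambda>x\<in>carrier X. \<zero>\<^bsub>Y\<^esub>) \<and> f \<notin> module_iso A X Y"
    then obtain f where f: "f \<in> module_hom A X Y" "f \<noteq> (\<lambda>x\<in>carrier X. \<zero>\<^bsub>Y\<^esub>)" "f \<notin> module_iso A X Y" by blast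
    have fl: "lin A X Y f" using f(1) module_hom_lin by blast
    have fn: "f ` carrier X \<noteq> {\<zero>\<^bsub>Y\<^esub>}" using nonzero_hom_iff[OF lX lY f(1)] f(2) by blast
    have fc: "f ` carrier X \<subseteq> carrier Y" using linD(1)[OF fl] by blast
    have "E.nzmap (cl X) (cl Y)" using nzmap_cl[OF fX fY] fl fn by blast
    moreover have "cl X \<noteq> cl Y"
    proof
      assume "cl X = cl Y"
      then have "isomorphic_modules A Y X" using cl_eq_iff[OF fY fX] by blast
      then obtain g where g: "lin A Y X g" "bij_betw g (carrier Y) (carrier X)" using isomorphic_iff[OF lY] by blast
      have gi: "inj_on g (carrier Y)" and gim: "g ` carrier Y = carrier X" using g(2) by (simp_all add: bij_betw_def)
      have "(\<lambda>x. g (f x)) ` carrier X \<noteq> {\<zero>\<^bsub>X\<^esub>}"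
      proof
        assume e: "(\<lambda>x. g (f x)) ` carrier X = {\<zero>\<^bsub>X\<^esub>}"
        have "f x = \<zero>\<^bsub>Y\<^esub>" if "x \<in> carrier X" for x
        proof -
          have "g (f x) = \<zero>\<^bsub>X\<^esub>" using e that by blast
          also have "\<dots> = g \<zero>\<^bsub>Y\<^esub>" by (rule lin_zero[OF lY lX g(1), symmetric])
          finally show ?thesis
            using inj_onD[OF gi] linD(1)[OF fl that]
              left_module.submoduleD(3)[OF lY left_module.submodule_carrier[OF lY]] by blast
        qed
        moreover have "carrier X \<noteq> {}"
          using left_module.submoduleD(3)[OF lX left_module.submodule_carrier[OF lX]] by blast
        ultimately have "f ` carrier X = {\<zero>\<^bsub>Y\<^esub>}" by (auto simp: image_iff)
        then show False using fn by simp
      qed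
      then have b: "bij_betw (\<lambda>x. g (f x)) (carrier X) (carrier X)"
        using bX brick_cl[OF fX] lin_comp[OF fl g(1)] by blast
      have "inj_on f (carrier X)" using b unfolding bij_betw_def inj_on_def by metis
      moreover have "f ` carrier X = carrier Y"
      proof
        show "carrier Y \<subseteq> f ` carrier X"
        proof
          fix y assume y: "y \<in> carrier Y"
          then have "g y \<in> (\<lambda>x. g (f x)) ` carrier X" using b g(2) linD(1)[OF g(1)] unfolding bij_betw_def by blast
          then obtain x where x: "x \<in> carrier X" "g y = g (f x)" by blast
          then have "y = f x" using inj_onD[OF gi, OF x(2)] y linD(1)[OF fl x(1)] by blast
          then show "y \<in> f ` carrier X" using x by blast
        qed
      qed (rule fc)
      ultimately show False using f(1,3) unfolding module_iso_def bij_betw_def by blast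
    qed
    ultimately show "cl X \<noteq> cl Y \<and> E.nzmap (cl X) (cl Y)" by blast
  next
    assume a: "cl X \<noteq> cl Y \<and> E.nzmap (cl X) (cl Y)"
    then obtain f where f: "lin A X Y f" "f ` carrier X \<noteq> {\<zero>\<^bsub>Y\<^esub>}" using nzmap_cl[OF fX fY] by blast
    have h: "restrict f (carrier X) \<in> module_hom A X Y" by (rule restrict_hom[OF lX f(1)])
    have "restrict f (carrier X) ` carrier X = f ` carrier X" by (rule image_cong) simp_all
    then have n: "restrict f (carrier X) \<noteq> (\<lambda>x\<in>carrier X. \<zero>\<^bsub>Y\<^esub>)" using nonzero_hom_iff[OF lX lY h] f(2) by simp
    have "restrict f (carrier X) \<notin> module_iso A X Y"
      using a cl_eq_iff[OF fX fY] unfolding isomorphic_modules_def by blast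
    then show "\<exists>f \<in> module_hom A X Y. f \<noteq> (\<lambda>x\<in>carrier X. \<zero>\<^bsub>Y\<^esub>) \<and> f \<notin> module_iso A X Y"
      using h n by blast
  qed
qed

definition brick_rel :: "(('a, nat \<Rightarrow> 'k) module set \<times> ('a, nat \<Rightarrow> 'k) module set) set" where
  "brick_rel = {(c, d). E.brick c \<and> E.brick d \<and> c \<noteq> d \<and> E.nzmap c d}"

lemma cycle_of_trancl:
  assumes "(c, c) \<in> brick_rel\<^sup>+"
  shows "\<exists>Xs fs. brick_cycle A Xs fs"
proof -
  obtain n where n: "n > 0" "(c, c) \<in> brick_rel ^^ n" using assms trancl_power by blast
  then obtain p where p: "p 0 = c" "p n = c" "\<And>i. i < n \<Longrightarrow> (p i, p (Suc i)) \<in> brick_rel"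
    unfolding relpow_fun_conv by blast
  have br: "E.brick (p i)" if "i \<le> n" for i
  proof (cases "i = n")
    case True
    then show ?thesis using p(1,2) p(3)[OF n(1)] unfolding brick_rel_def by simp
  next
    case False
    then show ?thesis using p(3)[of i] that unfolding brick_rel_def by simp
  qed
  define r where "r d = (SOME X. X \<in> bricks A \<and> cl X = d)" for d
  have r: "r d \<in> bricks A \<and> cl (r d) = d" if "E.brick d" for d
    unfolding r_def using brick_ex[OF that] by (rule someI2_bex) simp
  have "\<forall>i. \<exists>f. i < n \<longrightarrow> f \<in> module_hom A (r (p i)) (r (p (Suc i))) \<and>
      f \<noteq> (\<lambda>x\<in>carrier (r (p i)). \<zero>\<^bsub>r (p (Suc i))\<^esub>) \<and> f \<notin> module_iso A (r (p i)) (r (p (Suc i)))"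
  proof
    fix i
    show "\<exists>f. i < n \<longrightarrow> f \<in> module_hom A (r (p i)) (r (p (Suc i))) \<and>
      f \<noteq> (\<lambda>x\<in>carrier (r (p i)). \<zero>\<^bsub>r (p (Suc i))\<^esub>) \<and> f \<notin> module_iso A (r (p i)) (r (p (Suc i)))"
    proof (cases "i < n")
      case True
      then have b: "r (p i) \<in> bricks A" "r (p (Suc i)) \<in> bricks A"
        "cl (r (p i)) = p i" "cl (r (p (Suc i))) = p (Suc i)" using r br by simp_all
      have "p i \<noteq> p (Suc i) \<and> E.nzmap (p i) (p (Suc i))" using p(3)[OF True] unfolding brick_rel_def by blast
      then show ?thesis using cycle_step[OF b(1,2)] unfolding b(3,4) by blast
    qed simp
  qed
  from choice[OF this] obtain h where h: "\<And>i. i < n \<Longrightarrow> h i \<in> module_hom A (r (p i)) (r (p (Suc i))) \<and>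
      h i \<noteq> (\<lambda>x\<in>carrier (r (p i)). \<zero>\<^bsub>r (p (Suc i))\<^esub>) \<and> h i \<notin> module_iso A (r (p i)) (r (p (Suc i)))" by blast
  let ?Xs = "map (\<lambda>i. r (p i)) [0..<Suc n]" and ?fs = "map h [0..<n]"
  have nth: "?Xs ! i = r (p i)" if "i \<le> n" for i using that by (simp del: upt_Suc)
  have "brick_cycle A ?Xs ?fs"
    unfolding brick_cycle_def
  proof (intro conjI allI impI)
    show "?fs \<noteq> []" using n(1) by simp
    show "length ?Xs = Suc (length ?fs)" by simp
    show "set ?Xs \<subseteq> bricks A" using r br by (auto simp del: upt_Suc)
    have "hd ?Xs = r c" using p(1) by (simp add: hd_map del: upt_Suc)
    moreover have "last ?Xs = r c" using p(2) by simp
    moreover have "r c \<in> bricks A" using r br[of 0] p(1) by simp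
    then have "fgm A (r c)" using bricks_iff by blast
    ultimately show "isomorphic_modules A (hd ?Xs) (last ?Xs)" using iso_refl[OF fgmD] by simp
    fix j assume "j < length ?fs"
    then have j: "j < n" by simp
    have e: "?Xs ! j = r (p j)" "?Xs ! Suc j = r (p (Suc j))" "?fs ! j = h j" using nth j by simp_all
    show "?fs ! j \<in> module_hom A (?Xs ! j) (?Xs ! Suc j)"
      "?fs ! j \<noteq> (\<lambda>x\<in>carrier (?Xs ! j). \<zero>\<^bsub>?Xs ! Suc j\<^esub>)"
      "?fs ! j \<notin> module_iso A (?Xs ! j) (?Xs ! Suc j)"
      unfolding e using h[OF j] by blast+
  qed
  then show ?thesis by blast
qed

lemma trancl_of_cycle:
  assumes "brick_cycle A Xs fs"
  shows "\<exists>c. (c, c) \<in> brick_rel\<^sup>+"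
proof -
  let ?n = "length fs"
  have c: "fs \<noteq> []" "length Xs = Suc ?n" "set Xs \<subseteq> bricks A" "isomorphic_modules A (hd Xs) (last Xs)"
    "\<And>j. j < ?n \<Longrightarrow> fs ! j \<in> module_hom A (Xs ! j) (Xs ! Suc j) \<and>
        fs ! j \<noteq> (\<lambda>x\<in>carrier (Xs ! j). \<zero>\<^bsub>Xs ! Suc j\<^esub>) \<and> fs ! j \<notin> module_iso A (Xs ! j) (Xs ! Suc j)"
    using assms unfolding brick_cycle_def by blast+
  have b: "Xs ! j \<in> bricks A" if "j \<le> ?n" for j
    using c(2,3) that nth_mem[of j Xs] by auto
  have step: "(cl (Xs ! j), cl (Xs ! Suc j)) \<in> brick_rel" if j: "j < ?n" for j
  proof -
    have "Xs ! j \<in> bricks A" "Xs ! Suc j \<in> bricks A" using b j by simp_all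
    then show ?thesis using cycle_step c(5)[OF j] bricks_iff unfolding brick_rel_def by blast
  qed
  have tr: "j \<le> ?n \<Longrightarrow> j > 0 \<Longrightarrow> (cl (Xs ! 0), cl (Xs ! j)) \<in> brick_rel\<^sup>+" for j
  proof (induction j)
    case (Suc j)
    then have s: "(cl (Xs ! j), cl (Xs ! Suc j)) \<in> brick_rel" using step[of j] by simp
    show ?case
    proof (cases "j = 0")
      case True
      then show ?thesis using s by blast
    next
      case False
      then have "(cl (Xs ! 0), cl (Xs ! j)) \<in> brick_rel\<^sup>+" using Suc by simp
      then show ?thesis using s by (rule trancl_into_trancl)
    qed
  qed simp
  have ne: "Xs \<noteq> []" using c(2) by auto
  have "hd Xs = Xs ! 0" "last Xs = Xs ! ?n" using c(2) ne by (simp_all add: hd_conv_nth last_conv_nth)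
  then have "isomorphic_modules A (Xs ! 0) (Xs ! ?n)" using c(4) by simp
  moreover have "fgm A (Xs ! 0)" "fgm A (Xs ! ?n)" using b[of 0] b[of ?n] bricks_iff by auto
  ultimately have "cl (Xs ! 0) = cl (Xs ! ?n)" using cl_eq_iff[of "Xs ! 0" "Xs ! ?n"] by blast
  then show ?thesis using tr[of ?n] c(1) by auto
qed

lemma brick_directed_iff: "brick_directed A \<longleftrightarrow> acyclic brick_rel"
  unfolding brick_directed_def acyclic_def using cycle_of_trancl trancl_of_cycle by blast

end

section \<open>Identification of the Newton polytope and conclusion\<close>

locale algebra_with_simples = fin_dim_algebra K A
  for K :: "('k, 'q) ring_scheme" (structure) and A :: "('k, 'a) module" (structure) +
  fixes S :: "'n::finite \<Rightarrow> ('a, nat \<Rightarrow> 'k) module"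
  assumes simples: "simple_representatives A S"
begin

lemma S_fgm: "fgm A (S i)" and S_simple: "simple_module A (S i)"
  using simples mod_objects_iff unfolding simple_representatives_def by blast+

lemma S_unique: "fgm A (X :: ('a, nat \<Rightarrow> 'k) module) \<Longrightarrow> simple_module A X \<Longrightarrow> \<exists>!i. isomorphic_modules A X (S i)"
  using simples mod_objects_iff unfolding simple_representatives_def by blast

sublocale C: exact_structure_simples objs seq Zcl "\<lambda>i. cl (S i)"
proof unfold_locales
  fix c
  show "E.simple c \<longleftrightarrow> c \<in> range (\<lambda>i. cl (S i))"
  proof
    assume c: "E.simple c"
    then have "c \<in> objs" unfolding E.simple_def by blast
    then obtain X :: "('a, nat \<Rightarrow> 'k) module" where X: "fgm A X" "c = cl X" using objsE by blast
    then have "simple_module A X" using c simple_cl by blast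
    then obtain i where "isomorphic_modules A X (S i)" using S_unique[OF X(1)] by blast
    then have "cl X = cl (S i)" using cl_eq_iff[OF X(1) S_fgm] by blast
    then show "c \<in> range (\<lambda>i. cl (S i))" using X(2) by blast
  next
    assume "c \<in> range (\<lambda>i. cl (S i))"
    then show "E.simple c" using simple_cl[OF S_fgm] S_simple by blast
  qed
next
  show "inj (\<lambda>i. cl (S i))"
  proof (rule injI)
    fix i j assume "cl (S i) = cl (S j)"
    then have "isomorphic_modules A (S i) (S j)" using cl_eq_iff[OF S_fgm S_fgm] by blast
    moreover have "isomorphic_modules A (S i) (S i)" by (rule iso_refl[OF fgmD[OF S_fgm]])
    ultimately show "i = j" using S_unique[OF S_fgm S_simple] by blast
  qed
qed

text \<open>Every composition series in the concrete sense computes \<open>C.cs\<close>, so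
  uniqueness there makes the arbitrary choice in \<open>K0_class\<close> harmless.\<close>

lemma cs_composition_series:
  fixes X :: "('a, 'x) module"
  assumes X: "fgm A X" and Ls: "composition_series A X Ls"
  shows "k < length Ls \<Longrightarrow> C.cs (cl (X\<lparr>carrier := Ls ! k\<rparr>)) k
    (\<chi> i. real (card {j. j < k \<and> isomorphic_modules A (subquotient X (Ls ! j) (Ls ! Suc j)) (S i)}))"
proof (induction k)
  have c: "Ls \<noteq> []" "hd Ls = {\<zero>\<^bsub>X\<^esub>}" "\<And>L. L \<in> set Ls \<Longrightarrow> submodule L A X"
    "\<And>j. Suc j < length Ls \<Longrightarrow> Ls ! j \<subseteq> Ls ! Suc j \<and> simple_module A (subquotient X (Ls ! j) (Ls ! Suc j))"
    using Ls unfolding composition_series_def by blast+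
  {
    case 0
    have "Ls ! 0 = {\<zero>\<^bsub>X\<^esub>}" using c(1,2) by (simp add: hd_conv_nth)
    moreover have "submodule (Ls ! 0) A X" using c(3) nth_mem 0 by blast
    ultimately have "cl (X\<lparr>carrier := Ls ! 0\<rparr>) = Zcl" using cl_sub_zero[OF X] by blast
    moreover have "(\<chi> i. real (card {j. j < 0 \<and> isomorphic_modules A (subquotient X (Ls ! j) (Ls ! Suc j)) (S i)})) = (0 :: real ^ 'n)"
      by (simp add: vec_eq_iff)
    ultimately show ?case using C.cs_zero by simp
  next
    case (Suc k)
    let ?sq = "\<lambda>j. subquotient X (Ls ! j) (Ls ! Suc j)"
    let ?v = "\<lambda>k. (\<chi> i. real (card {j. j < k \<and> isomorphic_modules A (?sq j) (S i)})) :: real ^ 'n"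
    have s1: "submodule (Ls ! k) A X" "submodule (Ls ! Suc k) A X" using c(3) nth_mem Suc.prems by simp_all
    interpret X: left_module A X by (rule fgmD[OF X])
    let ?Y = "X\<lparr>carrier := Ls ! Suc k\<rparr>"
    have Y: "fgm A ?Y" by (rule fgm_submodule[OF X s1(2)])
    have s2: "submodule (Ls ! k) A ?Y" using X.submodule_sub_iff[OF s1(2)] s1(1) c(4)[OF Suc.prems] by blast
    have sq: "fgm A (?sq k)" unfolding subquotient_def by (rule fgm_quotient[OF Y s2])
    have seq: "seq (cl (X\<lparr>carrier := Ls ! k\<rparr>)) (cl ?Y) (cl (?sq k))"
      using seqI[OF Y s2] unfolding subquotient_def by simp
    have "E.simple (cl (?sq k))" using simple_cl[OF sq] c(4)[OF Suc.prems] by blast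
    then obtain i0 where i0: "cl (?sq k) = cl (S i0)" using C.simple_iff by blast
    have iso: "isomorphic_modules A (?sq k) (S i) \<longleftrightarrow> i = i0" for i
      using cl_eq_iff[OF sq S_fgm] i0 injD[OF C.inj_s] by metis
    have "C.cs (cl ?Y) (Suc k) (?v k + axis i0 1)"
      using C.cs_step[OF Suc.IH] seq Suc.prems unfolding i0 by simp
    moreover have "?v (Suc k) = ?v k + axis i0 1"
    proof -
      have "{j. j < Suc k \<and> isomorphic_modules A (?sq j) (S i)} =
          (if i = i0 then insert k {j. j < k \<and> isomorphic_modules A (?sq j) (S i)}
           else {j. j < k \<and> isomorphic_modules A (?sq j) (S i)})" for i
        using iso[of i] by (auto simp: less_Suc_eq)
      then show ?thesis by (simp add: vec_eq_iff axis_def)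
    qed
    ultimately show ?case by simp
  }
qed

lemma composition_series_ex:
  assumes "C.cs c n v"
  shows "\<And>X :: ('a, 'x) module. fgm A X \<Longrightarrow> cl X = c \<Longrightarrow> \<exists>Ls. composition_series A X Ls"
  using assms
proof (induction rule: C.cs.induct)
  case cs_zero
  then have c: "carrier X = {\<zero>\<^bsub>X\<^esub>}" using cl_zero_iff by blast
  then have "submodule {\<zero>\<^bsub>X\<^esub>} A X" using left_module.submodule_zero[OF fgmD[OF cs_zero(1)]] by blast
  then have "composition_series A X [{\<zero>\<^bsub>X\<^esub>}]" unfolding composition_series_def using c by simp
  then show ?case by blast
next
  case (cs_step U n v M i)
  interpret X: left_module A X by (rule fgmD[OF cs_step.prems(1)])
  note X = cs_step.prems(1)
  obtain L where L: "submodule L A X" "U = cl (X\<lparr>carrier := L\<rparr>)" "cl (S i) = cl (quotient_module X L)"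
    using cs_step.hyps(2) unfolding cs_step.prems(2)[symmetric] seq_iff[OF X] by blast
  have Y: "fgm A (X\<lparr>carrier := L\<rparr>)" by (rule fgm_submodule[OF X L(1)])
  obtain Ls where Ls: "composition_series A (X\<lparr>carrier := L\<rparr>) Ls" using cs_step.IH[OF Y] L(2) by blast
  have c: "Ls \<noteq> []" "hd Ls = {\<zero>\<^bsub>X\<^esub>}" "last Ls = L" "\<And>N. N \<in> set Ls \<Longrightarrow> submodule N A X"
    "\<And>j. Suc j < length Ls \<Longrightarrow> Ls ! j \<subseteq> Ls ! Suc j \<and> simple_module A (subquotient X (Ls ! j) (Ls ! Suc j))"
    using Ls X.submodule_sub_iff[OF L(1)] unfolding composition_series_def by (auto simp: subquotient_def)
  have Xc: "X\<lparr>carrier := carrier X\<rparr> = X" by (cases X) simp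
  have simple: "simple_module A (quotient_module X L)"
    using simple_cl[OF fgm_quotient[OF X L(1)]] simple_cl[OF S_fgm[of i]] S_simple L(3) by metis
  have "composition_series A X (Ls @ [carrier X])"
    unfolding composition_series_def
  proof (intro conjI ballI allI impI)
    show "hd (Ls @ [carrier X]) = {\<zero>\<^bsub>X\<^esub>}" using c(1,2) by simp
    show "submodule N A X" if "N \<in> set (Ls @ [carrier X])" for N using that c(4) X.submodule_carrier by auto
    fix j assume j: "Suc j < length (Ls @ [carrier X])"
    have "(Ls @ [carrier X]) ! j \<subseteq> (Ls @ [carrier X]) ! Suc j \<and>
        simple_module A (subquotient X ((Ls @ [carrier X]) ! j) ((Ls @ [carrier X]) ! Suc j))"
    proof (cases "Suc j < length Ls")
      case True
      then show ?thesis using c(5)[OF True] by (simp add: nth_append)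
    next
      case False
      then have e: "Suc j = length Ls" using j by simp
      then have "Ls ! j = L" using c(1,3) by (metis diff_Suc_1 last_conv_nth)
      then show ?thesis
        using e simple X.submoduleD(1)[OF L(1)] by (simp add: nth_append subquotient_def Xc)
    qed
    then show "(Ls @ [carrier X]) ! j \<subseteq> (Ls @ [carrier X]) ! Suc j"
      "simple_module A (subquotient X ((Ls @ [carrier X]) ! j) ((Ls @ [carrier X]) ! Suc j))" by blast+
  qed auto
  then show ?case by blast
qed

lemma K0_class_cls:
  fixes X :: "('a, 'x) module"
  assumes X: "fgm A X"
  shows "K0_class A S X = C.cls (cl X)"
proof -
  define Ls where "Ls = (SOME Ls. composition_series A X Ls)"
  obtain n v where "C.cs (cl X) n v" using C.cs_ex cl_objs[OF X] by blast
  from composition_series_ex[OF this X refl] have Ls: "composition_series A X Ls"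
    unfolding Ls_def by (rule someI_ex)
  have c: "Ls \<noteq> []" "last Ls = carrier X" using Ls unfolding composition_series_def by blast+
  \<comment> \<open>A list of submodules has one factor fewer than entries.\<close>
  let ?k = "length Ls - 1"
  have k: "?k < length Ls" "Ls ! ?k = carrier X" using c by (simp_all add: last_conv_nth)
  have "C.cls (cl X) = (\<chi> i. real (card {j. j < ?k \<and> isomorphic_modules A (subquotient X (Ls ! j) (Ls ! Suc j)) (S i)}))"
    using C.cs_cls[OF cs_composition_series[OF X Ls k(1)]] unfolding k(2) cl_sub_whole .
  moreover have "j < ?k \<longleftrightarrow> Suc j < length Ls" for j by auto
  ultimately show ?thesis unfolding K0_class_def Let_def Ls_def[symmetric] by simp
qed

lemma newton_polytope_eq:
  fixes X :: "('a, 'x) module"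
  assumes X: "fgm A X"
  shows "newton_polytope A S X = convex hull C.sub_classes (cl X)"
proof -
  have "{K0_class A S (X\<lparr>carrier := L\<rparr>) | L. submodule L A X} = C.sub_classes (cl X)"
    unfolding C.sub_classes_def seq_iff[OF X] using K0_class_cls[OF fgm_submodule[OF X]] by auto metis
  then show ?thesis unfolding newton_polytope_def by simp
qed

text \<open>A chain is a linear extension of the acyclic relation on bricks. Conversely, the index
  in a chain strictly decreases along the relation, which excludes cycles.\<close>

lemma brick_chain_iff:
  assumes fin: "finite {c. E.brick c}"
  shows "brick_directed A \<longleftrightarrow> (\<exists>m X. brick_chain objs seq Zcl (\<lambda>i. cl (S i)) m X)"
proof
  assume "brick_directed A"
  then have "acyclic brick_rel" using brick_directed_iff by blast
  from acyclic_enumeration[OF fin this] obtain m :: nat and X where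
    enum: "{c. E.brick c} = X ` {1..m} \<and> inj_on X {1..m} \<and>
      (\<forall>i \<in> {1..m}. \<forall>j \<in> {1..m}. (X i, X j) \<in> brick_rel \<longrightarrow> j < i)" by (elim exE)
  have X: "{c. E.brick c} = X ` {1..m}" "inj_on X {1..m}"
    by (rule enum[THEN conjunct1], rule enum[THEN conjunct2, THEN conjunct1])
  have X3: "j < i" if "i \<in> {1..m}" "j \<in> {1..m}" "(X i, X j) \<in> brick_rel" for i j
    using bspec[OF bspec[OF enum[THEN conjunct2, THEN conjunct2] that(1)] that(2)] that(3) by (rule mp)
  have b: "E.brick (X i)" if "i \<in> {1..m}" for i using that X(1) by blast
  have "brick_chain objs seq Zcl (\<lambda>i. cl (S i)) m X"
  proof unfold_locales
    show "E.brick c \<longleftrightarrow> c \<in> X ` {1..m}" for c using X(1) by blast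
    show "inj_on X {1..m}" by (rule X(2))
    fix i j assume ij: "i \<in> {1..m}" "j \<in> {1..m}" "E.nzmap (X i) (X j)"
    show "j \<le> i"
    proof (cases "X i = X j")
      case True
      then have "i = j" using inj_onD[OF X(2), OF True ij(1,2)] by simp
      then show ?thesis by simp
    next
      case False
      then have "(X i, X j) \<in> brick_rel" unfolding brick_rel_def using b ij by blast
      then show ?thesis using X3[OF ij(1,2)] by simp
    qed
  qed
  then show "\<exists>m X. brick_chain objs seq Zcl (\<lambda>i. cl (S i)) m X" by blast
next
  assume "\<exists>m X. brick_chain objs seq Zcl (\<lambda>i. cl (S i)) m X"
  then obtain m X where ch: "brick_chain objs seq Zcl (\<lambda>i. cl (S i)) m X" by blast
  interpret ch: brick_chain objs seq Zcl "\<lambda>i. cl (S i)" m X by (rule ch)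
  define idx where "idx c = (SOME i. i \<in> {1..m} \<and> X i = c)" for c
  have idx: "idx c \<in> {1..m} \<and> X (idx c) = c" if "E.brick c" for c
  proof -
    have "c \<in> X ` {1..m}" using that ch.bricks[of c] by simp
    then obtain i where "i \<in> {1..m}" "X i = c" by blast
    then show ?thesis unfolding idx_def by (intro someI[of "\<lambda>i. i \<in> {1..m} \<and> X i = c" i]) blast
  qed
  have lt: "idx d < idx c" if "(c, d) \<in> brick_rel" for c d
  proof -
    have cd: "E.brick c" "E.brick d" "c \<noteq> d" "E.nzmap c d" using that unfolding brick_rel_def by blast+
    have "idx d \<le> idx c" using ch.dir[of "idx c" "idx d"] idx[OF cd(1)] idx[OF cd(2)] cd(4) by simp
    moreover have "idx d \<noteq> idx c" using idx[OF cd(1)] idx[OF cd(2)] cd(3) by metis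
    ultimately show ?thesis by simp
  qed
  have "idx d < idx c" if "(c, d) \<in> brick_rel\<^sup>+" for c d
    using that by (induction rule: trancl_induct) (auto dest: lt)
  then show "brick_directed A" unfolding brick_directed_iff acyclic_def by blast
qed

lemma directed_iff_path:
  assumes fin: "finite {c. E.brick c}" and B: "brick_representatives A B"
  shows "brick_directed A \<longleftrightarrow>
    (\<exists>vs. increasing_path (newton_polytope A S (finite_direct_sum B)) vs \<and> indivisible_path vs \<and>
       hd vs = 0 \<and> last vs = K0_class A S (finite_direct_sum B))"
proof -
  note bij = representatives_bij[OF B]
  have finB: "finite B" using bij fin by (simp add: bij_betw_finite)
  have fB: "fgm A X" if "X \<in> B" for X using that B bricks_iff unfolding brick_representatives_def by blast
  let ?D = "\<lambda>B'. cl (finite_direct_sum (B' :: ('a, nat \<Rightarrow> 'k) module set))"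
  have split: "seq (?D B1) (?D (B1 \<union> B2)) (?D B2)" if "B1 \<subseteq> B" "B2 \<subseteq> B" "B1 \<inter> B2 = {}" for B1 B2
    by (rule seq_direct_sum) (use that finB fB in \<open>auto intro: finite_subset\<close>)
  have single: "?D {X} = cl X" if "X \<in> B" for X by (rule cl_direct_sum_single[OF fB[OF that]])
  have M: "fgm A (finite_direct_sum B)" by (rule direct_sum_fgm[OF A.ring_axioms finB fB])
  have goal: "(\<exists>vs. increasing_path (newton_polytope A S (finite_direct_sum B)) vs \<and> indivisible_path vs \<and>
       hd vs = 0 \<and> last vs = K0_class A S (finite_direct_sum B)) \<longleftrightarrow>
     (\<exists>vs. increasing_path (convex hull C.sub_classes (?D B)) vs \<and> indivisible_path vs \<and>
       hd vs = 0 \<and> last vs = C.cls (?D B))"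
    unfolding newton_polytope_eq[OF M] K0_class_cls[OF M] ..
  have "(\<exists>m X. brick_chain objs seq Zcl (\<lambda>i. cl (S i)) m X) \<longleftrightarrow>
     (\<exists>vs. increasing_path (convex hull C.sub_classes (?D B)) vs \<and> indivisible_path vs \<and>
       hd vs = 0 \<and> last vs = C.cls (?D B))"
  proof
    assume "\<exists>m X. brick_chain objs seq Zcl (\<lambda>i. cl (S i)) m X"
    then obtain m X where ch: "brick_chain objs seq Zcl (\<lambda>i. cl (S i)) m X" by blast
    interpret ch: brick_chain objs seq Zcl "\<lambda>i. cl (S i)" m X by (rule ch)
    \<comment> \<open>The member of B representing the i-th class, so that partial sums of bricks
      become sums over subsets of B.\<close>
    define Y where "Y i = inv_into B cl (X i)" for i
    have brX: "X i \<in> cl ` B" if "i \<in> {1..m}" for i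
      using ch.X_brick[OF that] bij unfolding bij_betw_def by blast
    have Y: "Y i \<in> B" "cl (Y i) = X i" if "i \<in> {1..m}" for i
      using brX[OF that] unfolding Y_def by (rule inv_into_into, rule f_inv_into_f)
    have Yinj: "inj_on Y {1..m}"
    proof (rule inj_onI)
      fix i j assume ij: "i \<in> {1..m}" "j \<in> {1..m}" "Y i = Y j"
      then have "X i = X j" using Y(2) by metis
      then show "i = j" using inj_onD[OF ch.inj_X] ij by blast
    qed
    have YB: "Y ` {1..m} = B"
    proof
      show "Y ` {1..m} \<subseteq> B" using Y(1) by blast
      show "B \<subseteq> Y ` {1..m}"
      proof
        fix b assume b: "b \<in> B"
        then have "E.brick (cl b)" using bij unfolding bij_betw_def by blast
        then obtain i where i: "i \<in> {1..m}" "cl b = X i" using ch.bricks by blast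
        then have "cl (Y i) = cl b" using Y by simp
        then have "Y i = b" using bij Y(1)[OF i(1)] b unfolding bij_betw_def by (meson inj_onD)
        then show "b \<in> Y ` {1..m}" using i(1) by blast
      qed
    qed
    have subB: "Y ` I \<subseteq> B" if "I \<subseteq> {1..m}" for I using Y(1) that by blast
    have spl: "seq (?D (Y ` I)) (?D (Y ` (I \<union> J))) (?D (Y ` J))" if "I \<subseteq> {1..m}" "J \<subseteq> {1..m}" "I \<inter> J = {}" for I J
      unfolding image_Un
      by (rule split[OF subB[OF that(1)] subB[OF that(2)]])
        (use inj_on_image_Int[OF Yinj that(1,2)] that(3) in simp)
    show "\<exists>vs. increasing_path (convex hull C.sub_classes (?D B)) vs \<and> indivisible_path vs \<and>
       hd vs = 0 \<and> last vs = C.cls (?D B)"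
    proof (rule ch.path_of_chain[where Lo = "\<lambda>i. ?D (Y ` {1..i})" and Up = "\<lambda>i. ?D (Y ` {Suc i..m})"])
      show "seq (?D (Y ` {1..i})) (?D B) (?D (Y ` {Suc i..m}))" if "i \<le> m" for i
      proof -
        have "{1..i} \<union> {Suc i..m} = {1..m}" using that by auto
        then show ?thesis using spl[of "{1..i}" "{Suc i..m}"] that YB by auto
      qed
      show "?D (Y ` {1..0}) = Zcl" by (simp add: cl_direct_sum_empty)
      show "?D (Y ` {1..m}) = ?D B" by (simp only: YB)
      fix i assume i: "i < m"
      have Si: "Suc i \<in> {1..m}" using i by simp
      have one: "?D (Y ` {Suc i}) = X (Suc i)" using single[OF Y(1)[OF Si]] Y(2)[OF Si] by simp
      have "{1..i} \<union> {Suc i} = {1..Suc i}" by auto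
      then show "seq (?D (Y ` {1..i})) (?D (Y ` {1..Suc i})) (X (Suc i))"
        using spl[of "{1..i}" "{Suc i}"] i one by auto
      have "{Suc i} \<union> {Suc (Suc i)..m} = {Suc i..m}" using i by auto
      then show "seq (X (Suc i)) (?D (Y ` {Suc i..m})) (?D (Y ` {Suc (Suc i)..m}))"
        using spl[of "{Suc i}" "{Suc (Suc i)..m}"] i one by auto
    qed
  next
    assume "\<exists>vs. increasing_path (convex hull C.sub_classes (?D B)) vs \<and> indivisible_path vs \<and>
       hd vs = 0 \<and> last vs = C.cls (?D B)"
    then obtain vs where vs: "increasing_path (convex hull C.sub_classes (?D B)) vs" "indivisible_path vs"
       "hd vs = 0" "last vs = C.cls (?D B)" by blast
    have sum: "C.cls (?D B') = (\<Sum>X\<in>B'. C.cls (cl X))" if "B' \<subseteq> B" for B'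
      using finite_subset[OF that finB] that
    proof (induction B' rule: finite_induct)
      case empty
      then show ?case by (simp add: cl_direct_sum_empty)
    next
      case (insert X B')
      then show ?case using C.cls_add[OF split[of "{X}" B']] single[of X] by simp
    qed
    have "C.cls (?D B) = (\<Sum>c | E.brick c. C.cls c)"
      using sum[OF order_refl] sum.reindex_bij_betw[OF bij, of C.cls] by simp
    moreover have "\<exists>N'. seq N (?D B) N' \<and> seq N' (?D B) N" if N: "E.brick N" for N
    proof -
      have "N \<in> cl ` B" unfolding bij_betw_imp_surj_on[OF bij] using N by (rule CollectI)
      then obtain X where X: "X \<in> B" "cl X = N" by (elim imageE) (simp only:)
      \<comment> \<open>The complement of a brick is the sum of the other representatives; both
        orders of the splitting are needed for a direct summand.\<close>
      have u: "{X} \<union> (B - {X}) = B" "(B - {X}) \<union> {X} = B" using X(1) by auto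
      have "seq (?D {X}) (?D B) (?D (B - {X}))" "seq (?D (B - {X})) (?D B) (?D {X})"
        using split[of "{X}" "B - {X}"] split[of "B - {X}" "{X}"] X(1) unfolding u by auto
      then show ?thesis unfolding single[OF X(1)] X(2) by blast
    qed
    ultimately show "\<exists>m X. brick_chain objs seq Zcl (\<lambda>i. cl (S i)) m X"
      using C.chain_of_path[OF fin _ _ vs] by blast
  qed
  then show ?thesis unfolding brick_chain_iff[OF fin] goal .
qed

end

theorem theorem1p12:
  fixes K :: "('k, 'q) ring_scheme"
    and A :: "('k, 'a) module"
    and S :: "'n::finite \<Rightarrow> ('a, nat \<Rightarrow> 'k) module"
    and B :: "('a, nat \<Rightarrow> 'k) module set"
  assumes "fin_dim_algebra K A"
    and "brick_finite A"
    and "simple_representatives A S"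
    and "brick_representatives A B"
  shows "brick_directed A \<longleftrightarrow>
    (\<exists>vs. increasing_path (newton_polytope A S (finite_direct_sum B)) vs \<and> indivisible_path vs \<and>
       hd vs = 0 \<and> last vs = K0_class A S (finite_direct_sum B))"
proof -
  interpret algebra_with_simples K A S
    using assms(1,3) by (simp add: algebra_with_simples_def algebra_with_simples_axioms_def)
  show ?thesis
    using directed_iff_path[OF _ assms(4)] assms(2) brick_classes_eq unfolding brick_finite_def by simp
qed

end
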